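(* Let $\Lambda$ be an artin algebra of finite global dimension. Then there is a duality of triangulated categories $$\mathbb{K}^{\mathrm b}_{\mathrm{ac}}(\mathrm{mod}\text{-}\Lambda^{\mathrm{op}})\simeq\mathbb{K}^{\mathrm b}_{\mathrm{ac}}(\mathrm{mod}\text{-}\Lambda).$$
   Context: An artin algebra means an artin $R$-algebra over a commutative artinian ring $R$. $\mathrm{mod}\text{-}\Lambda$ is the category of finitely presented right $\Lambda$-modules, $\mathrm{mod}\text{-}\Lambda^{\mathrm{op}}$ that of finitely presented left $\Lambda$-modules. For an abelian category $\mathcal{A}$, $\mathbb{K}^{\mathrm b}(\mathcal{A})$ is the bounded homotopy category and $\mathbb{K}^{\mathrm b}_{\mathrm{ac}}(\mathcal{A})$ its full subcategory of acyclic complexes. A duality of triangulated categories $\mathcal{T}\to\mathcal{T}'$ is a contravariant functor giving a triangle equivalence $\mathcal{T}\to(\mathcal{T}')^{\mathrm{op}}$. *)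

theory Defs
  imports "HOL-Algebra.Module" "HOL-Algebra.AbelCoset" "HOL-Algebra.RingHom"
begin

section \<open>Artin algebras and their modules\<close>

definition commutative_artinian_ring :: "('r, 'x) ring_scheme \<Rightarrow> bool" where
  "commutative_artinian_ring R \<longleftrightarrow> cring R \<and>
     (\<forall>I :: nat \<Rightarrow> 'r set. (\<forall>n. ideal (I n) R \<and> I (Suc n) \<subseteq> I n)
        \<longrightarrow> (\<exists>N. \<forall>n\<ge>N. I n = I N))"

text \<open>The locale \<open>algebra\<close> of HOL-Algebra is restricted to commutative algebras.
  Here \<open>\<phi>\<close> is the structure map of \<open>\<Lambda>\<close> as an \<open>R\<close>-algebra; its image is central, and
  \<open>\<Lambda>\<close> is finitely generated as an \<open>R\<close>-module.\<close>

definition artin_algebra ::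
    "('r, 'x) ring_scheme \<Rightarrow> ('a, 'y) ring_scheme \<Rightarrow> ('r \<Rightarrow> 'a) \<Rightarrow> bool" where
  "artin_algebra R \<Lambda> \<phi> \<longleftrightarrow>
     commutative_artinian_ring R \<and> ring \<Lambda> \<and> \<phi> \<in> ring_hom R \<Lambda> \<and>
     (\<forall>r\<in>carrier R. \<forall>x\<in>carrier \<Lambda>. \<phi> r \<otimes>\<^bsub>\<Lambda>\<^esub> x = x \<otimes>\<^bsub>\<Lambda>\<^esub> \<phi> r) \<and>
     (\<exists>S. finite S \<and> S \<subseteq> carrier \<Lambda> \<and>
        (\<forall>x\<in>carrier \<Lambda>. \<exists>c. c \<in> S \<rightarrow> carrier R \<and> x = (\<Oplus>\<^bsub>\<Lambda>\<^esub>s\<in>S. \<phi> (c s) \<otimes>\<^bsub>\<Lambda>\<^esub> s)))"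

definition opposite_ring :: "('a, 'y) ring_scheme \<Rightarrow> ('a, 'y) ring_scheme" where
  "opposite_ring \<Lambda> = \<Lambda>\<lparr>mult := (\<lambda>x y. y \<otimes>\<^bsub>\<Lambda>\<^esub> x)\<rparr>"

text \<open>The locale \<open>module\<close> of HOL-Algebra requires a commutative base ring. We reuse its record
  type for right modules over an arbitrary ring: the term \<open>a \<odot>\<^bsub>M\<^esub> x\<close> stands for the
  right action \<open>x \<cdot> a\<close>.\<close>

locale right_module = R: ring \<Lambda> + M: abelian_group M
  for \<Lambda> :: "('a, 'y) ring_scheme" and M :: "('a, 'm, 'z) module_scheme" +
  assumes act_closed:
      "\<lbrakk>a \<in> carrier \<Lambda>; x \<in> carrier M\<rbrakk> \<Longrightarrow> a \<odot>\<^bsub>M\<^esub> x \<in> carrier M"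
    and act_add_ring:
      "\<lbrakk>a \<in> carrier \<Lambda>; b \<in> carrier \<Lambda>; x \<in> carrier M\<rbrakk>
        \<Longrightarrow> (a \<oplus>\<^bsub>\<Lambda>\<^esub> b) \<odot>\<^bsub>M\<^esub> x = a \<odot>\<^bsub>M\<^esub> x \<oplus>\<^bsub>M\<^esub> b \<odot>\<^bsub>M\<^esub> x"
    and act_add_mod:
      "\<lbrakk>a \<in> carrier \<Lambda>; x \<in> carrier M; y \<in> carrier M\<rbrakk>
        \<Longrightarrow> a \<odot>\<^bsub>M\<^esub> (x \<oplus>\<^bsub>M\<^esub> y) = a \<odot>\<^bsub>M\<^esub> x \<oplus>\<^bsub>M\<^esub> a \<odot>\<^bsub>M\<^esub> y"
    and act_mult:
      "\<lbrakk>a \<in> carrier \<Lambda>; b \<in> carrier \<Lambda>; x \<in> carrier M\<rbrakk>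
        \<Longrightarrow> (a \<otimes>\<^bsub>\<Lambda>\<^esub> b) \<odot>\<^bsub>M\<^esub> x = b \<odot>\<^bsub>M\<^esub> (a \<odot>\<^bsub>M\<^esub> x)"
    and act_one:
      "x \<in> carrier M \<Longrightarrow> \<one>\<^bsub>\<Lambda>\<^esub> \<odot>\<^bsub>M\<^esub> x = x"

text \<open>Right modules over the opposite ring are the left \<open>\<Lambda>\<close>-modules.\<close>

lemma right_module_opposite_ring_iff:
  assumes "ring \<Lambda>"
  shows "right_module (opposite_ring \<Lambda>) M \<longleftrightarrow>
    abelian_group M \<and>
    (\<forall>a\<in>carrier \<Lambda>. \<forall>x\<in>carrier M. a \<odot>\<^bsub>M\<^esub> x \<in> carrier M) \<and>
    (\<forall>a\<in>carrier \<Lambda>. \<forall>b\<in>carrier \<Lambda>. \<forall>x\<in>carrier M.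
       (a \<oplus>\<^bsub>\<Lambda>\<^esub> b) \<odot>\<^bsub>M\<^esub> x = a \<odot>\<^bsub>M\<^esub> x \<oplus>\<^bsub>M\<^esub> b \<odot>\<^bsub>M\<^esub> x) \<and>
    (\<forall>a\<in>carrier \<Lambda>. \<forall>x\<in>carrier M. \<forall>y\<in>carrier M.
       a \<odot>\<^bsub>M\<^esub> (x \<oplus>\<^bsub>M\<^esub> y) = a \<odot>\<^bsub>M\<^esub> x \<oplus>\<^bsub>M\<^esub> a \<odot>\<^bsub>M\<^esub> y) \<and>
    (\<forall>a\<in>carrier \<Lambda>. \<forall>b\<in>carrier \<Lambda>. \<forall>x\<in>carrier M.
       (a \<otimes>\<^bsub>\<Lambda>\<^esub> b) \<odot>\<^bsub>M\<^esub> x = a \<odot>\<^bsub>M\<^esub> (b \<odot>\<^bsub>M\<^esub> x)) \<and>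
    (\<forall>x\<in>carrier M. \<one>\<^bsub>\<Lambda>\<^esub> \<odot>\<^bsub>M\<^esub> x = x)"
proof -
  interpret ring \<Lambda> by fact
  have "ring (opposite_ring \<Lambda>)"
  proof (rule ringI)
    show "abelian_group (opposite_ring \<Lambda>)"
      by (rule abelian_groupI)
        (simp_all add: opposite_ring_def a_ac add.l_inv_ex)
    show "monoid (opposite_ring \<Lambda>)"
      by (rule monoidI) (auto simp: opposite_ring_def m_assoc)
  qed (auto simp: opposite_ring_def l_distr r_distr)
  then show ?thesis
    unfolding right_module_def right_module_axioms_def
    by (simp add: opposite_ring_def Ball_def) meson
qed

definition right_hom ::
    "('a, 'y) ring_scheme \<Rightarrow> ('a, 'm) module \<Rightarrow> ('a, 'n) module \<Rightarrow> ('m \<Rightarrow> 'n) set" where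
  "right_hom \<Lambda> M N = {f \<in> carrier M \<rightarrow>\<^sub>E carrier N.
     (\<forall>x\<in>carrier M. \<forall>y\<in>carrier M. f (x \<oplus>\<^bsub>M\<^esub> y) = f x \<oplus>\<^bsub>N\<^esub> f y) \<and>
     (\<forall>a\<in>carrier \<Lambda>. \<forall>x\<in>carrier M. f (a \<odot>\<^bsub>M\<^esub> x) = a \<odot>\<^bsub>N\<^esub> f x)}"

text \<open>The free right module \<open>\<Lambda>\<^sup>n\<close>. The multiplicative fields of a module record play no role.\<close>

definition free_right_module :: "('a, 'y) ring_scheme \<Rightarrow> nat \<Rightarrow> ('a, nat \<Rightarrow> 'a) module" where
  "free_right_module \<Lambda> n =
     \<lparr>carrier = {..<n} \<rightarrow>\<^sub>E carrier \<Lambda>, mult = undefined, one = undefined,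
      zero = (\<lambda>i\<in>{..<n}. \<zero>\<^bsub>\<Lambda>\<^esub>),
      add = (\<lambda>v w. \<lambda>i\<in>{..<n}. v i \<oplus>\<^bsub>\<Lambda>\<^esub> w i),
      smult = (\<lambda>a v. \<lambda>i\<in>{..<n}. v i \<otimes>\<^bsub>\<Lambda>\<^esub> a)\<rparr>"

text \<open>A presentation \<open>\<Lambda>\<^sup>k \<rightarrow> \<Lambda>\<^sup>n \<rightarrow> M \<rightarrow> 0\<close>.\<close>

definition finitely_presented :: "('a, 'y) ring_scheme \<Rightarrow> ('a, 'm) module \<Rightarrow> bool" where
  "finitely_presented \<Lambda> M \<longleftrightarrow>
     (\<exists>k n. \<exists>f \<in> right_hom \<Lambda> (free_right_module \<Lambda> k) (free_right_module \<Lambda> n).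
        \<exists>g \<in> right_hom \<Lambda> (free_right_module \<Lambda> n) M.
          f ` carrier (free_right_module \<Lambda> k) = a_kernel (free_right_module \<Lambda> n) M g \<and>
          g ` carrier (free_right_module \<Lambda> n) = carrier M)"

text \<open>In HOL, modules must have their elements in some type. The type \<open>'m\<close> serves as a universe;
  the following condition ensures that it contains an isomorphic copy of every right or left
  \<open>\<Lambda>\<close>-module which is generated by at most \<open>|'m|\<close> elements. In particular, the finitely presented
  modules over \<open>'m\<close> form a category equivalent to that of all finitely presented modules.
  The type \<open>nat \<times> 'a\<close>, for example, always satisfies it.\<close>

definition module_universe :: "('a, 'y) ring_scheme \<Rightarrow> 'm itself \<Rightarrow> bool" where
  "module_universe \<Lambda> (_ :: 'm itself) \<longleftrightarrow>
     infinite (UNIV :: 'm set) \<and> (\<exists>f :: 'a \<Rightarrow> 'm. inj_on f (carrier \<Lambda>))"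

definition projective_module :: "('a, 'y) ring_scheme \<Rightarrow> ('a, 'm) module \<Rightarrow> bool" where
  "projective_module \<Lambda> P \<longleftrightarrow> right_module \<Lambda> P \<and>
     (\<forall>(M :: ('a, 'm) module) (N :: ('a, 'm) module) g f. right_module \<Lambda> M \<and> right_module \<Lambda> N \<and>
        g \<in> right_hom \<Lambda> M N \<and> g ` carrier M = carrier N \<and> f \<in> right_hom \<Lambda> P N
        \<longrightarrow> (\<exists>h \<in> right_hom \<Lambda> P M. \<forall>x\<in>carrier P. g (h x) = f x))"

text \<open>There is a projective resolution
  \<open>0 \<rightarrow> P\<^sub>d \<rightarrow> \<dots> \<rightarrow> P\<^sub>0 \<rightarrow> M \<rightarrow> 0\<close>.\<close>

definition projective_dimension_le ::
    "('a, 'y) ring_scheme \<Rightarrow> ('a, 'm) module \<Rightarrow> nat \<Rightarrow> bool" where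
  "projective_dimension_le \<Lambda> M d \<longleftrightarrow>
     (\<exists>(P :: nat \<Rightarrow> ('a, 'm) module) \<delta> \<epsilon>.
        (\<forall>i. projective_module \<Lambda> (P i)) \<and>
        (\<forall>i>d. carrier (P i) = {\<zero>\<^bsub>P i\<^esub>}) \<and>
        \<epsilon> \<in> right_hom \<Lambda> (P 0) M \<and>
        (\<forall>i. \<delta> i \<in> right_hom \<Lambda> (P (Suc i)) (P i)) \<and>
        \<epsilon> ` carrier (P 0) = carrier M \<and>
        \<delta> 0 ` carrier (P (Suc 0)) = a_kernel (P 0) M \<epsilon> \<and>
        (\<forall>i. \<delta> (Suc i) ` carrier (P (Suc (Suc i))) = a_kernel (P (Suc i)) (P i) (\<delta> i)))"

text \<open>The right global dimension, with all right modules taken in the universe \<open>'m\<close>. Under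
  \<open>module_universe\<close> the restriction is harmless: free covers exist inside \<open>'m\<close>, and by Auslander's
  theorem the cyclic modules already determine the global dimension. For artin algebras the left
  and right global dimensions agree.\<close>

definition finite_global_dimension :: "('a, 'y) ring_scheme \<Rightarrow> 'm itself \<Rightarrow> bool" where
  "finite_global_dimension \<Lambda> (_ :: 'm itself) \<longleftrightarrow>
     (\<exists>d. \<forall>M :: ('a, 'm) module. right_module \<Lambda> M \<longrightarrow> projective_dimension_le \<Lambda> M d)"


section \<open>Preadditive categories\<close>

text \<open>Only the additive part of the ring record \<open>Hom C X Y\<close> is relevant. Morphisms do not carry
  their domain and codomain, so \<open>Comp C X Y Z g f\<close> is the composite of \<open>f : X \<rightarrow> Y\<close> and
  \<open>g : Y \<rightarrow> Z\<close>.\<close>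

record ('o, 'h) precat =
  Obj :: "'o set"
  Hom :: "'o \<Rightarrow> 'o \<Rightarrow> 'h ring"
  Comp :: "'o \<Rightarrow> 'o \<Rightarrow> 'o \<Rightarrow> 'h \<Rightarrow> 'h \<Rightarrow> 'h"
  Id :: "'o \<Rightarrow> 'h"

abbreviation Mor :: "('o, 'h, 'z) precat_scheme \<Rightarrow> 'o \<Rightarrow> 'o \<Rightarrow> 'h set" where
  "Mor C X Y \<equiv> carrier (Hom C X Y)"

definition is_iso :: "('o, 'h, 'z) precat_scheme \<Rightarrow> 'o \<Rightarrow> 'o \<Rightarrow> 'h \<Rightarrow> bool" where
  "is_iso C X Y f \<longleftrightarrow> f \<in> Mor C X Y \<and>
     (\<exists>g \<in> Mor C Y X. Comp C X Y X g f = Id C X \<and> Comp C Y X Y f g = Id C Y)"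

definition is_zero_object :: "('o, 'h, 'z) precat_scheme \<Rightarrow> 'o \<Rightarrow> bool" where
  "is_zero_object C X \<longleftrightarrow> X \<in> Obj C \<and> Id C X = \<zero>\<^bsub>Hom C X X\<^esub>"

text \<open>\<open>Z\<close> is a biproduct of \<open>X\<close> and \<open>Y\<close>, with injections \<open>i\<close>, \<open>j\<close> and projections \<open>p\<close>, \<open>q\<close>.\<close>

definition is_biproduct :: "('o, 'h, 'z) precat_scheme \<Rightarrow> 'o \<Rightarrow> 'o \<Rightarrow> 'o
    \<Rightarrow> 'h \<Rightarrow> 'h \<Rightarrow> 'h \<Rightarrow> 'h \<Rightarrow> bool" where
  "is_biproduct C X Y Z i j p q \<longleftrightarrow> Z \<in> Obj C \<and>
     i \<in> Mor C X Z \<and> j \<in> Mor C Y Z \<and> p \<in> Mor C Z X \<and> q \<in> Mor C Z Y \<and>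
     Comp C X Z X p i = Id C X \<and> Comp C Y Z Y q j = Id C Y \<and>
     Comp C Y Z X p j = \<zero>\<^bsub>Hom C Y X\<^esub> \<and> Comp C X Z Y q i = \<zero>\<^bsub>Hom C X Y\<^esub> \<and>
     Comp C Z X Z i p \<oplus>\<^bsub>Hom C Z Z\<^esub> Comp C Z Y Z j q = Id C Z"

definition additive_functor ::
    "('o, 'h, 'z) precat_scheme \<Rightarrow> ('p, 'k, 'w) precat_scheme
     \<Rightarrow> ('o \<Rightarrow> 'p) \<Rightarrow> ('o \<Rightarrow> 'o \<Rightarrow> 'h \<Rightarrow> 'k) \<Rightarrow> bool" where
  "additive_functor C D F Fm \<longleftrightarrow>
     (\<forall>X\<in>Obj C. F X \<in> Obj D \<and> Fm X X (Id C X) = Id D (F X)) \<and>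
     (\<forall>X\<in>Obj C. \<forall>Y\<in>Obj C. \<forall>f\<in>Mor C X Y. Fm X Y f \<in> Mor D (F X) (F Y)) \<and>
     (\<forall>X\<in>Obj C. \<forall>Y\<in>Obj C. \<forall>f\<in>Mor C X Y. \<forall>g\<in>Mor C X Y.
        Fm X Y (f \<oplus>\<^bsub>Hom C X Y\<^esub> g) = Fm X Y f \<oplus>\<^bsub>Hom D (F X) (F Y)\<^esub> Fm X Y g) \<and>
     (\<forall>X\<in>Obj C. \<forall>Y\<in>Obj C. \<forall>Z\<in>Obj C. \<forall>f\<in>Mor C X Y. \<forall>g\<in>Mor C Y Z.
        Fm X Z (Comp C X Y Z g f) = Comp D (F X) (F Y) (F Z) (Fm Y Z g) (Fm X Y f))"

definition natural_iso ::
    "('o, 'h, 'z) precat_scheme \<Rightarrow> ('p, 'k, 'w) precat_scheme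
     \<Rightarrow> ('o \<Rightarrow> 'p) \<Rightarrow> ('o \<Rightarrow> 'o \<Rightarrow> 'h \<Rightarrow> 'k)
     \<Rightarrow> ('o \<Rightarrow> 'p) \<Rightarrow> ('o \<Rightarrow> 'o \<Rightarrow> 'h \<Rightarrow> 'k) \<Rightarrow> ('o \<Rightarrow> 'k) \<Rightarrow> bool" where
  "natural_iso C D F Fm G Gm \<eta> \<longleftrightarrow>
     (\<forall>X\<in>Obj C. is_iso D (F X) (G X) (\<eta> X)) \<and>
     (\<forall>X\<in>Obj C. \<forall>Y\<in>Obj C. \<forall>f\<in>Mor C X Y.
        Comp D (F X) (F Y) (G Y) (\<eta> Y) (Fm X Y f) = Comp D (F X) (G X) (G Y) (Gm X Y f) (\<eta> X))"

definition is_equivalence ::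
    "('o, 'h, 'z) precat_scheme \<Rightarrow> ('p, 'k, 'w) precat_scheme
     \<Rightarrow> ('o \<Rightarrow> 'p) \<Rightarrow> ('o \<Rightarrow> 'o \<Rightarrow> 'h \<Rightarrow> 'k) \<Rightarrow> bool" where
  "is_equivalence C D F Fm \<longleftrightarrow> additive_functor C D F Fm \<and>
     (\<exists>G Gm \<alpha> \<beta>. additive_functor D C G Gm \<and>
        natural_iso C C (\<lambda>X. G (F X)) (\<lambda>X Y f. Gm (F X) (F Y) (Fm X Y f))
          (\<lambda>X. X) (\<lambda>X Y f. f) \<alpha> \<and>
        natural_iso D D (\<lambda>X. F (G X)) (\<lambda>X Y f. Fm (G X) (G Y) (Gm X Y f))
          (\<lambda>X. X) (\<lambda>X Y f. f) \<beta>)"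


section \<open>Triangulated structures, triangle equivalences and dualities\<close>

text \<open>The shift is recorded together with its (strict) inverse. An element
  \<open>(X, Y, Z, u, v, w)\<close> of \<open>Dist T\<close> is a distinguished triangle
  \<open>X -u\<rightarrow> Y -v\<rightarrow> Z -w\<rightarrow> X[1]\<close>.\<close>

type_synonym ('o, 'h) triangle = "'o \<times> 'o \<times> 'o \<times> 'h \<times> 'h \<times> 'h"

record ('o, 'h) tricat = "('o, 'h) precat" +
  Shift :: "'o \<Rightarrow> 'o"
  ShiftM :: "'o \<Rightarrow> 'o \<Rightarrow> 'h \<Rightarrow> 'h"
  Unshift :: "'o \<Rightarrow> 'o"
  UnshiftM :: "'o \<Rightarrow> 'o \<Rightarrow> 'h \<Rightarrow> 'h"
  Dist :: "('o, 'h) triangle set"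

text \<open>The opposite category has shift \<open>[-1]\<close>; a triangle
  \<open>X \<rightarrow> Y \<rightarrow> Z \<rightarrow> X[-1]\<close> of the opposite category is distinguished iff the triangle
  \<open>X[-1] \<rightarrow> Z \<rightarrow> Y \<rightarrow> X = (X[-1])[1]\<close> of \<open>T\<close> is. (The other convention, with a sign on one
  of the maps, gives a triangle equivalent category, via the identity functor and \<open>\<eta> = -1\<close>.)\<close>

definition opposite_tricat :: "('o, 'h) tricat \<Rightarrow> ('o, 'h) tricat" where
  "opposite_tricat T =
     \<lparr>Obj = Obj T,
      Hom = (\<lambda>X Y. Hom T Y X),
      Comp = (\<lambda>X Y Z g f. Comp T Z Y X f g),
      Id = Id T,
      Shift = Unshift T,
      ShiftM = (\<lambda>X Y f. UnshiftM T Y X f),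
      Unshift = Shift T,
      UnshiftM = (\<lambda>X Y f. ShiftM T Y X f),
      Dist = {(X, Y, Z, u, v, w). X \<in> Obj T \<and> (Unshift T X, Z, Y, w, v, u) \<in> Dist T}\<rparr>"

definition triangle_functor ::
    "('o, 'h) tricat \<Rightarrow> ('p, 'k) tricat
     \<Rightarrow> ('o \<Rightarrow> 'p) \<Rightarrow> ('o \<Rightarrow> 'o \<Rightarrow> 'h \<Rightarrow> 'k) \<Rightarrow> ('o \<Rightarrow> 'k) \<Rightarrow> bool" where
  "triangle_functor S T F Fm \<eta> \<longleftrightarrow>
     additive_functor S T F Fm \<and>
     natural_iso S T
       (\<lambda>X. F (Shift S X)) (\<lambda>X Y f. Fm (Shift S X) (Shift S Y) (ShiftM S X Y f))
       (\<lambda>X. Shift T (F X)) (\<lambda>X Y f. ShiftM T (F X) (F Y) (Fm X Y f)) \<eta> \<and>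
     (\<forall>X Y Z u v w. (X, Y, Z, u, v, w) \<in> Dist S \<longrightarrow>
        (F X, F Y, F Z, Fm X Y u, Fm Y Z v,
          Comp T (F Z) (F (Shift S X)) (Shift T (F X)) (\<eta> X) (Fm Z (Shift S X) w)) \<in> Dist T)"

definition triangle_equivalence ::
    "('o, 'h) tricat \<Rightarrow> ('p, 'k) tricat
     \<Rightarrow> ('o \<Rightarrow> 'p) \<Rightarrow> ('o \<Rightarrow> 'o \<Rightarrow> 'h \<Rightarrow> 'k) \<Rightarrow> ('o \<Rightarrow> 'k) \<Rightarrow> bool" where
  "triangle_equivalence S T F Fm \<eta> \<longleftrightarrow> triangle_functor S T F Fm \<eta> \<and> is_equivalence S T F Fm"

definition triangulated_duality ::
    "('o, 'h) tricat \<Rightarrow> ('p, 'k) tricat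
     \<Rightarrow> ('o \<Rightarrow> 'p) \<Rightarrow> ('o \<Rightarrow> 'o \<Rightarrow> 'h \<Rightarrow> 'k) \<Rightarrow> ('o \<Rightarrow> 'k) \<Rightarrow> bool" where
  "triangulated_duality S T F Fm \<eta> \<longleftrightarrow> triangle_equivalence S (opposite_tricat T) F Fm \<eta>"

text \<open>Full triangulated subcategory on the objects satisfying \<open>P\<close>.\<close>

definition full_subtricat :: "('o, 'h) tricat \<Rightarrow> ('o \<Rightarrow> bool) \<Rightarrow> ('o, 'h) tricat" where
  "full_subtricat T P = T\<lparr>Obj := {X \<in> Obj T. P X},
     Dist := {(X, Y, Z, u, v, w). (X, Y, Z, u, v, w) \<in> Dist T \<and> P X \<and> P Y \<and> P Z}\<rparr>"


section \<open>The bounded homotopy category\<close>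

record ('o, 'h) cochain =
  Ob :: "int \<Rightarrow> 'o"
  Diff :: "int \<Rightarrow> 'h"

definition bounded_complexes :: "('o, 'h, 'z) precat_scheme \<Rightarrow> ('o, 'h) cochain set" where
  "bounded_complexes A = {X.
     (\<forall>n. Ob X n \<in> Obj A \<and> Diff X n \<in> Mor A (Ob X n) (Ob X (n + 1)) \<and>
        Comp A (Ob X n) (Ob X (n + 1)) (Ob X (n + 1 + 1)) (Diff X (n + 1)) (Diff X n)
          = \<zero>\<^bsub>Hom A (Ob X n) (Ob X (n + 1 + 1))\<^esub>) \<and>
     (\<exists>N. \<forall>n. \<bar>n\<bar> > N \<longrightarrow> is_zero_object A (Ob X n))}"

definition chain_maps ::
    "('o, 'h, 'z) precat_scheme \<Rightarrow> ('o, 'h) cochain \<Rightarrow> ('o, 'h) cochain \<Rightarrow> (int \<Rightarrow> 'h) ring" where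
  "chain_maps A X Y =
     \<lparr>carrier = {f. \<forall>n. f n \<in> Mor A (Ob X n) (Ob Y n) \<and>
        Comp A (Ob X n) (Ob X (n + 1)) (Ob Y (n + 1)) (f (n + 1)) (Diff X n)
          = Comp A (Ob X n) (Ob Y n) (Ob Y (n + 1)) (Diff Y n) (f n)},
      mult = undefined, one = undefined,
      zero = (\<lambda>n. \<zero>\<^bsub>Hom A (Ob X n) (Ob Y n)\<^esub>),
      add = (\<lambda>f g n. f n \<oplus>\<^bsub>Hom A (Ob X n) (Ob Y n)\<^esub> g n)\<rparr>"

definition chain_comp ::
    "('o, 'h, 'z) precat_scheme \<Rightarrow> ('o, 'h) cochain \<Rightarrow> ('o, 'h) cochain \<Rightarrow> ('o, 'h) cochain
     \<Rightarrow> (int \<Rightarrow> 'h) \<Rightarrow> (int \<Rightarrow> 'h) \<Rightarrow> (int \<Rightarrow> 'h)" where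
  "chain_comp A X Y Z g f = (\<lambda>n. Comp A (Ob X n) (Ob Y n) (Ob Z n) (g n) (f n))"

definition null_homotopic ::
    "('o, 'h, 'z) precat_scheme \<Rightarrow> ('o, 'h) cochain \<Rightarrow> ('o, 'h) cochain \<Rightarrow> (int \<Rightarrow> 'h) set" where
  "null_homotopic A X Y = {f \<in> carrier (chain_maps A X Y).
     \<exists>s. \<forall>n. s n \<in> Mor A (Ob X n) (Ob Y (n - 1)) \<and>
       f n = Comp A (Ob X n) (Ob Y (n - 1)) (Ob Y n) (Diff Y (n - 1)) (s n)
         \<oplus>\<^bsub>Hom A (Ob X n) (Ob Y n)\<^esub>
           Comp A (Ob X n) (Ob X (n + 1)) (Ob Y n) (s (n + 1)) (Diff X n)}"

definition homotopy_class ::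
    "('o, 'h, 'z) precat_scheme \<Rightarrow> ('o, 'h) cochain \<Rightarrow> ('o, 'h) cochain
     \<Rightarrow> (int \<Rightarrow> 'h) \<Rightarrow> (int \<Rightarrow> 'h) set" where
  "homotopy_class A X Y f = null_homotopic A X Y +>\<^bsub>chain_maps A X Y\<^esub> f"

text \<open>The bounded homotopy category as a category, without its triangulated structure.
  The union defining the composite ranges over a single homotopy class.\<close>

definition homotopy_precat ::
    "('o, 'h, 'z) precat_scheme \<Rightarrow> (('o, 'h) cochain, (int \<Rightarrow> 'h) set) precat" where
  "homotopy_precat A =
     \<lparr>Obj = bounded_complexes A,
      Hom = (\<lambda>X Y.
        \<lparr>carrier = a_rcosets\<^bsub>chain_maps A X Y\<^esub> (null_homotopic A X Y),
         mult = undefined, one = undefined,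
         zero = null_homotopic A X Y,
         add = set_add (chain_maps A X Y)\<rparr>),
      Comp = (\<lambda>X Y Z G F. \<Union>g\<in>G. \<Union>f\<in>F. homotopy_class A X Z (chain_comp A X Y Z g f)),
      Id = (\<lambda>X. homotopy_class A X X (\<lambda>n. Id A (Ob X n)))\<rparr>"

definition shift_complex ::
    "('o, 'h, 'z) precat_scheme \<Rightarrow> ('o, 'h) cochain \<Rightarrow> ('o, 'h) cochain" where
  "shift_complex A X =
     \<lparr>Ob = (\<lambda>n. Ob X (n + 1)),
      Diff = (\<lambda>n. \<ominus>\<^bsub>Hom A (Ob X (n + 1)) (Ob X (n + 1 + 1))\<^esub> Diff X (n + 1))\<rparr>"

definition unshift_complex ::
    "('o, 'h, 'z) precat_scheme \<Rightarrow> ('o, 'h) cochain \<Rightarrow> ('o, 'h) cochain" where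
  "unshift_complex A X =
     \<lparr>Ob = (\<lambda>n. Ob X (n - 1)),
      Diff = (\<lambda>n. \<ominus>\<^bsub>Hom A (Ob X (n - 1)) (Ob X n)\<^esub> Diff X (n - 1))\<rparr>"

text \<open>\<open>C\<close> is a mapping cone of the chain map \<open>f : X \<rightarrow> Y\<close>: in degree \<open>n\<close> it is a biproduct of
  \<open>X\<^bsup>n+1\<^esup>\<close> and \<open>Y\<^bsup>n\<^esup>\<close>, and its differential has matrix entries \<open>-d\<^sub>X\<close>, \<open>0\<close>, \<open>f\<close>, \<open>d\<^sub>Y\<close>.\<close>

definition is_mapping_cone ::
    "('o, 'h, 'z) precat_scheme \<Rightarrow> ('o, 'h) cochain \<Rightarrow> ('o, 'h) cochain \<Rightarrow> (int \<Rightarrow> 'h)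
     \<Rightarrow> ('o, 'h) cochain \<Rightarrow> (int \<Rightarrow> 'h) \<Rightarrow> (int \<Rightarrow> 'h) \<Rightarrow> (int \<Rightarrow> 'h) \<Rightarrow> (int \<Rightarrow> 'h) \<Rightarrow> bool" where
  "is_mapping_cone A X Y f C i j p q \<longleftrightarrow>
     C \<in> bounded_complexes A \<and>
     (\<forall>n. is_biproduct A (Ob X (n + 1)) (Ob Y n) (Ob C n) (i n) (j n) (p n) (q n)) \<and>
     (\<forall>n. let entry = (\<lambda>U V t s. Comp A U (Ob C (n + 1)) V t
                  (Comp A U (Ob C n) (Ob C (n + 1)) (Diff C n) s)) in
        entry (Ob X (n + 1)) (Ob X (n + 1 + 1)) (p (n + 1)) (i n)
          = \<ominus>\<^bsub>Hom A (Ob X (n + 1)) (Ob X (n + 1 + 1))\<^esub> Diff X (n + 1) \<and>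
        entry (Ob Y n) (Ob X (n + 1 + 1)) (p (n + 1)) (j n)
          = \<zero>\<^bsub>Hom A (Ob Y n) (Ob X (n + 1 + 1))\<^esub> \<and>
        entry (Ob X (n + 1)) (Ob Y (n + 1)) (q (n + 1)) (i n) = f (n + 1) \<and>
        entry (Ob Y n) (Ob Y (n + 1)) (q (n + 1)) (j n) = Diff Y n)"

text \<open>A triangle is distinguished if it is isomorphic in the homotopy category to a standard
  triangle \<open>X' -f\<rightarrow> Y' -j\<rightarrow> C -p\<rightarrow> X'[1]\<close> with \<open>C\<close> a mapping cone of \<open>f\<close>.\<close>

definition distinguished_triangles ::
    "('o, 'h, 'z) precat_scheme \<Rightarrow> (('o, 'h) cochain, (int \<Rightarrow> 'h) set) triangle set" where
  "distinguished_triangles A = {(X, Y, Z, u, v, w).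
     let K = homotopy_precat A; sh = shift_complex A in
     X \<in> Obj K \<and> Y \<in> Obj K \<and> Z \<in> Obj K \<and>
     u \<in> Mor K X Y \<and> v \<in> Mor K Y Z \<and> w \<in> Mor K Z (sh X) \<and>
     (\<exists>X' Y' C f i j p q a b c.
        X' \<in> Obj K \<and> Y' \<in> Obj K \<and> f \<in> carrier (chain_maps A X' Y') \<and>
        is_mapping_cone A X' Y' f C i j p q \<and>
        is_iso K X X' a \<and> is_iso K Y Y' b \<and> is_iso K Z C c \<and>
        Comp K X Y Y' b u = Comp K X X' Y' (homotopy_class A X' Y' f) a \<and>
        Comp K Y Z C c v = Comp K Y Y' C (homotopy_class A Y' C j) b \<and>
        Comp K Z (sh X) (sh X') ((\<lambda>h n. h (n + 1)) ` a) w
          = Comp K Z C (sh X') (homotopy_class A C (sh X') p) c)}"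

definition Kb ::
    "('o, 'h, 'z) precat_scheme \<Rightarrow> (('o, 'h) cochain, (int \<Rightarrow> 'h) set) tricat" where
  "Kb A =
     \<lparr>Obj = Obj (homotopy_precat A), Hom = Hom (homotopy_precat A),
      Comp = Comp (homotopy_precat A), Id = Id (homotopy_precat A),
      Shift = shift_complex A,
      ShiftM = (\<lambda>X Y F. (\<lambda>h n. h (n + 1)) ` F),
      Unshift = unshift_complex A,
      UnshiftM = (\<lambda>X Y F. (\<lambda>h n. h (n - 1)) ` F),
      Dist = distinguished_triangles A\<rparr>"


section \<open>Acyclic complexes of finitely presented modules\<close>

text \<open>The category of finitely presented right \<open>\<Lambda>\<close>-modules with elements in \<open>'m\<close>.\<close>

definition mod_cat ::
    "('a, 'y) ring_scheme \<Rightarrow> (('a, 'm) module, 'm \<Rightarrow> 'm) precat" where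
  "mod_cat \<Lambda> =
     \<lparr>Obj = {M. right_module \<Lambda> M \<and> finitely_presented \<Lambda> M},
      Hom = (\<lambda>M N.
        \<lparr>carrier = right_hom \<Lambda> M N, mult = undefined, one = undefined,
         zero = (\<lambda>x\<in>carrier M. \<zero>\<^bsub>N\<^esub>),
         add = (\<lambda>f g. \<lambda>x\<in>carrier M. f x \<oplus>\<^bsub>N\<^esub> g x)\<rparr>),
      Comp = (\<lambda>L M N g f. compose (carrier L) g f),
      Id = (\<lambda>M. \<lambda>x\<in>carrier M. x)\<rparr>"

definition acyclic_complex :: "(('a, 'm) module, 'm \<Rightarrow> 'm) cochain \<Rightarrow> bool" where
  "acyclic_complex X \<longleftrightarrow>
     (\<forall>n. Diff X (n - 1) ` carrier (Ob X (n - 1)) = a_kernel (Ob X n) (Ob X (n + 1)) (Diff X n))"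

definition Kb_ac_mod ::
    "('a, 'y) ring_scheme
     \<Rightarrow> ((('a, 'm) module, 'm \<Rightarrow> 'm) cochain, (int \<Rightarrow> 'm \<Rightarrow> 'm) set) tricat" where
  "Kb_ac_mod \<Lambda> = full_subtricat (Kb (mod_cat \<Lambda>)) acyclic_complex"

end

theory Submission
  imports Defs "HOL-Algebra.Ideal_Product" "HOL-Algebra.Subrings"
begin

text \<open>The image \<open>Z\<close> of \<open>R\<close> in \<open>\<Lambda>\<close> is a central artinian subring over which \<open>\<Lambda>\<close> has finite length. A
  commutative artinian ring has an injective cogenerator \<open>E\<close> for modules of finite length: take a
  module containing each simple module at most once which has no proper enlargement of
  this kind; the length of \<open>Z\<close> bounds the number of enlargements. For \<open>M\<close> of finite length
  over \<open>Z\<close>, the module \<open>Hom\<^sub>Z(M, E)\<close> again has finite length, and \<open>M\<close> is reflexive. Since finitely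
  presented \<open>\<Lambda>\<close>-modules are those of finite length over \<open>Z\<close>, the functor \<open>Hom\<^sub>Z(-, E)\<close> is an exact
  duality between right and left \<open>\<Lambda>\<close>-modules, with quasi-inverse given by the same formula.

  A contravariant additive functor acts on complexes by \<open>(D X)\<^sup>n = D(X\<^bsup>-n\<^esup>)\<close>, preserves homotopies and
  turns the cone of a map into a shifted cone of the dual map. A duality therefore induces a duality
  of bounded homotopy categories, and an exact one preserves acyclic complexes.\<close>

section \<open>Preadditive categories and quotients by ideals of morphisms\<close>

text \<open>The module part is shaped by types. Objects of \<open>mod_cat\<close> have their
  elements in \<open>'m\<close>, whereas \<open>Hom\<^sub>Z(M, E)\<close> consists of functions; the
  dual of \<open>M\<close> is therefore a chosen copy \<open>N\<close> of it inside
  \<open>'m\<close>, known only through a perfect pairing of \<open>M\<close> and \<open>N\<close>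
  with values in \<open>E\<close>. Dual morphisms are adjoints for these pairings. As the notion is
  symmetric in \<open>M\<close> and \<open>N\<close>, one existence statement yields both functors
  and both natural isomorphisms. The image \<open>Z\<close> replaces \<open>R\<close> because a
  module over \<open>\<Lambda>\<close> is a module over \<open>Z\<close> with the very same record.

  Finite length means reachable by adjoining elements that a maximal ideal annihilates modulo what
  is already there. Statements about it become inductions over one simple factor at a time, and this
  is why Baer's criterion and simple socles are demanded for maximal ideals only.

  On complexes the delicate point is a sign. The shift is carried to the inverse shift on the nose,
  but the dual of a standard triangle comes out as distinguished after one of its maps has been
  negated; the isomorphism with the shift carries that sign.\<close>

locale preadditive =
  fixes C :: "('o, 'h, 'z) precat_scheme"
  assumes hom_group: "\<lbrakk>X \<in> Obj C; Y \<in> Obj C\<rbrakk> \<Longrightarrow> abelian_group (Hom C X Y)"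
    and comp_closed: "\<lbrakk>X \<in> Obj C; Y \<in> Obj C; Z \<in> Obj C; f \<in> Mor C X Y; g \<in> Mor C Y Z\<rbrakk>
      \<Longrightarrow> Comp C X Y Z g f \<in> Mor C X Z"
    and id_closed: "X \<in> Obj C \<Longrightarrow> Id C X \<in> Mor C X X"
    and comp_assoc: "\<lbrakk>W \<in> Obj C; X \<in> Obj C; Y \<in> Obj C; Z \<in> Obj C;
      f \<in> Mor C W X; g \<in> Mor C X Y; h \<in> Mor C Y Z\<rbrakk>
      \<Longrightarrow> Comp C W X Z (Comp C X Y Z h g) f = Comp C W Y Z h (Comp C W X Y g f)"
    and id_left: "\<lbrakk>X \<in> Obj C; Y \<in> Obj C; f \<in> Mor C X Y\<rbrakk> \<Longrightarrow> Comp C X Y Y (Id C Y) f = f"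
    and id_right: "\<lbrakk>X \<in> Obj C; Y \<in> Obj C; f \<in> Mor C X Y\<rbrakk> \<Longrightarrow> Comp C X X Y f (Id C X) = f"
    and comp_add_left: "\<lbrakk>X \<in> Obj C; Y \<in> Obj C; Z \<in> Obj C; f \<in> Mor C X Y;
      g \<in> Mor C Y Z; g' \<in> Mor C Y Z\<rbrakk> \<Longrightarrow> Comp C X Y Z (g \<oplus>\<^bsub>Hom C Y Z\<^esub> g') f =
        Comp C X Y Z g f \<oplus>\<^bsub>Hom C X Z\<^esub> Comp C X Y Z g' f"
    and comp_add_right: "\<lbrakk>X \<in> Obj C; Y \<in> Obj C; Z \<in> Obj C; f \<in> Mor C X Y;
      f' \<in> Mor C X Y; g \<in> Mor C Y Z\<rbrakk> \<Longrightarrow> Comp C X Y Z g (f \<oplus>\<^bsub>Hom C X Y\<^esub> f') =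
        Comp C X Y Z g f \<oplus>\<^bsub>Hom C X Z\<^esub> Comp C X Y Z g f'"
begin

lemma add_closed: "\<lbrakk>X \<in> Obj C; Y \<in> Obj C; f \<in> Mor C X Y; g \<in> Mor C X Y\<rbrakk>
    \<Longrightarrow> f \<oplus>\<^bsub>Hom C X Y\<^esub> g \<in> Mor C X Y"
  by (meson hom_group abelian_groupE(1))

lemma zero_closed: "\<lbrakk>X \<in> Obj C; Y \<in> Obj C\<rbrakk> \<Longrightarrow> \<zero>\<^bsub>Hom C X Y\<^esub> \<in> Mor C X Y"
  by (meson hom_group abelian_groupE(2))

lemma neg_closed: "\<lbrakk>X \<in> Obj C; Y \<in> Obj C; f \<in> Mor C X Y\<rbrakk> \<Longrightarrow> \<ominus>\<^bsub>Hom C X Y\<^esub> f \<in> Mor C X Y"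
  by (meson hom_group abelian_group.a_inv_closed)

lemmas closed = comp_closed id_closed add_closed zero_closed neg_closed

text \<open>Cancellation in a group. It is the way to see that a bilinear composition or an additive
  functor preserves zero: the image of zero equals its own double.\<close>

lemma add_cancel_zero: "\<lbrakk>X \<in> Obj C; Y \<in> Obj C; f \<in> Mor C X Y; f = f \<oplus>\<^bsub>Hom C X Y\<^esub> f\<rbrakk>
    \<Longrightarrow> f = \<zero>\<^bsub>Hom C X Y\<^esub>"
  using hom_group[of X Y]
  by (metis abelian_group.a_group abelian_group.l_neg abelian_group.r_neg1 abelian_group.a_inv_closed)

lemma comp_zero_left: "\<lbrakk>X \<in> Obj C; Y \<in> Obj C; Z \<in> Obj C; f \<in> Mor C X Y\<rbrakk>
    \<Longrightarrow> Comp C X Y Z \<zero>\<^bsub>Hom C Y Z\<^esub> f = \<zero>\<^bsub>Hom C X Z\<^esub>"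
proof (rule add_cancel_zero)
  assume a: "X \<in> Obj C" "Y \<in> Obj C" "Z \<in> Obj C" "f \<in> Mor C X Y"
  interpret YZ: abelian_group "Hom C Y Z" by (simp add: a hom_group)
  show "Comp C X Y Z \<zero>\<^bsub>Hom C Y Z\<^esub> f =
      Comp C X Y Z \<zero>\<^bsub>Hom C Y Z\<^esub> f \<oplus>\<^bsub>Hom C X Z\<^esub> Comp C X Y Z \<zero>\<^bsub>Hom C Y Z\<^esub> f"
    using a by (simp flip: comp_add_left)
qed (simp_all add: closed)

lemma comp_zero_right: "\<lbrakk>X \<in> Obj C; Y \<in> Obj C; Z \<in> Obj C; g \<in> Mor C Y Z\<rbrakk>
    \<Longrightarrow> Comp C X Y Z g \<zero>\<^bsub>Hom C X Y\<^esub> = \<zero>\<^bsub>Hom C X Z\<^esub>"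
proof (rule add_cancel_zero)
  assume a: "X \<in> Obj C" "Y \<in> Obj C" "Z \<in> Obj C" "g \<in> Mor C Y Z"
  interpret XY: abelian_group "Hom C X Y" by (simp add: a hom_group)
  show "Comp C X Y Z g \<zero>\<^bsub>Hom C X Y\<^esub> =
      Comp C X Y Z g \<zero>\<^bsub>Hom C X Y\<^esub> \<oplus>\<^bsub>Hom C X Z\<^esub> Comp C X Y Z g \<zero>\<^bsub>Hom C X Y\<^esub>"
    using a by (simp flip: comp_add_right)
qed (simp_all add: closed)

lemma neg_eqI: "\<lbrakk>X \<in> Obj C; Y \<in> Obj C; f \<in> Mor C X Y; g \<in> Mor C X Y;
    f \<oplus>\<^bsub>Hom C X Y\<^esub> g = \<zero>\<^bsub>Hom C X Y\<^esub>\<rbrakk> \<Longrightarrow> f = \<ominus>\<^bsub>Hom C X Y\<^esub> g"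
  using hom_group[of X Y] by (metis abelian_group.minus_equality)

lemma comp_neg_left: "\<lbrakk>X \<in> Obj C; Y \<in> Obj C; Z \<in> Obj C; f \<in> Mor C X Y; g \<in> Mor C Y Z\<rbrakk>
    \<Longrightarrow> Comp C X Y Z (\<ominus>\<^bsub>Hom C Y Z\<^esub> g) f = \<ominus>\<^bsub>Hom C X Z\<^esub> Comp C X Y Z g f"
proof (rule neg_eqI)
  assume a: "X \<in> Obj C" "Y \<in> Obj C" "Z \<in> Obj C" "f \<in> Mor C X Y" "g \<in> Mor C Y Z"
  interpret YZ: abelian_group "Hom C Y Z" by (simp add: a hom_group)
  show "Comp C X Y Z (\<ominus>\<^bsub>Hom C Y Z\<^esub> g) f \<oplus>\<^bsub>Hom C X Z\<^esub> Comp C X Y Z g f = \<zero>\<^bsub>Hom C X Z\<^esub>"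
    using a by (simp add: YZ.l_neg comp_zero_left flip: comp_add_left)
qed (simp_all add: closed)

lemma comp_neg_right: "\<lbrakk>X \<in> Obj C; Y \<in> Obj C; Z \<in> Obj C; f \<in> Mor C X Y; g \<in> Mor C Y Z\<rbrakk>
    \<Longrightarrow> Comp C X Y Z g (\<ominus>\<^bsub>Hom C X Y\<^esub> f) = \<ominus>\<^bsub>Hom C X Z\<^esub> Comp C X Y Z g f"
proof (rule neg_eqI)
  assume a: "X \<in> Obj C" "Y \<in> Obj C" "Z \<in> Obj C" "f \<in> Mor C X Y" "g \<in> Mor C Y Z"
  interpret XY: abelian_group "Hom C X Y" by (simp add: a hom_group)
  show "Comp C X Y Z g (\<ominus>\<^bsub>Hom C X Y\<^esub> f) \<oplus>\<^bsub>Hom C X Z\<^esub> Comp C X Y Z g f = \<zero>\<^bsub>Hom C X Z\<^esub>"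
    using a by (simp add: XY.l_neg comp_zero_right flip: comp_add_right)
qed (simp_all add: closed)

lemma add_zero_left: "\<lbrakk>X \<in> Obj C; Y \<in> Obj C; f \<in> Mor C X Y\<rbrakk> \<Longrightarrow> \<zero>\<^bsub>Hom C X Y\<^esub> \<oplus>\<^bsub>Hom C X Y\<^esub> f = f"
  by (meson hom_group abelian_group.axioms(1) abelian_monoid.l_zero)

lemma add_zero_right: "\<lbrakk>X \<in> Obj C; Y \<in> Obj C; f \<in> Mor C X Y\<rbrakk> \<Longrightarrow> f \<oplus>\<^bsub>Hom C X Y\<^esub> \<zero>\<^bsub>Hom C X Y\<^esub> = f"
  by (meson hom_group abelian_group.axioms(1) abelian_monoid.r_zero)

lemma neg_zero: "\<lbrakk>X \<in> Obj C; Y \<in> Obj C\<rbrakk> \<Longrightarrow> \<ominus>\<^bsub>Hom C X Y\<^esub> \<zero>\<^bsub>Hom C X Y\<^esub> = \<zero>\<^bsub>Hom C X Y\<^esub>"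
  by (metis neg_eqI add_zero_left zero_closed)

lemma neg_neg: "\<lbrakk>X \<in> Obj C; Y \<in> Obj C; f \<in> Mor C X Y\<rbrakk> \<Longrightarrow> \<ominus>\<^bsub>Hom C X Y\<^esub> (\<ominus>\<^bsub>Hom C X Y\<^esub> f) = f"
  by (meson hom_group abelian_group.minus_minus)

lemma add_neg: "\<lbrakk>X \<in> Obj C; Y \<in> Obj C; f \<in> Mor C X Y\<rbrakk> \<Longrightarrow> f \<oplus>\<^bsub>Hom C X Y\<^esub> (\<ominus>\<^bsub>Hom C X Y\<^esub> f) = \<zero>\<^bsub>Hom C X Y\<^esub>"
  by (meson hom_group abelian_group.r_neg)

lemma neg_add: "\<lbrakk>X \<in> Obj C; Y \<in> Obj C; f \<in> Mor C X Y\<rbrakk> \<Longrightarrow> (\<ominus>\<^bsub>Hom C X Y\<^esub> f) \<oplus>\<^bsub>Hom C X Y\<^esub> f = \<zero>\<^bsub>Hom C X Y\<^esub>"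
  by (meson hom_group abelian_group.l_neg)

lemma add_commute: "\<lbrakk>X \<in> Obj C; Y \<in> Obj C; f \<in> Mor C X Y; g \<in> Mor C X Y\<rbrakk>
    \<Longrightarrow> f \<oplus>\<^bsub>Hom C X Y\<^esub> g = g \<oplus>\<^bsub>Hom C X Y\<^esub> f"
  by (meson hom_group abelian_group.axioms(1) abelian_monoid.a_comm)

lemma add_assoc: "\<lbrakk>X \<in> Obj C; Y \<in> Obj C; f \<in> Mor C X Y; g \<in> Mor C X Y; h \<in> Mor C X Y\<rbrakk>
    \<Longrightarrow> (f \<oplus>\<^bsub>Hom C X Y\<^esub> g) \<oplus>\<^bsub>Hom C X Y\<^esub> h = f \<oplus>\<^bsub>Hom C X Y\<^esub> (g \<oplus>\<^bsub>Hom C X Y\<^esub> h)"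
  by (meson hom_group abelian_group.axioms(1) abelian_monoid.a_assoc)

text \<open>A rewriting device. Simplification nests composites to the right by
  \<open>comp_assoc\<close>, so an equation for \<open>g\<close> after \<open>f\<close> no longer
  matches once something precedes \<open>f\<close>; this lemma supplies the equation prolonged by an
  arbitrary \<open>t\<close>.\<close>

lemma comp_assoc_eq:
  assumes "Comp C X Y Z g f = k"
    and "W \<in> Obj C" "X \<in> Obj C" "Y \<in> Obj C" "Z \<in> Obj C"
    and "t \<in> Mor C W X" "f \<in> Mor C X Y" "g \<in> Mor C Y Z"
  shows "Comp C W Y Z g (Comp C W X Y f t) = Comp C W X Z k t"
  using assms comp_assoc by metis

lemma is_iso_id: "X \<in> Obj C \<Longrightarrow> is_iso C X X (Id C X)"
  unfolding is_iso_def by (auto simp: closed id_left)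

lemma is_iso_neg_id: "X \<in> Obj C \<Longrightarrow> is_iso C X X (\<ominus>\<^bsub>Hom C X X\<^esub> Id C X)"
  unfolding is_iso_def
  by (auto intro!: bexI[of _ "\<ominus>\<^bsub>Hom C X X\<^esub> Id C X"] simp: closed comp_neg_left comp_neg_right id_left neg_neg)

lemma is_iso_comp:
  assumes "X \<in> Obj C" "Y \<in> Obj C" "Z \<in> Obj C" "is_iso C X Y f" "is_iso C Y Z g"
  shows "is_iso C X Z (Comp C X Y Z g f)"
proof -
  obtain f' g' where f': "f' \<in> Mor C Y X" "Comp C X Y X f' f = Id C X" "Comp C Y X Y f f' = Id C Y"
    and g': "g' \<in> Mor C Z Y" "Comp C Y Z Y g' g = Id C Y" "Comp C Z Y Z g g' = Id C Z"
    and f: "f \<in> Mor C X Y" and g: "g \<in> Mor C Y Z"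
    using assms unfolding is_iso_def by auto
  have "Comp C X Z X (Comp C Z Y X f' g') (Comp C X Y Z g f) = Id C X"
    using assms f g f' g' by (simp add: comp_assoc closed comp_assoc_eq[OF g'(2)] id_left)
  moreover have "Comp C Z X Z (Comp C X Y Z g f) (Comp C Z Y X f' g') = Id C Z"
    using assms f g f' g' by (simp add: comp_assoc closed comp_assoc_eq[OF f'(3)] id_left)
  ultimately show ?thesis
    unfolding is_iso_def using assms f g f' g' by (auto intro!: bexI[of _ "Comp C Z Y X f' g'"] simp: closed)
qed

end

section \<open>Opposite categories\<close>

definition op_precat :: "('o, 'h, 'z) precat_scheme \<Rightarrow> ('o, 'h) precat" where
  "op_precat C = \<lparr>Obj = Obj C, Hom = (\<lambda>X Y. Hom C Y X),
     Comp = (\<lambda>X Y Z g f. Comp C Z Y X f g), Id = Id C\<rparr>"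

lemma op_precat_simps [simp]:
  "Obj (op_precat C) = Obj C" "Hom (op_precat C) X Y = Hom C Y X"
  "Comp (op_precat C) X Y Z g f = Comp C Z Y X f g" "Id (op_precat C) = Id C"
  by (simp_all add: op_precat_def)

lemma (in preadditive) preadditive_op: "preadditive (op_precat C)"
  by (rule preadditive.intro)
    (simp_all add: hom_group closed comp_assoc id_left id_right comp_add_left comp_add_right)

lemma is_iso_op_iff: "is_iso (op_precat C) X Y f \<longleftrightarrow> is_iso C Y X f"
  unfolding is_iso_def by auto

section \<open>The quotient of a preadditive category by an ideal of morphisms\<close>

locale hom_ideal = preadditive C for C :: "('o, 'h, 'z) precat_scheme" +
  fixes N :: "'o \<Rightarrow> 'o \<Rightarrow> 'h set"
  assumes ideal_subgroup: "\<lbrakk>X \<in> Obj C; Y \<in> Obj C\<rbrakk> \<Longrightarrow> additive_subgroup (N X Y) (Hom C X Y)"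
    and ideal_comp_left: "\<lbrakk>X \<in> Obj C; Y \<in> Obj C; Z \<in> Obj C; f \<in> N X Y; g \<in> Mor C Y Z\<rbrakk>
      \<Longrightarrow> Comp C X Y Z g f \<in> N X Z"
    and ideal_comp_right: "\<lbrakk>X \<in> Obj C; Y \<in> Obj C; Z \<in> Obj C; f \<in> Mor C X Y; g \<in> N Y Z\<rbrakk>
      \<Longrightarrow> Comp C X Y Z g f \<in> N X Z"

text \<open>The cosets, the unions in the composition and the unspecified fields are those of
  \<open>homotopy_precat\<close>, so that the homotopy category becomes an instance by mere
  unfolding, see \<open>homotopy_precat_eq\<close>.\<close>

definition quotient_precat ::
    "('o, 'h, 'z) precat_scheme \<Rightarrow> ('o \<Rightarrow> 'o \<Rightarrow> 'h set) \<Rightarrow> ('o, 'h set) precat" where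
  "quotient_precat C N =
     \<lparr>Obj = Obj C,
      Hom = (\<lambda>X Y. \<lparr>carrier = a_rcosets\<^bsub>Hom C X Y\<^esub> (N X Y), mult = undefined, one = undefined,
         zero = N X Y, add = set_add (Hom C X Y)\<rparr>),
      Comp = (\<lambda>X Y Z G F. \<Union>g\<in>G. \<Union>f\<in>F. N X Z +>\<^bsub>Hom C X Z\<^esub> Comp C X Y Z g f),
      Id = (\<lambda>X. N X X +>\<^bsub>Hom C X X\<^esub> Id C X)\<rparr>"

context hom_ideal
begin

abbreviation Q where "Q \<equiv> quotient_precat C N"

abbreviation cls where "cls X Y f \<equiv> N X Y +>\<^bsub>Hom C X Y\<^esub> f"

lemma Obj_Q [simp]: "Obj Q = Obj C"
  by (simp add: quotient_precat_def)

lemma ideal_abelian_subgroup: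
  "\<lbrakk>X \<in> Obj C; Y \<in> Obj C\<rbrakk> \<Longrightarrow> abelian_subgroup (N X Y) (Hom C X Y)"
  by (simp add: abelian_subgroupI3 hom_group ideal_subgroup)

lemma Mor_Q: "Mor Q X Y = (\<lambda>f. cls X Y f) ` Mor C X Y"
  by (auto simp: quotient_precat_def A_RCOSETS_def')

lemma cls_Mor: "f \<in> Mor C X Y \<Longrightarrow> cls X Y f \<in> Mor Q X Y"
  by (simp add: Mor_Q)

lemma in_cls_iff: "\<lbrakk>X \<in> Obj C; Y \<in> Obj C; f \<in> Mor C X Y; g \<in> Mor C X Y\<rbrakk>
    \<Longrightarrow> g \<in> cls X Y f \<longleftrightarrow> g \<ominus>\<^bsub>Hom C X Y\<^esub> f \<in> N X Y"
  using abelian_subgroup.a_rcos_module_minus ideal_abelian_subgroup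
  by (metis abelian_group.minus_eq hom_group abelian_subgroup.a_rcos_module)

lemma cls_eq_iff: "\<lbrakk>X \<in> Obj C; Y \<in> Obj C; f \<in> Mor C X Y; g \<in> Mor C X Y\<rbrakk>
    \<Longrightarrow> cls X Y g = cls X Y f \<longleftrightarrow> g \<ominus>\<^bsub>Hom C X Y\<^esub> f \<in> N X Y"
  by (metis in_cls_iff abelian_subgroup.a_rcos_self abelian_subgroup.a_repr_independence'
      ideal_abelian_subgroup)

lemma cls_self: "\<lbrakk>X \<in> Obj C; Y \<in> Obj C; f \<in> Mor C X Y\<rbrakk> \<Longrightarrow> f \<in> cls X Y f"
  by (simp add: abelian_subgroup.a_rcos_self ideal_abelian_subgroup)

lemma cls_MorD: "\<lbrakk>X \<in> Obj C; Y \<in> Obj C; f \<in> Mor C X Y; g \<in> cls X Y f\<rbrakk> \<Longrightarrow> g \<in> Mor C X Y"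
  by (meson abelian_subgroup.a_elemrcos_carrier ideal_abelian_subgroup)

lemma Id_Q: "Id Q X = cls X X (Id C X)"
  by (simp add: quotient_precat_def)

lemma zero_Q: "\<lbrakk>X \<in> Obj C; Y \<in> Obj C\<rbrakk> \<Longrightarrow> \<zero>\<^bsub>Hom Q X Y\<^esub> = cls X Y \<zero>\<^bsub>Hom C X Y\<^esub>"
  using abelian_subgroup.a_rcos_const[OF ideal_abelian_subgroup, of X Y "\<zero>\<^bsub>Hom C X Y\<^esub>"]
    additive_subgroup.zero_closed[OF ideal_subgroup]
  by (simp add: quotient_precat_def)

lemma add_Q: "\<lbrakk>X \<in> Obj C; Y \<in> Obj C; f \<in> Mor C X Y; g \<in> Mor C X Y\<rbrakk>
    \<Longrightarrow> cls X Y f \<oplus>\<^bsub>Hom Q X Y\<^esub> cls X Y g = cls X Y (f \<oplus>\<^bsub>Hom C X Y\<^esub> g)"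
  by (simp add: quotient_precat_def abelian_subgroup.a_rcos_sum ideal_abelian_subgroup)

text \<open>The two factors are exchanged one after the other: the composites
  \<open>g' (f' - f)\<close> and \<open>(g' - g) f\<close> lie in the ideal.\<close>

lemma comp_cong:
  assumes X: "X \<in> Obj C" and Y: "Y \<in> Obj C" and Z: "Z \<in> Obj C"
    and f: "f \<in> Mor C X Y" and g: "g \<in> Mor C Y Z"
    and f': "f' \<in> cls X Y f" and g': "g' \<in> cls Y Z g"
  shows "cls X Z (Comp C X Y Z g' f') = cls X Z (Comp C X Y Z g f)"
proof -
  interpret XY: abelian_group "Hom C X Y" by (simp add: X Y hom_group)
  interpret YZ: abelian_group "Hom C Y Z" by (simp add: Z Y hom_group)
  interpret XZ: abelian_group "Hom C X Z" by (simp add: X Z hom_group)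
  have f'm: "f' \<in> Mor C X Y" and g'm: "g' \<in> Mor C Y Z"
    using cls_MorD assms by blast+
  have a: "f' \<ominus>\<^bsub>Hom C X Y\<^esub> f \<in> N X Y" "g' \<ominus>\<^bsub>Hom C Y Z\<^esub> g \<in> N Y Z"
    using assms in_cls_iff f'm g'm by auto
  have "cls X Z (Comp C X Y Z g' f') = cls X Z (Comp C X Y Z g' f)"
  proof -
    have "Comp C X Y Z g' (f' \<ominus>\<^bsub>Hom C X Y\<^esub> f) \<in> N X Z"
      using ideal_comp_left a g'm assms by blast
    also have "Comp C X Y Z g' (f' \<ominus>\<^bsub>Hom C X Y\<^esub> f) = Comp C X Y Z g' f' \<ominus>\<^bsub>Hom C X Z\<^esub> Comp C X Y Z g' f"
      using assms f'm g'm by (simp add: XY.minus_eq XZ.minus_eq comp_add_right comp_neg_right closed)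
    finally show ?thesis
      using assms f'm g'm by (subst cls_eq_iff) (simp_all add: closed)
  qed
  also have "cls X Z (Comp C X Y Z g' f) = cls X Z (Comp C X Y Z g f)"
  proof -
    have "Comp C X Y Z (g' \<ominus>\<^bsub>Hom C Y Z\<^esub> g) f \<in> N X Z"
      using ideal_comp_right a g'm assms by blast
    also have "Comp C X Y Z (g' \<ominus>\<^bsub>Hom C Y Z\<^esub> g) f = Comp C X Y Z g' f \<ominus>\<^bsub>Hom C X Z\<^esub> Comp C X Y Z g f"
      using assms f'm g'm by (simp add: YZ.minus_eq XZ.minus_eq comp_add_left comp_neg_left closed)
    finally show ?thesis
      using assms f'm g'm by (subst cls_eq_iff) (simp_all add: closed)
  qed
  finally show ?thesis .
qed

text \<open>All members of the union are the same coset by \<open>comp_cong\<close>, and the union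
  is not empty since a coset contains its representative.\<close>

lemma comp_Q:
  assumes "X \<in> Obj C" "Y \<in> Obj C" "Z \<in> Obj C" "f \<in> Mor C X Y" "g \<in> Mor C Y Z"
  shows "Comp Q X Y Z (cls Y Z g) (cls X Y f) = cls X Z (Comp C X Y Z g f)"
proof -
  have "Comp Q X Y Z (cls Y Z g) (cls X Y f) =
      (\<Union>g'\<in>cls Y Z g. \<Union>f'\<in>cls X Y f. cls X Z (Comp C X Y Z g' f'))"
    by (simp add: quotient_precat_def)
  also have "\<dots> = (\<Union>g'\<in>cls Y Z g. \<Union>f'\<in>cls X Y f. cls X Z (Comp C X Y Z g f))"
    using comp_cong[OF assms] by (intro SUP_cong refl) auto
  also have "\<dots> = cls X Z (Comp C X Y Z g f)"
    using cls_self assms by blast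
  finally show ?thesis .
qed

lemma Mor_QE:
  assumes "F \<in> Mor Q X Y"
  obtains f where "f \<in> Mor C X Y" "F = cls X Y f"
  using assms by (auto simp: Mor_Q)

lemma preadditive_Q: "preadditive Q"
proof (rule preadditive.intro)
  fix X Y assume "X \<in> Obj Q" "Y \<in> Obj Q"
  then have o: "X \<in> Obj C" "Y \<in> Obj C" by simp_all
  interpret XY: abelian_group "Hom C X Y" by (simp add: o hom_group)
  show "abelian_group (Hom Q X Y)"
  proof (rule abelian_groupI)
    fix F assume "F \<in> Mor Q X Y"
    then obtain f where f: "f \<in> Mor C X Y" "F = cls X Y f" by (rule Mor_QE)
    show "\<exists>G\<in>Mor Q X Y. G \<oplus>\<^bsub>Hom Q X Y\<^esub> F = \<zero>\<^bsub>Hom Q X Y\<^esub>"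
      using f o by (auto intro!: bexI[of _ "cls X Y (\<ominus>\<^bsub>Hom C X Y\<^esub> f)"]
          simp: add_Q zero_Q cls_Mor XY.l_neg)
  qed (auto elim!: Mor_QE simp: o add_Q zero_Q cls_Mor XY.a_ac)
qed (auto elim!: Mor_QE simp: comp_Q add_Q Id_Q cls_Mor closed comp_assoc id_left id_right comp_add_left comp_add_right)

lemma neg_Q: assumes "X \<in> Obj C" "Y \<in> Obj C" "f \<in> Mor C X Y"
  shows "\<ominus>\<^bsub>Hom Q X Y\<^esub> cls X Y f = cls X Y (\<ominus>\<^bsub>Hom C X Y\<^esub> f)"
proof -
  interpret Q: preadditive Q by (rule preadditive_Q)
  have "cls X Y (\<ominus>\<^bsub>Hom C X Y\<^esub> f) = \<ominus>\<^bsub>Hom Q X Y\<^esub> cls X Y f"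
    using assms by (intro Q.neg_eqI) (simp_all add: cls_Mor neg_closed add_Q zero_Q neg_add)
  then show ?thesis by simp
qed

lemma is_iso_clsI:
  assumes "X \<in> Obj C" "Y \<in> Obj C" "is_iso C X Y f"
  shows "is_iso Q X Y (cls X Y f)"
proof -
  obtain g where g: "g \<in> Mor C Y X" "Comp C X Y X g f = Id C X" "Comp C Y X Y f g = Id C Y" "f \<in> Mor C X Y"
    using assms unfolding is_iso_def by auto
  then show ?thesis
    unfolding is_iso_def using assms
    by (auto intro!: bexI[of _ "cls Y X g"] cls_Mor simp: comp_Q Id_Q)
qed

lemma hom_ideal_op: "hom_ideal (op_precat C) (\<lambda>X Y. N Y X)"
  by (intro hom_ideal.intro preadditive_op hom_ideal_axioms.intro)
    (simp_all add: ideal_subgroup ideal_comp_left ideal_comp_right)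

end

lemma quotient_op: "quotient_precat (op_precat C) (\<lambda>X Y. N Y X) = op_precat (quotient_precat C N)"
  by (auto simp: quotient_precat_def op_precat_def fun_eq_iff)

text \<open>The map induced on cosets; the union ranges over a single coset.\<close>

definition quotient_map where
  "quotient_map D N' F Fm X Y H = (\<Union>h\<in>H. N' (F X) (F Y) +>\<^bsub>Hom D (F X) (F Y)\<^esub> Fm X Y h)"

section \<open>Functors induced on quotients\<close>

locale quotient_functor = C: hom_ideal C N + D: hom_ideal D N'
  for C :: "('o, 'h, 'z) precat_scheme" and N
    and D :: "('p, 'k, 'w) precat_scheme" and N' +
  fixes F Fm
  assumes is_functor: "additive_functor C D F Fm"
    and ideal: "\<lbrakk>X \<in> Obj C; Y \<in> Obj C; f \<in> N X Y\<rbrakk> \<Longrightarrow> Fm X Y f \<in> N' (F X) (F Y)"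
begin

lemma F_obj: "X \<in> Obj C \<Longrightarrow> F X \<in> Obj D"
  and F_id: "X \<in> Obj C \<Longrightarrow> Fm X X (Id C X) = Id D (F X)"
  and F_mor: "\<lbrakk>X \<in> Obj C; Y \<in> Obj C; f \<in> Mor C X Y\<rbrakk> \<Longrightarrow> Fm X Y f \<in> Mor D (F X) (F Y)"
  and F_add: "\<lbrakk>X \<in> Obj C; Y \<in> Obj C; f \<in> Mor C X Y; g \<in> Mor C X Y\<rbrakk>
    \<Longrightarrow> Fm X Y (f \<oplus>\<^bsub>Hom C X Y\<^esub> g) = Fm X Y f \<oplus>\<^bsub>Hom D (F X) (F Y)\<^esub> Fm X Y g"
  and F_comp: "\<lbrakk>X \<in> Obj C; Y \<in> Obj C; Z \<in> Obj C; f \<in> Mor C X Y; g \<in> Mor C Y Z\<rbrakk>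
    \<Longrightarrow> Fm X Z (Comp C X Y Z g f) = Comp D (F X) (F Y) (F Z) (Fm Y Z g) (Fm X Y f)"
  using is_functor unfolding additive_functor_def by blast+

text \<open>\<open>Fm\<close> carries the difference of two members of a coset into
  \<open>N'\<close>, so the union in \<open>quotient_map\<close> is over a constant family.\<close>

lemma quotient_map_cls:
  assumes "X \<in> Obj C" "Y \<in> Obj C" "f \<in> Mor C X Y"
  shows "quotient_map D N' F Fm X Y (C.cls X Y f) = D.cls (F X) (F Y) (Fm X Y f)"
proof -
  interpret XY: abelian_group "Hom C X Y" by (simp add: assms C.hom_group)
  interpret FXY: abelian_group "Hom D (F X) (F Y)" by (simp add: assms D.hom_group F_obj)
  have "D.cls (F X) (F Y) (Fm X Y h) = D.cls (F X) (F Y) (Fm X Y f)" if h: "h \<in> C.cls X Y f" for h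
  proof -
    have hm: "h \<in> Mor C X Y" and *: "h \<ominus>\<^bsub>Hom C X Y\<^esub> f \<in> N X Y"
      using h assms C.cls_MorD C.in_cls_iff by blast+
    have "Fm X Y h = Fm X Y ((h \<ominus>\<^bsub>Hom C X Y\<^esub> f) \<oplus>\<^bsub>Hom C X Y\<^esub> f)"
      using hm assms by (simp add: XY.minus_eq XY.a_assoc XY.l_neg)
    also have "\<dots> = Fm X Y (h \<ominus>\<^bsub>Hom C X Y\<^esub> f) \<oplus>\<^bsub>Hom D (F X) (F Y)\<^esub> Fm X Y f"
      using hm assms by (simp add: F_add)
    finally have "Fm X Y h \<ominus>\<^bsub>Hom D (F X) (F Y)\<^esub> Fm X Y f = Fm X Y (h \<ominus>\<^bsub>Hom C X Y\<^esub> f)"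
      using hm assms by (simp add: FXY.minus_eq FXY.a_assoc F_mor FXY.r_neg)
    then show ?thesis
      using ideal * hm assms by (simp add: D.cls_eq_iff F_obj F_mor)
  qed
  then have "quotient_map D N' F Fm X Y (C.cls X Y f) =
      (\<Union>h\<in>C.cls X Y f. D.cls (F X) (F Y) (Fm X Y f))"
    unfolding quotient_map_def by (intro SUP_cong refl)
  then show ?thesis
    using C.cls_self[OF assms] by blast
qed

lemma functor_Q: "additive_functor C.Q D.Q F (quotient_map D N' F Fm)"
  unfolding additive_functor_def
  by (auto elim!: C.Mor_QE simp: F_obj F_mor quotient_map_cls C.Id_Q D.Id_Q F_id C.add_Q D.add_Q F_add
      C.comp_Q D.comp_Q F_comp C.closed D.cls_Mor)

end

lemma quotient_natural_iso:
  assumes F: "quotient_functor C N D N' F Fm" and G: "quotient_functor C N D N' G Gm"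
    and nat: "natural_iso C D F Fm G Gm \<eta>"
  shows "natural_iso (quotient_precat C N) (quotient_precat D N')
    F (quotient_map D N' F Fm) G (quotient_map D N' G Gm)
    (\<lambda>X. N' (F X) (G X) +>\<^bsub>Hom D (F X) (G X)\<^esub> \<eta> X)"
proof -
  interpret F: quotient_functor C N D N' F Fm by (rule F)
  interpret G: quotient_functor C N D N' G Gm by (rule G)
  have iso: "is_iso D (F X) (G X) (\<eta> X)" if "X \<in> Obj C" for X
    using nat that unfolding natural_iso_def by blast
  then have mor: "\<eta> X \<in> Mor D (F X) (G X)" if "X \<in> Obj C" for X
    using that unfolding is_iso_def by blast
  have *: "Comp D (F X) (F Y) (G Y) (\<eta> Y) (Fm X Y f) = Comp D (F X) (G X) (G Y) (Gm X Y f) (\<eta> X)"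
    if "X \<in> Obj C" "Y \<in> Obj C" "f \<in> Mor C X Y" for X Y f
    using nat that unfolding natural_iso_def by blast
  show ?thesis
    unfolding natural_iso_def
    by (auto elim!: F.C.Mor_QE intro!: F.D.is_iso_clsI
        simp: F.F_obj G.F_obj F.quotient_map_cls G.quotient_map_cls F.D.comp_Q F.F_mor G.F_mor mor * iso)
qed

text \<open>In the opposite category the components of \<eta> point from \<open>X\<close> to
  \<open>F X\<close>. The transformation from \<open>F\<close> to the identity there consists of
  their inverses. This is what the counit of an equivalence with an opposite category
  requires.\<close>

lemma natural_iso_op:
  assumes C: "preadditive C" and F: "additive_functor C C F Fm"
    and nat: "natural_iso C C F Fm (\<lambda>X. X) (\<lambda>X Y f. f) \<eta>"
  shows "\<exists>\<theta>. natural_iso (op_precat C) (op_precat C) F (\<lambda>X Y f. Fm Y X f) (\<lambda>X. X) (\<lambda>X Y f. f) \<theta>"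
proof -
  interpret preadditive C by (rule C)
  have obj: "F X \<in> Obj C" if "X \<in> Obj C" for X
    using F that unfolding additive_functor_def by blast
  have mor: "Fm X Y f \<in> Mor C (F X) (F Y)" if "X \<in> Obj C" "Y \<in> Obj C" "f \<in> Mor C X Y" for X Y f
    using F that unfolding additive_functor_def by blast
  have iso: "is_iso C (F X) X (\<eta> X)" if "X \<in> Obj C" for X
    using nat that unfolding natural_iso_def by blast
  then have "\<forall>X\<in>Obj C. \<exists>g. g \<in> Mor C X (F X) \<and> Comp C (F X) X (F X) g (\<eta> X) = Id C (F X) \<and>
      Comp C X (F X) X (\<eta> X) g = Id C X"
    unfolding is_iso_def by blast
  then obtain \<theta> where th: "\<And>X. X \<in> Obj C \<Longrightarrow> \<theta> X \<in> Mor C X (F X) \<and>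
      Comp C (F X) X (F X) (\<theta> X) (\<eta> X) = Id C (F X) \<and> Comp C X (F X) X (\<eta> X) (\<theta> X) = Id C X"
    by metis
  have eta: "\<eta> X \<in> Mor C (F X) X" if "X \<in> Obj C" for X
    using iso that unfolding is_iso_def by blast
  have n: "Comp C (F X) (F Y) Y (\<eta> Y) (Fm X Y f) = Comp C (F X) X Y f (\<eta> X)"
    if "X \<in> Obj C" "Y \<in> Obj C" "f \<in> Mor C X Y" for X Y f
    using nat that unfolding natural_iso_def by blast
  have "Comp C X (F X) (F Y) (Fm X Y f) (\<theta> X) = Comp C X Y (F Y) (\<theta> Y) f"
    if XY: "X \<in> Obj C" "Y \<in> Obj C" and f: "f \<in> Mor C X Y" for X Y f
  proof -
    note s = XY f obj mor th eta
    \<comment> \<open>The identity of \<open>F Y\<close> is written as \<open>\<theta> Y\<close>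
      after \<open>\<eta> Y\<close>, which brings in the naturality square of \<eta>.\<close>
    have "Comp C X (F X) (F Y) (Fm X Y f) (\<theta> X) =
        Comp C X (F X) (F Y) (Comp C (F X) (F Y) (F Y) (Comp C (F Y) Y (F Y) (\<theta> Y) (\<eta> Y)) (Fm X Y f)) (\<theta> X)"
      using s by (simp add: id_left)
    also have "\<dots> = Comp C X Y (F Y) (\<theta> Y) (Comp C X (F X) Y (Comp C (F X) (F Y) Y (\<eta> Y) (Fm X Y f)) (\<theta> X))"
      using s by (simp add: comp_assoc closed comp_assoc_eq[of "F Y" Y "F Y" "\<theta> Y" "\<eta> Y" "Id C (F Y)"])
    also have "\<dots> = Comp C X Y (F Y) (\<theta> Y) f"
      using s by (simp add: n comp_assoc closed id_right)
    finally show ?thesis .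
  qed
  then have "natural_iso (op_precat C) (op_precat C) F (\<lambda>X Y f. Fm Y X f) (\<lambda>X. X) (\<lambda>X Y f. f) \<theta>"
    unfolding natural_iso_def is_iso_op_iff using th eta obj
    by (auto simp: is_iso_def intro!: bexI[of _ "\<eta> _"])
  then show ?thesis by blast
qed

section \<open>Complexes over a preadditive category\<close>

definition chain_precat :: "('o, 'h, 'z) precat_scheme \<Rightarrow> (('o, 'h) cochain, int \<Rightarrow> 'h) precat" where
  "chain_precat A = \<lparr>Obj = bounded_complexes A, Hom = chain_maps A, Comp = chain_comp A,
     Id = (\<lambda>X n. Id A (Ob X n))\<rparr>"

lemma chain_precat_simps [simp]:
  "Obj (chain_precat A) = bounded_complexes A" "Hom (chain_precat A) = chain_maps A"
  "Comp (chain_precat A) = chain_comp A" "Id (chain_precat A) X = (\<lambda>n. Id A (Ob X n))"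
  by (simp_all add: chain_precat_def)

lemma homotopy_precat_eq: "homotopy_precat A = quotient_precat (chain_precat A) (null_homotopic A)"
  by (simp add: homotopy_precat_def quotient_precat_def homotopy_class_def)

lemma chain_maps_simps [simp]:
  "\<zero>\<^bsub>chain_maps A X Y\<^esub> = (\<lambda>n. \<zero>\<^bsub>Hom A (Ob X n) (Ob Y n)\<^esub>)"
  "f \<oplus>\<^bsub>chain_maps A X Y\<^esub> g = (\<lambda>n. f n \<oplus>\<^bsub>Hom A (Ob X n) (Ob Y n)\<^esub> g n)"
  by (simp_all add: chain_maps_def)

text \<open>The target degree is a separate variable tied to \<open>n\<close> by an equation, here
  and in the following lemmas. The rules then also apply to degrees written as \<open>n - 1\<close>
  and \<open>n\<close>, where unification alone would fail.\<close>

lemma Ob_Obj: "X \<in> bounded_complexes A \<Longrightarrow> Ob X n \<in> Obj A"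
  and Diff_Mor: "\<lbrakk>X \<in> bounded_complexes A; m = n + 1\<rbrakk> \<Longrightarrow> Diff X n \<in> Mor A (Ob X n) (Ob X m)"
  by (simp_all add: bounded_complexes_def)

lemma Diff_Diff: "\<lbrakk>X \<in> bounded_complexes A; m = n + 1; k = n + 2\<rbrakk>
    \<Longrightarrow> Comp A (Ob X n) (Ob X m) (Ob X k) (Diff X m) (Diff X n) = \<zero>\<^bsub>Hom A (Ob X n) (Ob X k)\<^esub>"
proof -
  assume *: "X \<in> bounded_complexes A" "m = n + 1" "k = n + 2"
  then have k: "k = n + 1 + 1" by simp
  from * have "Comp A (Ob X n) (Ob X (n + 1)) (Ob X (n + 1 + 1)) (Diff X (n + 1)) (Diff X n)
      = \<zero>\<^bsub>Hom A (Ob X n) (Ob X (n + 1 + 1))\<^esub>"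
    unfolding bounded_complexes_def by blast
  then show ?thesis
    by (simp only: k *(2))
qed

lemma bounded_complexesI:
  assumes "\<And>n. Ob X n \<in> Obj A" "\<And>n. Diff X n \<in> Mor A (Ob X n) (Ob X (n + 1))"
    and "\<And>n. Comp A (Ob X n) (Ob X (n + 1)) (Ob X (n + 2)) (Diff X (n + 1)) (Diff X n)
      = \<zero>\<^bsub>Hom A (Ob X n) (Ob X (n + 2))\<^esub>"
    and "\<And>n. \<bar>n\<bar> > N \<Longrightarrow> is_zero_object A (Ob X n)"
  shows "X \<in> bounded_complexes A"
  unfolding bounded_complexes_def using assms by (auto simp: add.assoc)

lemma chain_map_Mor: "f \<in> carrier (chain_maps A X Y) \<Longrightarrow> f n \<in> Mor A (Ob X n) (Ob Y n)"
  by (simp add: chain_maps_def)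

lemma chain_map_square: "\<lbrakk>f \<in> carrier (chain_maps A X Y); m = n + 1\<rbrakk>
    \<Longrightarrow> Comp A (Ob X n) (Ob X m) (Ob Y m) (f m) (Diff X n)
      = Comp A (Ob X n) (Ob Y n) (Ob Y m) (Diff Y n) (f n)"
  by (simp add: chain_maps_def)

lemma chain_mapI:
  assumes "\<And>n. f n \<in> Mor A (Ob X n) (Ob Y n)"
    and "\<And>n. Comp A (Ob X n) (Ob X (n + 1)) (Ob Y (n + 1)) (f (n + 1)) (Diff X n)
      = Comp A (Ob X n) (Ob Y n) (Ob Y (n + 1)) (Diff Y n) (f n)"
  shows "f \<in> carrier (chain_maps A X Y)"
  using assms by (simp add: chain_maps_def)

context preadditive
begin

lemmas cx = Ob_Obj Diff_Mor Diff_Diff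

lemma chain_neg_closed: "\<lbrakk>X \<in> bounded_complexes C; Y \<in> bounded_complexes C; f \<in> carrier (chain_maps C X Y)\<rbrakk>
    \<Longrightarrow> (\<lambda>n. \<ominus>\<^bsub>Hom C (Ob X n) (Ob Y n)\<^esub> f n) \<in> carrier (chain_maps C X Y)"
  by (rule chain_mapI)
    (simp_all add: closed cx chain_map_Mor comp_neg_left comp_neg_right chain_map_square)

lemma chain_comp_closed:
  assumes "X \<in> bounded_complexes C" "Y \<in> bounded_complexes C" "Z \<in> bounded_complexes C"
    and f: "f \<in> carrier (chain_maps C X Y)" and g: "g \<in> carrier (chain_maps C Y Z)"
  shows "chain_comp C X Y Z g f \<in> carrier (chain_maps C X Z)"
proof (rule chain_mapI)
  fix n
  show "Comp C (Ob X n) (Ob X (n + 1)) (Ob Z (n + 1)) (chain_comp C X Y Z g f (n + 1)) (Diff X n) =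
         Comp C (Ob X n) (Ob Z n) (Ob Z (n + 1)) (Diff Z n) (chain_comp C X Y Z g f n)"
    using assms comp_assoc_eq[OF chain_map_square[OF g refl], of "Ob X n" n "f n"]
    by (simp add: chain_comp_def comp_assoc closed cx chain_map_Mor chain_map_square[OF f])
qed (use assms in \<open>simp_all add: chain_comp_def closed cx chain_map_Mor\<close>)

lemma preadditive_chain: "preadditive (chain_precat C)"
proof (rule preadditive.intro)
  fix X Y assume "X \<in> Obj (chain_precat C)" "Y \<in> Obj (chain_precat C)"
  then have o: "X \<in> bounded_complexes C" "Y \<in> bounded_complexes C" by simp_all
  show "abelian_group (Hom (chain_precat C) X Y)"
  proof (rule abelian_groupI)
    fix f assume "f \<in> Mor (chain_precat C) X Y"
    then have f: "f \<in> carrier (chain_maps C X Y)" by simp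
    show "\<exists>g\<in>Mor (chain_precat C) X Y. g \<oplus>\<^bsub>Hom (chain_precat C) X Y\<^esub> f = \<zero>\<^bsub>Hom (chain_precat C) X Y\<^esub>"
      using f o chain_neg_closed[of X Y f]
      by (auto intro!: bexI[of _ "\<lambda>n. \<ominus>\<^bsub>Hom C (Ob X n) (Ob Y n)\<^esub> f n"] simp: neg_add cx chain_map_Mor)
  next
    show "\<zero>\<^bsub>Hom (chain_precat C) X Y\<^esub> \<in> Mor (chain_precat C) X Y"
      unfolding chain_precat_simps
      by (rule chain_mapI) (simp_all add: o closed cx comp_zero_left comp_zero_right)
  next
    fix f g assume "f \<in> Mor (chain_precat C) X Y" "g \<in> Mor (chain_precat C) X Y"
    then show "f \<oplus>\<^bsub>Hom (chain_precat C) X Y\<^esub> g \<in> Mor (chain_precat C) X Y"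
      unfolding chain_precat_simps
      by (intro chain_mapI)
        (simp_all add: o closed cx comp_add_left comp_add_right chain_map_Mor chain_map_square)
  qed (auto simp: fun_eq_iff o add_assoc add_commute add_zero_left cx chain_map_Mor)
next
  fix X assume "X \<in> Obj (chain_precat C)"
  then show "Id (chain_precat C) X \<in> Mor (chain_precat C) X X"
    unfolding chain_precat_simps
    by (intro chain_mapI) (simp_all add: closed cx id_left id_right)
qed (auto simp: chain_comp_closed[unfolded chain_comp_def] chain_comp_def fun_eq_iff closed cx
    chain_map_Mor comp_assoc id_left id_right comp_add_left comp_add_right)

lemma chain_neg: assumes "X \<in> bounded_complexes C" "Y \<in> bounded_complexes C" "f \<in> carrier (chain_maps C X Y)"
  shows "\<ominus>\<^bsub>chain_maps C X Y\<^esub> f = (\<lambda>n. \<ominus>\<^bsub>Hom C (Ob X n) (Ob Y n)\<^esub> f n)"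
proof -
  interpret Ch: preadditive "chain_precat C" by (rule preadditive_chain)
  show ?thesis
    using Ch.neg_eqI[of X Y "\<lambda>n. \<ominus>\<^bsub>Hom C (Ob X n) (Ob Y n)\<^esub> f n" f] assms
    by (simp add: chain_neg_closed neg_add cx chain_map_Mor)
qed

section \<open>The ideal of null-homotopic maps\<close>

lemma null_homotopicI:
  assumes "f \<in> carrier (chain_maps C X Y)" "\<And>n. s n \<in> Mor C (Ob X n) (Ob Y (n - 1))"
    and "\<And>n. f n = Comp C (Ob X n) (Ob Y (n - 1)) (Ob Y n) (Diff Y (n - 1)) (s n)
         \<oplus>\<^bsub>Hom C (Ob X n) (Ob Y n)\<^esub>
           Comp C (Ob X n) (Ob X (n + 1)) (Ob Y n) (s (n + 1)) (Diff X n)"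
  shows "f \<in> null_homotopic C X Y"
  unfolding null_homotopic_def using assms by blast

lemma null_homotopicE:
  assumes "f \<in> null_homotopic C X Y"
  obtains s where "f \<in> carrier (chain_maps C X Y)"
    and "\<And>n m. m = n - 1 \<Longrightarrow> s n \<in> Mor C (Ob X n) (Ob Y m)"
    and "\<And>n. f n = Comp C (Ob X n) (Ob Y (n - 1)) (Ob Y n) (Diff Y (n - 1)) (s n)
         \<oplus>\<^bsub>Hom C (Ob X n) (Ob Y n)\<^esub>
           Comp C (Ob X n) (Ob X (n + 1)) (Ob Y n) (s (n + 1)) (Diff X n)"
  using assms unfolding null_homotopic_def by blast

lemma add_swap_middle: "\<lbrakk>X \<in> Obj C; Y \<in> Obj C; a \<in> Mor C X Y; b \<in> Mor C X Y; c \<in> Mor C X Y; d \<in> Mor C X Y\<rbrakk>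
    \<Longrightarrow> (a \<oplus>\<^bsub>Hom C X Y\<^esub> b) \<oplus>\<^bsub>Hom C X Y\<^esub> (c \<oplus>\<^bsub>Hom C X Y\<^esub> d) =
      (a \<oplus>\<^bsub>Hom C X Y\<^esub> c) \<oplus>\<^bsub>Hom C X Y\<^esub> (b \<oplus>\<^bsub>Hom C X Y\<^esub> d)"
  by (metis add_assoc add_commute add_closed)

lemma neg_add_distrib: "\<lbrakk>X \<in> Obj C; Y \<in> Obj C; a \<in> Mor C X Y; b \<in> Mor C X Y\<rbrakk>
    \<Longrightarrow> \<ominus>\<^bsub>Hom C X Y\<^esub> (a \<oplus>\<^bsub>Hom C X Y\<^esub> b) = (\<ominus>\<^bsub>Hom C X Y\<^esub> a) \<oplus>\<^bsub>Hom C X Y\<^esub> (\<ominus>\<^bsub>Hom C X Y\<^esub> b)"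
  by (meson hom_group abelian_group.minus_add)

lemma null_subgroup:
  assumes o: "X \<in> bounded_complexes C" "Y \<in> bounded_complexes C"
  shows "additive_subgroup (null_homotopic C X Y) (chain_maps C X Y)"
proof -
  interpret Ch: preadditive "chain_precat C" by (rule preadditive_chain)
  interpret H: abelian_group "chain_maps C X Y" using Ch.hom_group o by simp
  show ?thesis
  proof (intro additive_subgroup.intro H.add.subgroupI)
    show "null_homotopic C X Y \<subseteq> carrier (chain_maps C X Y)"
      by (auto simp: null_homotopic_def)
    have "\<zero>\<^bsub>chain_maps C X Y\<^esub> \<in> null_homotopic C X Y"
      by (rule null_homotopicI[where s = "\<lambda>n. \<zero>\<^bsub>Hom C (Ob X n) (Ob Y (n - 1))\<^esub>"])
        (use H.zero_closed in \<open>auto simp: o closed cx comp_zero_left comp_zero_right add_zero_left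
          simp del: add_diff_cancel_right' \<close>)
    then show "null_homotopic C X Y \<noteq> {}" by blast
  next
    fix f assume "f \<in> null_homotopic C X Y"
    then obtain s where f: "f \<in> carrier (chain_maps C X Y)"
      and s: "\<And>n m. m = n - 1 \<Longrightarrow> s n \<in> Mor C (Ob X n) (Ob Y m)"
      and e: "\<And>n. f n = Comp C (Ob X n) (Ob Y (n - 1)) (Ob Y n) (Diff Y (n - 1)) (s n)
         \<oplus>\<^bsub>Hom C (Ob X n) (Ob Y n)\<^esub>
           Comp C (Ob X n) (Ob X (n + 1)) (Ob Y n) (s (n + 1)) (Diff X n)"
      by (rule null_homotopicE) blast
    show "\<ominus>\<^bsub>chain_maps C X Y\<^esub> f \<in> null_homotopic C X Y"
    proof (rule null_homotopicI[where s = "\<lambda>n. \<ominus>\<^bsub>Hom C (Ob X n) (Ob Y (n - 1))\<^esub> s n"])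
      fix n
      show "(\<ominus>\<^bsub>chain_maps C X Y\<^esub> f) n =
         Comp C (Ob X n) (Ob Y (n - 1)) (Ob Y n) (Diff Y (n - 1)) (\<ominus>\<^bsub>Hom C (Ob X n) (Ob Y (n - 1))\<^esub> s n)
         \<oplus>\<^bsub>Hom C (Ob X n) (Ob Y n)\<^esub>
         Comp C (Ob X n) (Ob X (n + 1)) (Ob Y n) (\<ominus>\<^bsub>Hom C (Ob X (n + 1)) (Ob Y (n + 1 - 1))\<^esub> s (n + 1)) (Diff X n)"
        using o f by (simp add: chain_neg e neg_add_distrib comp_neg_left comp_neg_right closed cx s)
    qed (use o f s in \<open>simp_all add: closed cx\<close>)
  next
    fix f g assume "f \<in> null_homotopic C X Y" "g \<in> null_homotopic C X Y"
    obtain s where f: "f \<in> carrier (chain_maps C X Y)"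
      and s: "\<And>n m. m = n - 1 \<Longrightarrow> s n \<in> Mor C (Ob X n) (Ob Y m)"
      and e: "\<And>n. f n = Comp C (Ob X n) (Ob Y (n - 1)) (Ob Y n) (Diff Y (n - 1)) (s n)
         \<oplus>\<^bsub>Hom C (Ob X n) (Ob Y n)\<^esub>
           Comp C (Ob X n) (Ob X (n + 1)) (Ob Y n) (s (n + 1)) (Diff X n)"
      using \<open>f \<in> _\<close> by (rule null_homotopicE) blast
    obtain t where g: "g \<in> carrier (chain_maps C X Y)"
      and t: "\<And>n m. m = n - 1 \<Longrightarrow> t n \<in> Mor C (Ob X n) (Ob Y m)"
      and e': "\<And>n. g n = Comp C (Ob X n) (Ob Y (n - 1)) (Ob Y n) (Diff Y (n - 1)) (t n)
         \<oplus>\<^bsub>Hom C (Ob X n) (Ob Y n)\<^esub>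
           Comp C (Ob X n) (Ob X (n + 1)) (Ob Y n) (t (n + 1)) (Diff X n)"
      using \<open>g \<in> _\<close> by (rule null_homotopicE) blast
    show "f \<oplus>\<^bsub>chain_maps C X Y\<^esub> g \<in> null_homotopic C X Y"
    proof (rule null_homotopicI[where s = "\<lambda>n. s n \<oplus>\<^bsub>Hom C (Ob X n) (Ob Y (n - 1))\<^esub> t n"])
      fix n
      show "(f \<oplus>\<^bsub>chain_maps C X Y\<^esub> g) n =
         Comp C (Ob X n) (Ob Y (n - 1)) (Ob Y n) (Diff Y (n - 1)) (s n \<oplus>\<^bsub>Hom C (Ob X n) (Ob Y (n - 1))\<^esub> t n)
         \<oplus>\<^bsub>Hom C (Ob X n) (Ob Y n)\<^esub>
         Comp C (Ob X n) (Ob X (n + 1)) (Ob Y n) (s (n + 1) \<oplus>\<^bsub>Hom C (Ob X (n + 1)) (Ob Y (n + 1 - 1))\<^esub> t (n + 1)) (Diff X n)"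
        using o by (simp add: e e' comp_add_left comp_add_right closed cx s t add_swap_middle)
    qed (use o f g s t H.a_closed[OF f g] in \<open>simp_all add: closed cx\<close>)
  qed
qed

text \<open>A homotopy \<open>s\<close> of \<open>f\<close> gives the homotopy
  \<open>g (n - 1)\<close> after \<open>s n\<close> of the composite, because \<open>g\<close>
  commutes with the differentials; \<open>null_comp_right\<close> takes \<open>s n\<close> after
  \<open>f n\<close> for the same reason.\<close>

lemma null_comp_left:
  assumes o: "X \<in> bounded_complexes C" "Y \<in> bounded_complexes C" "Z \<in> bounded_complexes C"
    and "f \<in> null_homotopic C X Y" and g: "g \<in> carrier (chain_maps C Y Z)"
  shows "chain_comp C X Y Z g f \<in> null_homotopic C X Z"
proof -
  obtain s where f: "f \<in> carrier (chain_maps C X Y)"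
    and s: "\<And>n m. m = n - 1 \<Longrightarrow> s n \<in> Mor C (Ob X n) (Ob Y m)"
    and e: "\<And>n. f n = Comp C (Ob X n) (Ob Y (n - 1)) (Ob Y n) (Diff Y (n - 1)) (s n)
       \<oplus>\<^bsub>Hom C (Ob X n) (Ob Y n)\<^esub>
         Comp C (Ob X n) (Ob X (n + 1)) (Ob Y n) (s (n + 1)) (Diff X n)"
    using \<open>f \<in> _\<close> by (rule null_homotopicE) blast
  have "chain_comp C X Y Z g f \<in> null_homotopic C X Z"
  proof (rule null_homotopicI[where s = "\<lambda>n. Comp C (Ob X n) (Ob Y (n - 1)) (Ob Z (n - 1)) (g (n - 1)) (s n)"])
    fix n
    show "chain_comp C X Y Z g f n = Comp C (Ob X n) (Ob Z (n - 1)) (Ob Z n) (Diff Z (n - 1))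
         (Comp C (Ob X n) (Ob Y (n - 1)) (Ob Z (n - 1)) (g (n - 1)) (s n)) \<oplus>\<^bsub>Hom C (Ob X n) (Ob Z n)\<^esub>
        Comp C (Ob X n) (Ob X (n + 1)) (Ob Z n)
         (Comp C (Ob X (n + 1)) (Ob Y (n + 1 - 1)) (Ob Z (n + 1 - 1)) (g (n + 1 - 1)) (s (n + 1))) (Diff X n)"
      using o f g comp_assoc_eq[OF chain_map_square[OF g, of n "n - 1"], of "Ob X n" "s n"]
      by (simp add: chain_comp_def e s comp_add_right comp_assoc closed cx chain_map_Mor)
  qed (use o f g s in \<open>simp_all add: chain_comp_closed closed cx chain_map_Mor\<close>)
  then show ?thesis .
qed

lemma null_comp_right:
  assumes o: "X \<in> bounded_complexes C" "Y \<in> bounded_complexes C" "Z \<in> bounded_complexes C"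
    and f: "f \<in> carrier (chain_maps C X Y)" and "g \<in> null_homotopic C Y Z"
  shows "chain_comp C X Y Z g f \<in> null_homotopic C X Z"
proof -
  obtain s where g: "g \<in> carrier (chain_maps C Y Z)"
    and s: "\<And>n m. m = n - 1 \<Longrightarrow> s n \<in> Mor C (Ob Y n) (Ob Z m)"
    and e: "\<And>n. g n = Comp C (Ob Y n) (Ob Z (n - 1)) (Ob Z n) (Diff Z (n - 1)) (s n)
       \<oplus>\<^bsub>Hom C (Ob Y n) (Ob Z n)\<^esub>
         Comp C (Ob Y n) (Ob Y (n + 1)) (Ob Z n) (s (n + 1)) (Diff Y n)"
    using \<open>g \<in> _\<close> by (rule null_homotopicE) blast
  have "chain_comp C X Y Z g f \<in> null_homotopic C X Z"
  proof (rule null_homotopicI[where s = "\<lambda>n. Comp C (Ob X n) (Ob Y n) (Ob Z (n - 1)) (s n) (f n)"])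
    fix n
    show "chain_comp C X Y Z g f n = Comp C (Ob X n) (Ob Z (n - 1)) (Ob Z n) (Diff Z (n - 1))
         (Comp C (Ob X n) (Ob Y n) (Ob Z (n - 1)) (s n) (f n)) \<oplus>\<^bsub>Hom C (Ob X n) (Ob Z n)\<^esub>
        Comp C (Ob X n) (Ob X (n + 1)) (Ob Z n)
         (Comp C (Ob X (n + 1)) (Ob Y (n + 1)) (Ob Z (n + 1 - 1)) (s (n + 1)) (f (n + 1))) (Diff X n)"
      using o f g
      by (simp add: chain_comp_def e s comp_add_left comp_assoc closed cx chain_map_Mor chain_map_square[OF f])
  qed (use o f g s in \<open>simp_all add: chain_comp_closed closed cx chain_map_Mor\<close>)
  then show ?thesis .
qed

lemma hom_ideal_null: "hom_ideal (chain_precat C) (null_homotopic C)"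
  by (intro hom_ideal.intro hom_ideal_axioms.intro preadditive_chain)
    (simp_all add: null_subgroup null_comp_left null_comp_right)

text \<open>Degreewise inverses commute with the differentials automatically: insert
  \<open>f g = 1\<close> before \<open>Diff Y n\<close>, move \<open>f\<close> across its square and
  cancel \<open>g f\<close>.\<close>

lemma chain_iso:
  assumes o: "X \<in> bounded_complexes C" "Y \<in> bounded_complexes C"
    and f: "f \<in> carrier (chain_maps C X Y)" and iso: "\<And>n. is_iso C (Ob X n) (Ob Y n) (f n)"
  shows "is_iso (chain_precat C) X Y f"
proof -
  have "\<forall>n. \<exists>g. g \<in> Mor C (Ob Y n) (Ob X n) \<and> Comp C (Ob X n) (Ob Y n) (Ob X n) g (f n) = Id C (Ob X n) \<and>
    Comp C (Ob Y n) (Ob X n) (Ob Y n) (f n) g = Id C (Ob Y n)"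
    using iso unfolding is_iso_def by blast
  then obtain g where g: "\<And>n. g n \<in> Mor C (Ob Y n) (Ob X n)"
    and gf: "\<And>n. Comp C (Ob X n) (Ob Y n) (Ob X n) (g n) (f n) = Id C (Ob X n)"
    and fg: "\<And>n. Comp C (Ob Y n) (Ob X n) (Ob Y n) (f n) (g n) = Id C (Ob Y n)"
    by metis
  have gm: "g \<in> carrier (chain_maps C Y X)"
  proof (rule chain_mapI)
    fix n
    note s = o f g closed cx chain_map_Mor
    have "Comp C (Ob Y n) (Ob Y (n + 1)) (Ob X (n + 1)) (g (n + 1)) (Diff Y n) =
      Comp C (Ob Y n) (Ob Y (n + 1)) (Ob X (n + 1)) (g (n + 1)) (Comp C (Ob Y n) (Ob X n) (Ob Y (n + 1))
         (Comp C (Ob X n) (Ob Y n) (Ob Y (n + 1)) (Diff Y n) (f n)) (g n))"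
      by (simp add: s comp_assoc fg id_right)
    also have "\<dots> = Comp C (Ob Y n) (Ob Y (n + 1)) (Ob X (n + 1)) (g (n + 1)) (Comp C (Ob Y n) (Ob X n) (Ob Y (n + 1))
         (Comp C (Ob X n) (Ob X (n + 1)) (Ob Y (n + 1)) (f (n + 1)) (Diff X n)) (g n))"
      by (simp add: chain_map_square[OF f])
    also have "\<dots> = Comp C (Ob Y n) (Ob X n) (Ob X (n + 1)) (Diff X n) (g n)"
      by (simp add: s comp_assoc comp_assoc_eq[OF gf] id_left)
    finally show "Comp C (Ob Y n) (Ob Y (n + 1)) (Ob X (n + 1)) (g (n + 1)) (Diff Y n) =
      Comp C (Ob Y n) (Ob X n) (Ob X (n + 1)) (Diff X n) (g n)" .
  qed (rule g)
  then show ?thesis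
    unfolding is_iso_def using f by (auto intro!: bexI[of _ g] simp: chain_comp_def gf fg)
qed

end

section \<open>Contravariant functors on complexes\<close>

locale contravariant = A: preadditive A + B: preadditive B
  for A :: "('o, 'h, 'z) precat_scheme" and B :: "('p, 'k, 'w) precat_scheme" +
  fixes D Dm
  assumes is_functor: "additive_functor A (op_precat B) D Dm"
begin

lemma D_obj: "X \<in> Obj A \<Longrightarrow> D X \<in> Obj B"
  and D_id: "X \<in> Obj A \<Longrightarrow> Dm X X (Id A X) = Id B (D X)"
  and D_mor: "\<lbrakk>X \<in> Obj A; Y \<in> Obj A; f \<in> Mor A X Y\<rbrakk> \<Longrightarrow> Dm X Y f \<in> Mor B (D Y) (D X)"
  and D_add: "\<lbrakk>X \<in> Obj A; Y \<in> Obj A; f \<in> Mor A X Y; g \<in> Mor A X Y\<rbrakk>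
    \<Longrightarrow> Dm X Y (f \<oplus>\<^bsub>Hom A X Y\<^esub> g) = Dm X Y f \<oplus>\<^bsub>Hom B (D Y) (D X)\<^esub> Dm X Y g"
  and D_comp: "\<lbrakk>X \<in> Obj A; Y \<in> Obj A; Z \<in> Obj A; f \<in> Mor A X Y; g \<in> Mor A Y Z\<rbrakk>
    \<Longrightarrow> Dm X Z (Comp A X Y Z g f) = Comp B (D Z) (D Y) (D X) (Dm X Y f) (Dm Y Z g)"
  using is_functor unfolding additive_functor_def by (simp_all add: Ball_def)

lemma D_zero: assumes "X \<in> Obj A" "Y \<in> Obj A"
  shows "Dm X Y \<zero>\<^bsub>Hom A X Y\<^esub> = \<zero>\<^bsub>Hom B (D Y) (D X)\<^esub>"
proof (rule B.add_cancel_zero)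
  show "Dm X Y \<zero>\<^bsub>Hom A X Y\<^esub> = Dm X Y \<zero>\<^bsub>Hom A X Y\<^esub> \<oplus>\<^bsub>Hom B (D Y) (D X)\<^esub> Dm X Y \<zero>\<^bsub>Hom A X Y\<^esub>"
    using assms by (simp add: A.add_zero_left A.closed flip: D_add)
qed (use assms in \<open>simp_all add: D_obj D_mor A.closed\<close>)

lemma D_neg: assumes "X \<in> Obj A" "Y \<in> Obj A" "f \<in> Mor A X Y"
  shows "Dm X Y (\<ominus>\<^bsub>Hom A X Y\<^esub> f) = \<ominus>\<^bsub>Hom B (D Y) (D X)\<^esub> Dm X Y f"
proof (rule B.neg_eqI)
  show "Dm X Y (\<ominus>\<^bsub>Hom A X Y\<^esub> f) \<oplus>\<^bsub>Hom B (D Y) (D X)\<^esub> Dm X Y f = \<zero>\<^bsub>Hom B (D Y) (D X)\<^esub>"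
    using assms by (simp add: A.neg_add A.closed D_zero flip: D_add)
qed (use assms in \<open>simp_all add: D_obj D_mor A.closed\<close>)

lemma D_zero_object: "is_zero_object A X \<Longrightarrow> is_zero_object B (D X)"
  unfolding is_zero_object_def by (metis D_obj D_id D_zero)

text \<open>No sign is put into the differential. Dualising twice then returns
  \<open>Diff X n\<close> up to the unit without correction, and the shift goes to
  \<open>unshift_complex\<close> as an equality of complexes, see \<open>dual_complex_shift\<close>.
  The price is a sign in \<open>dual_cone_triangle\<close>.\<close>

definition dual_complex where
  "dual_complex X = \<lparr>Ob = (\<lambda>n. D (Ob X (- n))),
     Diff = (\<lambda>n. Dm (Ob X (- n - 1)) (Ob X (- n)) (Diff X (- n - 1)))\<rparr>"

definition dual_map where
  "dual_map X Y f = (\<lambda>n. Dm (Ob X (- n)) (Ob Y (- n)) (f (- n)))"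

lemma dual_complex_simps [simp]:
  "Ob (dual_complex X) n = D (Ob X (- n))"
  "Diff (dual_complex X) n = Dm (Ob X (- n - 1)) (Ob X (- n)) (Diff X (- n - 1))"
  by (simp_all add: dual_complex_def)

lemma dual_complex_closed:
  assumes X: "X \<in> bounded_complexes A"
  shows "dual_complex X \<in> bounded_complexes B"
proof -
  obtain N where N: "\<And>n. \<bar>n\<bar> > N \<Longrightarrow> is_zero_object A (Ob X n)"
    using X unfolding bounded_complexes_def by blast
  show ?thesis
  proof (rule bounded_complexesI[where N = N])
    fix n :: int
    have [simp]: "- 2 - n = - n - 2" by simp
    show "Comp B (Ob (dual_complex X) n) (Ob (dual_complex X) (n + 1)) (Ob (dual_complex X) (n + 2))
        (Diff (dual_complex X) (n + 1)) (Diff (dual_complex X) n)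
      = \<zero>\<^bsub>Hom B (Ob (dual_complex X) n) (Ob (dual_complex X) (n + 2))\<^esub>"
      using X D_comp[of "Ob X (- n - 2)" "Ob X (- n - 1)" "Ob X (- n)" "Diff X (- n - 2)" "Diff X (- n - 1)"]
      by (simp add: A.cx D_zero)
  qed (use X N in \<open>simp_all add: D_obj D_mor A.cx D_zero_object\<close>)
qed

lemma dual_map_closed:
  assumes o: "X \<in> bounded_complexes A" "Y \<in> bounded_complexes A" and f: "f \<in> carrier (chain_maps A X Y)"
  shows "dual_map X Y f \<in> carrier (chain_maps B (dual_complex Y) (dual_complex X))"
proof (rule chain_mapI)
  fix n
  note s = o A.cx chain_map_Mor[OF f]
  show "Comp B (Ob (dual_complex Y) n) (Ob (dual_complex Y) (n + 1)) (Ob (dual_complex X) (n + 1))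
          (dual_map X Y f (n + 1)) (Diff (dual_complex Y) n) =
        Comp B (Ob (dual_complex Y) n) (Ob (dual_complex X) n) (Ob (dual_complex X) (n + 1))
          (Diff (dual_complex X) n) (dual_map X Y f n)"
    using chain_map_square[OF f, of "- n" "- n - 1"]
      D_comp[of "Ob X (- n - 1)" "Ob X (- n)" "Ob Y (- n)" "Diff X (- n - 1)" "f (- n)"]
      D_comp[of "Ob X (- n - 1)" "Ob Y (- n - 1)" "Ob Y (- n)" "f (- n - 1)" "Diff Y (- n - 1)"]
    by (simp add: s dual_map_def)
qed (simp add: dual_map_def o A.cx D_mor chain_map_Mor[OF f])

lemma chain_functor: "additive_functor (chain_precat A) (op_precat (chain_precat B)) dual_complex dual_map"
  unfolding additive_functor_def
  by (auto simp: dual_complex_closed dual_map_closed fun_eq_iff chain_comp_def A.cx chain_map_Mor D_comp D_add D_id)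
    (auto simp: dual_map_def chain_comp_def A.cx chain_map_Mor D_comp D_add D_id)

lemma dual_null:
  assumes o: "X \<in> bounded_complexes A" "Y \<in> bounded_complexes A" and "f \<in> null_homotopic A X Y"
  shows "dual_map X Y f \<in> null_homotopic B (dual_complex Y) (dual_complex X)"
proof -
  obtain s where f: "f \<in> carrier (chain_maps A X Y)"
    and s: "\<And>n m. m = n - 1 \<Longrightarrow> s n \<in> Mor A (Ob X n) (Ob Y m)"
    and e: "\<And>n. f n = Comp A (Ob X n) (Ob Y (n - 1)) (Ob Y n) (Diff Y (n - 1)) (s n)
       \<oplus>\<^bsub>Hom A (Ob X n) (Ob Y n)\<^esub>
         Comp A (Ob X n) (Ob X (n + 1)) (Ob Y n) (s (n + 1)) (Diff X n)"
    using \<open>f \<in> _\<close> by (rule A.null_homotopicE) blast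
  show ?thesis
  \<comment> \<open>The component \<open>s (1 - n)\<close> goes from degree \<open>1 - n\<close> of
    \<open>X\<close> to degree \<open>- n\<close> of \<open>Y\<close>; its dual goes from degree
    \<open>n\<close> of the dual of \<open>Y\<close> to degree \<open>n - 1\<close> of the dual of
    \<open>X\<close>. Dualising exchanges the two summands of the homotopy formula.\<close>
  proof (rule B.null_homotopicI[where s = "\<lambda>n. Dm (Ob X (1 - n)) (Ob Y (- n)) (s (1 - n))"])
    show "dual_map X Y f \<in> carrier (chain_maps B (dual_complex Y) (dual_complex X))"
      by (rule dual_map_closed[OF o f])
  next
    fix n :: int
    have [simp]: "- (n - 1) = 1 - n" by simp
    show "Dm (Ob X (1 - n)) (Ob Y (- n)) (s (1 - n)) \<in> Mor B (Ob (dual_complex Y) n) (Ob (dual_complex X) (n - 1))"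
      using o by (simp add: D_mor A.cx s)
    have [simp]: "1 - n - 1 = - n" "- n - 1 + 1 = - n" "- n + 1 = 1 - n" by simp_all
    show "dual_map X Y f n =
        Comp B (Ob (dual_complex Y) n) (Ob (dual_complex X) (n - 1)) (Ob (dual_complex X) n)
          (Diff (dual_complex X) (n - 1)) (Dm (Ob X (1 - n)) (Ob Y (- n)) (s (1 - n)))
        \<oplus>\<^bsub>Hom B (Ob (dual_complex Y) n) (Ob (dual_complex X) n)\<^esub>
        Comp B (Ob (dual_complex Y) n) (Ob (dual_complex Y) (n + 1)) (Ob (dual_complex X) n)
          (Dm (Ob X (1 - (n + 1))) (Ob Y (- (n + 1))) (s (1 - (n + 1)))) (Diff (dual_complex Y) n)"
      using o by (simp add: dual_map_def e D_add D_comp D_obj D_mor A.closed B.closed A.cx s B.add_commute)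
  qed
qed

sublocale Q: quotient_functor "chain_precat A" "null_homotopic A" "op_precat (chain_precat B)"
    "\<lambda>X Y. null_homotopic B Y X" dual_complex dual_map
  by (intro quotient_functor.intro quotient_functor_axioms.intro A.hom_ideal_null
      B.hom_ideal_null[THEN hom_ideal.hom_ideal_op] chain_functor) (simp add: dual_null)

end

section \<open>Biproducts and mapping cones\<close>

context preadditive
begin

lemma biproductD:
  assumes "is_biproduct C X Y Z i j p q"
  shows "Z \<in> Obj C" "i \<in> Mor C X Z" "j \<in> Mor C Y Z" "p \<in> Mor C Z X" "q \<in> Mor C Z Y"
    "Comp C X Z X p i = Id C X" "Comp C Y Z Y q j = Id C Y"
    "Comp C Y Z X p j = \<zero>\<^bsub>Hom C Y X\<^esub>" "Comp C X Z Y q i = \<zero>\<^bsub>Hom C X Y\<^esub>"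
    "Comp C Z X Z i p \<oplus>\<^bsub>Hom C Z Z\<^esub> Comp C Z Y Z j q = Id C Z"
  using assms unfolding is_biproduct_def by simp_all

lemma biproduct_decomp_left:
  assumes bp: "is_biproduct C X Y Z i j p q" and o: "X \<in> Obj C" "Y \<in> Obj C" "T \<in> Obj C"
    and f: "f \<in> Mor C T Z"
  shows "f = Comp C T X Z i (Comp C T Z X p f) \<oplus>\<^bsub>Hom C T Z\<^esub> Comp C T Y Z j (Comp C T Z Y q f)"
proof -
  note b = biproductD[OF bp]
  have "f = Comp C T Z Z (Comp C Z X Z i p \<oplus>\<^bsub>Hom C Z Z\<^esub> Comp C Z Y Z j q) f"
    using o f b(1) by (simp add: b(10) id_left)
  also have "\<dots> = Comp C T X Z i (Comp C T Z X p f) \<oplus>\<^bsub>Hom C T Z\<^esub> Comp C T Y Z j (Comp C T Z Y q f)"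
    using o f b(1-5) by (simp add: comp_add_left comp_assoc closed)
  finally show ?thesis .
qed

lemma biproduct_decomp_right:
  assumes bp: "is_biproduct C X Y Z i j p q" and o: "X \<in> Obj C" "Y \<in> Obj C" "T \<in> Obj C"
    and f: "f \<in> Mor C Z T"
  shows "f = Comp C Z X T (Comp C X Z T f i) p \<oplus>\<^bsub>Hom C Z T\<^esub> Comp C Z Y T (Comp C Y Z T f j) q"
proof -
  note b = biproductD[OF bp]
  have "f = Comp C Z Z T f (Comp C Z X Z i p \<oplus>\<^bsub>Hom C Z Z\<^esub> Comp C Z Y Z j q)"
    using o f b(1) by (simp add: b(10) id_right)
  also have "\<dots> = Comp C Z X T (Comp C X Z T f i) p \<oplus>\<^bsub>Hom C Z T\<^esub> Comp C Z Y T (Comp C Y Z T f j) q"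
    using o f b(1-5) by (simp add: comp_add_right comp_assoc closed)
  finally show ?thesis .
qed

text \<open>The projections of a biproduct are jointly monic. Equations between maps into a cone are
  checked in this way, one component at a time.\<close>

lemma biproduct_eqI:
  assumes "is_biproduct C X Y Z i j p q" "X \<in> Obj C" "Y \<in> Obj C" "T \<in> Obj C"
    and "f \<in> Mor C T Z" "g \<in> Mor C T Z"
    and "Comp C T Z X p f = Comp C T Z X p g" "Comp C T Z Y q f = Comp C T Z Y q g"
  shows "f = g"
  using biproduct_decomp_left[OF assms(1-4)] assms(5-8) by metis

text \<open>The identity of \<open>Z\<close> is the sum of two maps that factor through the
  identities of \<open>X\<close> and \<open>Y\<close>, which are zero.\<close>

lemma biproduct_zero_object:
  assumes bp: "is_biproduct C X Y Z i j p q" and "is_zero_object C X" "is_zero_object C Y"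
  shows "is_zero_object C Z"
proof -
  note b = biproductD[OF bp]
  have o: "X \<in> Obj C" "Y \<in> Obj C" using assms unfolding is_zero_object_def by auto
  have "Comp C Z X Z i p = Comp C Z X Z (Comp C X X Z i \<zero>\<^bsub>Hom C X X\<^esub>) p"
    using assms(2) o b by (metis id_right is_zero_object_def)
  also have "\<dots> = \<zero>\<^bsub>Hom C Z Z\<^esub>"
    using o b(1-5) by (simp add: comp_zero_right comp_zero_left)
  finally have 1: "Comp C Z X Z i p = \<zero>\<^bsub>Hom C Z Z\<^esub>" .
  have "Comp C Z Y Z j q = Comp C Z Y Z (Comp C Y Y Z j \<zero>\<^bsub>Hom C Y Y\<^esub>) q"
    using assms(3) o b by (metis id_right is_zero_object_def)
  also have "\<dots> = \<zero>\<^bsub>Hom C Z Z\<^esub>"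
    using o b(1-5) by (simp add: comp_zero_right comp_zero_left)
  finally have 2: "Comp C Z Y Z j q = \<zero>\<^bsub>Hom C Z Z\<^esub>" .
  show ?thesis
    unfolding is_zero_object_def using b(1) b(10) by (simp add: 1 2 add_zero_left closed)
qed

section \<open>Mapping cones\<close>

lemma mapping_cone_biproduct:
  "\<lbrakk>is_mapping_cone C X Y f Z i j p q; m = n + 1\<rbrakk>
    \<Longrightarrow> is_biproduct C (Ob X m) (Ob Y n) (Ob Z n) (i n) (j n) (p n) (q n)"
  by (simp add: is_mapping_cone_def)

lemma mapping_cone_closed: "is_mapping_cone C X Y f Z i j p q \<Longrightarrow> Z \<in> bounded_complexes C"
  by (simp add: is_mapping_cone_def)

lemma mapping_cone_Mor:
  assumes "is_mapping_cone C X Y f Z i j p q" "m = n + 1"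
  shows "i n \<in> Mor C (Ob X m) (Ob Z n)" "j n \<in> Mor C (Ob Y n) (Ob Z n)"
    "p n \<in> Mor C (Ob Z n) (Ob X m)" "q n \<in> Mor C (Ob Z n) (Ob Y n)"
  using biproductD(2-5)[OF mapping_cone_biproduct[OF assms]] by simp_all

text \<open>A cone is specified by the four matrix entries of its differential. Expanding along the
  biproduct in degree \<open>n + 1\<close> turns them into the columns, the differential after
  \<open>i\<close> and \<open>j\<close>; expanding along the one in degree \<open>n\<close> gives
  the rows, \<open>p\<close> and \<open>q\<close> after the differential.\<close>

lemma mapping_cone_Diff:
  assumes mc: "is_mapping_cone C X Y f Z i j p q"
    and X: "X \<in> bounded_complexes C" and Y: "Y \<in> bounded_complexes C"
    and f: "f \<in> carrier (chain_maps C X Y)" and m: "m = n + 1" and k: "k = n + 2"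
  shows "Comp C (Ob X m) (Ob Z n) (Ob Z m) (Diff Z n) (i n) =
      Comp C (Ob X m) (Ob X k) (Ob Z m) (i m) (\<ominus>\<^bsub>Hom C (Ob X m) (Ob X k)\<^esub> Diff X m)
      \<oplus>\<^bsub>Hom C (Ob X m) (Ob Z m)\<^esub> Comp C (Ob X m) (Ob Y m) (Ob Z m) (j m) (f m)"
    and "Comp C (Ob Y n) (Ob Z n) (Ob Z m) (Diff Z n) (j n) =
      Comp C (Ob Y n) (Ob Y m) (Ob Z m) (j m) (Diff Y n)"
    and "Comp C (Ob Z n) (Ob Z m) (Ob X k) (p m) (Diff Z n) =
      Comp C (Ob Z n) (Ob X m) (Ob X k) (\<ominus>\<^bsub>Hom C (Ob X m) (Ob X k)\<^esub> Diff X m) (p n)"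
    and "Comp C (Ob Z n) (Ob Z m) (Ob Y m) (q m) (Diff Z n) =
      Comp C (Ob Z n) (Ob X m) (Ob Y m) (f m) (p n) \<oplus>\<^bsub>Hom C (Ob Z n) (Ob Y m)\<^esub>
      Comp C (Ob Z n) (Ob Y n) (Ob Y m) (Diff Y n) (q n)"
proof -
  have k': "k = m + 1" and nk: "m + 1 = k" using m k by simp_all
  have Z: "Z \<in> bounded_complexes C" by (rule mapping_cone_closed[OF mc])
  note bn = mapping_cone_biproduct[OF mc m] and bm = mapping_cone_biproduct[OF mc k']
  note mn = mapping_cone_Mor[OF mc m] and mm = mapping_cone_Mor[OF mc k']
  have dZ: "Diff Z n \<in> Mor C (Ob Z n) (Ob Z m)" and dX: "Diff X m \<in> Mor C (Ob X m) (Ob X k)"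
    and dY: "Diff Y n \<in> Mor C (Ob Y n) (Ob Y m)"
    by (simp_all add: Diff_Mor X Y Z m k)
  note oX = Ob_Obj[OF X] and oY = Ob_Obj[OF Y] and oZ = Ob_Obj[OF Z] and fm = chain_map_Mor[OF f]
  have e: "Comp C (Ob X m) (Ob Z m) (Ob X k) (p m) (Comp C (Ob X m) (Ob Z n) (Ob Z m) (Diff Z n) (i n))
      = \<ominus>\<^bsub>Hom C (Ob X m) (Ob X k)\<^esub> Diff X m"
    "Comp C (Ob Y n) (Ob Z m) (Ob X k) (p m) (Comp C (Ob Y n) (Ob Z n) (Ob Z m) (Diff Z n) (j n))
      = \<zero>\<^bsub>Hom C (Ob Y n) (Ob X k)\<^esub>"
    "Comp C (Ob X m) (Ob Z m) (Ob Y m) (q m) (Comp C (Ob X m) (Ob Z n) (Ob Z m) (Diff Z n) (i n)) = f m"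
    "Comp C (Ob Y n) (Ob Z m) (Ob Y m) (q m) (Comp C (Ob Y n) (Ob Z n) (Ob Z m) (Diff Z n) (j n)) = Diff Y n"
    using mc[unfolded is_mapping_cone_def Let_def, THEN conjunct2, THEN conjunct2, THEN spec, of n]
    by (simp_all only: nk flip: m)
  note s = oX oY oZ dX dY dZ mn mm fm
  show "Comp C (Ob X m) (Ob Z n) (Ob Z m) (Diff Z n) (i n) =
      Comp C (Ob X m) (Ob X k) (Ob Z m) (i m) (\<ominus>\<^bsub>Hom C (Ob X m) (Ob X k)\<^esub> Diff X m)
      \<oplus>\<^bsub>Hom C (Ob X m) (Ob Z m)\<^esub> Comp C (Ob X m) (Ob Y m) (Ob Z m) (j m) (f m)"
    using biproduct_decomp_left[OF bm oX oY oX[of m], of "Comp C (Ob X m) (Ob Z n) (Ob Z m) (Diff Z n) (i n)"]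
    by (simp add: s closed e)
  show "Comp C (Ob Y n) (Ob Z n) (Ob Z m) (Diff Z n) (j n) =
      Comp C (Ob Y n) (Ob Y m) (Ob Z m) (j m) (Diff Y n)"
    using biproduct_decomp_left[OF bm oX oY oY[of n], of "Comp C (Ob Y n) (Ob Z n) (Ob Z m) (Diff Z n) (j n)"]
    by (simp add: s closed e comp_zero_right add_zero_left)
  show "Comp C (Ob Z n) (Ob Z m) (Ob X k) (p m) (Diff Z n) =
      Comp C (Ob Z n) (Ob X m) (Ob X k) (\<ominus>\<^bsub>Hom C (Ob X m) (Ob X k)\<^esub> Diff X m) (p n)"
    using biproduct_decomp_right[OF bn oX oY oX[of k], of "Comp C (Ob Z n) (Ob Z m) (Ob X k) (p m) (Diff Z n)"]
    by (simp add: s closed comp_assoc comp_assoc_eq[OF e(1)] e comp_zero_left add_zero_right)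
  show "Comp C (Ob Z n) (Ob Z m) (Ob Y m) (q m) (Diff Z n) =
      Comp C (Ob Z n) (Ob X m) (Ob Y m) (f m) (p n) \<oplus>\<^bsub>Hom C (Ob Z n) (Ob Y m)\<^esub>
      Comp C (Ob Z n) (Ob Y n) (Ob Y m) (Diff Y n) (q n)"
    using biproduct_decomp_right[OF bn oX oY oY[of m], of "Comp C (Ob Z n) (Ob Z m) (Ob Y m) (q m) (Diff Z n)"]
    by (simp add: s closed comp_assoc e)
qed

end

definition has_biproducts :: "('o, 'h, 'z) precat_scheme \<Rightarrow> bool" where
  "has_biproducts C \<longleftrightarrow> (\<forall>X\<in>Obj C. \<forall>Y\<in>Obj C. \<exists>Z i j p q. is_biproduct C X Y Z i j p q)"

lemma (in preadditive) mapping_cone_exists: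
  assumes bp: "has_biproducts C"
    and X: "X \<in> bounded_complexes C" and Y: "Y \<in> bounded_complexes C"
    and f: "f \<in> carrier (chain_maps C X Y)"
  shows "\<exists>Z i j p q. is_mapping_cone C X Y f Z i j p q"
proof -
  note oX = Ob_Obj[OF X] and oY = Ob_Obj[OF Y] and fm = chain_map_Mor[OF f]
    and dX = Diff_Mor[OF X] and dY = Diff_Mor[OF Y]
  have "\<forall>n. \<exists>Z i j p q. is_biproduct C (Ob X (n + 1)) (Ob Y n) Z i j p q"
    using bp oX oY unfolding has_biproducts_def by blast
  then obtain Z i j p q where b: "\<And>n. is_biproduct C (Ob X (n + 1)) (Ob Y n) (Z n) (i n) (j n) (p n) (q n)"
    by metis
  \<comment> \<open>The map with components \<open>p d = - d\<^sub>X p\<close> and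
    \<open>q d = f p + d\<^sub>Y q\<close>, recorded below as \<open>pd\<close> and
    \<open>qd\<close>. It is determined by them, and \<open>d d = 0\<close> is checked on
    them.\<close>
  define d where "d n = Comp C (Z n) (Ob X (n + 2)) (Z (n + 1)) (i (n + 1))
      (Comp C (Z n) (Ob X (n + 1)) (Ob X (n + 2)) (\<ominus>\<^bsub>Hom C (Ob X (n + 1)) (Ob X (n + 2))\<^esub> Diff X (n + 1)) (p n))
    \<oplus>\<^bsub>Hom C (Z n) (Z (n + 1))\<^esub> Comp C (Z n) (Ob Y (n + 1)) (Z (n + 1)) (j (n + 1))
      (Comp C (Z n) (Ob X (n + 1)) (Ob Y (n + 1)) (f (n + 1)) (p n) \<oplus>\<^bsub>Hom C (Z n) (Ob Y (n + 1))\<^esub>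
       Comp C (Z n) (Ob Y n) (Ob Y (n + 1)) (Diff Y n) (q n))" for n
  have b2: "is_biproduct C (Ob X (n + 2)) (Ob Y (n + 1)) (Z (n + 1)) (i (n + 1)) (j (n + 1)) (p (n + 1)) (q (n + 1))" for n
    using b[of "n + 1"] by (simp add: add.assoc)
  note bD = biproductD[OF b] and bD2 = biproductD[OF b2]
  note s = oX oY fm dX dY bD(1-5) bD2(2-5)
  have d: "d n \<in> Mor C (Z n) (Z (n + 1))" for n
    unfolding d_def by (simp add: s closed)
  have pd: "Comp C (Z n) (Z (n + 1)) (Ob X (n + 2)) (p (n + 1)) (d n) =
      Comp C (Z n) (Ob X (n + 1)) (Ob X (n + 2)) (\<ominus>\<^bsub>Hom C (Ob X (n + 1)) (Ob X (n + 2))\<^esub> Diff X (n + 1)) (p n)" for n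
    unfolding d_def
    by (simp add: s closed comp_add_right comp_assoc_eq[OF bD2(6)] comp_assoc_eq[OF bD2(8)] comp_zero_left
        id_left add_zero_right add_zero_left)
  have qd: "Comp C (Z n) (Z (n + 1)) (Ob Y (n + 1)) (q (n + 1)) (d n) =
      Comp C (Z n) (Ob X (n + 1)) (Ob Y (n + 1)) (f (n + 1)) (p n) \<oplus>\<^bsub>Hom C (Z n) (Ob Y (n + 1))\<^esub>
       Comp C (Z n) (Ob Y n) (Ob Y (n + 1)) (Diff Y n) (q n)" for n
    unfolding d_def
    by (simp add: s closed comp_add_right comp_assoc_eq[OF bD2(7)] comp_assoc_eq[OF bD2(9)] comp_zero_left
        id_left add_zero_left add_zero_right)
  have dd: "Comp C (Z n) (Z (n + 1)) (Z (n + 2)) (d (n + 1)) (d n) = \<zero>\<^bsub>Hom C (Z n) (Z (n + 2))\<^esub>" for n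
  proof -
    have n: "n + 1 + 1 = n + 2" "n + 1 + 2 = n + 3" by simp_all
    note b3 = b2[of "n + 1", unfolded n] and d' = d[of "n + 1", unfolded n]
    note bD3 = biproductD[OF b3]
    note pd' = comp_assoc_eq[OF pd[of "n + 1", unfolded n], of "Z n" "d n"]
    note qd' = comp_assoc_eq[OF qd[of "n + 1", unfolded n], of "Z n" "d n"]
    show ?thesis
    proof (rule biproduct_eqI[OF b3])
      show "Comp C (Z n) (Z (n + 2)) (Ob X (n + 3)) (p (n + 2)) (Comp C (Z n) (Z (n + 1)) (Z (n + 2)) (d (n + 1)) (d n)) =
          Comp C (Z n) (Z (n + 2)) (Ob X (n + 3)) (p (n + 2)) \<zero>\<^bsub>Hom C (Z n) (Z (n + 2))\<^esub>"
        by (simp add: pd' s d d' bD3(1-5) closed comp_zero_right comp_assoc pd comp_neg_left comp_neg_right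
            comp_assoc_eq[OF Diff_Diff[OF X]] comp_zero_left neg_zero neg_neg)
      have sq: "Comp C (Ob X (n + 1)) (Ob X (n + 2)) (Ob Y (n + 2)) (f (n + 2)) (Diff X (n + 1))
          = Comp C (Ob X (n + 1)) (Ob Y (n + 1)) (Ob Y (n + 2)) (Diff Y (n + 1)) (f (n + 1))"
        by (rule chain_map_square[OF f]) simp
      show "Comp C (Z n) (Z (n + 2)) (Ob Y (n + 2)) (q (n + 2)) (Comp C (Z n) (Z (n + 1)) (Z (n + 2)) (d (n + 1)) (d n)) =
          Comp C (Z n) (Z (n + 2)) (Ob Y (n + 2)) (q (n + 2)) \<zero>\<^bsub>Hom C (Z n) (Z (n + 2))\<^esub>"
        by (simp add: qd' s d d' bD3(1-5) closed comp_zero_right comp_assoc pd qd comp_neg_left comp_neg_right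
            comp_assoc_eq[OF Diff_Diff[OF Y]] comp_zero_left neg_zero neg_neg comp_add_left comp_add_right
            comp_assoc_eq[OF sq] add_zero_right neg_add)
    qed (simp_all add: s d d' closed)
  qed
  define W where "W = \<lparr>Ob = Z, Diff = d\<rparr>"
  obtain N N' where N: "\<And>n. \<bar>n\<bar> > N \<Longrightarrow> is_zero_object C (Ob X n)" "\<And>n. \<bar>n\<bar> > N' \<Longrightarrow> is_zero_object C (Ob Y n)"
    using X Y unfolding bounded_complexes_def by blast
  have W: "W \<in> bounded_complexes C"
  \<comment> \<open>The extra \<open>1\<close> is for \<open>X\<close>, which enters degree
    \<open>n\<close> of the cone with its term of degree \<open>n + 1\<close>; the absolute values
    keep the sum above both bounds if one of them is negative.\<close>
  proof (rule bounded_complexesI[where N = "\<bar>N\<bar> + \<bar>N'\<bar> + 1"])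
    fix n :: int assume "\<bar>N\<bar> + \<bar>N'\<bar> + 1 < \<bar>n\<bar>"
    then show "is_zero_object C (Ob W n)"
      using biproduct_zero_object[OF b[of n] N] by (simp add: W_def)
  qed (simp_all add: W_def bD d dd)
  have ei: "Comp C (Ob X (n + 1)) (Z n) (Z (n + 1)) (d n) (i n) =
      Comp C (Ob X (n + 1)) (Ob X (n + 2)) (Z (n + 1)) (i (n + 1)) (\<ominus>\<^bsub>Hom C (Ob X (n + 1)) (Ob X (n + 2))\<^esub> Diff X (n + 1))
      \<oplus>\<^bsub>Hom C (Ob X (n + 1)) (Z (n + 1))\<^esub> Comp C (Ob X (n + 1)) (Ob Y (n + 1)) (Z (n + 1)) (j (n + 1)) (f (n + 1))" for n
    unfolding d_def
    by (simp add: s closed comp_add_left comp_assoc bD(6,9) id_right comp_zero_right add_zero_right)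
  have ej: "Comp C (Ob Y n) (Z n) (Z (n + 1)) (d n) (j n) =
      Comp C (Ob Y n) (Ob Y (n + 1)) (Z (n + 1)) (j (n + 1)) (Diff Y n)" for n
    unfolding d_def
    by (simp add: s closed comp_add_left comp_assoc bD(7,8) id_right comp_zero_right add_zero_left)
  have n2: "n + 1 + 1 = n + 2" for n :: int by simp
  have "is_mapping_cone C X Y f W i j p q"
    unfolding is_mapping_cone_def Let_def n2
    by (simp add: W[unfolded W_def] b W_def ei ej s closed comp_add_right comp_assoc_eq[OF bD2(6)] comp_assoc_eq[OF bD2(8)]
        comp_assoc_eq[OF bD2(7)] comp_assoc_eq[OF bD2(9)] comp_zero_left id_left add_zero_right add_zero_left)
  then show ?thesis by blast
qed

section \<open>Shifts and distinguished triangles\<close>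

lemma shift_complex_simps [simp]:
  "Ob (shift_complex A X) n = Ob X (n + 1)"
  "Diff (shift_complex A X) n = \<ominus>\<^bsub>Hom A (Ob X (n + 1)) (Ob X (n + 1 + 1))\<^esub> Diff X (n + 1)"
  "Ob (unshift_complex A X) n = Ob X (n - 1)"
  "Diff (unshift_complex A X) n = \<ominus>\<^bsub>Hom A (Ob X (n - 1)) (Ob X n)\<^esub> Diff X (n - 1)"
  by (simp_all add: shift_complex_def unshift_complex_def)

lemma cochain_eqI:
  fixes X Y :: "('o, 'h) cochain"
  assumes "\<And>n. Ob X n = Ob Y n" "\<And>n. Diff X n = Diff Y n"
  shows "X = Y"
  using assms by (cases X; cases Y) (auto simp: fun_eq_iff)

section \<open>Homotopy classes and the shift\<close>

context preadditive
begin

interpretation K: hom_ideal "chain_precat C" "null_homotopic C"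
  by (rule hom_ideal_null)

abbreviation "Ch \<equiv> \<lambda>X Y. carrier (chain_maps C X Y)"
abbreviation "Bc \<equiv> bounded_complexes C"
abbreviation "HK \<equiv> homotopy_precat C"
abbreviation "hc \<equiv> homotopy_class C"

lemma hc_eq_cls: "hc X Y f = K.cls X Y f"
  by (simp add: homotopy_class_def)

lemma HK_preadditive: "preadditive HK"
  using K.preadditive_Q by (simp add: homotopy_precat_eq)

lemma HK_Obj [simp]: "Obj HK = Bc"
  by (simp add: homotopy_precat_def)

lemma hc_Mor: "f \<in> Ch X Y \<Longrightarrow> hc X Y f \<in> Mor HK X Y"
  using K.cls_Mor[of f X Y] by (simp add: homotopy_precat_eq hc_eq_cls)

lemma HK_MorE:
  assumes "F \<in> Mor HK X Y"
  obtains f where "f \<in> Ch X Y" "F = hc X Y f"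
  using assms K.Mor_QE[of F X Y] by (auto simp: homotopy_precat_eq hc_eq_cls)

lemma HK_comp: "\<lbrakk>X \<in> Bc; Y \<in> Bc; Z \<in> Bc; f \<in> Ch X Y; g \<in> Ch Y Z\<rbrakk>
    \<Longrightarrow> Comp HK X Y Z (hc Y Z g) (hc X Y f) = hc X Z (chain_comp C X Y Z g f)"
  using K.comp_Q[of X Y Z f g] by (simp add: homotopy_precat_eq hc_eq_cls)

lemma HK_Id: "Id HK X = hc X X (\<lambda>n. Id C (Ob X n))"
  by (simp add: homotopy_precat_def)

lemma HK_neg: "\<lbrakk>X \<in> Bc; Y \<in> Bc; f \<in> Ch X Y\<rbrakk>
    \<Longrightarrow> \<ominus>\<^bsub>Hom HK X Y\<^esub> hc X Y f = hc X Y (\<lambda>n. \<ominus>\<^bsub>Hom C (Ob X n) (Ob Y n)\<^esub> f n)"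
  using K.neg_Q[of X Y f] by (simp add: homotopy_precat_eq hc_eq_cls chain_neg)

lemma id_chain: "X \<in> Bc \<Longrightarrow> (\<lambda>n. Id C (Ob X n)) \<in> Ch X X"
  by (rule chain_mapI) (simp_all add: closed cx id_left id_right)

lemma chain_minus: "\<lbrakk>X \<in> Bc; Y \<in> Bc; f \<in> Ch X Y; g \<in> Ch X Y\<rbrakk>
    \<Longrightarrow> f \<ominus>\<^bsub>chain_maps C X Y\<^esub> g = (\<lambda>n. f n \<ominus>\<^bsub>Hom C (Ob X n) (Ob Y n)\<^esub> g n)"
  by (simp add: a_minus_def chain_neg)

lemma in_hc_iff: "\<lbrakk>X \<in> Bc; Y \<in> Bc; f \<in> Ch X Y\<rbrakk>
    \<Longrightarrow> g \<in> hc X Y f \<longleftrightarrow> g \<in> Ch X Y \<and> (\<lambda>n. g n \<ominus>\<^bsub>Hom C (Ob X n) (Ob Y n)\<^esub> f n) \<in> null_homotopic C X Y"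
  using K.in_cls_iff[of X Y f g] K.cls_MorD[of X Y f g] chain_minus[of X Y g f]
  by (auto simp: hc_eq_cls)

lemma hc_eqI:
  assumes "X \<in> Bc" "Y \<in> Bc" "f \<in> Ch X Y" "g \<in> Ch X Y" "\<And>n. s n \<in> Mor C (Ob X n) (Ob Y (n - 1))"
    and e: "\<And>n. f n = g n \<oplus>\<^bsub>Hom C (Ob X n) (Ob Y n)\<^esub>
       (Comp C (Ob X n) (Ob Y (n - 1)) (Ob Y n) (Diff Y (n - 1)) (s n)
         \<oplus>\<^bsub>Hom C (Ob X n) (Ob Y n)\<^esub>
           Comp C (Ob X n) (Ob X (n + 1)) (Ob Y n) (s (n + 1)) (Diff X n))"
  shows "hc X Y f = hc X Y g"
proof -
  let ?d = "\<lambda>n. f n \<ominus>\<^bsub>Hom C (Ob X n) (Ob Y n)\<^esub> g n"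
  let ?h = "\<lambda>n. Comp C (Ob X n) (Ob Y (n - 1)) (Ob Y n) (Diff Y (n - 1)) (s n)
         \<oplus>\<^bsub>Hom C (Ob X n) (Ob Y n)\<^esub>
           Comp C (Ob X n) (Ob X (n + 1)) (Ob Y n) (s (n + 1)) (Diff X n)"
  have sm: "s (n + 1) \<in> Mor C (Ob X (n + 1)) (Ob Y n)" for n
    using assms(5)[of "n + 1"] by simp
  have hm: "?h n \<in> Mor C (Ob X n) (Ob Y n)" for n
    using assms(1-5) sm by (simp add: closed cx)
  have "?d n = ?h n" for n
  proof -
    have gm: "g n \<in> Mor C (Ob X n) (Ob Y n)" by (rule chain_map_Mor[OF assms(4)])
    have "?d n = (g n \<oplus>\<^bsub>Hom C (Ob X n) (Ob Y n)\<^esub> ?h n) \<ominus>\<^bsub>Hom C (Ob X n) (Ob Y n)\<^esub> g n"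
      by (simp only: e[of n])
    also have "\<dots> = ?h n"
      using assms(1,2) gm hm[of n]
      by (simp add: a_minus_def add_commute[of _ _ "g n" "?h n"] add_assoc closed cx add_neg add_zero_right)
    finally show ?thesis .
  qed
  moreover have "?d \<in> Ch X Y"
  proof -
    interpret G: abelian_group "chain_maps C X Y" using K.hom_group[of X Y] assms(1,2) by simp
    have "f \<ominus>\<^bsub>chain_maps C X Y\<^esub> g \<in> Ch X Y" using assms by simp
    then show ?thesis using assms by (simp add: chain_minus)
  qed
  ultimately have "?d \<in> null_homotopic C X Y"
    by (intro null_homotopicI[OF _ assms(5)]) simp_all
  then show ?thesis
    using K.cls_eq_iff[of X Y g f] assms by (simp add: hc_eq_cls chain_minus)
qed

lemma shift_closed: assumes "X \<in> Bc" shows "shift_complex C X \<in> Bc"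
proof -
  obtain N where N: "\<And>n. \<bar>n\<bar> > N \<Longrightarrow> is_zero_object C (Ob X n)"
    using assms unfolding bounded_complexes_def by blast
  show ?thesis
    by (rule bounded_complexesI[where N = "N + 1"])
      (use assms N in \<open>simp_all add: closed cx comp_neg_left comp_neg_right neg_zero\<close>)
qed

lemma unshift_closed: assumes "X \<in> Bc" shows "unshift_complex C X \<in> Bc"
proof -
  have *: "1 + n = n + 1" for n :: int by simp
  obtain N where N: "\<And>n. \<bar>n\<bar> > N \<Longrightarrow> is_zero_object C (Ob X n)"
    using assms unfolding bounded_complexes_def by blast
  show ?thesis
    by (rule bounded_complexesI[where N = "N + 1"])
      (use assms N in \<open>simp_all add: closed cx comp_neg_left comp_neg_right neg_zero *\<close>)
qed

lemma shift_unshift: "X \<in> Bc \<Longrightarrow> shift_complex C (unshift_complex C X) = X"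
proof (rule cochain_eqI)
  have *: "1 + n = n + 1" for n :: int by simp
  show "X \<in> Bc \<Longrightarrow> Diff (shift_complex C (unshift_complex C X)) n = Diff X n" for n
    by (simp add: neg_neg cx *)
qed simp

lemma neg_inject: "\<lbrakk>X \<in> Obj C; Y \<in> Obj C; f \<in> Mor C X Y; g \<in> Mor C X Y\<rbrakk>
    \<Longrightarrow> \<ominus>\<^bsub>Hom C X Y\<^esub> f = \<ominus>\<^bsub>Hom C X Y\<^esub> g \<longleftrightarrow> f = g"
  by (metis neg_neg)

lemma chain_map_shift_iff:
  assumes o: "X \<in> Bc" "Y \<in> Bc"
  shows "(\<lambda>n. f (n + 1)) \<in> Ch (shift_complex C X) (shift_complex C Y) \<longleftrightarrow> f \<in> Ch X Y"
proof
  assume f: "f \<in> Ch X Y"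
  show "(\<lambda>n. f (n + 1)) \<in> Ch (shift_complex C X) (shift_complex C Y)"
    by (rule chain_mapI)
      (use o in \<open>simp_all add: chain_map_Mor[OF f] comp_neg_left comp_neg_right closed cx chain_map_square[OF f]\<close>)
next
  assume f: "(\<lambda>n. f (n + 1)) \<in> Ch (shift_complex C X) (shift_complex C Y)"
  have fm: "f n \<in> Mor C (Ob X n) (Ob Y n)" for n
    using chain_map_Mor[OF f, of "n - 1"] by simp
  show "f \<in> Ch X Y"
  proof (rule chain_mapI)
    fix n
    show "Comp C (Ob X n) (Ob X (n + 1)) (Ob Y (n + 1)) (f (n + 1)) (Diff X n)
      = Comp C (Ob X n) (Ob Y n) (Ob Y (n + 1)) (Diff Y n) (f n)"
      using chain_map_square[OF f, of n "n - 1"] o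
      by (simp add: comp_neg_left comp_neg_right fm closed cx neg_inject)
  qed (rule fm)
qed

text \<open>The shift negates the differentials, so a homotopy has to be negated along with it. An
  equivalence is proved because the shift acts on a morphism by reindexing every member of its
  class, and the result must be an entire class again, see \<open>shift_hc\<close>.\<close>

lemma null_shift_iff:
  assumes o: "X \<in> Bc" "Y \<in> Bc"
  shows "(\<lambda>n. f (n + 1)) \<in> null_homotopic C (shift_complex C X) (shift_complex C Y) \<longleftrightarrow>
    f \<in> null_homotopic C X Y"
proof
  assume "f \<in> null_homotopic C X Y"
  then obtain s where f: "f \<in> carrier (chain_maps C X Y)"
    and s: "\<And>n m. m = n - 1 \<Longrightarrow> s n \<in> Mor C (Ob X n) (Ob Y m)"
    and e: "\<And>n. f n = Comp C (Ob X n) (Ob Y (n - 1)) (Ob Y n) (Diff Y (n - 1)) (s n)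
       \<oplus>\<^bsub>Hom C (Ob X n) (Ob Y n)\<^esub>
         Comp C (Ob X n) (Ob X (n + 1)) (Ob Y n) (s (n + 1)) (Diff X n)"
    by (rule null_homotopicE) blast
  show "(\<lambda>n. f (n + 1)) \<in> null_homotopic C (shift_complex C X) (shift_complex C Y)"
  proof (rule null_homotopicI[where s = "\<lambda>n. \<ominus>\<^bsub>Hom C (Ob X (n + 1)) (Ob Y n)\<^esub> s (n + 1)"])
    fix n
    show "f (n + 1) = Comp C (Ob (shift_complex C X) n) (Ob (shift_complex C Y) (n - 1)) (Ob (shift_complex C Y) n)
          (Diff (shift_complex C Y) (n - 1)) (\<ominus>\<^bsub>Hom C (Ob X (n + 1)) (Ob Y n)\<^esub> s (n + 1))
        \<oplus>\<^bsub>Hom C (Ob (shift_complex C X) n) (Ob (shift_complex C Y) n)\<^esub>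
        Comp C (Ob (shift_complex C X) n) (Ob (shift_complex C X) (n + 1)) (Ob (shift_complex C Y) n)
          (\<ominus>\<^bsub>Hom C (Ob X (n + 1 + 1)) (Ob Y (n + 1))\<^esub> s (n + 1 + 1)) (Diff (shift_complex C X) n)"
      using o by (simp add: e[of "n + 1"] comp_neg_left comp_neg_right neg_neg s closed cx)
  qed (use o f in \<open>simp_all add: chain_map_shift_iff s closed cx\<close>)
next
  assume "(\<lambda>n. f (n + 1)) \<in> null_homotopic C (shift_complex C X) (shift_complex C Y)"
  then obtain s where f': "(\<lambda>n. f (n + 1)) \<in> carrier (chain_maps C (shift_complex C X) (shift_complex C Y))"
    and s: "\<And>n m. m = n - 1 \<Longrightarrow> s n \<in> Mor C (Ob (shift_complex C X) n) (Ob (shift_complex C Y) m)"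
    and e: "\<And>n. f (n + 1) = Comp C (Ob (shift_complex C X) n) (Ob (shift_complex C Y) (n - 1))
        (Ob (shift_complex C Y) n) (Diff (shift_complex C Y) (n - 1)) (s n)
       \<oplus>\<^bsub>Hom C (Ob (shift_complex C X) n) (Ob (shift_complex C Y) n)\<^esub>
         Comp C (Ob (shift_complex C X) n) (Ob (shift_complex C X) (n + 1)) (Ob (shift_complex C Y) n) (s (n + 1))
          (Diff (shift_complex C X) n)"
    by (rule null_homotopicE) blast
  have f: "f \<in> Ch X Y" using f' o by (simp add: chain_map_shift_iff)
  have s': "s n \<in> Mor C (Ob X (n + 1)) (Ob Y n)" for n
    using s[of "n - 1" n] by simp
  have s1: "s (n - 1) \<in> Mor C (Ob X n) (Ob Y (n - 1))" for n
    using s'[of "n - 1"] by simp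
  show "f \<in> null_homotopic C X Y"
  proof (rule null_homotopicI[where s = "\<lambda>n. \<ominus>\<^bsub>Hom C (Ob X n) (Ob Y (n - 1))\<^esub> s (n - 1)"])
    fix n
    show "f n = Comp C (Ob X n) (Ob Y (n - 1)) (Ob Y n)
          (Diff Y (n - 1)) (\<ominus>\<^bsub>Hom C (Ob X n) (Ob Y (n - 1))\<^esub> s (n - 1))
        \<oplus>\<^bsub>Hom C (Ob X n) (Ob Y n)\<^esub>
        Comp C (Ob X n) (Ob X (n + 1)) (Ob Y n)
          (\<ominus>\<^bsub>Hom C (Ob X (n + 1)) (Ob Y (n + 1 - 1))\<^esub> s (n + 1 - 1)) (Diff X n)"
      using o e[of "n - 1"] by (simp add: comp_neg_left comp_neg_right s' s1 closed cx)
  qed (use o f s' s1 in \<open>simp_all add: closed cx\<close>)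
qed

lemma shift_hc:
  assumes o: "X \<in> Bc" "Y \<in> Bc" and f: "f \<in> Ch X Y"
  shows "(\<lambda>h n. h (n + 1)) ` hc X Y f = hc (shift_complex C X) (shift_complex C Y) (\<lambda>n. f (n + 1))"
proof -
  have 1: "(\<lambda>n. g (n + 1)) \<in> hc (shift_complex C X) (shift_complex C Y) (\<lambda>n. f (n + 1)) \<longleftrightarrow> g \<in> hc X Y f" for g
  proof -
    have "(\<lambda>n. g (n + 1)) \<in> hc (shift_complex C X) (shift_complex C Y) (\<lambda>n. f (n + 1)) \<longleftrightarrow>
      g \<in> Ch X Y \<and> (\<lambda>n. (\<lambda>n. g n \<ominus>\<^bsub>Hom C (Ob X n) (Ob Y n)\<^esub> f n) (n + 1))
        \<in> null_homotopic C (shift_complex C X) (shift_complex C Y)"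
      using o f by (subst in_hc_iff) (simp_all add: shift_closed chain_map_shift_iff)
    also have "\<dots> \<longleftrightarrow> g \<in> hc X Y f"
      using o f null_shift_iff[OF o, of "\<lambda>n. g n \<ominus>\<^bsub>Hom C (Ob X n) (Ob Y n)\<^esub> f n"]
      by (simp add: in_hc_iff)
    finally show ?thesis .
  qed
  show ?thesis
  proof (intro equalityI subsetI)
    fix g assume g: "g \<in> hc (shift_complex C X) (shift_complex C Y) (\<lambda>n. f (n + 1))"
    have "(\<lambda>n. g (n - 1)) \<in> hc X Y f"
      using 1[of "\<lambda>n. g (n - 1)"] g by simp
    then show "g \<in> (\<lambda>h n. h (n + 1)) ` hc X Y f"
      by (intro image_eqI[of _ _ "\<lambda>n. g (n - 1)"]) simp_all
  qed (use 1 in auto)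
qed

lemma chain_map_unshift:
  assumes o: "X \<in> Bc" "Y \<in> Bc" and f: "f \<in> Ch X Y"
  shows "(\<lambda>n. f (n - 1)) \<in> Ch (unshift_complex C X) (unshift_complex C Y)"
  using chain_map_shift_iff[of "unshift_complex C X" "unshift_complex C Y" "\<lambda>n. f (n - 1)"] assms
  by (simp add: shift_unshift unshift_closed)

lemma unshift_hc:
  assumes o: "X \<in> Bc" "Y \<in> Bc" and f: "f \<in> Ch X Y"
  shows "(\<lambda>h n. h (n - 1)) ` hc X Y f = hc (unshift_complex C X) (unshift_complex C Y) (\<lambda>n. f (n - 1))"
proof -
  have "hc X Y f = (\<lambda>h n. h (n + 1)) ` hc (unshift_complex C X) (unshift_complex C Y) (\<lambda>n. f (n - 1))"
    using shift_hc[of "unshift_complex C X" "unshift_complex C Y" "\<lambda>n. f (n - 1)"] assms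
    by (simp add: shift_unshift unshift_closed chain_map_unshift)
  then show ?thesis by (simp add: image_comp comp_def)
qed

abbreviation "shm \<equiv> (`) (\<lambda>(h :: int \<Rightarrow> 'h) n. h (n + 1))"

lemma shm_Mor: "\<lbrakk>X \<in> Bc; Y \<in> Bc; F \<in> Mor HK X Y\<rbrakk> \<Longrightarrow> shm F \<in> Mor HK (shift_complex C X) (shift_complex C Y)"
  by (auto elim!: HK_MorE simp: shift_hc chain_map_shift_iff intro!: hc_Mor simp del: shift_complex_simps)

lemma shm_comp: "\<lbrakk>X \<in> Bc; Y \<in> Bc; Z \<in> Bc; F \<in> Mor HK X Y; G \<in> Mor HK Y Z\<rbrakk>
    \<Longrightarrow> shm (Comp HK X Y Z G F) =
      Comp HK (shift_complex C X) (shift_complex C Y) (shift_complex C Z) (shm G) (shm F)"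
  by (elim HK_MorE)
    (simp add: HK_comp shift_hc chain_comp_closed chain_map_shift_iff shift_closed, simp add: chain_comp_def)

lemma shm_Id: "X \<in> Bc \<Longrightarrow> shm (Id HK X) = Id HK (shift_complex C X)"
  by (simp add: HK_Id shift_hc id_chain)

section \<open>Standard triangles and the triangles isomorphic to them\<close>

lemma distinguishedI:
  assumes "X \<in> Bc" "Y \<in> Bc" "Z \<in> Bc" "u \<in> Mor HK X Y" "v \<in> Mor HK Y Z" "w \<in> Mor HK Z (shift_complex C X)"
    and "X' \<in> Bc" "Y' \<in> Bc" "f \<in> Ch X' Y'" "is_mapping_cone C X' Y' f Z' i j p q"
    and "is_iso HK X X' a" "is_iso HK Y Y' b" "is_iso HK Z Z' c"
    and "Comp HK X Y Y' b u = Comp HK X X' Y' (hc X' Y' f) a"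
    and "Comp HK Y Z Z' c v = Comp HK Y Y' Z' (hc Y' Z' j) b"
    and "Comp HK Z (shift_complex C X) (shift_complex C X') (shm a) w
          = Comp HK Z Z' (shift_complex C X') (hc Z' (shift_complex C X') p) c"
  shows "(X, Y, Z, u, v, w) \<in> distinguished_triangles C"
  unfolding distinguished_triangles_def Let_def mem_Collect_eq prod.case HK_Obj
  apply (intro conjI assms(1-6))
  apply (rule exI[of _ X'], rule exI[of _ Y'], rule exI[of _ Z'], rule exI[of _ f], rule exI[of _ i],
      rule exI[of _ j], rule exI[of _ p], rule exI[of _ q], rule exI[of _ a], rule exI[of _ b], rule exI[of _ c])
  apply (intro conjI assms(7-))
  done

lemma distinguishedE:
  assumes "(X, Y, Z, u, v, w) \<in> distinguished_triangles C"
  obtains X' Y' Z' f i j p q a b c where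
    "X \<in> Bc" "Y \<in> Bc" "Z \<in> Bc" "u \<in> Mor HK X Y" "v \<in> Mor HK Y Z" "w \<in> Mor HK Z (shift_complex C X)"
    and "X' \<in> Bc" "Y' \<in> Bc" "f \<in> Ch X' Y'" "is_mapping_cone C X' Y' f Z' i j p q"
    and "is_iso HK X X' a" "is_iso HK Y Y' b" "is_iso HK Z Z' c"
    and "Comp HK X Y Y' b u = Comp HK X X' Y' (hc X' Y' f) a"
    and "Comp HK Y Z Z' c v = Comp HK Y Y' Z' (hc Y' Z' j) b"
    and "Comp HK Z (shift_complex C X) (shift_complex C X') (shm a) w
          = Comp HK Z Z' (shift_complex C X') (hc Z' (shift_complex C X') p) c"
  using assms unfolding distinguished_triangles_def by (auto simp: Let_def)

lemma mapping_cone_inl: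
  assumes mc: "is_mapping_cone C X Y f Z i j p q" and o: "X \<in> Bc" "Y \<in> Bc" and f: "f \<in> Ch X Y"
  shows "j \<in> Ch Y Z"
  by (rule chain_mapI)
    (simp_all add: mapping_cone_Mor[OF mc] mapping_cone_Diff[OF mc o f refl refl])

lemma mapping_cone_pr:
  assumes mc: "is_mapping_cone C X Y f Z i j p q" and o: "X \<in> Bc" "Y \<in> Bc" and f: "f \<in> Ch X Y"
  shows "p \<in> Ch Z (shift_complex C X)"
proof (rule chain_mapI)
  fix n :: int
  have [simp]: "n + 1 + 1 = n + 2" by simp
  show "Comp C (Ob Z n) (Ob Z (n + 1)) (Ob (shift_complex C X) (n + 1)) (p (n + 1)) (Diff Z n) =
      Comp C (Ob Z n) (Ob (shift_complex C X) n) (Ob (shift_complex C X) (n + 1))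
        (Diff (shift_complex C X) n) (p n)"
    by (simp add: mapping_cone_Diff(3)[OF mc o f refl refl])
qed (simp add: mapping_cone_Mor[OF mc])

lemma inverse_square:
  assumes o: "X \<in> Obj C" "Y \<in> Obj C" "X2 \<in> Obj C" "Y2 \<in> Obj C"
    and m: "u \<in> Mor C X Y" "u2 \<in> Mor C X2 Y2" "a \<in> Mor C X X2" "b \<in> Mor C Y Y2"
       "a' \<in> Mor C X2 X" "b' \<in> Mor C Y2 Y"
    and inv: "Comp C X2 X X2 a a' = Id C X2" "Comp C Y Y2 Y b' b = Id C Y"
    and sq: "Comp C X X2 Y2 u2 a = Comp C X Y Y2 b u"
  shows "Comp C X2 Y2 Y b' u2 = Comp C X2 X Y u a'"
proof -
  have "Comp C X2 Y2 Y b' u2 = Comp C X2 Y2 Y b' (Comp C X2 X Y2 (Comp C X X2 Y2 u2 a) a')"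
    using o m by (simp add: comp_assoc inv id_right closed)
  also have "\<dots> = Comp C X2 X Y u a'"
    using o m by (simp add: sq comp_assoc comp_assoc_eq[OF inv(2)] id_left closed)
  finally show ?thesis .
qed

end

text \<open>The isomorphism of the old triangle with a standard one is composed with the inverse of
  \<open>(a, b, c)\<close>. Since the squares are given for \<open>a\<close>, \<open>b\<close> and
  \<open>c\<close>, each has to be inverted by \<open>inverse_square\<close>.\<close>

lemma (in preadditive) distinguished_iso:
  assumes dist: "(X, Y, Z, u, v, w) \<in> distinguished_triangles C"
    and o: "X2 \<in> Bc" "Y2 \<in> Bc" "Z2 \<in> Bc"
    and m: "u2 \<in> Mor HK X2 Y2" "v2 \<in> Mor HK Y2 Z2" "w2 \<in> Mor HK Z2 (shift_complex C X2)"
    and iso: "is_iso HK X X2 a" "is_iso HK Y Y2 b" "is_iso HK Z Z2 c"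
    and sq: "Comp HK X X2 Y2 u2 a = Comp HK X Y Y2 b u"
      "Comp HK Y Y2 Z2 v2 b = Comp HK Y Z Z2 c v"
      "Comp HK Z Z2 (shift_complex C X2) w2 c =
        Comp HK Z (shift_complex C X) (shift_complex C X2) (shm a) w"
  shows "(X2, Y2, Z2, u2, v2, w2) \<in> distinguished_triangles C"
proof -
  interpret H: preadditive HK by (rule HK_preadditive)
  obtain X' Y' Z' f i j p q a0 b0 c0 where
    d: "X \<in> Bc" "Y \<in> Bc" "Z \<in> Bc" "u \<in> Mor HK X Y" "v \<in> Mor HK Y Z" "w \<in> Mor HK Z (shift_complex C X)"
    and d': "X' \<in> Bc" "Y' \<in> Bc" and f: "f \<in> Ch X' Y'" and mc: "is_mapping_cone C X' Y' f Z' i j p q"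
    and i0: "is_iso HK X X' a0" "is_iso HK Y Y' b0" "is_iso HK Z Z' c0"
    and q0: "Comp HK X Y Y' b0 u = Comp HK X X' Y' (hc X' Y' f) a0"
      "Comp HK Y Z Z' c0 v = Comp HK Y Y' Z' (hc Y' Z' j) b0"
      "Comp HK Z (shift_complex C X) (shift_complex C X') (shm a0) w
          = Comp HK Z Z' (shift_complex C X') (hc Z' (shift_complex C X') p) c0"
    using dist by (rule distinguishedE)
  have Z': "Z' \<in> Bc" by (rule mapping_cone_closed[OF mc])
  note jc = mapping_cone_inl[OF mc d' f] and pc = mapping_cone_pr[OF mc d' f]
  obtain a' where a': "a' \<in> Mor HK X2 X" "Comp HK X X2 X a' a = Id HK X" "Comp HK X2 X X2 a a' = Id HK X2"
      and am: "a \<in> Mor HK X X2"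
    using iso(1) unfolding is_iso_def by blast
  obtain b' where b': "b' \<in> Mor HK Y2 Y" "Comp HK Y Y2 Y b' b = Id HK Y" "Comp HK Y2 Y Y2 b b' = Id HK Y2"
      and bm: "b \<in> Mor HK Y Y2"
    using iso(2) unfolding is_iso_def by blast
  obtain c' where c': "c' \<in> Mor HK Z2 Z" "Comp HK Z Z2 Z c' c = Id HK Z" "Comp HK Z2 Z Z2 c c' = Id HK Z2"
      and cm: "c \<in> Mor HK Z Z2"
    using iso(3) unfolding is_iso_def by blast
  have iso': "is_iso HK X2 X a'" "is_iso HK Y2 Y b'" "is_iso HK Z2 Z c'"
    using a' b' c' am bm cm unfolding is_iso_def by blast+
  have m0: "a0 \<in> Mor HK X X'" "b0 \<in> Mor HK Y Y'" "c0 \<in> Mor HK Z Z'"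
    using i0 unfolding is_iso_def by blast+
  have sq': "Comp HK X2 Y2 Y b' u2 = Comp HK X2 X Y u a'"
    by (rule H.inverse_square) (use d o m am bm a' b' sq in simp_all)
  have sq2': "Comp HK Y2 Z2 Z c' v2 = Comp HK Y2 Y Z v b'"
    by (rule H.inverse_square) (use d o m bm cm b' c' sq in simp_all)
  have sh: "Comp HK (shift_complex C X) (shift_complex C X2) (shift_complex C X) (shm a') (shm a) = Id HK (shift_complex C X)"
    using shm_comp[of X X2 X a a'] d o am a' by (simp add: shm_Id)
  have sq3': "Comp HK Z2 (shift_complex C X2) (shift_complex C X) (shm a') w2 = Comp HK Z2 Z (shift_complex C X) w c'"
    by (rule H.inverse_square[where b = "shm a"]) (use d o m am cm a' c' sq sh in \<open>simp_all add: shift_closed shm_Mor\<close>)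
  note cl = d d' o m m0 am bm cm a'(1) b'(1) c'(1) Z' shift_closed shm_Mor hc_Mor[OF f] hc_Mor[OF jc] hc_Mor[OF pc]
  show ?thesis
  proof (rule distinguishedI[OF o m d' f mc])
    show "is_iso HK X2 X' (Comp HK X2 X X' a0 a')" "is_iso HK Y2 Y' (Comp HK Y2 Y Y' b0 b')"
      "is_iso HK Z2 Z' (Comp HK Z2 Z Z' c0 c')"
      using H.is_iso_comp iso' i0 by (simp_all add: cl)
    show "Comp HK X2 Y2 Y' (Comp HK Y2 Y Y' b0 b') u2 = Comp HK X2 X' Y' (hc X' Y' f) (Comp HK X2 X X' a0 a')"
      using H.comp_assoc_eq[OF q0(1), of X2 a']
      by (simp add: cl H.comp_assoc sq')
    show "Comp HK Y2 Z2 Z' (Comp HK Z2 Z Z' c0 c') v2 = Comp HK Y2 Y' Z' (hc Y' Z' j) (Comp HK Y2 Y Y' b0 b')"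
      using H.comp_assoc_eq[OF q0(2), of Y2 b']
      by (simp add: cl H.comp_assoc sq2')
    show "Comp HK Z2 (shift_complex C X2) (shift_complex C X') (shm (Comp HK X2 X X' a0 a')) w2 =
      Comp HK Z2 Z' (shift_complex C X') (hc Z' (shift_complex C X') p) (Comp HK Z2 Z Z' c0 c')"
      using H.comp_assoc_eq[OF q0(3), of Z2 c']
      by (simp add: cl H.comp_assoc sq3' shm_comp)
  qed
qed

section \<open>Triangles from degreewise split sequences\<close>

context preadditive
begin

lemma neg_add_cancel: "\<lbrakk>X \<in> Obj C; Y \<in> Obj C; a \<in> Mor C X Y; b \<in> Mor C X Y\<rbrakk>
    \<Longrightarrow> (\<ominus>\<^bsub>Hom C X Y\<^esub> a) \<oplus>\<^bsub>Hom C X Y\<^esub> (a \<oplus>\<^bsub>Hom C X Y\<^esub> b) = b"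
  by (metis add_assoc neg_add add_zero_left neg_closed)

text \<open>The pattern that remains in the first component of the cone when the homotopies of
  \<open>split_triangle\<close> are verified: the term of \<chi>, the two terms of the homotopy, and
  the two summands of \<open>\<rho>d\<close>.\<close>

lemma neg_neg_cancel: "\<lbrakk>X \<in> Obj C; Y \<in> Obj C; a \<in> Mor C X Y; b \<in> Mor C X Y; c \<in> Mor C X Y\<rbrakk>
    \<Longrightarrow> (\<ominus>\<^bsub>Hom C X Y\<^esub> a) \<oplus>\<^bsub>Hom C X Y\<^esub> ((\<ominus>\<^bsub>Hom C X Y\<^esub> b) \<oplus>\<^bsub>Hom C X Y\<^esub>
      (c \<oplus>\<^bsub>Hom C X Y\<^esub> (b \<oplus>\<^bsub>Hom C X Y\<^esub> a))) = c"
proof -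
  assume *: "X \<in> Obj C" "Y \<in> Obj C" "a \<in> Mor C X Y" "b \<in> Mor C X Y" "c \<in> Mor C X Y"
  then have "c \<oplus>\<^bsub>Hom C X Y\<^esub> (b \<oplus>\<^bsub>Hom C X Y\<^esub> a) = b \<oplus>\<^bsub>Hom C X Y\<^esub> (a \<oplus>\<^bsub>Hom C X Y\<^esub> c)"
    by (metis add_assoc add_commute add_closed)
  with * show ?thesis by (simp add: neg_add_cancel closed)
qed

text \<open>A degreewise split short exact sequence of complexes with connecting cocycle \<open>h\<close>: the section
  \<open>w \<mapsto> (-h w, \<sigma> w)\<close> identifies \<open>W\<close> with the cone of \<open>\<iota>\<close> up to homotopy. The homotopies are
  \<open>v \<mapsto> (\<rho> v, 0)\<close> and \<open>(u, v) \<mapsto> (\<rho> v, 0)\<close>.\<close>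

lemma split_triangle:
  assumes bp: "has_biproducts C"
    and U: "U \<in> Bc" and V: "V \<in> Bc" and W: "W \<in> Bc"
    and \<iota>: "\<iota> \<in> Ch U V" and \<pi>: "\<pi> \<in> Ch V W" and h: "h \<in> Ch W (shift_complex C U)"
    and b: "\<And>n. is_biproduct C (Ob U n) (Ob W n) (Ob V n) (\<iota> n) (\<sigma> n) (\<rho> n) (\<pi> n)"
    and d\<sigma>: "\<And>n. Comp C (Ob W n) (Ob V n) (Ob V (n + 1)) (Diff V n) (\<sigma> n) =
        Comp C (Ob W n) (Ob U (n + 1)) (Ob V (n + 1)) (\<iota> (n + 1)) (h n)
        \<oplus>\<^bsub>Hom C (Ob W n) (Ob V (n + 1))\<^esub>
        Comp C (Ob W n) (Ob W (n + 1)) (Ob V (n + 1)) (\<sigma> (n + 1)) (Diff W n)"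
    and \<rho>d: "\<And>n. Comp C (Ob V n) (Ob V (n + 1)) (Ob U (n + 1)) (\<rho> (n + 1)) (Diff V n) =
        Comp C (Ob V n) (Ob U n) (Ob U (n + 1)) (Diff U n) (\<rho> n)
        \<oplus>\<^bsub>Hom C (Ob V n) (Ob U (n + 1))\<^esub>
        Comp C (Ob V n) (Ob W n) (Ob U (n + 1)) (h n) (\<pi> n)"
  shows "(U, V, W, \<ominus>\<^bsub>Hom HK U V\<^esub> hc U V \<iota>, hc V W \<pi>, hc W (shift_complex C U) h)
    \<in> distinguished_triangles C"
proof -
  interpret H: preadditive HK by (rule HK_preadditive)
  obtain Z I J P Q where mc: "is_mapping_cone C U V \<iota> Z I J P Q"
    using mapping_cone_exists[OF bp U V \<iota>] by blast
  have Z: "Z \<in> Bc" by (rule mapping_cone_closed[OF mc])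
  note J = mapping_cone_inl[OF mc U V \<iota>] and P = mapping_cone_pr[OF mc U V \<iota>]
  note mb = mapping_cone_biproduct[OF mc]
  note bD = biproductD[OF b] and mbD = biproductD[OF mb]
  have hM: "m = n + 1 \<Longrightarrow> h n \<in> Mor C (Ob W n) (Ob U m)" for m n
    using chain_map_Mor[OF h] by simp
  note M = Ob_Obj[OF U] Ob_Obj[OF V] Ob_Obj[OF W] Ob_Obj[OF Z] Diff_Mor[OF U] Diff_Mor[OF V] Diff_Mor[OF W]
    Diff_Mor[OF Z] bD(2-5) hM mapping_cone_Mor[OF mc]
  define \<chi> where "\<chi> n = Comp C (Ob W n) (Ob U (n + 1)) (Ob Z n) (I n) (\<ominus>\<^bsub>Hom C (Ob W n) (Ob U (n + 1))\<^esub> h n)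
    \<oplus>\<^bsub>Hom C (Ob W n) (Ob Z n)\<^esub> Comp C (Ob W n) (Ob V n) (Ob Z n) (J n) (\<sigma> n)" for n
  have \<chi>M: "\<chi> n \<in> Mor C (Ob W n) (Ob Z n)" for n
    unfolding \<chi>_def by (simp add: M closed)
  note idrules = comp_zero_left comp_zero_right id_left id_right add_zero_left add_zero_right
  have P\<chi>: "m = n + 1 \<Longrightarrow> Comp C (Ob W n) (Ob Z n) (Ob U m) (P n) (\<chi> n) = \<ominus>\<^bsub>Hom C (Ob W n) (Ob U m)\<^esub> h n" for m n
    unfolding \<chi>_def
    by (simp add: M closed comp_add_right comp_assoc_eq[OF mbD(6)] comp_assoc_eq[OF mbD(8)] idrules)
  have Q\<chi>: "Comp C (Ob W n) (Ob Z n) (Ob V n) (Q n) (\<chi> n) = \<sigma> n" for n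
    unfolding \<chi>_def
    by (simp add: M closed comp_add_right comp_assoc_eq[OF mbD(7)] comp_assoc_eq[OF mbD(9)] idrules)
  have two: "n + 1 + 1 = n + 2" for n :: int by simp
  note dZ = mapping_cone_Diff[OF mc U V \<iota>]
  have hsq: "Comp C (Ob W n) (Ob W (n + 1)) (Ob U (n + 2)) (h (n + 1)) (Diff W n) =
      \<ominus>\<^bsub>Hom C (Ob W n) (Ob U (n + 2))\<^esub> Comp C (Ob W n) (Ob U (n + 1)) (Ob U (n + 2)) (Diff U (n + 1)) (h n)" for n
    using chain_map_square[OF h, of "n + 1" n] by (simp add: two M comp_neg_left)
  have \<chi>: "\<chi> \<in> Ch W Z"
  proof (rule chain_mapI)
    fix n
    show "Comp C (Ob W n) (Ob W (n + 1)) (Ob Z (n + 1)) (\<chi> (n + 1)) (Diff W n) =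
         Comp C (Ob W n) (Ob Z n) (Ob Z (n + 1)) (Diff Z n) (\<chi> n)"
    proof (rule biproduct_eqI[OF mb[of "n + 2" "n + 1"]])
      show "Comp C (Ob W n) (Ob Z (n + 1)) (Ob U (n + 2)) (P (n + 1))
          (Comp C (Ob W n) (Ob W (n + 1)) (Ob Z (n + 1)) (\<chi> (n + 1)) (Diff W n)) =
        Comp C (Ob W n) (Ob Z (n + 1)) (Ob U (n + 2)) (P (n + 1))
          (Comp C (Ob W n) (Ob Z n) (Ob Z (n + 1)) (Diff Z n) (\<chi> n))"
        by (simp add: M \<chi>M comp_assoc_eq[OF P\<chi>] comp_assoc_eq[OF dZ(3)] comp_neg_left comp_neg_right closed
          comp_assoc P\<chi> hsq neg_neg)
      show "Comp C (Ob W n) (Ob Z (n + 1)) (Ob V (n + 1)) (Q (n + 1))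
          (Comp C (Ob W n) (Ob W (n + 1)) (Ob Z (n + 1)) (\<chi> (n + 1)) (Diff W n)) =
        Comp C (Ob W n) (Ob Z (n + 1)) (Ob V (n + 1)) (Q (n + 1))
          (Comp C (Ob W n) (Ob Z n) (Ob Z (n + 1)) (Diff Z n) (\<chi> n))"
        by (simp add: M \<chi>M comp_assoc_eq[OF Q\<chi>] comp_assoc_eq[OF dZ(4)] comp_neg_left comp_neg_right closed
          comp_assoc P\<chi> Q\<chi> comp_add_left d\<sigma> neg_add_cancel)
    qed (simp_all add: M \<chi>M closed)
  qed (rule \<chi>M)
  \<comment> \<open>The homotopy inverse of \<chi> sends \<open>(u, v)\<close> to
    \<open>\<pi> v\<close>. It is a chain map because \<open>\<pi> \<iota> = 0\<close> removes the
    part of the cone differential that comes from \<iota>. The composite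
    \<open>\<psi> \<chi>\<close> is the identity on the nose; \<open>\<chi> \<psi>\<close> is so up
    to homotopy.\<close>
  define \<psi> where "\<psi> n = Comp C (Ob Z n) (Ob V n) (Ob W n) (\<pi> n) (Q n)" for n
  have \<psi>M: "\<psi> n \<in> Mor C (Ob Z n) (Ob W n)" for n
    unfolding \<psi>_def by (simp add: M closed)
  have \<pi>\<iota>: "Comp C (Ob U n) (Ob V n) (Ob W n) (\<pi> n) (\<iota> n) = \<zero>\<^bsub>Hom C (Ob U n) (Ob W n)\<^esub>" for n
    by (rule bD(9))
  have \<psi>: "\<psi> \<in> Ch Z W"
  proof (rule chain_mapI)
    fix n
    show "Comp C (Ob Z n) (Ob Z (n + 1)) (Ob W (n + 1)) (\<psi> (n + 1)) (Diff Z n) =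
         Comp C (Ob Z n) (Ob W n) (Ob W (n + 1)) (Diff W n) (\<psi> n)"
      unfolding \<psi>_def
      by (simp add: M closed comp_assoc dZ(4) comp_add_right comp_assoc_eq[OF \<pi>\<iota>]
        comp_assoc_eq[OF chain_map_square[OF \<pi>]] idrules)
  qed (rule \<psi>M)
  have \<psi>\<chi>: "Comp HK W Z W (hc Z W \<psi>) (hc W Z \<chi>) = Id HK W"
  proof -
    have "chain_comp C W Z W \<psi> \<chi> = (\<lambda>n. Id C (Ob W n))"
      by (simp add: chain_comp_def \<psi>_def fun_eq_iff M \<chi>M closed comp_assoc Q\<chi> bD(7))
    then show ?thesis by (simp add: HK_comp W Z \<chi> \<psi> HK_Id)
  qed
  define s where "s n = Comp C (Ob V n) (Ob U n) (Ob Z (n - 1)) (I (n - 1)) (\<rho> n)" for n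
  have sM: "m = n - 1 \<Longrightarrow> s n \<in> Mor C (Ob V n) (Ob Z m)" for m n
    unfolding s_def by (simp add: M closed)
  have I': "I (n - 1) \<in> Mor C (Ob U n) (Ob Z (n - 1))" for n
    by (simp add: M)
  have Ps: "m = n - 1 \<Longrightarrow> Comp C (Ob V n) (Ob Z m) (Ob U n) (P m) (s n) = \<rho> n" for m n
    unfolding s_def by (simp add: M closed comp_assoc_eq[OF mbD(6)] idrules)
  have Qs: "m = n - 1 \<Longrightarrow> Comp C (Ob V n) (Ob Z m) (Ob V m) (Q m) (s n) = \<zero>\<^bsub>Hom C (Ob V n) (Ob V m)\<^esub>" for m n
    unfolding s_def by (simp add: M closed comp_assoc_eq[OF mbD(9)] idrules)
  have PdZ: "Comp C (Ob Z (n - 1)) (Ob Z n) (Ob U (n + 1)) (P n) (Diff Z (n - 1)) =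
      Comp C (Ob Z (n - 1)) (Ob U n) (Ob U (n + 1)) (\<ominus>\<^bsub>Hom C (Ob U n) (Ob U (n + 1))\<^esub> Diff U n) (P (n - 1))" for n
    using dZ(3)[of n "n - 1" "n + 1"] by simp
  have QdZ: "Comp C (Ob Z (n - 1)) (Ob Z n) (Ob V n) (Q n) (Diff Z (n - 1)) =
      Comp C (Ob Z (n - 1)) (Ob U n) (Ob V n) (\<iota> n) (P (n - 1)) \<oplus>\<^bsub>Hom C (Ob Z (n - 1)) (Ob V n)\<^esub>
      Comp C (Ob Z (n - 1)) (Ob V (n - 1)) (Ob V n) (Diff V (n - 1)) (Q (n - 1))" for n
    using dZ(4)[of n "n - 1" "n + 1"] by simp
  have split: "a \<in> Mor C T (Ob V n) \<Longrightarrow> T \<in> Obj C \<Longrightarrow> Comp C T (Ob W n) (Ob V n) (\<sigma> n) (Comp C T (Ob V n) (Ob W n) (\<pi> n) a)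
      \<oplus>\<^bsub>Hom C T (Ob V n)\<^esub> Comp C T (Ob U n) (Ob V n) (\<iota> n) (Comp C T (Ob V n) (Ob U n) (\<rho> n) a) = a" for a n T
    using biproduct_decomp_left[OF b[of n], of T a] add_commute M by (simp add: closed)
  have ZP: "P n \<in> Mor C (Ob Z n) (Ob U (n + 1))" "P (n - 1) \<in> Mor C (Ob Z (n - 1)) (Ob U n)" for n
    by (simp_all add: M)
  have \<chi>\<psi>: "Comp HK Z W Z (hc W Z \<chi>) (hc Z W \<psi>) = Id HK Z"
  proof -
    define t where "t n = Comp C (Ob Z n) (Ob V n) (Ob Z (n - 1)) (s n) (Q n)" for n
    have tM: "m = n - 1 \<Longrightarrow> t n \<in> Mor C (Ob Z n) (Ob Z m)" for m n
      unfolding t_def by (simp add: M sM closed)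
    have "hc Z Z (\<lambda>n. Id C (Ob Z n)) = hc Z Z (chain_comp C Z W Z \<chi> \<psi>)"
    proof (rule hc_eqI[where s = t])
      fix n
      let ?r = "chain_comp C Z W Z \<chi> \<psi> n \<oplus>\<^bsub>Hom C (Ob Z n) (Ob Z n)\<^esub>
        (Comp C (Ob Z n) (Ob Z (n - 1)) (Ob Z n) (Diff Z (n - 1)) (t n) \<oplus>\<^bsub>Hom C (Ob Z n) (Ob Z n)\<^esub>
         Comp C (Ob Z n) (Ob Z (n + 1)) (Ob Z n) (t (n + 1)) (Diff Z n))"
      have tM1: "t (n + 1) \<in> Mor C (Ob Z (n + 1)) (Ob Z n)" by (simp add: tM)
      have dM: "Diff Z (n - 1) \<in> Mor C (Ob Z (n - 1)) (Ob Z n)" by (simp add: M)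
      have sM1: "s (n + 1) \<in> Mor C (Ob V (n + 1)) (Ob Z n)" by (simp add: sM)
      show "Id C (Ob Z n) = ?r"
      proof (rule biproduct_eqI[OF mb[of "n + 1" n]])
        show "Comp C (Ob Z n) (Ob Z n) (Ob U (n + 1)) (P n) (Id C (Ob Z n)) =
          Comp C (Ob Z n) (Ob Z n) (Ob U (n + 1)) (P n) ?r"
          unfolding chain_comp_def t_def \<psi>_def
          by (simp add: M sM sM1 dM \<chi>M closed comp_add_right comp_assoc comp_assoc_eq[OF P\<chi>] comp_assoc_eq[OF PdZ]
            comp_assoc_eq[OF Ps] comp_neg_left dZ(4) comp_assoc_eq[OF \<rho>d] comp_add_left
            comp_assoc_eq[OF bD(6)] id_left id_right ZP neg_neg_cancel)
        show "Comp C (Ob Z n) (Ob Z n) (Ob V n) (Q n) (Id C (Ob Z n)) =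
          Comp C (Ob Z n) (Ob Z n) (Ob V n) (Q n) ?r"
          unfolding chain_comp_def t_def \<psi>_def
          by (simp add: M sM sM1 dM \<chi>M closed comp_add_right comp_assoc comp_assoc_eq[OF Q\<chi>] comp_assoc_eq[OF QdZ]
            comp_assoc_eq[OF Ps] comp_assoc_eq[OF Qs] comp_add_left idrules ZP split)
      qed (simp_all add: chain_comp_def M tM tM1 dM \<chi>M \<psi>M closed)
    qed (simp_all add: id_chain chain_comp_closed Z W \<chi> \<psi> tM)
    then show ?thesis by (simp add: HK_comp W Z \<chi> \<psi> HK_Id)
  qed
  \<comment> \<open>\<open>J\<close> and \<open>\<chi> \<pi>\<close> are different chain maps: they
    differ by the boundary of \<open>s\<close>.\<close>
  have \<chi>\<pi>: "Comp HK V W Z (hc W Z \<chi>) (hc V W \<pi>) = hc V Z J"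
  proof -
    have "hc V Z J = hc V Z (chain_comp C V W Z \<chi> \<pi>)"
    proof (rule hc_eqI[where s = s])
      fix n
      let ?r = "chain_comp C V W Z \<chi> \<pi> n \<oplus>\<^bsub>Hom C (Ob V n) (Ob Z n)\<^esub>
        (Comp C (Ob V n) (Ob Z (n - 1)) (Ob Z n) (Diff Z (n - 1)) (s n) \<oplus>\<^bsub>Hom C (Ob V n) (Ob Z n)\<^esub>
         Comp C (Ob V n) (Ob V (n + 1)) (Ob Z n) (s (n + 1)) (Diff V n))"
      have dM: "Diff Z (n - 1) \<in> Mor C (Ob Z (n - 1)) (Ob Z n)" by (simp add: M)
      have sM1: "s (n + 1) \<in> Mor C (Ob V (n + 1)) (Ob Z n)" by (simp add: sM)
      show "J n = ?r"
      proof (rule biproduct_eqI[OF mb[of "n + 1" n]])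
        show "Comp C (Ob V n) (Ob Z n) (Ob U (n + 1)) (P n) (J n) =
          Comp C (Ob V n) (Ob Z n) (Ob U (n + 1)) (P n) ?r"
          unfolding chain_comp_def
          using neg_neg_cancel[of "Ob V n" "Ob U (n + 1)" "Comp C (Ob V n) (Ob W n) (Ob U (n + 1)) (h n) (\<pi> n)"
              "Comp C (Ob V n) (Ob U n) (Ob U (n + 1)) (Diff U n) (\<rho> n)" "\<zero>\<^bsub>Hom C (Ob V n) (Ob U (n + 1))\<^esub>"]
          by (simp add: M sM sM1 dM \<chi>M closed comp_add_right comp_assoc_eq[OF P\<chi>] comp_assoc_eq[OF PdZ]
            comp_assoc_eq[OF Ps] comp_neg_left comp_assoc \<rho>d mbD(8) Ps idrules ZP)
        show "Comp C (Ob V n) (Ob Z n) (Ob V n) (Q n) (J n) =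
          Comp C (Ob V n) (Ob Z n) (Ob V n) (Q n) ?r"
          unfolding chain_comp_def
          using bD(10)[of n]
          by (simp add: M sM sM1 dM \<chi>M closed comp_add_right comp_assoc_eq[OF Q\<chi>] comp_assoc_eq[OF QdZ]
            comp_assoc_eq[OF Qs] comp_assoc comp_add_left idrules ZP Ps Qs mbD(7) add_commute)
      qed (simp_all add: chain_comp_def M sM sM1 dM \<chi>M \<psi>M closed)
    qed (simp_all add: J chain_comp_closed Z W V \<chi> \<pi> sM)
    then show ?thesis by (simp add: HK_comp W Z V \<chi> \<pi>)
  qed
  have iso: "is_iso HK W Z (hc W Z \<chi>)"
    unfolding is_iso_def using \<psi>\<chi> \<chi>\<psi> hc_Mor[OF \<chi>] hc_Mor[OF \<psi>] by blast
  have H: "U \<in> Obj HK" "V \<in> Obj HK" "W \<in> Obj HK" "Z \<in> Obj HK" "shift_complex C U \<in> Obj HK"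
    by (simp_all add: U V W Z shift_closed)
  have P\<chi>': "Comp HK W Z (shift_complex C U) (hc Z (shift_complex C U) P) (hc W Z \<chi>) =
      \<ominus>\<^bsub>Hom HK W (shift_complex C U)\<^esub> hc W (shift_complex C U) h"
  proof -
    have "chain_comp C W Z (shift_complex C U) P \<chi> = (\<lambda>n. \<ominus>\<^bsub>Hom C (Ob W n) (Ob (shift_complex C U) n)\<^esub> h n)"
      by (simp add: chain_comp_def P\<chi>)
    then show ?thesis using H by (simp add: HK_comp \<chi> P HK_neg h del: shift_complex_simps)
  qed
  have neg: "shm (\<ominus>\<^bsub>Hom HK U U\<^esub> Id HK U) = \<ominus>\<^bsub>Hom HK (shift_complex C U) (shift_complex C U)\<^esub> Id HK (shift_complex C U)"
    using U HK_neg[of "shift_complex C U" "shift_complex C U", OF _ _ id_chain]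
    by (simp add: HK_Id HK_neg id_chain shift_hc chain_neg_closed shift_closed)
  show ?thesis
  proof (rule distinguishedI[OF U V W _ _ _ U V \<iota> mc])
    \<comment> \<open>The last map of the standard triangle gives \<open>P \<chi> = - h\<close>. The
      sign is absorbed by taking \<open>-1\<close> on \<open>U\<close>, and this in turn puts
      \<open>- \<iota>\<close> in the first place of the triangle.\<close>
    show "is_iso HK U U (\<ominus>\<^bsub>Hom HK U U\<^esub> Id HK U)" "is_iso HK V V (Id HK V)" "is_iso HK W Z (hc W Z \<chi>)"
      using H iso by (simp_all add: H.is_iso_neg_id H.is_iso_id)
  qed (use H in \<open>simp_all add: neg H.closed hc_Mor \<iota> \<pi> h J P \<chi> H.id_left H.id_right H.comp_neg_left H.comp_neg_right \<chi>\<pi> P\<chi>'\<close>)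
qed

end

section \<open>The triangulated duality induced by a contravariant functor\<close>

lemma additive_functor_comp:
  assumes "additive_functor C D F Fm" "additive_functor D E G Gm"
  shows "additive_functor C E (\<lambda>X. G (F X)) (\<lambda>X Y f. Gm (F X) (F Y) (Fm X Y f))"
  using assms unfolding additive_functor_def by (simp add: Ball_def)

lemma additive_functor_op: "additive_functor C (op_precat D) F Fm \<Longrightarrow> additive_functor (op_precat C) D F (\<lambda>X Y. Fm Y X)"
  unfolding additive_functor_def by simp

lemma (in hom_ideal) quotient_functor_id: "quotient_functor C N C N (\<lambda>X. X) (\<lambda>X Y f. f)"
  by (intro quotient_functor.intro quotient_functor_axioms.intro hom_ideal_axioms)
    (simp_all add: additive_functor_def)

context contravariant
begin

abbreviation "KA \<equiv> homotopy_precat A"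
abbreviation "KB \<equiv> homotopy_precat B"

definition "dual_class X Y = quotient_map (op_precat (chain_precat B)) (\<lambda>X Y. null_homotopic B Y X) dual_complex dual_map X Y"

lemma dual_class_hc:
  assumes "X \<in> bounded_complexes A" "Y \<in> bounded_complexes A" "f \<in> carrier (chain_maps A X Y)"
  shows "dual_class X Y (homotopy_class A X Y f) =
    homotopy_class B (dual_complex Y) (dual_complex X) (dual_map X Y f)"
  using Q.quotient_map_cls[of X Y f] assms by (simp add: dual_class_def homotopy_class_def)

lemma dual_class_functor: "additive_functor KA (op_precat KB) dual_complex dual_class"
  using Q.functor_Q
  by (simp add: homotopy_precat_eq dual_class_def[abs_def] flip: quotient_op)

lemma dual_class_Mor: "\<lbrakk>X \<in> bounded_complexes A; Y \<in> bounded_complexes A; F \<in> Mor KA X Y\<rbrakk>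
    \<Longrightarrow> dual_class X Y F \<in> Mor KB (dual_complex Y) (dual_complex X)"
  using dual_class_functor unfolding additive_functor_def by simp

lemma dual_class_comp: "\<lbrakk>X \<in> bounded_complexes A; Y \<in> bounded_complexes A; Z \<in> bounded_complexes A;
      F \<in> Mor KA X Y; G \<in> Mor KA Y Z\<rbrakk>
    \<Longrightarrow> dual_class X Z (Comp KA X Y Z G F) =
      Comp KB (dual_complex Z) (dual_complex Y) (dual_complex X) (dual_class X Y F) (dual_class Y Z G)"
  using dual_class_functor unfolding additive_functor_def by simp

lemma dual_class_Id: "X \<in> bounded_complexes A \<Longrightarrow> dual_class X X (Id KA X) = Id KB (dual_complex X)"
  using dual_class_functor unfolding additive_functor_def by simp

lemma dual_class_iso:
  assumes o: "X \<in> bounded_complexes A" "Y \<in> bounded_complexes A" and "is_iso KA X Y a"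
  shows "is_iso KB (dual_complex Y) (dual_complex X) (dual_class X Y a)"
proof -
  obtain a' where a: "a \<in> Mor KA X Y" "a' \<in> Mor KA Y X"
    "Comp KA X Y X a' a = Id KA X" "Comp KA Y X Y a a' = Id KA Y"
    using assms(3) unfolding is_iso_def by blast
  then show ?thesis
    unfolding is_iso_def
    using dual_class_comp[of X Y X a a'] dual_class_comp[of Y X Y a' a] o
    by (auto intro!: bexI[of _ "dual_class Y X a'"] dual_class_Mor simp: dual_class_Id)
qed

lemma dual_complex_shift: "X \<in> bounded_complexes A \<Longrightarrow> dual_complex (shift_complex A X) = unshift_complex B (dual_complex X)"
proof (rule cochain_eqI)
  fix n :: int assume X: "X \<in> bounded_complexes A"
  have [simp]: "- (n - 1) = - n + 1" "- n - 1 + 1 = - n" "- n + 1 - 1 = - n" "- (n - 1) - 1 = - n" by simp_all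
  show "Ob (dual_complex (shift_complex A X)) n = Ob (unshift_complex B (dual_complex X)) n"
    by simp
  show "Diff (dual_complex (shift_complex A X)) n = Diff (unshift_complex B (dual_complex X)) n"
    using X by (simp add: D_neg A.cx)
qed

lemma dual_class_shift:
  assumes o: "X \<in> bounded_complexes A" "Y \<in> bounded_complexes A" and "F \<in> Mor KA X Y"
  shows "dual_class (shift_complex A X) (shift_complex A Y) ((\<lambda>h n. h (n + 1)) ` F) =
    (\<lambda>h n. h (n - 1)) ` dual_class X Y F"
proof -
  obtain f where f: "f \<in> carrier (chain_maps A X Y)" and F: "F = homotopy_class A X Y f"
    using assms(3) by (rule A.HK_MorE)
  have "dual_map (shift_complex A X) (shift_complex A Y) (\<lambda>n. f (n + 1)) = (\<lambda>n. dual_map X Y f (n - 1))"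
    by (simp add: dual_map_def fun_eq_iff)
  then show ?thesis
    using o f by (simp add: F dual_class_hc A.shift_hc A.shift_closed A.chain_map_shift_iff
        B.unshift_hc dual_complex_closed dual_map_closed dual_complex_shift)
qed

text \<open>A cone is a degreewise split extension of \<open>X[1]\<close> by \<open>Y\<close>. Its
  dual is a degreewise split extension with injection \<open>D p\<close>, projection
  \<open>D j\<close>, section \<open>D q\<close> and retraction \<open>D i\<close>; the connecting
  cocycle is the entry \<open>f\<close> of the cone differential, dualised. The triangle is the one
  of \<open>split_triangle\<close>, whose sign falls on \<open>D p\<close>.\<close>

lemma dual_cone_triangle:
  assumes bp: "has_biproducts B"
    and X: "X \<in> bounded_complexes A" and Y: "Y \<in> bounded_complexes A" and f: "f \<in> carrier (chain_maps A X Y)"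
    and mc: "is_mapping_cone A X Y f Z i j p q"
  defines "U \<equiv> dual_complex (shift_complex A X)"
  shows "(U, dual_complex Z, dual_complex Y,
      \<ominus>\<^bsub>Hom KB U (dual_complex Z)\<^esub> dual_class Z (shift_complex A X) (homotopy_class A Z (shift_complex A X) p),
      dual_class Y Z (homotopy_class A Y Z j), dual_class X Y (homotopy_class A X Y f))
    \<in> distinguished_triangles B"
proof -
  have Z: "Z \<in> bounded_complexes A" by (rule A.mapping_cone_closed[OF mc])
  have sX: "shift_complex A X \<in> bounded_complexes A" by (rule A.shift_closed[OF X])
  have pc: "p \<in> carrier (chain_maps A Z (shift_complex A X))" by (rule A.mapping_cone_pr[OF mc X Y f])
  have jc: "j \<in> carrier (chain_maps A Y Z)" by (rule A.mapping_cone_inl[OF mc X Y f])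
  have shU: "shift_complex B U = dual_complex X"
    unfolding U_def by (simp add: dual_complex_shift X B.shift_unshift dual_complex_closed)
  have pU: "dual_map Z (shift_complex A X) p \<in> carrier (chain_maps B U (dual_complex Z))"
    and UB: "U \<in> bounded_complexes B"
    unfolding U_def by (rule dual_map_closed[OF Z sX pc] dual_complex_closed[OF sX])+
  note M = Ob_Obj[OF X] Ob_Obj[OF Y] Ob_Obj[OF Z] Diff_Mor[OF X] Diff_Mor[OF Y] Diff_Mor[OF Z]
    chain_map_Mor[OF f] A.mapping_cone_Mor[OF mc]
  note dZ = A.mapping_cone_Diff[OF mc X Y f]
  have "(U, dual_complex Z, dual_complex Y,
      \<ominus>\<^bsub>Hom KB U (dual_complex Z)\<^esub> homotopy_class B U (dual_complex Z) (dual_map Z (shift_complex A X) p),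
      homotopy_class B (dual_complex Z) (dual_complex Y) (dual_map Y Z j),
      homotopy_class B (dual_complex Y) (shift_complex B U) (dual_map X Y f))
    \<in> distinguished_triangles B"
  proof (rule B.split_triangle[OF bp, where \<sigma> = "\<lambda>n. Dm (Ob Z (- n)) (Ob Y (- n)) (q (- n))"
        and \<rho> = "\<lambda>n. Dm (Ob X (- n + 1)) (Ob Z (- n)) (i (- n))"])
    fix n :: int
    \<comment> \<open>In terms of \<open>m\<close> the three degrees of the original cone that
      matter are \<open>m\<close>, \<open>m + 1\<close> and \<open>m + 2\<close>, so
      \<open>mapping_cone_Diff\<close> applies literally.\<close>
    define m where "m = - n - 1"
    have n: "- n = m + 1" and m2: "- (n + 1) = m" "- n + 1 = m + 2" "- (n + 1) + 1 = m + 1"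
      "- n - 1 = m" "- (n + 1) - 1 = m - 1" "m + 1 + 1 = m + 2" "m + 1 - 1 = m"
      by (simp_all add: m_def)
    have b: "is_biproduct A (Ob X (m + 2)) (Ob Y (m + 1)) (Ob Z (m + 1)) (i (m + 1)) (j (m + 1)) (p (m + 1)) (q (m + 1))"
      by (rule A.mapping_cone_biproduct[OF mc]) simp
    note bD = A.biproductD[OF b]
    show "is_biproduct B (Ob U n) (Ob (dual_complex Y) n) (Ob (dual_complex Z) n) (dual_map Z (shift_complex A X) p n)
          (Dm (Ob Z (- n)) (Ob Y (- n)) (q (- n))) (Dm (Ob X (- n + 1)) (Ob Z (- n)) (i (- n))) (dual_map Y Z j n)"
      unfolding is_biproduct_def U_def dual_map_def dual_complex_simps shift_complex_simps n m2
      using bD(6-10)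
      by (simp add: M bD(1-5) D_obj D_mor A.closed D_id D_zero flip: D_comp D_add)
    show "Comp B (Ob (dual_complex Y) n) (Ob (dual_complex Z) n) (Ob (dual_complex Z) (n + 1)) (Diff (dual_complex Z) n)
          (Dm (Ob Z (- n)) (Ob Y (- n)) (q (- n))) =
         Comp B (Ob (dual_complex Y) n) (Ob U (n + 1)) (Ob (dual_complex Z) (n + 1)) (dual_map Z (shift_complex A X) p (n + 1))
          (dual_map X Y f n) \<oplus>\<^bsub>Hom B (Ob (dual_complex Y) n) (Ob (dual_complex Z) (n + 1))\<^esub>
         Comp B (Ob (dual_complex Y) n) (Ob (dual_complex Y) (n + 1)) (Ob (dual_complex Z) (n + 1))
          (Dm (Ob Z (- (n + 1))) (Ob Y (- (n + 1))) (q (- (n + 1)))) (Diff (dual_complex Y) n)"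
      unfolding U_def dual_map_def dual_complex_simps shift_complex_simps n m2
      using dZ(4)[of "m + 1" m "m + 2"]
      by (simp add: M bD(1-5) A.closed flip: D_comp D_add)
    show "Comp B (Ob (dual_complex Z) n) (Ob (dual_complex Z) (n + 1)) (Ob U (n + 1))
          (Dm (Ob X (- (n + 1) + 1)) (Ob Z (- (n + 1))) (i (- (n + 1)))) (Diff (dual_complex Z) n) =
         Comp B (Ob (dual_complex Z) n) (Ob U n) (Ob U (n + 1)) (Diff U n) (Dm (Ob X (- n + 1)) (Ob Z (- n)) (i (- n)))
         \<oplus>\<^bsub>Hom B (Ob (dual_complex Z) n) (Ob U (n + 1))\<^esub>
         Comp B (Ob (dual_complex Z) n) (Ob (dual_complex Y) n) (Ob U (n + 1)) (dual_map X Y f n) (dual_map Y Z j n)"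
      unfolding U_def dual_map_def dual_complex_simps shift_complex_simps n m2
      using dZ(1)[of "m + 1" m "m + 2"]
      by (simp add: M bD(1-5) A.closed flip: D_comp D_add)
  qed (use pU UB jc f in \<open>simp_all add: shU dual_complex_closed X Y Z dual_map_closed\<close>)
  then show ?thesis
    by (simp add: U_def dual_class_hc X Y Z sX pc jc f shU[unfolded U_def])
qed


text \<open>The isomorphism \<open>F (X[1]) \<cong> (F X)[-1]\<close> is \<open>-1\<close>: the sign corrects the one in
  \<open>dual_cone_triangle\<close>.\<close>

definition "dual_shift_iso X = \<ominus>\<^bsub>Hom KB (unshift_complex B (dual_complex X)) (unshift_complex B (dual_complex X))\<^esub>
  Id KB (unshift_complex B (dual_complex X))"

text \<open>This is what distinguished in \<open>opposite_tricat\<close> means for the image of a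
  triangle: read in \<open>B\<close> it starts at the unshifted dual of \<open>X\<close>. An
  isomorphism onto a standard triangle dualises to one that starts at the dual of the standard
  triangle, so \<open>dual_cone_triangle\<close> is transported by
  \<open>distinguished_iso\<close>.\<close>

lemma dual_triangle:
  assumes bp: "has_biproducts B" and dist: "(X, Y, Z, u, v, w) \<in> distinguished_triangles A"
  defines "U \<equiv> unshift_complex B (dual_complex X)"
  shows "(U, dual_complex Z, dual_complex Y,
      Comp KB U U (dual_complex Z) (dual_class Z (shift_complex A X) w) (dual_shift_iso X),
      dual_class Y Z v, dual_class X Y u) \<in> distinguished_triangles B"
proof -
  interpret HB: preadditive KB by (rule B.HK_preadditive)
  obtain X' Y' Z' f i j p q a b c where
    o: "X \<in> bounded_complexes A" "Y \<in> bounded_complexes A" "Z \<in> bounded_complexes A"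
    and m: "u \<in> Mor KA X Y" "v \<in> Mor KA Y Z" "w \<in> Mor KA Z (shift_complex A X)"
    and o': "X' \<in> bounded_complexes A" "Y' \<in> bounded_complexes A" and f: "f \<in> carrier (chain_maps A X' Y')"
    and mc: "is_mapping_cone A X' Y' f Z' i j p q"
    and iso: "is_iso KA X X' a" "is_iso KA Y Y' b" "is_iso KA Z Z' c"
    and sq: "Comp KA X Y Y' b u = Comp KA X X' Y' (homotopy_class A X' Y' f) a"
      "Comp KA Y Z Z' c v = Comp KA Y Y' Z' (homotopy_class A Y' Z' j) b"
      "Comp KA Z (shift_complex A X) (shift_complex A X') ((`) (\<lambda>h n. h (n + 1)) a) w
          = Comp KA Z Z' (shift_complex A X') (homotopy_class A Z' (shift_complex A X') p) c"
    using dist by (rule A.distinguishedE)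
  have Z': "Z' \<in> bounded_complexes A" by (rule A.mapping_cone_closed[OF mc])
  define U' where "U' = unshift_complex B (dual_complex X')"
  have U: "U = dual_complex (shift_complex A X)" and U': "U' = dual_complex (shift_complex A X')"
    by (simp_all add: U_def U'_def dual_complex_shift o o')
  have abc: "a \<in> Mor KA X X'" "b \<in> Mor KA Y Y'" "c \<in> Mor KA Z Z'"
    using iso unfolding is_iso_def by blast+
  have hM: "homotopy_class A X' Y' f \<in> Mor KA X' Y'" "homotopy_class A Y' Z' j \<in> Mor KA Y' Z'"
    "homotopy_class A Z' (shift_complex A X') p \<in> Mor KA Z' (shift_complex A X')"
    by (simp_all add: A.hc_Mor f A.mapping_cone_inl[OF mc o' f] A.mapping_cone_pr[OF mc o' f])
  have oB: "dual_complex X \<in> Obj KB" "dual_complex Y \<in> Obj KB" "dual_complex Z \<in> Obj KB"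
    "dual_complex X' \<in> Obj KB" "dual_complex Y' \<in> Obj KB" "dual_complex Z' \<in> Obj KB" "U \<in> Obj KB" "U' \<in> Obj KB"
    by (simp_all add: dual_complex_closed o o' Z' U U' A.shift_closed)
  have shU: "shift_complex B U = dual_complex X" "shift_complex B U' = dual_complex X'"
    unfolding U_def U'_def using oB by (simp_all add: B.shift_unshift)
  have sa: "(`) (\<lambda>h n. h (n + 1)) a \<in> Mor KA (shift_complex A X) (shift_complex A X')"
    by (rule A.shm_Mor[OF o(1) o'(1) abc(1)])
  have saB: "dual_class (shift_complex A X) (shift_complex A X') ((`) (\<lambda>h n. h (n + 1)) a) =
      (\<lambda>h n. h (n - 1)) ` dual_class X X' a"
    by (rule dual_class_shift[OF o(1) o'(1) abc(1)])
  let ?Fa = "dual_class (shift_complex A X) (shift_complex A X') ((`) (\<lambda>h n. h (n + 1)) a)"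
  have FaM: "?Fa \<in> Mor KB U' U"
    unfolding U U' using o o' sa by (intro dual_class_Mor) (simp_all add: A.shift_closed)
  have shFa: "(\<lambda>h n. h (n + 1)) ` ?Fa = dual_class X X' a"
    unfolding saB by (simp add: image_comp comp_def)
  have FaIso: "is_iso KB U' U ?Fa"
  proof -
    obtain a' where a': "a' \<in> Mor KA X' X" "Comp KA X X' X a' a = Id KA X" "Comp KA X' X X' a a' = Id KA X'"
      using iso(1) unfolding is_iso_def by blast
    have "is_iso KA (shift_complex A X) (shift_complex A X') ((`) (\<lambda>h n. h (n + 1)) a)"
      unfolding is_iso_def
      using A.shm_comp[of X X' X a a'] A.shm_comp[of X' X X' a' a] o o' a' abc sa A.shm_Mor[OF o'(1) o(1) a'(1)]
      by (auto simp: A.shm_Id intro!: bexI[of _ "(`) (\<lambda>h n. h (n + 1)) a'"])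
    then show ?thesis unfolding U U' using o o' by (intro dual_class_iso) (simp_all add: A.shift_closed)
  qed
  have DM: "dual_class X X' a \<in> Mor KB (dual_complex X') (dual_complex X)"
    "dual_class Y Y' b \<in> Mor KB (dual_complex Y') (dual_complex Y)"
    "dual_class Z Z' c \<in> Mor KB (dual_complex Z') (dual_complex Z)"
    "dual_class X Y u \<in> Mor KB (dual_complex Y) (dual_complex X)"
    "dual_class Y Z v \<in> Mor KB (dual_complex Z) (dual_complex Y)"
    "dual_class Z (shift_complex A X) w \<in> Mor KB U (dual_complex Z)"
    "dual_class Z' (shift_complex A X') (homotopy_class A Z' (shift_complex A X') p) \<in> Mor KB U' (dual_complex Z')"
    unfolding U U' using o o' Z' abc m hM by (intro dual_class_Mor; simp add: A.shift_closed)+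
  note base = dual_cone_triangle[OF bp o' f mc, folded U']
  have idM: "Id KB U \<in> Mor KB U U" by (rule HB.id_closed) (rule oB)
  show ?thesis
  proof (rule B.distinguished_iso[OF base])
    show "is_iso KB U' U ?Fa" by (rule FaIso)
    show "is_iso KB (dual_complex Z') (dual_complex Z) (dual_class Z Z' c)"
      "is_iso KB (dual_complex Y') (dual_complex Y) (dual_class Y Y' b)"
      using o o' Z' iso by (simp_all add: dual_class_iso)
    have "Comp KB U' U (dual_complex Z) (dual_class Z (shift_complex A X) w) ?Fa =
        Comp KB U' (dual_complex Z') (dual_complex Z) (dual_class Z Z' c)
          (dual_class Z' (shift_complex A X') (homotopy_class A Z' (shift_complex A X') p))"
      using dual_class_comp[of Z "shift_complex A X" "shift_complex A X'" w "(`) (\<lambda>h n. h (n + 1)) a"]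
        dual_class_comp[of Z Z' "shift_complex A X'" c "homotopy_class A Z' (shift_complex A X') p"] o o' Z' m abc hM sa
      by (simp add: A.shift_closed U U' sq)
    then show "Comp KB U' U (dual_complex Z)
        (Comp KB U U (dual_complex Z) (dual_class Z (shift_complex A X) w) (dual_shift_iso X)) ?Fa =
      Comp KB U' (dual_complex Z') (dual_complex Z) (dual_class Z Z' c)
        (\<ominus>\<^bsub>Hom KB U' (dual_complex Z')\<^esub> dual_class Z' (shift_complex A X') (homotopy_class A Z' (shift_complex A X') p))"
      using oB DM FaM idM
      by (simp add: dual_shift_iso_def U_def[symmetric] HB.comp_neg_right HB.comp_neg_left HB.id_right HB.closed
          del: B.HK_Obj)
    show "Comp KB (dual_complex Z') (dual_complex Z) (dual_complex Y) (dual_class Y Z v) (dual_class Z Z' c) =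
        Comp KB (dual_complex Z') (dual_complex Y') (dual_complex Y) (dual_class Y Y' b)
          (dual_class Y' Z' (homotopy_class A Y' Z' j))"
      using dual_class_comp[of Y Z Z' v c] dual_class_comp[of Y Y' Z' b "homotopy_class A Y' Z' j"] o o' Z' m abc hM sq
      by simp
    show "Comp KB (dual_complex Y') (dual_complex Y) (shift_complex B U) (dual_class X Y u) (dual_class Y Y' b) =
        Comp KB (dual_complex Y') (shift_complex B U') (shift_complex B U) ((`) (\<lambda>h n. h (n + 1)) ?Fa)
          (dual_class X' Y' (homotopy_class A X' Y' f))"
      using dual_class_comp[of X Y Y' u b] dual_class_comp[of X X' Y' a "homotopy_class A X' Y' f"] o o' Z' m abc hM sq
      by (simp add: shFa shU)
  qed (use oB DM idM in \<open>simp_all add: shU dual_shift_iso_def U_def[symmetric] HB.closed del: B.HK_Obj, simp_all add: B.HK_Obj\<close>)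
qed

text \<open>Both sides are the negative of the same class, since \<open>dual_shift_iso\<close> is
  \<open>-1\<close> and \<open>dual_class_shift\<close> identifies the two images of
  \<open>F\<close>.\<close>

lemma natural_dual_shift:
  assumes o: "X \<in> bounded_complexes A" "Y \<in> bounded_complexes A" and F: "F \<in> Mor KA X Y"
  defines "U \<equiv> unshift_complex B (dual_complex X)" and "V \<equiv> unshift_complex B (dual_complex Y)"
  shows "Comp KB V V U (dual_class (shift_complex A X) (shift_complex A Y) ((\<lambda>h n. h (n + 1)) ` F)) (dual_shift_iso Y) =
    Comp KB V U U (dual_shift_iso X) ((\<lambda>h n. h (n - 1)) ` dual_class X Y F)"
proof -
  interpret HB: preadditive KB by (rule B.HK_preadditive)
  have oB: "U \<in> Obj KB" "V \<in> Obj KB"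
    by (simp_all add: U_def V_def o dual_complex_closed B.unshift_closed)
  have "dual_class (shift_complex A X) (shift_complex A Y) ((\<lambda>h n. h (n + 1)) ` F) \<in> Mor KB V U"
    unfolding U_def V_def using o A.shm_Mor[OF o F]
    by (simp add: A.shift_closed dual_class_Mor flip: dual_complex_shift)
  then show ?thesis
    using oB HB.id_closed[OF oB(1)] HB.id_closed[OF oB(2)]
    unfolding dual_shift_iso_def U_def[symmetric] V_def[symmetric] dual_class_shift[OF o F, symmetric]
    by (simp add: HB.comp_neg_left HB.comp_neg_right HB.id_left HB.id_right del: B.HK_Obj)
qed

end

section \<open>Natural isomorphisms induced on homotopy categories\<close>

lemma natural_iso_cong:
  assumes "natural_iso C D F Fm G Gm \<eta>"
    and "\<And>X Y f. \<lbrakk>X \<in> Obj C; Y \<in> Obj C; f \<in> Mor C X Y\<rbrakk> \<Longrightarrow> Fm X Y f = Fm' X Y f"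
    and "\<And>X Y f. \<lbrakk>X \<in> Obj C; Y \<in> Obj C; f \<in> Mor C X Y\<rbrakk> \<Longrightarrow> Gm X Y f = Gm' X Y f"
  shows "natural_iso C D F Fm' G Gm' \<eta>"
  using assms unfolding natural_iso_def by simp

text \<open>One natural isomorphism is recorded, the one on \<open>A\<close>. The other comes from
  the locale with the two functors exchanged, so that every consequence of the locale serves both
  sides.\<close>

locale contravariant_pair = D: contravariant A B D Dm + G: contravariant B A G Gm
  for A :: "('o, 'h, 'z) precat_scheme" and B :: "('p, 'k, 'w) precat_scheme" and D Dm G Gm +
  fixes \<alpha>
  assumes unit: "natural_iso A A (\<lambda>X. G (D X)) (\<lambda>X Y f. Gm (D Y) (D X) (Dm X Y f)) (\<lambda>X. X) (\<lambda>X Y f. f) \<alpha>"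
begin

lemma chain_unit:
  "natural_iso (chain_precat A) (chain_precat A)
    (\<lambda>X. G.dual_complex (D.dual_complex X))
    (\<lambda>X Y f. G.dual_map (D.dual_complex Y) (D.dual_complex X) (D.dual_map X Y f))
    (\<lambda>X. X) (\<lambda>X Y f. f) (\<lambda>X n. \<alpha> (Ob X n))"
proof -
  have iso: "is_iso A (G (D X)) X (\<alpha> X)" if "X \<in> Obj A" for X
    using unit that unfolding natural_iso_def by blast
  then have mor: "\<alpha> X \<in> Mor A (G (D X)) X" if "X \<in> Obj A" for X
    using that unfolding is_iso_def by blast
  have nat: "Comp A (G (D X)) (G (D Y)) Y (\<alpha> Y) (Gm (D Y) (D X) (Dm X Y f)) = Comp A (G (D X)) X Y f (\<alpha> X)"
    if "X \<in> Obj A" "Y \<in> Obj A" "f \<in> Mor A X Y" for X Y f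
    using unit that unfolding natural_iso_def by blast
  have "is_iso (chain_precat A) (G.dual_complex (D.dual_complex X)) X (\<lambda>n. \<alpha> (Ob X n))"
    if X: "X \<in> bounded_complexes A" for X
  proof (rule D.A.chain_iso)
    show "(\<lambda>n. \<alpha> (Ob X n)) \<in> carrier (chain_maps A (G.dual_complex (D.dual_complex X)) X)"
    proof (rule chain_mapI)
      fix n :: int
      have [simp]: "- (- n - 1) = n + 1" "- (- n - 1) - 1 = n" "1 + n = n + 1" by simp_all
      show "Comp A (Ob (G.dual_complex (D.dual_complex X)) n) (Ob (G.dual_complex (D.dual_complex X)) (n + 1))
          (Ob X (n + 1)) (\<alpha> (Ob X (n + 1))) (Diff (G.dual_complex (D.dual_complex X)) n) =
        Comp A (Ob (G.dual_complex (D.dual_complex X)) n) (Ob X n) (Ob X (n + 1)) (Diff X n) (\<alpha> (Ob X n))"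
        using nat[of "Ob X n" "Ob X (n + 1)" "Diff X n"] X by (simp add: D.A.cx)
    qed (use X in \<open>simp add: mor D.A.cx\<close>)
  qed (use X in \<open>simp_all add: D.dual_complex_closed G.dual_complex_closed iso D.A.cx\<close>)
  then show ?thesis
    unfolding natural_iso_def
    by (auto simp: chain_comp_def fun_eq_iff D.dual_map_def G.dual_map_def nat D.A.cx chain_map_Mor)
qed

lemma chain_round_trip:
  "quotient_functor (chain_precat A) (null_homotopic A) (chain_precat A) (null_homotopic A)
    (\<lambda>X. G.dual_complex (D.dual_complex X))
    (\<lambda>X Y f. G.dual_map (D.dual_complex Y) (D.dual_complex X) (D.dual_map X Y f))"
proof (intro quotient_functor.intro quotient_functor_axioms.intro D.A.hom_ideal_null)
  show "additive_functor (chain_precat A) (chain_precat A)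
    (\<lambda>X. G.dual_complex (D.dual_complex X))
    (\<lambda>X Y f. G.dual_map (D.dual_complex Y) (D.dual_complex X) (D.dual_map X Y f))"
    by (rule additive_functor_comp[OF D.chain_functor additive_functor_op[OF G.chain_functor]])
qed (simp add: D.dual_null G.dual_null D.dual_complex_closed)

lemma homotopy_unit:
  "\<exists>\<eta>. natural_iso (homotopy_precat A) (homotopy_precat A)
    (\<lambda>X. G.dual_complex (D.dual_complex X))
    (\<lambda>X Y F. G.dual_class (D.dual_complex Y) (D.dual_complex X) (D.dual_class X Y F))
    (\<lambda>X. X) (\<lambda>X Y F. F) \<eta>"
proof -
  interpret I: quotient_functor "chain_precat A" "null_homotopic A" "chain_precat A" "null_homotopic A"
    "\<lambda>X. X" "\<lambda>X Y f. f"
    by (rule hom_ideal.quotient_functor_id[OF D.A.hom_ideal_null])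
  interpret T: quotient_functor "chain_precat A" "null_homotopic A" "chain_precat A" "null_homotopic A"
    "\<lambda>X. G.dual_complex (D.dual_complex X)"
    "\<lambda>X Y f. G.dual_map (D.dual_complex Y) (D.dual_complex X) (D.dual_map X Y f)"
    by (rule chain_round_trip)
  have "natural_iso (homotopy_precat A) (homotopy_precat A)
    (\<lambda>X. G.dual_complex (D.dual_complex X))
    (\<lambda>X Y F. G.dual_class (D.dual_complex Y) (D.dual_complex X) (D.dual_class X Y F))
    (\<lambda>X. X) (\<lambda>X Y F. F)
    (\<lambda>X. null_homotopic A (G.dual_complex (D.dual_complex X)) X
      +>\<^bsub>chain_maps A (G.dual_complex (D.dual_complex X)) X\<^esub> (\<lambda>n. \<alpha> (Ob X n)))"
    using quotient_natural_iso[OF chain_round_trip I.quotient_functor_axioms chain_unit]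
    unfolding homotopy_precat_eq[symmetric] chain_precat_simps(2)
  proof (rule natural_iso_cong)
    fix X Y F assume o: "X \<in> Obj (homotopy_precat A)" "Y \<in> Obj (homotopy_precat A)"
      and F: "F \<in> Mor (homotopy_precat A) X Y"
    obtain f where f: "f \<in> carrier (chain_maps A X Y)" and Ff: "F = homotopy_class A X Y f"
      using F by (rule D.A.HK_MorE)
    show "quotient_map (chain_precat A) (null_homotopic A) (\<lambda>X. G.dual_complex (D.dual_complex X))
          (\<lambda>X Y f. G.dual_map (D.dual_complex Y) (D.dual_complex X) (D.dual_map X Y f)) X Y F =
         G.dual_class (D.dual_complex Y) (D.dual_complex X) (D.dual_class X Y F)"
      using T.quotient_map_cls[of X Y f] o f
      by (simp add: Ff D.dual_class_hc G.dual_class_hc D.dual_complex_closed D.dual_map_closed)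
        (simp add: homotopy_class_def)
    show "quotient_map (chain_precat A) (null_homotopic A) (\<lambda>X. X) (\<lambda>X Y f. f) X Y F = F"
      using I.quotient_map_cls[of X Y f] o f by (simp add: Ff homotopy_class_def)
  qed
  then show ?thesis by blast
qed

end

section \<open>Dualities between full subcategories of homotopy categories\<close>

lemma Kb_sub_simps [simp]:
  "Obj (full_subtricat (Kb A) P) = {X \<in> bounded_complexes A. P X}"
  "Hom (full_subtricat (Kb A) P) = Hom (homotopy_precat A)"
  "Comp (full_subtricat (Kb A) P) = Comp (homotopy_precat A)"
  "Id (full_subtricat (Kb A) P) = Id (homotopy_precat A)"
  "Shift (full_subtricat (Kb A) P) = shift_complex A"
  "ShiftM (full_subtricat (Kb A) P) X Y F = (\<lambda>h n. h (n + 1)) ` F"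
  "Unshift (full_subtricat (Kb A) P) = unshift_complex A"
  "UnshiftM (full_subtricat (Kb A) P) X Y F = (\<lambda>h n. h (n - 1)) ` F"
  "(X, Y, Z, u, v, w) \<in> Dist (full_subtricat (Kb A) P) \<longleftrightarrow>
    (X, Y, Z, u, v, w) \<in> distinguished_triangles A \<and> P X \<and> P Y \<and> P Z"
  by (simp_all add: full_subtricat_def Kb_def homotopy_precat_def)

lemma opposite_tricat_simps [simp]:
  "Obj (opposite_tricat T) = Obj T" "Hom (opposite_tricat T) X Y = Hom T Y X"
  "Comp (opposite_tricat T) X Y Z g f = Comp T Z Y X f g" "Id (opposite_tricat T) = Id T"
  "Shift (opposite_tricat T) = Unshift T" "ShiftM (opposite_tricat T) X Y f = UnshiftM T Y X f"
  "(X, Y, Z, u, v, w) \<in> Dist (opposite_tricat T) \<longleftrightarrow> X \<in> Obj T \<and> (Unshift T X, Z, Y, w, v, u) \<in> Dist T"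
  by (simp_all add: opposite_tricat_def)

lemma is_iso_Kb_sub:
  "is_iso (full_subtricat (Kb A) P) = is_iso (homotopy_precat A)"
  "is_iso (opposite_tricat (full_subtricat (Kb A) P)) X Y f \<longleftrightarrow> is_iso (homotopy_precat A) Y X f"
  by (auto simp: is_iso_def fun_eq_iff)

text \<open>The quasi-inverse is induced by \<open>G\<close>. The condition on
  \<open>unshift_complex\<close> is there because a distinguished triangle of the opposite category
  starts, when read in \<open>B\<close>, at the unshifted object, which has to satisfy
  \<open>Q\<close> as well.\<close>

theorem Kb_duality:
  fixes A :: "('o, 'h, 'z) precat_scheme" and B :: "('p, 'k, 'w) precat_scheme"
  assumes "contravariant_pair A B D Dm G Gm \<alpha>" and "contravariant_pair B A G Gm D Dm \<beta>"
    and bp: "has_biproducts B"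
    and PQ: "\<And>X. \<lbrakk>X \<in> bounded_complexes A; P X\<rbrakk> \<Longrightarrow> Q (contravariant.dual_complex D Dm X)"
    and QP: "\<And>X. \<lbrakk>X \<in> bounded_complexes B; Q X\<rbrakk> \<Longrightarrow> P (contravariant.dual_complex G Gm X)"
    and Qshift: "\<And>X. \<lbrakk>X \<in> bounded_complexes B; Q X\<rbrakk> \<Longrightarrow> Q (unshift_complex B X)"
  shows "\<exists>F Fm \<eta>. triangulated_duality (full_subtricat (Kb A) P) (full_subtricat (Kb B) Q) F Fm \<eta>"
proof -
  interpret DG: contravariant_pair A B D Dm G Gm \<alpha> by fact
  interpret GD: contravariant_pair B A G Gm D Dm \<beta> by fact
  let ?S = "full_subtricat (Kb A) P" and ?T = "opposite_tricat (full_subtricat (Kb B) Q)"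
  have F: "additive_functor ?S ?T DG.D.dual_complex DG.D.dual_class"
    using DG.D.dual_class_functor PQ unfolding additive_functor_def by auto
  have G: "additive_functor ?T ?S DG.G.dual_complex (\<lambda>X Y. DG.G.dual_class Y X)"
    using DG.G.dual_class_functor QP unfolding additive_functor_def by auto
  have FG: "additive_functor (homotopy_precat B) (homotopy_precat B)
     (\<lambda>X. DG.D.dual_complex (DG.G.dual_complex X))
     (\<lambda>X Y F. DG.D.dual_class (DG.G.dual_complex Y) (DG.G.dual_complex X) (DG.G.dual_class X Y F))"
    by (rule additive_functor_comp[OF DG.G.dual_class_functor additive_functor_op[OF DG.D.dual_class_functor]])
  obtain \<eta> where \<eta>: "natural_iso (homotopy_precat A) (homotopy_precat A)
    (\<lambda>X. DG.G.dual_complex (DG.D.dual_complex X))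
    (\<lambda>X Y F. DG.G.dual_class (DG.D.dual_complex Y) (DG.D.dual_complex X) (DG.D.dual_class X Y F))
    (\<lambda>X. X) (\<lambda>X Y F. F) \<eta>"
    using DG.homotopy_unit by blast
  obtain \<theta>0 where "natural_iso (homotopy_precat B) (homotopy_precat B)
    (\<lambda>X. DG.D.dual_complex (DG.G.dual_complex X))
    (\<lambda>X Y F. DG.D.dual_class (DG.G.dual_complex Y) (DG.G.dual_complex X) (DG.G.dual_class X Y F))
    (\<lambda>X. X) (\<lambda>X Y F. F) \<theta>0"
    using GD.homotopy_unit by blast
  then obtain \<theta> where \<theta>: "natural_iso (op_precat (homotopy_precat B)) (op_precat (homotopy_precat B))
    (\<lambda>X. DG.D.dual_complex (DG.G.dual_complex X))
    (\<lambda>X Y F. DG.D.dual_class (DG.G.dual_complex X) (DG.G.dual_complex Y) (DG.G.dual_class Y X F))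
    (\<lambda>X. X) (\<lambda>X Y F. F) \<theta>"
    using natural_iso_op[OF DG.D.B.HK_preadditive FG] by blast
  have equiv: "is_equivalence ?S ?T DG.D.dual_complex DG.D.dual_class"
    unfolding is_equivalence_def
  proof (intro conjI exI)
    show "natural_iso ?S ?S (\<lambda>X. DG.G.dual_complex (DG.D.dual_complex X))
      (\<lambda>X Y f. DG.G.dual_class (DG.D.dual_complex Y) (DG.D.dual_complex X) (DG.D.dual_class X Y f))
      (\<lambda>X. X) (\<lambda>X Y f. f) \<eta>"
      using \<eta> unfolding natural_iso_def is_iso_Kb_sub by auto
    show "natural_iso ?T ?T (\<lambda>X. DG.D.dual_complex (DG.G.dual_complex X))
      (\<lambda>X Y f. DG.D.dual_class (DG.G.dual_complex X) (DG.G.dual_complex Y) (DG.G.dual_class Y X f))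
      (\<lambda>X. X) (\<lambda>X Y f. f) \<theta>"
      using \<theta> unfolding natural_iso_def is_iso_Kb_sub is_iso_op_iff by auto
  qed (rule F G)+
  interpret HB: preadditive "homotopy_precat B" by (rule DG.D.B.HK_preadditive)
  have shift_iso: "is_iso (homotopy_precat B) (unshift_complex B (DG.D.dual_complex X))
      (unshift_complex B (DG.D.dual_complex X)) (DG.D.dual_shift_iso X)"
    if "X \<in> bounded_complexes A" for X
    unfolding DG.D.dual_shift_iso_def
    by (rule HB.is_iso_neg_id) (simp add: that DG.D.dual_complex_closed DG.D.B.unshift_closed)
  have "triangle_functor ?S ?T DG.D.dual_complex DG.D.dual_class DG.D.dual_shift_iso"
    unfolding triangle_functor_def
  proof (intro conjI allI impI F)
    show "natural_iso ?S ?T (\<lambda>X. DG.D.dual_complex (Shift ?S X))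
       (\<lambda>X Y f. DG.D.dual_class (Shift ?S X) (Shift ?S Y) (ShiftM ?S X Y f))
       (\<lambda>X. Shift ?T (DG.D.dual_complex X))
       (\<lambda>X Y f. ShiftM ?T (DG.D.dual_complex X) (DG.D.dual_complex Y) (DG.D.dual_class X Y f)) DG.D.dual_shift_iso"
      unfolding natural_iso_def is_iso_Kb_sub
      by (simp add: DG.D.dual_complex_shift DG.D.natural_dual_shift shift_iso)
  next
    fix X Y Z u v w assume "(X, Y, Z, u, v, w) \<in> Dist ?S"
    then have d: "(X, Y, Z, u, v, w) \<in> distinguished_triangles A" and p: "P X" "P Y" "P Z" by auto
    then have o: "X \<in> bounded_complexes A" "Y \<in> bounded_complexes A" "Z \<in> bounded_complexes A"
      by (auto elim: DG.D.A.distinguishedE)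
    show "(DG.D.dual_complex X, DG.D.dual_complex Y, DG.D.dual_complex Z, DG.D.dual_class X Y u, DG.D.dual_class Y Z v,
        Comp ?T (DG.D.dual_complex Z) (DG.D.dual_complex (Shift ?S X)) (Shift ?T (DG.D.dual_complex X))
         (DG.D.dual_shift_iso X) (DG.D.dual_class Z (Shift ?S X) w)) \<in> Dist ?T"
      using DG.D.dual_triangle[OF bp d] o p
      by (simp add: DG.D.dual_complex_shift PQ Qshift DG.D.dual_complex_closed)
  qed
  then show ?thesis
    unfolding triangulated_duality_def triangle_equivalence_def using equiv by blast
qed

section \<open>Right modules\<close>

context right_module
begin

lemma act_zero_left: "x \<in> carrier M \<Longrightarrow> \<zero>\<^bsub>\<Lambda>\<^esub> \<odot>\<^bsub>M\<^esub> x = \<zero>\<^bsub>M\<^esub>"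
  using act_add_ring[of "\<zero>\<^bsub>\<Lambda>\<^esub>" "\<zero>\<^bsub>\<Lambda>\<^esub>" x] act_closed[of "\<zero>\<^bsub>\<Lambda>\<^esub>" x] by simp

lemma act_zero_right: "a \<in> carrier \<Lambda> \<Longrightarrow> a \<odot>\<^bsub>M\<^esub> \<zero>\<^bsub>M\<^esub> = \<zero>\<^bsub>M\<^esub>"
  using act_add_mod[of a "\<zero>\<^bsub>M\<^esub>" "\<zero>\<^bsub>M\<^esub>"] act_closed[of a "\<zero>\<^bsub>M\<^esub>"] by simp

lemma act_neg_left: "\<lbrakk>a \<in> carrier \<Lambda>; x \<in> carrier M\<rbrakk> \<Longrightarrow> (\<ominus>\<^bsub>\<Lambda>\<^esub> a) \<odot>\<^bsub>M\<^esub> x = \<ominus>\<^bsub>M\<^esub> (a \<odot>\<^bsub>M\<^esub> x)"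
  using act_add_ring[of "\<ominus>\<^bsub>\<Lambda>\<^esub> a" a x] act_closed
  by (simp add: R.l_neg act_zero_left M.minus_equality)

lemma act_neg_right: "\<lbrakk>a \<in> carrier \<Lambda>; x \<in> carrier M\<rbrakk> \<Longrightarrow> a \<odot>\<^bsub>M\<^esub> (\<ominus>\<^bsub>M\<^esub> x) = \<ominus>\<^bsub>M\<^esub> (a \<odot>\<^bsub>M\<^esub> x)"
  using act_add_mod[of a "\<ominus>\<^bsub>M\<^esub> x" x] act_closed
  by (simp add: M.l_neg act_zero_right M.minus_equality)

lemma neg_zero: "\<ominus>\<^bsub>M\<^esub> \<zero>\<^bsub>M\<^esub> = \<zero>\<^bsub>M\<^esub>"
  by (metis M.l_neg M.r_zero M.zero_closed M.a_inv_closed)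

lemma minus_zero: "x \<in> carrier M \<Longrightarrow> x \<ominus>\<^bsub>M\<^esub> \<zero>\<^bsub>M\<^esub> = x"
  by (simp add: M.minus_eq neg_zero)

lemma act_minus: "\<lbrakk>a \<in> carrier \<Lambda>; x \<in> carrier M; y \<in> carrier M\<rbrakk>
    \<Longrightarrow> a \<odot>\<^bsub>M\<^esub> (x \<ominus>\<^bsub>M\<^esub> y) = (a \<odot>\<^bsub>M\<^esub> x) \<ominus>\<^bsub>M\<^esub> (a \<odot>\<^bsub>M\<^esub> y)"
  by (simp add: M.minus_eq act_add_mod act_neg_right)

end

section \<open>Homomorphisms and the category of modules\<close>

lemma right_homI:
  assumes "\<And>x. x \<in> carrier M \<Longrightarrow> f x \<in> carrier N" "f \<in> extensional (carrier M)"
    and "\<And>x y. \<lbrakk>x \<in> carrier M; y \<in> carrier M\<rbrakk> \<Longrightarrow> f (x \<oplus>\<^bsub>M\<^esub> y) = f x \<oplus>\<^bsub>N\<^esub> f y"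
    and "\<And>a x. \<lbrakk>a \<in> carrier \<Lambda>; x \<in> carrier M\<rbrakk> \<Longrightarrow> f (a \<odot>\<^bsub>M\<^esub> x) = a \<odot>\<^bsub>N\<^esub> f x"
  shows "f \<in> right_hom \<Lambda> M N"
  using assms unfolding right_hom_def by (auto simp: PiE_def)

lemma right_homD:
  assumes "f \<in> right_hom \<Lambda> M N"
  shows "x \<in> carrier M \<Longrightarrow> f x \<in> carrier N" "f \<in> extensional (carrier M)"
    and "\<lbrakk>x \<in> carrier M; y \<in> carrier M\<rbrakk> \<Longrightarrow> f (x \<oplus>\<^bsub>M\<^esub> y) = f x \<oplus>\<^bsub>N\<^esub> f y"
    and "\<lbrakk>a \<in> carrier \<Lambda>; x \<in> carrier M\<rbrakk> \<Longrightarrow> f (a \<odot>\<^bsub>M\<^esub> x) = a \<odot>\<^bsub>N\<^esub> f x"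
  using assms unfolding right_hom_def by (auto simp: PiE_def)

lemma right_hom_zero:
  assumes "abelian_group M" "abelian_group N" "f \<in> right_hom \<Lambda> M N"
  shows "f \<zero>\<^bsub>M\<^esub> = \<zero>\<^bsub>N\<^esub>"
proof -
  interpret M: abelian_group M by fact
  interpret N: abelian_group N by fact
  show ?thesis
    using right_homD(1)[OF assms(3), of "\<zero>\<^bsub>M\<^esub>"] right_homD(3)[OF assms(3), of "\<zero>\<^bsub>M\<^esub>" "\<zero>\<^bsub>M\<^esub>"] by simp
qed

lemma right_hom_neg:
  assumes "abelian_group M" "abelian_group N" "f \<in> right_hom \<Lambda> M N" "x \<in> carrier M"
  shows "f (\<ominus>\<^bsub>M\<^esub> x) = \<ominus>\<^bsub>N\<^esub> f x"
proof -
  interpret M: abelian_group M by fact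
  interpret N: abelian_group N by fact
  show ?thesis
    using right_homD(1,3)[OF assms(3)] right_hom_zero[OF assms(1-3)] assms(4)
    by (metis M.a_inv_closed M.l_neg N.minus_equality)
qed

lemma right_hom_minus:
  assumes "abelian_group M" "abelian_group N" "f \<in> right_hom \<Lambda> M N" "x \<in> carrier M" "y \<in> carrier M"
  shows "f (x \<ominus>\<^bsub>M\<^esub> y) = f x \<ominus>\<^bsub>N\<^esub> f y"
  using assms by (simp add: a_minus_def right_homD abelian_group.a_inv_closed right_hom_neg)

lemma right_hom_eqI:
  assumes "f \<in> right_hom \<Lambda> M N" "g \<in> right_hom \<Lambda> M N'" "\<And>x. x \<in> carrier M \<Longrightarrow> f x = g x"
  shows "f = g"
  using assms right_homD(2) by (metis extensionalityI)

lemma right_hom_compose: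
  assumes "f \<in> right_hom \<Lambda> L M" "g \<in> right_hom \<Lambda> M N" "right_module \<Lambda> L"
  shows "compose (carrier L) g f \<in> right_hom \<Lambda> L N"
proof -
  interpret L: right_module \<Lambda> L by fact
  show ?thesis
    by (rule right_homI) (use assms in \<open>auto simp: compose_def right_homD L.act_closed\<close>)
qed

lemma right_hom_add_closed:
  assumes f: "f \<in> right_hom \<Lambda> M N" and g: "g \<in> right_hom \<Lambda> M N" and "right_module \<Lambda> M" "right_module \<Lambda> N"
  shows "(\<lambda>x\<in>carrier M. f x \<oplus>\<^bsub>N\<^esub> g x) \<in> right_hom \<Lambda> M N"
proof -
  interpret M: right_module \<Lambda> M by fact
  interpret N: right_module \<Lambda> N by fact
  show ?thesis
    by (rule right_homI)
      (use right_homD[OF f] right_homD[OF g] in \<open>simp_all add: M.act_closed N.act_add_mod N.M.a_ac\<close>)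
qed

lemma right_hom_zero_closed:
  assumes "right_module \<Lambda> M" "right_module \<Lambda> N"
  shows "(\<lambda>x\<in>carrier M. \<zero>\<^bsub>N\<^esub>) \<in> right_hom \<Lambda> M N"
proof -
  interpret M: right_module \<Lambda> M by fact
  interpret N: right_module \<Lambda> N by fact
  show ?thesis
    by (rule right_homI) (simp_all add: M.act_closed N.act_zero_right)
qed

lemma right_hom_neg_closed:
  assumes f: "f \<in> right_hom \<Lambda> M N" and "right_module \<Lambda> M" "right_module \<Lambda> N"
  shows "(\<lambda>x\<in>carrier M. \<ominus>\<^bsub>N\<^esub> f x) \<in> right_hom \<Lambda> M N"
proof -
  interpret M: right_module \<Lambda> M by fact
  interpret N: right_module \<Lambda> N by fact
  show ?thesis
    by (rule right_homI)
      (use right_homD[OF f] in \<open>simp_all add: M.act_closed N.act_neg_right N.M.minus_add\<close>)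
qed

lemma right_hom_id: "right_module \<Lambda> M \<Longrightarrow> (\<lambda>x\<in>carrier M. x) \<in> right_hom \<Lambda> M M"
proof -
  assume "right_module \<Lambda> M"
  then interpret M: right_module \<Lambda> M .
  show ?thesis by (rule right_homI) (simp_all add: M.act_closed)
qed

lemma mod_cat_simps [simp]:
  "Obj (mod_cat \<Lambda>) = {M. right_module \<Lambda> M \<and> finitely_presented \<Lambda> M}"
  "carrier (Hom (mod_cat \<Lambda>) M N) = right_hom \<Lambda> M N"
  "\<zero>\<^bsub>Hom (mod_cat \<Lambda>) M N\<^esub> = (\<lambda>x\<in>carrier M. \<zero>\<^bsub>N\<^esub>)"
  "f \<oplus>\<^bsub>Hom (mod_cat \<Lambda>) M N\<^esub> g = (\<lambda>x\<in>carrier M. f x \<oplus>\<^bsub>N\<^esub> g x)"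
  "Comp (mod_cat \<Lambda>) L M N g' f' = compose (carrier L) g' f'"
  "Id (mod_cat \<Lambda>) M = (\<lambda>x\<in>carrier M. x)"
  by (simp_all add: mod_cat_def)

lemma preadditive_mod_cat: "preadditive (mod_cat \<Lambda> :: (('a, 'm) module, 'm \<Rightarrow> 'm) precat)"
proof (rule preadditive.intro)
  fix M N :: "('a, 'm) module" assume "M \<in> Obj (mod_cat \<Lambda>)" "N \<in> Obj (mod_cat \<Lambda>)"
  then have mod: "right_module \<Lambda> M" "right_module \<Lambda> N" by auto
  interpret M: right_module \<Lambda> M by fact
  interpret N: right_module \<Lambda> N by fact
  show "abelian_group (Hom (mod_cat \<Lambda>) M N)"
  proof (rule abelian_groupI)
    fix f assume f: "f \<in> Mor (mod_cat \<Lambda>) M N"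
    then show "\<exists>g\<in>Mor (mod_cat \<Lambda>) M N. g \<oplus>\<^bsub>Hom (mod_cat \<Lambda>) M N\<^esub> f = \<zero>\<^bsub>Hom (mod_cat \<Lambda>) M N\<^esub>"
      using mod right_hom_neg_closed[of f \<Lambda> M N]
      by (auto intro!: bexI[of _ "\<lambda>x\<in>carrier M. \<ominus>\<^bsub>N\<^esub> f x"] simp: fun_eq_iff right_homD N.M.l_neg)
  qed (use mod in \<open>auto simp: right_hom_add_closed[unfolded restrict_def] right_hom_zero_closed[unfolded restrict_def] right_homD fun_eq_iff N.M.a_ac
      restrict_def dest: right_homD(2) simp: extensional_def\<close>)
next
  fix X Y Z :: "('a, 'm) module" and f g g'
  assume a: "X \<in> Obj (mod_cat \<Lambda>)" "Y \<in> Obj (mod_cat \<Lambda>)" "Z \<in> Obj (mod_cat \<Lambda>)"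
    "f \<in> Mor (mod_cat \<Lambda>) X Y" "g \<in> Mor (mod_cat \<Lambda>) Y Z" "g' \<in> Mor (mod_cat \<Lambda>) Y Z"
  then show "Comp (mod_cat \<Lambda>) X Y Z (g \<oplus>\<^bsub>Hom (mod_cat \<Lambda>) Y Z\<^esub> g') f =
    Comp (mod_cat \<Lambda>) X Y Z g f \<oplus>\<^bsub>Hom (mod_cat \<Lambda>) X Z\<^esub> Comp (mod_cat \<Lambda>) X Y Z g' f"
    by (auto simp: compose_def fun_eq_iff right_homD)
next
  fix X Y Z :: "('a, 'm) module" and f f' g
  assume a: "X \<in> Obj (mod_cat \<Lambda>)" "Y \<in> Obj (mod_cat \<Lambda>)" "Z \<in> Obj (mod_cat \<Lambda>)"
    "f \<in> Mor (mod_cat \<Lambda>) X Y" "f' \<in> Mor (mod_cat \<Lambda>) X Y" "g \<in> Mor (mod_cat \<Lambda>) Y Z"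
  then show "Comp (mod_cat \<Lambda>) X Y Z g (f \<oplus>\<^bsub>Hom (mod_cat \<Lambda>) X Y\<^esub> f') =
    Comp (mod_cat \<Lambda>) X Y Z g f \<oplus>\<^bsub>Hom (mod_cat \<Lambda>) X Z\<^esub> Comp (mod_cat \<Lambda>) X Y Z g f'"
    by (auto simp: compose_def fun_eq_iff right_homD)
qed (auto simp: right_hom_compose[unfolded compose_def] right_hom_id compose_def fun_eq_iff right_homD
    dest: right_homD(2) simp: extensional_def)

section \<open>Submodules and quotients\<close>

definition submod :: "('a, 'y) ring_scheme \<Rightarrow> ('a, 'm, 'z) module_scheme \<Rightarrow> 'm set \<Rightarrow> bool" where
  "submod \<Lambda> M N \<longleftrightarrow> N \<subseteq> carrier M \<and> \<zero>\<^bsub>M\<^esub> \<in> N \<and> (\<forall>x\<in>N. \<forall>y\<in>N. x \<oplus>\<^bsub>M\<^esub> y \<in> N) \<and>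
     (\<forall>a\<in>carrier \<Lambda>. \<forall>x\<in>N. a \<odot>\<^bsub>M\<^esub> x \<in> N)"

text \<open>Negatives belong to a submodule because \<open>-1\<close> acts on it;
  \<open>submod\<close> itself speaks of zero, sums and multiples.\<close>

lemma (in right_module) submodD:
  assumes "submod \<Lambda> M N"
  shows "x \<in> N \<Longrightarrow> x \<in> carrier M" "\<zero>\<^bsub>M\<^esub> \<in> N" "\<lbrakk>x \<in> N; y \<in> N\<rbrakk> \<Longrightarrow> x \<oplus>\<^bsub>M\<^esub> y \<in> N"
    "\<lbrakk>a \<in> carrier \<Lambda>; x \<in> N\<rbrakk> \<Longrightarrow> a \<odot>\<^bsub>M\<^esub> x \<in> N" "x \<in> N \<Longrightarrow> \<ominus>\<^bsub>M\<^esub> x \<in> N" "\<lbrakk>x \<in> N; y \<in> N\<rbrakk> \<Longrightarrow> x \<ominus>\<^bsub>M\<^esub> y \<in> N"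
proof -
  show c: "x \<in> N \<Longrightarrow> x \<in> carrier M" "\<zero>\<^bsub>M\<^esub> \<in> N" "\<And>x y. \<lbrakk>x \<in> N; y \<in> N\<rbrakk> \<Longrightarrow> x \<oplus>\<^bsub>M\<^esub> y \<in> N"
    "\<lbrakk>a \<in> carrier \<Lambda>; x \<in> N\<rbrakk> \<Longrightarrow> a \<odot>\<^bsub>M\<^esub> x \<in> N" for x a
    using assms unfolding submod_def by auto
  show n: "x \<in> N \<Longrightarrow> \<ominus>\<^bsub>M\<^esub> x \<in> N" for x
    using c(1)[of x] c(4)[of "\<ominus>\<^bsub>\<Lambda>\<^esub> \<one>\<^bsub>\<Lambda>\<^esub>" x] by (simp add: act_neg_left act_one)
  show "\<lbrakk>x \<in> N; y \<in> N\<rbrakk> \<Longrightarrow> x \<ominus>\<^bsub>M\<^esub> y \<in> N" by (simp add: M.minus_eq c n)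
qed

lemma (in right_module) submod_carrier: "submod \<Lambda> M (carrier M)"
  by (simp add: submod_def act_closed)

lemma submod_kernel:
  assumes "right_module \<Lambda> M" "right_module \<Lambda> N" and f: "f \<in> right_hom \<Lambda> M N"
  shows "submod \<Lambda> M (a_kernel M N f)"
proof -
  interpret M: right_module \<Lambda> M by fact
  interpret N: right_module \<Lambda> N by fact
  show ?thesis
    using right_homD[OF f] right_hom_zero[OF M.M.abelian_group_axioms N.M.abelian_group_axioms f]
    by (auto simp: submod_def a_kernel_def' M.act_closed N.act_zero_right)
qed

text \<open>The quotient by \<open>K\<close>, realised on representatives inside any type into which \<open>M\<close> embeds.\<close>

lemma quotient_module:
  fixes M :: "('a, 'b) module" and j :: "'b \<Rightarrow> 'm"
  assumes mod: "right_module \<Lambda> M" and K: "submod \<Lambda> M K" and j: "inj_on j (carrier M)"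
  obtains N :: "('a, 'm) module" and q where "right_module \<Lambda> N" "q \<in> right_hom \<Lambda> M N"
    "q ` carrier M = carrier N" "a_kernel M N q = K"
    "\<And>x y. \<lbrakk>x \<in> carrier M; y \<in> carrier M\<rbrakk> \<Longrightarrow> q x = q y \<longleftrightarrow> x \<ominus>\<^bsub>M\<^esub> y \<in> K"
proof -
  interpret M: right_module \<Lambda> M by fact
  note KD = M.submodD[OF K]
  define r where "r x = (SOME y. y \<in> carrier M \<and> x \<ominus>\<^bsub>M\<^esub> y \<in> K)" for x
  have r: "r x \<in> carrier M" "x \<ominus>\<^bsub>M\<^esub> r x \<in> K" if "x \<in> carrier M" for x
  proof -
    have "x \<in> carrier M \<and> x \<ominus>\<^bsub>M\<^esub> x \<in> K" using that KD(2) by (simp add: M.M.minus_eq M.M.r_neg)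
    then have "r x \<in> carrier M \<and> x \<ominus>\<^bsub>M\<^esub> r x \<in> K" unfolding r_def by (rule someI)
    then show "r x \<in> carrier M" "x \<ominus>\<^bsub>M\<^esub> r x \<in> K" by auto
  qed
  have diff_sym: "y \<ominus>\<^bsub>M\<^esub> x \<in> K" if "x \<in> carrier M" "y \<in> carrier M" "x \<ominus>\<^bsub>M\<^esub> y \<in> K" for x y
    using KD(5)[OF that(3)] that by (simp add: M.M.minus_eq M.M.minus_add M.M.a_comm)
  have diff_trans: "x \<ominus>\<^bsub>M\<^esub> z \<in> K"
    if c: "x \<in> carrier M" "y \<in> carrier M" "z \<in> carrier M" and xy: "x \<ominus>\<^bsub>M\<^esub> y \<in> K" and yz: "y \<ominus>\<^bsub>M\<^esub> z \<in> K" for x y z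
  proof -
    have "x \<ominus>\<^bsub>M\<^esub> z = (x \<ominus>\<^bsub>M\<^esub> y) \<oplus>\<^bsub>M\<^esub> (y \<ominus>\<^bsub>M\<^esub> z)"
      using c by (simp add: M.M.minus_eq M.M.a_assoc M.M.r_neg1)
    then show ?thesis using KD(3) xy yz by simp
  qed
  have r_eq: "r x = r y \<longleftrightarrow> x \<ominus>\<^bsub>M\<^esub> y \<in> K" if c: "x \<in> carrier M" "y \<in> carrier M" for x y
  proof
    assume "r x = r y"
    then have "x \<ominus>\<^bsub>M\<^esub> r y \<in> K" "r y \<ominus>\<^bsub>M\<^esub> y \<in> K" using r c diff_sym by metis+
    then show "x \<ominus>\<^bsub>M\<^esub> y \<in> K" using diff_trans r c by blast
  next
    assume xy: "x \<ominus>\<^bsub>M\<^esub> y \<in> K"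
    \<comment> \<open>Congruent elements give the same choice predicate, hence literally the same
      representative.\<close>
    have "z \<in> carrier M \<and> x \<ominus>\<^bsub>M\<^esub> z \<in> K \<longleftrightarrow> z \<in> carrier M \<and> y \<ominus>\<^bsub>M\<^esub> z \<in> K" for z
      using diff_trans diff_sym c xy by blast
    then show "r x = r y" unfolding r_def by simp
  qed
  define q where "q = (\<lambda>x\<in>carrier M. j (r x))"
  have q_eq: "q x = q y \<longleftrightarrow> x \<ominus>\<^bsub>M\<^esub> y \<in> K" if "x \<in> carrier M" "y \<in> carrier M" for x y
    using that r r_eq j by (simp add: q_def inj_on_eq_iff)
  define s where "s = inv_into (carrier M) q"
  have s: "s (q x) \<in> carrier M" "q (s (q x)) = q x" if "x \<in> carrier M" for x
    using that unfolding s_def by (auto simp: inv_into_into f_inv_into_f)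
  \<comment> \<open>The operations are those of \<open>M\<close> on preimages chosen by
    \<open>s\<close>. The choice is immaterial, because \<open>q\<close> identifies exactly the
    elements congruent modulo \<open>K\<close>.\<close>
  define N :: "('a, 'm) module" where "N = \<lparr>carrier = q ` carrier M, mult = undefined, one = undefined,
    zero = q \<zero>\<^bsub>M\<^esub>, add = (\<lambda>a b. q (s a \<oplus>\<^bsub>M\<^esub> s b)), smult = (\<lambda>c a. q (c \<odot>\<^bsub>M\<^esub> s a))\<rparr>"
  have N: "carrier N = q ` carrier M" "\<zero>\<^bsub>N\<^esub> = q \<zero>\<^bsub>M\<^esub>" by (simp_all add: N_def)
  have add: "q x \<oplus>\<^bsub>N\<^esub> q y = q (x \<oplus>\<^bsub>M\<^esub> y)" if c: "x \<in> carrier M" "y \<in> carrier M" for x y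
  proof -
    have "(s (q x) \<oplus>\<^bsub>M\<^esub> s (q y)) \<ominus>\<^bsub>M\<^esub> (x \<oplus>\<^bsub>M\<^esub> y) = (s (q x) \<ominus>\<^bsub>M\<^esub> x) \<oplus>\<^bsub>M\<^esub> (s (q y) \<ominus>\<^bsub>M\<^esub> y)"
      using c s by (simp add: M.M.minus_eq M.M.minus_add M.M.a_ac)
    also have "\<dots> \<in> K" using c s q_eq by (intro KD(3)) blast+
    finally show ?thesis using c s by (simp add: N_def q_eq)
  qed
  have act: "a \<odot>\<^bsub>N\<^esub> q x = q (a \<odot>\<^bsub>M\<^esub> x)" if c: "a \<in> carrier \<Lambda>" "x \<in> carrier M" for a x
  proof -
    have "a \<odot>\<^bsub>M\<^esub> s (q x) \<ominus>\<^bsub>M\<^esub> a \<odot>\<^bsub>M\<^esub> x = a \<odot>\<^bsub>M\<^esub> (s (q x) \<ominus>\<^bsub>M\<^esub> x)"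
      using c s by (simp add: M.act_minus)
    also have "\<dots> \<in> K" using c s q_eq by (intro KD(4)) blast+
    finally show ?thesis using c s by (simp add: N_def q_eq M.act_closed)
  qed
  have ab: "abelian_group N"
  proof (rule abelian_groupI)
    fix a assume "a \<in> carrier N"
    then obtain x where "x \<in> carrier M" "a = q x" unfolding N by auto
    then show "\<exists>b\<in>carrier N. b \<oplus>\<^bsub>N\<^esub> a = \<zero>\<^bsub>N\<^esub>"
      by (auto intro!: bexI[of _ "\<ominus>\<^bsub>M\<^esub> x"] simp: N add M.M.l_neg)
  qed (auto simp: N add M.M.a_ac)
  have Nmod: "right_module \<Lambda> N"
    by (intro right_module.intro right_module_axioms.intro ab M.R.ring_axioms)
      (auto simp: N add act M.act_closed M.act_add_ring M.act_add_mod M.act_mult M.act_one)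
  have qh: "q \<in> right_hom \<Lambda> M N"
    by (rule right_homI) (auto simp: N add act, simp add: q_def)
  have "a_kernel M N q = K"
    using q_eq[of _ "\<zero>\<^bsub>M\<^esub>"] KD(1) by (auto simp: a_kernel_def' N M.minus_zero)
  then show thesis
    using that[OF Nmod qh] q_eq N by simp
qed

section \<open>Modules of finite length over a commutative ring\<close>

definition adjoin :: "('a, 'y) ring_scheme \<Rightarrow> ('a, 'm, 'z) module_scheme \<Rightarrow> 'm set \<Rightarrow> 'm \<Rightarrow> 'm set" where
  "adjoin Z M N x = {y \<oplus>\<^bsub>M\<^esub> r \<odot>\<^bsub>M\<^esub> x |y r. y \<in> N \<and> r \<in> carrier Z}"

text \<open>A submodule has finite length if it is reached from \<open>0\<close> by finitely many steps
  \<open>N \<subseteq> N + Z x\<close> with \<open>x\<close> annihilated by a maximal ideal modulo \<open>N\<close>; such a step is trivial or has a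
  simple quotient.\<close>

inductive finite_length :: "('a, 'y) ring_scheme \<Rightarrow> ('a, 'm, 'z) module_scheme \<Rightarrow> 'm set \<Rightarrow> bool"
  for Z M where
  zero: "finite_length Z M {\<zero>\<^bsub>M\<^esub>}"
| step: "\<lbrakk>finite_length Z M N; x \<in> carrier M; maximalideal m Z; \<And>r. r \<in> m \<Longrightarrow> r \<odot>\<^bsub>M\<^esub> x \<in> N\<rbrakk>
    \<Longrightarrow> finite_length Z M (adjoin Z M N x)"

text \<open>The ideal generated by \<open>m\<close> and \<open>r\<close> is the whole ring.
  Maximality is mostly used in this form below: \<open>t\<close> inverts \<open>r\<close> up to the
  error \<open>u\<close> in \<open>m\<close>.\<close>

lemma (in cring) maximal_unit_mod:
  assumes m: "maximalideal m R" and r: "r \<in> carrier R" "r \<notin> m"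
  obtains t u where "t \<in> carrier R" "u \<in> m" "t \<otimes> r \<oplus> u = \<one>"
proof -
  interpret m: maximalideal m R by fact
  have i: "ideal (m <+>\<^bsub>R\<^esub> PIdl r) R"
    by (intro add_ideals m.ideal_axioms cgenideal_ideal r)
  have sub: "m \<subseteq> m <+>\<^bsub>R\<^esub> PIdl r"
  proof
    fix x assume x: "x \<in> m"
    have "x = x \<oplus> \<zero> \<otimes> r" using m.a_Hcarr[OF x] r by simp
    then show "x \<in> m <+>\<^bsub>R\<^esub> PIdl r"
      unfolding set_add_def' cgenideal_def using x by blast
  qed
  have rin: "r \<in> m <+>\<^bsub>R\<^esub> PIdl r"
  proof -
    have "r = \<zero> \<oplus> \<one> \<otimes> r" using r by simp
    then show ?thesis unfolding set_add_def' cgenideal_def using m.zero_closed by blast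
  qed
  have "m <+>\<^bsub>R\<^esub> PIdl r = carrier R"
    using m.I_maximal[OF i sub] ideal.Icarr[OF i] rin r by blast
  then have "\<one> \<in> m <+>\<^bsub>R\<^esub> PIdl r" by simp
  then obtain u t where "u \<in> m" "t \<in> carrier R" "\<one> = u \<oplus> t \<otimes> r"
    unfolding set_add_def' cgenideal_def by auto
  then show thesis using that[of t u] r m.a_Hcarr[of u] by (simp add: a_comm)
qed

locale comm_module = right_module Z M + Z: cring Z
  for Z :: "('a, 'y) ring_scheme" and M :: "('a, 'm, 'z) module_scheme"
begin

lemma act_swap: "\<lbrakk>a \<in> carrier Z; b \<in> carrier Z; x \<in> carrier M\<rbrakk>
    \<Longrightarrow> a \<odot>\<^bsub>M\<^esub> (b \<odot>\<^bsub>M\<^esub> x) = b \<odot>\<^bsub>M\<^esub> (a \<odot>\<^bsub>M\<^esub> x)"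
  by (metis Z.m_comm act_mult)

lemma adjoinI: "\<lbrakk>y \<in> N; r \<in> carrier Z\<rbrakk> \<Longrightarrow> y \<oplus>\<^bsub>M\<^esub> r \<odot>\<^bsub>M\<^esub> x \<in> adjoin Z M N x"
  unfolding adjoin_def by blast

lemma adjoin_sub: "\<lbrakk>submod Z M N; x \<in> carrier M\<rbrakk> \<Longrightarrow> N \<subseteq> adjoin Z M N x"
  using adjoinI[of _ N "\<zero>\<^bsub>Z\<^esub>" x] submodD(1) by (fastforce simp: act_zero_left)

lemma adjoin_self: "\<lbrakk>submod Z M N; x \<in> carrier M\<rbrakk> \<Longrightarrow> x \<in> adjoin Z M N x"
  using adjoinI[of "\<zero>\<^bsub>M\<^esub>" N "\<one>\<^bsub>Z\<^esub>" x] submodD(2) by (simp add: act_one)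

lemma submod_adjoin: assumes N: "submod Z M N" and x: "x \<in> carrier M" shows "submod Z M (adjoin Z M N x)"
  unfolding submod_def
proof (intro conjI ballI)
  note D = submodD[OF N]
  show "adjoin Z M N x \<subseteq> carrier M" using D x by (auto simp: adjoin_def act_closed)
  show "\<zero>\<^bsub>M\<^esub> \<in> adjoin Z M N x" using adjoin_sub[OF N x] D(2) by blast
  fix a assume "a \<in> adjoin Z M N x"
  then obtain y r where a: "y \<in> N" "r \<in> carrier Z" "a = y \<oplus>\<^bsub>M\<^esub> r \<odot>\<^bsub>M\<^esub> x" unfolding adjoin_def by blast
  {
    fix b assume "b \<in> adjoin Z M N x"
    then obtain z s where b: "z \<in> N" "s \<in> carrier Z" "b = z \<oplus>\<^bsub>M\<^esub> s \<odot>\<^bsub>M\<^esub> x" unfolding adjoin_def by blast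
    have "a \<oplus>\<^bsub>M\<^esub> b = (y \<oplus>\<^bsub>M\<^esub> z) \<oplus>\<^bsub>M\<^esub> (r \<oplus>\<^bsub>Z\<^esub> s) \<odot>\<^bsub>M\<^esub> x"
      using a b x D(1) by (simp add: act_add_ring M.a_ac act_closed)
    then show "a \<oplus>\<^bsub>M\<^esub> b \<in> adjoin Z M N x" using a b D(3) by (simp add: adjoinI)
  }
  fix c assume c: "c \<in> carrier Z"
  have "c \<odot>\<^bsub>M\<^esub> a = c \<odot>\<^bsub>M\<^esub> y \<oplus>\<^bsub>M\<^esub> (r \<otimes>\<^bsub>Z\<^esub> c) \<odot>\<^bsub>M\<^esub> x"
    using a c x D(1) by (simp add: act_add_mod act_mult act_closed)
  then show "c \<odot>\<^bsub>M\<^esub> a \<in> adjoin Z M N x" using a c D(4) by (simp add: adjoinI)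
qed

lemma finite_length_submod: "finite_length Z M N \<Longrightarrow> submod Z M N"
proof (induction rule: finite_length.induct)
  case zero
  then show ?case by (simp add: submod_def act_zero_right)
next
  case (step N x m)
  then show ?case using submod_adjoin by blast
qed

text \<open>The quotient of \<open>N + Z x\<close> by \<open>N\<close> is simple or zero, so
  anything outside \<open>N\<close> generates it. Concretely, the coefficient of \<open>x\<close> in
  \<open>y\<close> lies outside \<open>m\<close>, and dividing by it modulo \<open>m\<close>
  recovers \<open>x\<close>.\<close>

lemma adjoin_generator:
  assumes N: "submod Z M N" and x: "x \<in> carrier M" and m: "maximalideal m Z"
    and mx: "\<And>r. r \<in> m \<Longrightarrow> r \<odot>\<^bsub>M\<^esub> x \<in> N"
    and y: "y \<in> adjoin Z M N x" "y \<notin> N"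
  obtains t z where "t \<in> carrier Z" "z \<in> N" "x = z \<oplus>\<^bsub>M\<^esub> t \<odot>\<^bsub>M\<^esub> y"
proof -
  note D = submodD[OF N]
  obtain w r where w: "w \<in> N" "r \<in> carrier Z" "y = w \<oplus>\<^bsub>M\<^esub> r \<odot>\<^bsub>M\<^esub> x"
    using y unfolding adjoin_def by blast
  have "r \<notin> m" using mx[of r] w y D(3) by blast
  then obtain t u where tu: "t \<in> carrier Z" "u \<in> m" "t \<otimes>\<^bsub>Z\<^esub> r \<oplus>\<^bsub>Z\<^esub> u = \<one>\<^bsub>Z\<^esub>"
    using Z.maximal_unit_mod[OF m] w by metis
  have u: "u \<in> carrier Z" using tu m by (meson ideal.Icarr maximalideal.axioms(1))
  have wm: "w \<in> carrier M" using w D(1) by blast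
  have "x = (t \<otimes>\<^bsub>Z\<^esub> r) \<odot>\<^bsub>M\<^esub> x \<oplus>\<^bsub>M\<^esub> u \<odot>\<^bsub>M\<^esub> x"
    using tu u w x by (simp add: act_one flip: act_add_ring)
  also have "(t \<otimes>\<^bsub>Z\<^esub> r) \<odot>\<^bsub>M\<^esub> x = t \<odot>\<^bsub>M\<^esub> (r \<odot>\<^bsub>M\<^esub> x)"
    using tu w x by (simp add: act_mult act_swap)
  also have "r \<odot>\<^bsub>M\<^esub> x = y \<ominus>\<^bsub>M\<^esub> w"
    using w x wm by (simp add: M.minus_eq act_closed M.a_comm[of w] M.a_assoc M.r_neg)
  also have "t \<odot>\<^bsub>M\<^esub> (y \<ominus>\<^bsub>M\<^esub> w) = t \<odot>\<^bsub>M\<^esub> y \<ominus>\<^bsub>M\<^esub> t \<odot>\<^bsub>M\<^esub> w"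
    using tu w x wm by (simp add: act_minus act_closed)
  finally have "x = (u \<odot>\<^bsub>M\<^esub> x \<ominus>\<^bsub>M\<^esub> t \<odot>\<^bsub>M\<^esub> w) \<oplus>\<^bsub>M\<^esub> t \<odot>\<^bsub>M\<^esub> y"
    using tu u w x wm by (simp add: M.minus_eq M.a_ac act_closed)
  moreover have "u \<odot>\<^bsub>M\<^esub> x \<ominus>\<^bsub>M\<^esub> t \<odot>\<^bsub>M\<^esub> w \<in> N"
    using tu w mx D(4,6) by blast
  ultimately show thesis using that tu by blast
qed

lemma adjoin_adjoin_generator:
  assumes N: "submod Z M N" and x: "x \<in> carrier M" and y: "y \<in> adjoin Z M N x"
    and zt: "t \<in> carrier Z" "z \<in> N" "x = z \<oplus>\<^bsub>M\<^esub> t \<odot>\<^bsub>M\<^esub> y"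
  shows "adjoin Z M N y = adjoin Z M N x"
proof -
  note D = submodD[OF N]
  have ym: "y \<in> carrier M" using submod_adjoin[OF N x] y by (auto simp: submod_def)
  note E = submodD[OF submod_adjoin[OF N x]] and F = submodD[OF submod_adjoin[OF N ym]]
  have "x \<in> adjoin Z M N y" using zt adjoinI by blast
  then have "adjoin Z M N x \<subseteq> adjoin Z M N y"
    using adjoin_sub[OF N ym] F(3,4) unfolding adjoin_def[of Z M N x] by blast
  moreover have "adjoin Z M N y \<subseteq> adjoin Z M N x"
    using y adjoin_sub[OF N x] E(3,4) unfolding adjoin_def[of Z M N y] by blast
  ultimately show ?thesis by blast
qed

text \<open>The trace of a composition series on \<open>N\<close>. Passing from \<open>K\<close> to
  \<open>K + Z x\<close> either leaves the trace unchanged or adds some \<open>y\<close> of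
  \<open>N\<close> outside \<open>K\<close>; such a \<open>y\<close> generates the same step as
  \<open>x\<close>, is annihilated by the same \<open>m\<close> modulo \<open>K\<close>, and so
  extends the trace by one factor.\<close>

lemma finite_length_Int:
  assumes "finite_length Z M K" and N: "submod Z M N"
  shows "finite_length Z M (K \<inter> N)"
  using assms(1)
proof (induction rule: finite_length.induct)
  case zero
  have "{\<zero>\<^bsub>M\<^esub>} \<inter> N = {\<zero>\<^bsub>M\<^esub>}" using submodD(2)[OF N] by blast
  then show ?case by (simp add: finite_length.zero)
next
  case (step K x m)
  have K: "submod Z M K" using step(1) by (rule finite_length_submod)
  note D = submodD[OF N] and E = submodD[OF K]
  show ?case
  proof (cases "adjoin Z M K x \<inter> N \<subseteq> K")
    case True
    then have "adjoin Z M K x \<inter> N = K \<inter> N" using adjoin_sub[OF K step(2)] by blast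
    then show ?thesis using step by simp
  next
    case False
    then obtain y where y: "y \<in> adjoin Z M K x" "y \<in> N" "y \<notin> K" by blast
    have ym: "y \<in> carrier M" using y D by blast
    obtain t z where tz: "t \<in> carrier Z" "z \<in> K" "x = z \<oplus>\<^bsub>M\<^esub> t \<odot>\<^bsub>M\<^esub> y"
      using adjoin_generator[OF K step(2-4) y(1,3)] by blast
    have eq: "adjoin Z M K y = adjoin Z M K x"
      by (rule adjoin_adjoin_generator[OF K step(2) y(1) tz])
    have my: "r \<odot>\<^bsub>M\<^esub> y \<in> K \<inter> N" if "r \<in> m" for r
    proof -
      obtain k s where ks: "k \<in> K" "s \<in> carrier Z" "y = k \<oplus>\<^bsub>M\<^esub> s \<odot>\<^bsub>M\<^esub> x"
        using y(1) unfolding adjoin_def by blast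
      have r: "r \<in> carrier Z" using that step(3) by (meson ideal.Icarr maximalideal.axioms(1))
      have "r \<odot>\<^bsub>M\<^esub> y = r \<odot>\<^bsub>M\<^esub> k \<oplus>\<^bsub>M\<^esub> s \<odot>\<^bsub>M\<^esub> (r \<odot>\<^bsub>M\<^esub> x)"
        unfolding ks(3) using r ks(2) step(2) E(1)[OF ks(1)]
        by (simp add: act_add_mod act_closed act_swap[of r s x])
      also have "\<dots> \<in> K" by (intro E(3,4) ks r step(4)[OF that])
      finally show ?thesis using D(4)[OF r y(2)] by blast
    qed
    have "adjoin Z M K x \<inter> N = adjoin Z M (K \<inter> N) y"
    proof
      show "adjoin Z M (K \<inter> N) y \<subseteq> adjoin Z M K x \<inter> N"
      proof
        fix w assume "w \<in> adjoin Z M (K \<inter> N) y"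
        then obtain k s where ks: "k \<in> K" "k \<in> N" "s \<in> carrier Z" "w = k \<oplus>\<^bsub>M\<^esub> s \<odot>\<^bsub>M\<^esub> y"
          unfolding adjoin_def by blast
        show "w \<in> adjoin Z M K x \<inter> N"
          unfolding ks(4) eq[symmetric] by (intro IntI adjoinI D(3,4) ks y)
      qed
      show "adjoin Z M K x \<inter> N \<subseteq> adjoin Z M (K \<inter> N) y"
      proof
        fix w assume w: "w \<in> adjoin Z M K x \<inter> N"
        then have "w \<in> adjoin Z M K y" unfolding eq by blast
        then obtain k s where ks: "k \<in> K" "s \<in> carrier Z" "w = k \<oplus>\<^bsub>M\<^esub> s \<odot>\<^bsub>M\<^esub> y"
          unfolding adjoin_def by blast
        have "k = w \<ominus>\<^bsub>M\<^esub> s \<odot>\<^bsub>M\<^esub> y"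
          using ks ym E(1) by (simp add: M.minus_eq M.a_assoc act_closed M.r_neg)
        also have "\<dots> \<in> N" using w by (intro D(4,6) y ks) blast
        finally have "k \<in> K \<inter> N" using ks by blast
        then show "w \<in> adjoin Z M (K \<inter> N) y" unfolding ks(3) using ks(2) by (rule adjoinI)
      qed
    qed
    then show ?thesis using finite_length.step[OF step(5) ym step(3) my] by simp
  qed
qed

end

lemma finite_length_image:
  assumes M: "comm_module Z M" and M': "comm_module Z M'" and h: "h \<in> right_hom Z M M'"
    and "finite_length Z M N"
  shows "finite_length Z M' (h ` N)"
  using assms(4)
proof (induction rule: finite_length.induct)
  case zero
  interpret M: comm_module Z M by fact
  interpret M': comm_module Z M' by fact
  show ?case
    using right_hom_zero[OF M.M.abelian_group_axioms M'.M.abelian_group_axioms h]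
    by (simp add: finite_length.zero)
next
  case (step N x m)
  interpret M: comm_module Z M by fact
  interpret M': comm_module Z M' by fact
  have N: "submod Z M N" by (rule M.finite_length_submod[OF step(1)])
  have mc: "r \<in> m \<Longrightarrow> r \<in> carrier Z" for r using step(3) by (meson ideal.Icarr maximalideal.axioms(1))
  have hh: "h (y \<oplus>\<^bsub>M\<^esub> r \<odot>\<^bsub>M\<^esub> x) = h y \<oplus>\<^bsub>M'\<^esub> r \<odot>\<^bsub>M'\<^esub> h x" if "y \<in> N" "r \<in> carrier Z" for y r
    using that step(2) M.submodD(1)[OF N] by (simp add: right_homD[OF h] M.act_closed)
  have "h ` adjoin Z M N x = adjoin Z M' (h ` N) (h x)"
  proof (intro equalityI subsetI)
    fix w assume "w \<in> adjoin Z M' (h ` N) (h x)"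
    then obtain y r where w: "y \<in> N" "r \<in> carrier Z" "w = h y \<oplus>\<^bsub>M'\<^esub> r \<odot>\<^bsub>M'\<^esub> h x" unfolding adjoin_def by blast
    show "w \<in> h ` adjoin Z M N x"
      unfolding w(3) hh[OF w(1,2), symmetric] by (intro imageI M.adjoinI w)
  next
    fix w assume "w \<in> h ` adjoin Z M N x"
    then obtain y r where w: "y \<in> N" "r \<in> carrier Z" "w = h (y \<oplus>\<^bsub>M\<^esub> r \<odot>\<^bsub>M\<^esub> x)" unfolding adjoin_def by blast
    show "w \<in> adjoin Z M' (h ` N) (h x)"
      unfolding w(3) hh[OF w(1,2)] by (intro imageI M'.adjoinI w)
  qed
  moreover have "finite_length Z M' (adjoin Z M' (h ` N) (h x))"
  proof (rule finite_length.step[OF step(5) _ step(3)])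
    show "h x \<in> carrier M'" using step(2) by (simp add: right_homD[OF h])
    fix r assume r: "r \<in> m"
    show "r \<odot>\<^bsub>M'\<^esub> h x \<in> h ` N"
      unfolding right_homD(4)[OF h mc[OF r] step(2), symmetric] using step(4)[OF r] by (rule imageI)
  qed
  ultimately show ?case by simp
qed

section \<open>Central subrings and finitely generated modules\<close>

definition regular_module :: "('a, 'y) ring_scheme \<Rightarrow> ('a, 'a) module" where
  "regular_module \<Lambda> = \<lparr>carrier = carrier \<Lambda>, mult = undefined, one = undefined, zero = \<zero>\<^bsub>\<Lambda>\<^esub>,
     add = add \<Lambda>, smult = (\<lambda>a x. x \<otimes>\<^bsub>\<Lambda>\<^esub> a)\<rparr>"

lemma regular_module_simps [simp]:
  "carrier (regular_module \<Lambda>) = carrier \<Lambda>" "\<zero>\<^bsub>regular_module \<Lambda>\<^esub> = \<zero>\<^bsub>\<Lambda>\<^esub>"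
  "x \<oplus>\<^bsub>regular_module \<Lambda>\<^esub> y = x \<oplus>\<^bsub>\<Lambda>\<^esub> y" "a \<odot>\<^bsub>regular_module \<Lambda>\<^esub> x = x \<otimes>\<^bsub>\<Lambda>\<^esub> a"
  by (simp_all add: regular_module_def)

lemma (in ring) right_module_regular: "right_module R (regular_module R)"
proof (intro right_module.intro right_module_axioms.intro ring_axioms)
  show "abelian_group (regular_module R)"
  proof (rule abelian_groupI)
    fix x assume "x \<in> carrier (regular_module R)"
    then show "\<exists>y\<in>carrier (regular_module R). y \<oplus>\<^bsub>regular_module R\<^esub> x = \<zero>\<^bsub>regular_module R\<^esub>"
      by (auto intro!: bexI[of _ "\<ominus> x"] simp: l_neg)
  qed (auto simp: a_ac)
qed (auto simp: r_distr l_distr m_assoc)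

text \<open>Both rings have the element type \<open>'a\<close>, and \<open>Z\<close> has the
  structure of \<Lambda>. Restriction of scalars along the inclusion is therefore the identity on
  module records and on homomorphisms.\<close>

locale central_subring = Z: cring Z + \<Lambda>: ring \<Lambda>
  for Z :: "('a, 'y) ring_scheme" and \<Lambda> :: "('a, 'y) ring_scheme" +
  assumes sub: "a \<in> carrier Z \<Longrightarrow> a \<in> carrier \<Lambda>"
    and add_eq: "\<lbrakk>a \<in> carrier Z; b \<in> carrier Z\<rbrakk> \<Longrightarrow> a \<oplus>\<^bsub>Z\<^esub> b = a \<oplus>\<^bsub>\<Lambda>\<^esub> b"
    and mult_eq: "\<lbrakk>a \<in> carrier Z; b \<in> carrier Z\<rbrakk> \<Longrightarrow> a \<otimes>\<^bsub>Z\<^esub> b = a \<otimes>\<^bsub>\<Lambda>\<^esub> b"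
    and one_eq: "\<one>\<^bsub>Z\<^esub> = \<one>\<^bsub>\<Lambda>\<^esub>"
    and central: "\<lbrakk>a \<in> carrier Z; x \<in> carrier \<Lambda>\<rbrakk> \<Longrightarrow> a \<otimes>\<^bsub>\<Lambda>\<^esub> x = x \<otimes>\<^bsub>\<Lambda>\<^esub> a"
begin

lemma comm_module_restrict:
  assumes "right_module \<Lambda> M" shows "comm_module Z M"
proof -
  interpret M: right_module \<Lambda> M by fact
  show ?thesis
    by (intro comm_module.intro right_module.intro right_module_axioms.intro Z.ring_axioms Z.cring_axioms
        M.M.abelian_group_axioms)
      (simp_all add: sub add_eq mult_eq one_eq M.act_closed M.act_add_ring M.act_add_mod M.act_mult M.act_one)
qed

lemma right_module_restrict: "right_module \<Lambda> M \<Longrightarrow> right_module Z M"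
  using comm_module_restrict comm_module.axioms(1) by blast

lemma right_hom_restrict: "f \<in> right_hom \<Lambda> M N \<Longrightarrow> f \<in> right_hom Z M N"
  using sub unfolding right_hom_def by blast

lemma submod_restrict: "submod \<Lambda> M N \<Longrightarrow> submod Z M N"
  using sub unfolding submod_def by blast

lemma finite_length_cyclic:
  assumes M: "right_module \<Lambda> M" and N: "finite_length Z M N" and s: "s \<in> carrier M"
    and L: "finite_length Z (regular_module \<Lambda>) L"
  shows "finite_length Z M {y \<oplus>\<^bsub>M\<^esub> a \<odot>\<^bsub>M\<^esub> s |y a. y \<in> N \<and> a \<in> L}"
  using L
proof (induction rule: finite_length.induct)
  case zero
  interpret M: right_module \<Lambda> M by fact
  interpret ZM: comm_module Z M by (rule comm_module_restrict[OF M])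
  note D = ZM.submodD[OF ZM.finite_length_submod[OF N]]
  have "{y \<oplus>\<^bsub>M\<^esub> a \<odot>\<^bsub>M\<^esub> s |y a. y \<in> N \<and> a \<in> {\<zero>\<^bsub>regular_module \<Lambda>\<^esub>}} = N"
    using D(1) s by (auto simp: M.act_zero_left) (metis D(1) M.M.r_zero)
  then show ?case using N by simp
next
  case (step L x m)
  interpret M: right_module \<Lambda> M by fact
  interpret ZM: comm_module Z M by (rule comm_module_restrict[OF M])
  interpret ZL: comm_module Z "regular_module \<Lambda>"
    by (rule comm_module_restrict[OF \<Lambda>.right_module_regular])
  note D = ZM.submodD[OF ZM.finite_length_submod[OF N]]
    and E = ZL.submodD[OF ZL.finite_length_submod[OF step(1)]]
  let ?S = "\<lambda>L. {y \<oplus>\<^bsub>M\<^esub> a \<odot>\<^bsub>M\<^esub> s |y a. y \<in> N \<and> a \<in> L}"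
  have x: "x \<in> carrier \<Lambda>" using step(2) by simp
  have mc: "r \<in> m \<Longrightarrow> r \<in> carrier Z" for r using step(3) by (meson ideal.Icarr maximalideal.axioms(1))
  have e: "y \<oplus>\<^bsub>M\<^esub> (b \<oplus>\<^bsub>\<Lambda>\<^esub> x \<otimes>\<^bsub>\<Lambda>\<^esub> r) \<odot>\<^bsub>M\<^esub> s = (y \<oplus>\<^bsub>M\<^esub> b \<odot>\<^bsub>M\<^esub> s) \<oplus>\<^bsub>M\<^esub> r \<odot>\<^bsub>M\<^esub> (x \<odot>\<^bsub>M\<^esub> s)"
    if "y \<in> N" "b \<in> L" "r \<in> carrier Z" for y b r
    using that D(1) E(1) x s sub
    by (simp add: M.act_add_ring M.act_mult M.M.a_assoc M.act_closed)
  have "?S (adjoin Z (regular_module \<Lambda>) L x) = adjoin Z M (?S L) (x \<odot>\<^bsub>M\<^esub> s)"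
  proof (intro equalityI subsetI)
    fix w assume "w \<in> ?S (adjoin Z (regular_module \<Lambda>) L x)"
    then obtain y b r where *: "y \<in> N" "b \<in> L" "r \<in> carrier Z" "w = y \<oplus>\<^bsub>M\<^esub> (b \<oplus>\<^bsub>\<Lambda>\<^esub> x \<otimes>\<^bsub>\<Lambda>\<^esub> r) \<odot>\<^bsub>M\<^esub> s"
      unfolding adjoin_def by auto
    show "w \<in> adjoin Z M (?S L) (x \<odot>\<^bsub>M\<^esub> s)"
      unfolding *(4) e[OF *(1-3)] using * by (intro ZM.adjoinI) blast+
  next
    fix w assume "w \<in> adjoin Z M (?S L) (x \<odot>\<^bsub>M\<^esub> s)"
    then obtain y b r where *: "y \<in> N" "b \<in> L" "r \<in> carrier Z"
      "w = (y \<oplus>\<^bsub>M\<^esub> b \<odot>\<^bsub>M\<^esub> s) \<oplus>\<^bsub>M\<^esub> r \<odot>\<^bsub>M\<^esub> (x \<odot>\<^bsub>M\<^esub> s)"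
      unfolding adjoin_def by blast
    show "w \<in> ?S (adjoin Z (regular_module \<Lambda>) L x)"
      unfolding *(4) e[OF *(1-3), symmetric] adjoin_def using * by auto
  qed
  moreover have "finite_length Z M (adjoin Z M (?S L) (x \<odot>\<^bsub>M\<^esub> s))"
  proof (rule finite_length.step[OF step(5) _ step(3)])
    show "x \<odot>\<^bsub>M\<^esub> s \<in> carrier M" using x s by (rule M.act_closed)
    fix r assume r: "r \<in> m"
    have "r \<odot>\<^bsub>M\<^esub> (x \<odot>\<^bsub>M\<^esub> s) = \<zero>\<^bsub>M\<^esub> \<oplus>\<^bsub>M\<^esub> (x \<otimes>\<^bsub>\<Lambda>\<^esub> r) \<odot>\<^bsub>M\<^esub> s"
      using r mc sub x s by (simp add: M.act_mult M.act_closed)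
    then show "r \<odot>\<^bsub>M\<^esub> (x \<odot>\<^bsub>M\<^esub> s) \<in> ?S L" using step(4)[OF r] D(2) by auto
  qed
  ultimately show ?case by simp
qed

end

lemma (in cring) central_subring_self: "central_subring R R"
  by (intro central_subring.intro central_subring_axioms.intro cring_axioms ring_axioms)
    (simp_all add: m_comm)

lemma (in comm_module) finite_length_adjoin:
  assumes Z: "finite_length Z (regular_module Z) (carrier Z)" and N: "finite_length Z M N" and s: "s \<in> carrier M"
  shows "finite_length Z M (adjoin Z M N s)"
  using central_subring.finite_length_cyclic[OF Z.central_subring_self right_module_axioms N s Z]
  by (simp add: adjoin_def)

section \<open>Artinian rings have finite length\<close>

text \<open>Zorn's lemma for the submodules that contain \<open>N0\<close> and miss
  \<open>x\<close>. For ideals and \<open>x = 1\<close> it gives maximal ideals; for an element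
  outside a given ideal it is the source of simple quotients in
  \<open>artinian_finite_length_ideal\<close>.\<close>

lemma (in right_module) submod_avoiding:
  assumes N0: "submod \<Lambda> M N0" and x: "x \<notin> N0"
  obtains N where "submod \<Lambda> M N" "N0 \<subseteq> N" "x \<notin> N"
    "\<And>L. \<lbrakk>submod \<Lambda> M L; N \<subseteq> L; x \<notin> L\<rbrakk> \<Longrightarrow> L = N"
proof -
  let ?A = "{N. submod \<Lambda> M N \<and> N0 \<subseteq> N \<and> x \<notin> N}"
  have "\<exists>N\<in>?A. \<forall>X\<in>?A. N \<subseteq> X \<longrightarrow> X = N"
  proof (rule subset_Zorn_nonempty)
    show "?A \<noteq> {}" using assms by blast
  next
    fix \<C> assume ne: "\<C> \<noteq> {}" and ch: "subset.chain ?A \<C>"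
    have in_A: "N \<in> ?A" if "N \<in> \<C>" for N using ch that unfolding subset.chain_def by blast
    have s: "submod \<Lambda> M N" if "N \<in> \<C>" for N using in_A[OF that] by blast
    have lin: "N \<subseteq> N' \<or> N' \<subseteq> N" if "N \<in> \<C>" "N' \<in> \<C>" for N N'
      using ch that unfolding subset_chain_def by blast
    have "submod \<Lambda> M (\<Union>\<C>)"
      unfolding submod_def
    proof (intro conjI ballI)
      show "\<Union>\<C> \<subseteq> carrier M" using s unfolding submod_def by blast
      show "\<zero>\<^bsub>M\<^esub> \<in> \<Union>\<C>" using ne s unfolding submod_def by blast
      fix a assume "a \<in> \<Union>\<C>"
      then obtain N where a: "N \<in> \<C>" "a \<in> N" by blast
      {
        fix b assume "b \<in> \<Union>\<C>"
        then obtain N' where b: "N' \<in> \<C>" "b \<in> N'" by blast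
        from lin[OF a(1) b(1)] show "a \<oplus>\<^bsub>M\<^esub> b \<in> \<Union>\<C>"
        proof
          assume "N \<subseteq> N'"
          then have "a \<oplus>\<^bsub>M\<^esub> b \<in> N'" using a b by (intro submodD(3)[OF s[OF b(1)]]) auto
          then show ?thesis using b by blast
        next
          assume "N' \<subseteq> N"
          then have "a \<oplus>\<^bsub>M\<^esub> b \<in> N" using a b by (intro submodD(3)[OF s[OF a(1)]]) auto
          then show ?thesis using a by blast
        qed
      }
      fix c assume "c \<in> carrier \<Lambda>"
      then have "c \<odot>\<^bsub>M\<^esub> a \<in> N" using a by (intro submodD(4)[OF s[OF a(1)]])
      then show "c \<odot>\<^bsub>M\<^esub> a \<in> \<Union>\<C>" using a by blast
    qed
    moreover have "N0 \<subseteq> \<Union>\<C>" using in_A ne by blast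
    moreover have "x \<notin> \<Union>\<C>" using in_A by blast
    ultimately show "\<Union>\<C> \<in> ?A" by blast
  qed
  then obtain N where N: "submod \<Lambda> M N" "N0 \<subseteq> N" "x \<notin> N" and max: "\<forall>X\<in>?A. N \<subseteq> X \<longrightarrow> X = N"
    by auto
  show thesis
  proof (rule that[OF N])
    fix L assume L: "submod \<Lambda> M L" "N \<subseteq> L" "x \<notin> L"
    then have "L \<in> ?A" using N(2) by auto
    then show "L = N" using max L(2) by auto
  qed
qed

context cring
begin

lemma comm_module_regular: "comm_module R (regular_module R)"
  by (intro comm_module.intro right_module_regular cring_axioms)

lemma submod_regular_iff: "submod R (regular_module R) I \<longleftrightarrow> ideal I R"
proof
  interpret reg: comm_module R "regular_module R" by (rule comm_module_regular)
  assume I: "submod R (regular_module R) I"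
  note D = reg.submodD[OF I]
  have neg: "\<ominus> x \<in> I" if "x \<in> I" for x
  proof -
    have "x \<otimes> \<ominus> \<one> \<in> I" using D(4)[of "\<ominus> \<one>" x] that by simp
    then show ?thesis using D(1)[OF that] by (simp add: r_minus)
  qed
  show "ideal I R"
  proof (intro idealI ring_axioms)
    show "subgroup I (add_monoid R)"
      by (rule subgroup.intro) (use D neg in \<open>auto simp flip: a_inv_def\<close>)
  next
    fix a x assume "a \<in> I" "x \<in> carrier R"
    then show "x \<otimes> a \<in> I" "a \<otimes> x \<in> I" using D(1)[of a] D(4)[of x a] by (simp_all add: m_comm)
  qed
next
  assume "ideal I R"
  then interpret ideal I R .
  show "submod R (regular_module R) I"
    by (auto simp: submod_def I_r_closed)
qed

lemma maximal_ideal_exists: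
  assumes I: "ideal I R" "\<one> \<notin> I"
  obtains m where "maximalideal m R" "I \<subseteq> m"
proof -
  interpret reg: comm_module R "regular_module R" by (rule comm_module_regular)
  obtain m where m: "ideal m R" "I \<subseteq> m" "\<one> \<notin> m"
    and max: "\<And>L. \<lbrakk>ideal L R; m \<subseteq> L; \<one> \<notin> L\<rbrakk> \<Longrightarrow> L = m"
    using reg.submod_avoiding[of I \<one>] I unfolding submod_regular_iff by metis
  have "maximalideal m R"
  proof (rule maximalidealI[OF m(1)])
    show "carrier R \<noteq> m" using m by blast
    fix J assume J: "ideal J R" "m \<subseteq> J" "J \<subseteq> carrier R"
    show "J = m \<or> J = carrier R"
      using max[OF J(1,2)] ideal.one_imp_carrier[OF J(1)] by blast
  qed
  then show thesis using that m by blast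
qed

end

text \<open>The chain condition is phrased for sequences: a nonempty set without minimal element
  contains a strictly decreasing sequence, obtained by iterating a choice of smaller
  members.\<close>

lemma artinian_minimal:
  assumes art: "commutative_artinian_ring R" and S: "S \<noteq> {}" "\<And>I. I \<in> S \<Longrightarrow> ideal I R"
  obtains I where "I \<in> S" "\<And>J. \<lbrakk>J \<in> S; J \<subseteq> I\<rbrakk> \<Longrightarrow> J = I"
proof -
  have "\<exists>I\<in>S. \<forall>J\<in>S. J \<subseteq> I \<longrightarrow> J = I"
  proof (rule ccontr)
    assume "\<not> (\<exists>I\<in>S. \<forall>J\<in>S. J \<subseteq> I \<longrightarrow> J = I)"
    then have "\<forall>I\<in>S. \<exists>J. J \<in> S \<and> J \<subset> I" by blast
    then obtain g where g: "\<And>I. I \<in> S \<Longrightarrow> g I \<in> S \<and> g I \<subset> I" by metis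
    obtain I0 where "I0 \<in> S" using S by blast
    define f where "f n = (g ^^ n) I0" for n :: nat
    have f: "f n \<in> S" for n by (induction n) (use \<open>I0 \<in> S\<close> g in \<open>auto simp: f_def\<close>)
    have dec: "f (Suc n) \<subset> f n" for n using g[OF f[of n]] by (simp add: f_def)
    have "\<exists>N. \<forall>n\<ge>N. f n = f N"
      using art S(2)[OF f] dec unfolding commutative_artinian_ring_def by (metis psubsetE)
    then obtain N where "\<forall>n\<ge>N. f n = f N" by blast
    then have "f (Suc N) = f N" by (meson le_SucI order_refl)
    then show False using dec[of N] by blast
  qed
  then show thesis using that by blast
qed

text \<open>Nakayama's lemma for arbitrary ideals of an artinian ring.\<close>

lemma artinian_maximal_prod_neq:
  assumes art: "commutative_artinian_ring R" and I: "ideal I R" "I \<noteq> {\<zero>\<^bsub>R\<^esub>}"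
  shows "\<exists>m. maximalideal m R \<and> ideal_prod R m I \<noteq> I"
proof (rule ccontr)
  assume "\<not> (\<exists>m. maximalideal m R \<and> ideal_prod R m I \<noteq> I)"
  then have mI: "ideal_prod R m I = I" if "maximalideal m R" for m using that by blast
  interpret cring R using art unfolding commutative_artinian_ring_def by blast
  have maxD: "ideal m R" if "maximalideal m R" for m using that by (rule maximalideal.axioms(1))
  \<comment> \<open>By assumption \<open>Q m\<close> fixes \<open>I\<close> for every maximal
    \<open>m\<close>, and so does \<open>Q Q\<close>. Minimality makes \<open>Q\<close> idempotent
    and places it inside every maximal ideal.\<close>
  obtain Q where Q: "ideal Q R" "ideal_prod R Q I = I"
    and Qmin: "\<And>J. \<lbrakk>ideal J R; ideal_prod R J I = I; J \<subseteq> Q\<rbrakk> \<Longrightarrow> J = Q"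
  proof (rule artinian_minimal[OF art])
    show "{Q. ideal Q R \<and> ideal_prod R Q I = I} \<noteq> {}"
      using oneideal ideal_prod_one[OF I(1)] ideal_prod_commute[OF I(1) oneideal] by auto
  qed auto
  have Qm: "Q \<subseteq> m" if m: "maximalideal m R" for m
  proof -
    have "ideal_prod R (ideal_prod R Q m) I = I"
      using ideal_prod_assoc[OF Q(1) maxD[OF m] I(1)] mI[OF m] Q(2) by simp
    then have "ideal_prod R Q m = Q"
      using Qmin ideal_prod_is_ideal[OF Q(1) maxD[OF m]] ideal_prod_inter[OF Q(1) maxD[OF m]] by blast
    then show ?thesis using ideal_prod_inter[OF Q(1) maxD[OF m]] by blast
  qed
  have "ideal_prod R (ideal_prod R Q Q) I = I"
    using ideal_prod_assoc[OF Q(1) Q(1) I(1)] Q(2) by simp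
  then have QQ: "ideal_prod R Q Q = Q"
    using Qmin ideal_prod_is_ideal[OF Q(1) Q(1)] ideal_prod_inter[OF Q(1) Q(1)] by blast
  have Q0: "Q \<noteq> {\<zero>\<^bsub>R\<^esub>}"
    using Q(2) I ideal_prod_zero[OF I(1)] ideal_prod_commute[OF I(1) zeroideal] by auto
  \<comment> \<open>The classical argument that an idempotent ideal inside the radical vanishes. A
    minimal \<open>K\<close> with \<open>K Q\<close> nonzero satisfies \<open>K Q = K\<close> and is
    generated by a single \<open>x\<close>, which gives \<open>x = x y\<close> with \<open>y\<close>
    in \<open>Q\<close>.\<close>
  obtain K where K: "ideal K R" "ideal_prod R K Q \<noteq> {\<zero>\<^bsub>R\<^esub>}"
    and Kmin: "\<And>J. \<lbrakk>ideal J R; ideal_prod R J Q \<noteq> {\<zero>\<^bsub>R\<^esub>}; J \<subseteq> K\<rbrakk> \<Longrightarrow> J = K"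
  proof (rule artinian_minimal[OF art])
    show "{K. ideal K R \<and> ideal_prod R K Q \<noteq> {\<zero>\<^bsub>R\<^esub>}} \<noteq> {}" using Q(1) Q0 QQ by auto
  qed auto
  have KQ: "ideal_prod R K Q = K"
  proof (rule Kmin)
    show "ideal_prod R (ideal_prod R K Q) Q \<noteq> {\<zero>\<^bsub>R\<^esub>}"
      using ideal_prod_assoc[OF K(1) Q(1) Q(1)] QQ K(2) by simp
  qed (use ideal_prod_is_ideal[OF K(1) Q(1)] ideal_prod_inter[OF K(1) Q(1)] in auto)
  have "\<exists>x\<in>K. \<exists>q\<in>Q. x \<otimes>\<^bsub>R\<^esub> q \<noteq> \<zero>\<^bsub>R\<^esub>"
  proof (rule ccontr)
    assume *: "\<not> (\<exists>x\<in>K. \<exists>q\<in>Q. x \<otimes>\<^bsub>R\<^esub> q \<noteq> \<zero>\<^bsub>R\<^esub>)"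
    have "z = \<zero>\<^bsub>R\<^esub>" if "z \<in> ideal_prod R K Q" for z
      using that by (induction rule: ideal_prod.induct) (use * in auto)
    then show False
      using K(2) additive_subgroup.zero_closed[OF ideal.axioms(1)[OF ideal_prod_is_ideal[OF K(1) Q(1)]]] by blast
  qed
  then obtain x q where xq: "x \<in> K" "q \<in> Q" "x \<otimes>\<^bsub>R\<^esub> q \<noteq> \<zero>\<^bsub>R\<^esub>" by blast
  have x: "x \<in> carrier R" using xq(1) ideal.Icarr[OF K(1)] by blast
  have xi: "ideal (PIdl\<^bsub>R\<^esub> x) R" by (rule cgenideal_ideal[OF x])
  have "PIdl\<^bsub>R\<^esub> x = K"
  proof (rule Kmin[OF xi])
    have "x \<otimes>\<^bsub>R\<^esub> q \<in> ideal_prod R (PIdl\<^bsub>R\<^esub> x) Q"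
      using cgenideal_self[OF x] xq(2) by (rule ideal_prod.prod)
    then show "ideal_prod R (PIdl\<^bsub>R\<^esub> x) Q \<noteq> {\<zero>\<^bsub>R\<^esub>}" using xq(3) by blast
    show "PIdl\<^bsub>R\<^esub> x \<subseteq> K" by (rule cgenideal_minimal[OF K(1) xq(1)])
  qed
  then have xin: "x \<in> ideal_prod R (PIdl\<^bsub>R\<^esub> x) Q" using KQ xq(1) by simp
  have "\<exists>y\<in>Q. z = x \<otimes>\<^bsub>R\<^esub> y" if "z \<in> ideal_prod R (PIdl\<^bsub>R\<^esub> x) Q" for z
    using that
  proof (induction rule: ideal_prod.induct)
    case (prod a b)
    then obtain c where "c \<in> carrier R" "a = c \<otimes>\<^bsub>R\<^esub> x" unfolding cgenideal_def by blast
    then show ?case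
      using prod(2) x ideal.Icarr[OF Q(1) prod(2)] ideal.I_l_closed[OF Q(1) prod(2)]
      by (auto intro!: bexI[of _ "c \<otimes>\<^bsub>R\<^esub> b"] simp: m_ac)
  next
    case (sum a b)
    then obtain c d where "c \<in> Q" "a = x \<otimes>\<^bsub>R\<^esub> c" "d \<in> Q" "b = x \<otimes>\<^bsub>R\<^esub> d" by blast
    then show ?case
      using x ideal.Icarr[OF Q(1)] additive_subgroup.a_closed[OF ideal.axioms(1)[OF Q(1)]]
      by (auto intro!: bexI[of _ "c \<oplus>\<^bsub>R\<^esub> d"] simp: r_distr)
  qed
  then obtain y where y: "y \<in> Q" "x = x \<otimes>\<^bsub>R\<^esub> y" using xin by blast
  have yc: "y \<in> carrier R" using y ideal.Icarr[OF Q(1)] by blast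
  \<comment> \<open>Since \<open>y\<close> lies in every maximal ideal, \<open>1 - y\<close> is a
    unit. Then \<open>x (1 - y) = 0\<close> gives \<open>x = 0\<close>, against the choice of
    \<open>x\<close>.\<close>
  have "\<one>\<^bsub>R\<^esub> \<in> PIdl\<^bsub>R\<^esub> (\<one>\<^bsub>R\<^esub> \<ominus>\<^bsub>R\<^esub> y)"
  proof (rule ccontr)
    assume "\<one>\<^bsub>R\<^esub> \<notin> PIdl\<^bsub>R\<^esub> (\<one>\<^bsub>R\<^esub> \<ominus>\<^bsub>R\<^esub> y)"
    then obtain m where m: "maximalideal m R" "PIdl\<^bsub>R\<^esub> (\<one>\<^bsub>R\<^esub> \<ominus>\<^bsub>R\<^esub> y) \<subseteq> m"
      using maximal_ideal_exists[OF cgenideal_ideal] yc by (metis minus_closed one_closed)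
    then interpret m: ideal m R using maxD by blast
    have "\<one>\<^bsub>R\<^esub> \<ominus>\<^bsub>R\<^esub> y \<in> m" using m(2) cgenideal_self[of "\<one>\<^bsub>R\<^esub> \<ominus>\<^bsub>R\<^esub> y"] yc by blast
    moreover have "y \<in> m" using Qm[OF m(1)] y(1) by blast
    ultimately have "(\<one>\<^bsub>R\<^esub> \<ominus>\<^bsub>R\<^esub> y) \<oplus>\<^bsub>R\<^esub> y \<in> m" by (rule m.a_closed)
    moreover have "(\<one>\<^bsub>R\<^esub> \<ominus>\<^bsub>R\<^esub> y) \<oplus>\<^bsub>R\<^esub> y = \<one>\<^bsub>R\<^esub>" using yc by (simp add: minus_eq a_assoc l_neg)
    ultimately have "m = carrier R" using m.one_imp_carrier by simp
    then show False using maximalideal.I_notcarr[OF m(1)] by simp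
  qed
  then obtain u where u: "u \<in> carrier R" "\<one>\<^bsub>R\<^esub> = u \<otimes>\<^bsub>R\<^esub> (\<one>\<^bsub>R\<^esub> \<ominus>\<^bsub>R\<^esub> y)" unfolding cgenideal_def by blast
  have x1: "x \<otimes>\<^bsub>R\<^esub> (\<one>\<^bsub>R\<^esub> \<ominus>\<^bsub>R\<^esub> y) = x \<ominus>\<^bsub>R\<^esub> x \<otimes>\<^bsub>R\<^esub> y"
    using x yc by (simp add: minus_eq r_distr r_minus)
  also have "\<dots> = \<zero>\<^bsub>R\<^esub>" using x y(2) by (simp add: minus_eq r_neg)
  finally have "x \<otimes>\<^bsub>R\<^esub> (u \<otimes>\<^bsub>R\<^esub> (\<one>\<^bsub>R\<^esub> \<ominus>\<^bsub>R\<^esub> y)) = \<zero>\<^bsub>R\<^esub>"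
    using x yc u(1) by (simp add: m_lcomm[of x u])
  then have "x = \<zero>\<^bsub>R\<^esub>" unfolding u(2)[symmetric] using x by simp
  then show False using xq(3) ideal.Icarr[OF Q(1) xq(2)] by simp
qed

text \<open>Take a minimal counterexample \<open>I\<close> and a maximal ideal \<open>m\<close> with
  \<open>m I \<noteq> I\<close>. A submodule \<open>J\<close> that contains \<open>m I\<close> and
  is maximal among those missing some \<open>y\<close> of \<open>I\<close> meets \<open>I\<close> in
  a smaller ideal, of finite length by minimality. The quotient of \<open>I\<close> by it is
  annihilated by \<open>m\<close> and generated by \<open>y\<close>.\<close>

lemma artinian_finite_length_ideal:
  assumes art: "commutative_artinian_ring R" and I: "ideal I R"
  shows "finite_length R (regular_module R) I"
proof (rule ccontr)
  interpret cring R using art unfolding commutative_artinian_ring_def by blast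
  interpret reg: comm_module R "regular_module R" by (rule comm_module_regular)
  assume "\<not> finite_length R (regular_module R) I"
  then have ne: "{I. ideal I R \<and> \<not> finite_length R (regular_module R) I} \<noteq> {}" using I by blast
  obtain I where I: "ideal I R" "\<not> finite_length R (regular_module R) I"
    and min: "\<And>J. \<lbrakk>ideal J R; \<not> finite_length R (regular_module R) J; J \<subseteq> I\<rbrakk> \<Longrightarrow> J = I"
    by (rule artinian_minimal[OF art ne]) auto
  interpret I: ideal I R by (rule I(1))
  have "I \<noteq> {\<zero>\<^bsub>R\<^esub>}" using I(2) finite_length.zero[of R "regular_module R"] by auto
  then obtain m where m: "maximalideal m R" and neq: "ideal_prod R m I \<noteq> I"
    using artinian_maximal_prod_neq[OF art I(1)] by blast
  have mi: "ideal m R" using m by (rule maximalideal.axioms(1))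
  have pi: "ideal (ideal_prod R m I) R" by (rule ideal_prod_is_ideal[OF mi I(1)])
  obtain y where y: "y \<in> I" "y \<notin> ideal_prod R m I"
    using neq ideal_prod_inter[OF mi I(1)] by blast
  obtain J where J: "submod R (regular_module R) J" "ideal_prod R m I \<subseteq> J" "y \<notin> J"
    and Jmax: "\<And>L. \<lbrakk>submod R (regular_module R) L; J \<subseteq> L; y \<notin> L\<rbrakk> \<Longrightarrow> L = J"
    using reg.submod_avoiding[of "ideal_prod R m I" y] pi y(2) submod_regular_iff by blast
  have JI: "submod R (regular_module R) (J \<inter> I)"
    using J(1) I(1) i_intersect submod_regular_iff by blast
  have yc: "y \<in> carrier R" using y ideal.Icarr[OF I(1)] by blast
  note DI = reg.submodD[OF submod_regular_iff[THEN iffD2, OF I(1)], simplified]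
  note DJ = reg.submodD[OF J(1), simplified]
  have fl: "finite_length R (regular_module R) (J \<inter> I)"
    using min[of "J \<inter> I"] JI y J(3) unfolding submod_regular_iff by blast
  have "I = adjoin R (regular_module R) (J \<inter> I) y"
  proof (intro equalityI subsetI)
    fix z assume "z \<in> adjoin R (regular_module R) (J \<inter> I) y"
    then show "z \<in> I" unfolding adjoin_def using y(1) by (auto intro!: DI(3,4))
  next
    fix z assume z: "z \<in> I"
    have zc: "z \<in> carrier R" by (rule DI(1)[OF z])
    show "z \<in> adjoin R (regular_module R) (J \<inter> I) y"
    proof (cases "z \<in> J")
      case True
      then show ?thesis using reg.adjoin_sub[OF JI] yc z by auto
    next
      case False
      have "y \<in> adjoin R (regular_module R) J z"
      proof (rule ccontr)
        assume "y \<notin> adjoin R (regular_module R) J z"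
        then have "adjoin R (regular_module R) J z = J"
          using Jmax[of "adjoin R (regular_module R) J z"] reg.submod_adjoin[OF J(1)] reg.adjoin_sub[OF J(1)] zc by simp
        then show False using reg.adjoin_self[OF J(1)] zc False by auto
      qed
      then obtain a r where ar: "a \<in> J" "r \<in> carrier R" "y = a \<oplus>\<^bsub>R\<^esub> z \<otimes>\<^bsub>R\<^esub> r" unfolding adjoin_def by auto
      have "r \<notin> m"
      proof
        assume "r \<in> m"
        then have "r \<otimes>\<^bsub>R\<^esub> z \<in> J" using J(2) z ideal_prod.prod[of r m z I R] by blast
        then have "y \<in> J" unfolding ar(3) using ar zc by (intro DJ(3)) (simp_all add: m_comm)
        then show False using J(3) by blast
      qed
      then obtain t u where tu: "t \<in> carrier R" "u \<in> m" "t \<otimes>\<^bsub>R\<^esub> r \<oplus>\<^bsub>R\<^esub> u = \<one>\<^bsub>R\<^esub>"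
        using maximal_unit_mod[OF m ar(2)] by blast
      have uc: "u \<in> carrier R" using tu ideal.Icarr[OF mi] by blast
      have ac: "a \<in> carrier R" using ar DJ(1) by blast
      have uz: "u \<otimes>\<^bsub>R\<^esub> z \<in> J" using J(2) z tu ideal_prod.prod[of u m z I R] by blast
      have aI: "a \<in> I"
      proof -
        have "a = y \<ominus>\<^bsub>R\<^esub> z \<otimes>\<^bsub>R\<^esub> r" unfolding ar(3) using ac ar zc by (simp add: minus_eq a_assoc r_neg)
        also have "\<dots> \<in> I"
          unfolding minus_eq by (intro I.a_closed I.a_inv_closed y I.I_r_closed z ar)
        finally show ?thesis .
      qed
      \<comment> \<open>From \<open>y = a + z r\<close> one gets \<open>t r z = y t - a t\<close>.
        What remains of \<open>z = t r z + u z\<close> besides \<open>y t\<close> is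
        \<open>u z - a t\<close>, which lies in both \<open>J\<close> and \<open>I\<close>.\<close>
      have "z = (t \<otimes>\<^bsub>R\<^esub> r \<oplus>\<^bsub>R\<^esub> u) \<otimes>\<^bsub>R\<^esub> z" using tu zc by simp
      also have "\<dots> = (u \<otimes>\<^bsub>R\<^esub> z \<oplus>\<^bsub>R\<^esub> a \<otimes>\<^bsub>R\<^esub> (\<ominus>\<^bsub>R\<^esub> t)) \<oplus>\<^bsub>R\<^esub> y \<otimes>\<^bsub>R\<^esub> t"
      proof -
        have yt: "y \<otimes>\<^bsub>R\<^esub> t = a \<otimes>\<^bsub>R\<^esub> t \<oplus>\<^bsub>R\<^esub> t \<otimes>\<^bsub>R\<^esub> r \<otimes>\<^bsub>R\<^esub> z"
          unfolding ar(3) using ac ar(2) tu(1) zc by (simp add: l_distr r_distr m_ac)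
        show ?thesis
          unfolding yt using ac ar(2) tu(1) zc uc
          by (simp add: l_distr r_minus a_assoc r_neg1 a_comm[of _ "u \<otimes>\<^bsub>R\<^esub> z"])
      qed
      finally have ze: "z = (u \<otimes>\<^bsub>R\<^esub> z \<oplus>\<^bsub>R\<^esub> a \<otimes>\<^bsub>R\<^esub> (\<ominus>\<^bsub>R\<^esub> t)) \<oplus>\<^bsub>R\<^esub> y \<otimes>\<^bsub>R\<^esub> t" .
      have "u \<otimes>\<^bsub>R\<^esub> z \<oplus>\<^bsub>R\<^esub> a \<otimes>\<^bsub>R\<^esub> (\<ominus>\<^bsub>R\<^esub> t) \<in> J \<inter> I"
        by (intro IntI DJ(3,4) I.a_closed I.I_l_closed I.I_r_closed uz ar(1) aI z uc a_inv_closed tu(1))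
      then show ?thesis
        using reg.adjoinI[of "u \<otimes>\<^bsub>R\<^esub> z \<oplus>\<^bsub>R\<^esub> a \<otimes>\<^bsub>R\<^esub> (\<ominus>\<^bsub>R\<^esub> t)" "J \<inter> I" t y] tu(1) ze by simp
    qed
  qed
  moreover have "finite_length R (regular_module R) (adjoin R (regular_module R) (J \<inter> I) y)"
  proof (rule finite_length.step[OF fl _ m])
    show "y \<in> carrier (regular_module R)" using yc by simp
    fix r assume r: "r \<in> m"
    have rc: "r \<in> carrier R" using r ideal.Icarr[OF mi] by blast
    have "r \<otimes>\<^bsub>R\<^esub> y \<in> J \<inter> I" using J(2) ideal_prod.prod[OF r y(1), of R] I.I_l_closed[OF y(1) rc] by blast
    then show "r \<odot>\<^bsub>regular_module R\<^esub> y \<in> J \<inter> I" using rc yc by (simp add: m_comm)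
  qed
  ultimately show False using I(2) by simp
qed

lemma artinian_finite_length:
  assumes "commutative_artinian_ring R"
  shows "finite_length R (regular_module R) (carrier R)"
proof -
  interpret cring R using assms unfolding commutative_artinian_ring_def by blast
  show ?thesis by (rule artinian_finite_length_ideal[OF assms oneideal])
qed

section \<open>The dualising module of an artinian ring\<close>

definition linear_on where
  "linear_on Z M N E f \<longleftrightarrow> f \<in> N \<rightarrow> carrier E \<and>
     (\<forall>x\<in>N. \<forall>y\<in>N. f (x \<oplus>\<^bsub>M\<^esub> y) = f x \<oplus>\<^bsub>E\<^esub> f y) \<and>
     (\<forall>a\<in>carrier Z. \<forall>x\<in>N. f (a \<odot>\<^bsub>M\<^esub> x) = a \<odot>\<^bsub>E\<^esub> f x)"

lemma linear_onD:
  assumes "linear_on Z M N E f"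
  shows "x \<in> N \<Longrightarrow> f x \<in> carrier E" "\<lbrakk>x \<in> N; y \<in> N\<rbrakk> \<Longrightarrow> f (x \<oplus>\<^bsub>M\<^esub> y) = f x \<oplus>\<^bsub>E\<^esub> f y"
    "\<lbrakk>a \<in> carrier Z; x \<in> N\<rbrakk> \<Longrightarrow> f (a \<odot>\<^bsub>M\<^esub> x) = a \<odot>\<^bsub>E\<^esub> f x"
  using assms unfolding linear_on_def by blast+

text \<open>The part of \<open>E\<close> annihilated by the set \<open>I\<close>. For an ideal
  \<open>I\<close> it is \<open>Hom(Z/I, E)\<close>; for a maximal one it is the
  \<open>Z/I\<close>-part of the socle.\<close>

definition killed :: "('a, 'm, 'z) module_scheme \<Rightarrow> 'a set \<Rightarrow> 'm set" where
  "killed E I = {e \<in> carrier E. \<forall>r\<in>I. r \<odot>\<^bsub>E\<^esub> e = \<zero>\<^bsub>E\<^esub>}"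

text \<open>The elements killed by a maximal \<open>m\<close> form a vector space over
  \<open>Z/m\<close>. Its dimension is required to be at most one, so every simple module occurs at
  most once in the socle.\<close>

definition simple_socles :: "('a, 'y) ring_scheme \<Rightarrow> ('a, 'm, 'z) module_scheme \<Rightarrow> bool" where
  "simple_socles Z E \<longleftrightarrow> (\<forall>m. maximalideal m Z \<longrightarrow> (\<forall>a\<in>killed E m. \<forall>b\<in>killed E m.
     a \<noteq> \<zero>\<^bsub>E\<^esub> \<longrightarrow> (\<exists>t\<in>carrier Z. b = t \<odot>\<^bsub>E\<^esub> a)))"

text \<open>\<open>E\<close> is an injective cogenerator containing each simple module once; the second condition is
  Baer's criterion for maximal ideals.\<close>

definition dualising_module :: "('a, 'y) ring_scheme \<Rightarrow> ('a, 'm) module \<Rightarrow> bool" where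
  "dualising_module Z E \<longleftrightarrow> right_module Z E \<and> simple_socles Z E \<and>
     (\<forall>m g. maximalideal m Z \<and> linear_on Z (regular_module Z) m E g
        \<longrightarrow> (\<exists>e\<in>carrier E. \<forall>r\<in>m. g r = r \<odot>\<^bsub>E\<^esub> e)) \<and>
     (\<forall>m. maximalideal m Z \<longrightarrow> (\<exists>e\<in>killed E m. e \<noteq> \<zero>\<^bsub>E\<^esub>))"

definition prod_module :: "('a, 'm) module \<Rightarrow> ('a, 'n) module \<Rightarrow> ('a, 'm \<times> 'n) module" where
  "prod_module M N = \<lparr>carrier = carrier M \<times> carrier N, mult = undefined, one = undefined,
     zero = (\<zero>\<^bsub>M\<^esub>, \<zero>\<^bsub>N\<^esub>), add = (\<lambda>x y. (fst x \<oplus>\<^bsub>M\<^esub> fst y, snd x \<oplus>\<^bsub>N\<^esub> snd y)),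
     smult = (\<lambda>a x. (a \<odot>\<^bsub>M\<^esub> fst x, a \<odot>\<^bsub>N\<^esub> snd x))\<rparr>"

lemma prod_module_simps [simp]:
  "carrier (prod_module M N) = carrier M \<times> carrier N" "\<zero>\<^bsub>prod_module M N\<^esub> = (\<zero>\<^bsub>M\<^esub>, \<zero>\<^bsub>N\<^esub>)"
  "x \<oplus>\<^bsub>prod_module M N\<^esub> y = (fst x \<oplus>\<^bsub>M\<^esub> fst y, snd x \<oplus>\<^bsub>N\<^esub> snd y)"
  "a \<odot>\<^bsub>prod_module M N\<^esub> x = (a \<odot>\<^bsub>M\<^esub> fst x, a \<odot>\<^bsub>N\<^esub> snd x)"
  by (simp_all add: prod_module_def)

lemma right_module_prod:
  assumes "right_module \<Lambda> M" "right_module \<Lambda> N"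
  shows "right_module \<Lambda> (prod_module M N)"
proof -
  interpret M: right_module \<Lambda> M by fact
  interpret N: right_module \<Lambda> N by fact
  show ?thesis
  proof (intro right_module.intro right_module_axioms.intro M.R.ring_axioms)
    show "abelian_group (prod_module M N)"
    proof (rule abelian_groupI)
      fix x assume "x \<in> carrier (prod_module M N)"
      then show "\<exists>y\<in>carrier (prod_module M N). y \<oplus>\<^bsub>prod_module M N\<^esub> x = \<zero>\<^bsub>prod_module M N\<^esub>"
        by (auto intro!: bexI[of _ "(\<ominus>\<^bsub>M\<^esub> fst x, \<ominus>\<^bsub>N\<^esub> snd x)"] simp: M.M.l_neg N.M.l_neg)
    qed (auto simp: M.M.a_ac N.M.a_ac)
  qed (auto simp: M.act_closed N.act_closed M.act_add_ring N.act_add_ring M.act_add_mod N.act_add_mod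
      M.act_mult N.act_mult M.act_one N.act_one)
qed

lemma prod_module_minus:
  assumes "right_module \<Lambda> M" "right_module \<Lambda> N" "x \<in> carrier (prod_module M N)" "y \<in> carrier (prod_module M N)"
  shows "x \<ominus>\<^bsub>prod_module M N\<^esub> y = (fst x \<ominus>\<^bsub>M\<^esub> fst y, snd x \<ominus>\<^bsub>N\<^esub> snd y)"
proof -
  interpret M: right_module \<Lambda> M by fact
  interpret N: right_module \<Lambda> N by fact
  interpret P: right_module \<Lambda> "prod_module M N" by (rule right_module_prod) fact+
  have "\<ominus>\<^bsub>prod_module M N\<^esub> y = (\<ominus>\<^bsub>M\<^esub> fst y, \<ominus>\<^bsub>N\<^esub> snd y)"
    using assms(4) by (intro P.M.minus_equality) (auto simp: M.M.l_neg N.M.l_neg)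
  then show ?thesis by (simp add: a_minus_def)
qed

text \<open>Cardinal arithmetic: an infinite type is equipotent to its square. This keeps pushouts
  and free modules inside the universe \<open>'m\<close>.\<close>

lemma infinite_prod_embedding:
  assumes inf: "infinite (UNIV :: 'm set)" and f: "inj_on (f :: 'b \<Rightarrow> 'm) A" and g: "inj_on (g :: 'c \<Rightarrow> 'm) B"
  obtains h :: "'b \<times> 'c \<Rightarrow> 'm" where "inj_on h (A \<times> B)"
proof -
  have "\<exists>k. bij_betw k (UNIV \<times> UNIV :: ('m \<times> 'm) set) (UNIV :: 'm set)"
    unfolding card_of_ordIso by (rule card_of_Times_same_infinite[OF inf])
  then obtain k :: "'m \<times> 'm \<Rightarrow> 'm" where "bij_betw k (UNIV \<times> UNIV) UNIV" by (elim exE)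
  then have k: "inj k" by (simp add: bij_betw_def)
  have "inj_on (\<lambda>x. k (f (fst x), g (snd x))) (A \<times> B)"
  proof (rule inj_onI)
    fix x y assume xy: "x \<in> A \<times> B" "y \<in> A \<times> B" "k (f (fst x), g (snd x)) = k (f (fst y), g (snd y))"
    then have "f (fst x) = f (fst y)" "g (snd x) = g (snd y)" using injD[OF k xy(3)] by simp_all
    then show "x = y" using xy(1,2) inj_onD[OF f] inj_onD[OF g] by (auto simp: prod_eq_iff mem_Times_iff)
  qed
  then show thesis by (rule that)
qed

lemma (in cring) maximal_mult_in:
  assumes m: "maximalideal m R" and a: "a \<in> carrier R" "a \<notin> m" and b: "b \<in> carrier R" and ab: "a \<otimes> b \<in> m"
  shows "b \<in> m"
proof -
  interpret m: maximalideal m R by fact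
  obtain t u where tu: "t \<in> carrier R" "u \<in> m" "t \<otimes> a \<oplus> u = \<one>" using maximal_unit_mod[OF m a] by blast
  have uc: "u \<in> carrier R" using tu m.Icarr by blast
  have "b = (t \<otimes> a \<oplus> u) \<otimes> b" using tu b by simp
  also have "\<dots> = t \<otimes> (a \<otimes> b) \<oplus> u \<otimes> b" using tu(1) uc a b by (simp add: l_distr m_assoc)
  also have "\<dots> \<in> m" by (intro m.a_closed m.I_l_closed m.I_r_closed ab tu b)
  finally show ?thesis .
qed

lemma killedD: "e \<in> killed E I \<Longrightarrow> e \<in> carrier E" "\<lbrakk>e \<in> killed E I; r \<in> I\<rbrakk> \<Longrightarrow> r \<odot>\<^bsub>E\<^esub> e = \<zero>\<^bsub>E\<^esub>"
  by (auto simp: killed_def)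

lemma killedI: "\<lbrakk>e \<in> carrier E; \<And>r. r \<in> I \<Longrightarrow> r \<odot>\<^bsub>E\<^esub> e = \<zero>\<^bsub>E\<^esub>\<rbrakk> \<Longrightarrow> e \<in> killed E I"
  by (auto simp: killed_def)

text \<open>The number of composition factors of \<open>I\<close> that are detected by \<open>E\<close> bounds the tower of
  embeddings between modules with simple socles.\<close>

lemma socle_measure:
  assumes Z: "cring Z" and "finite_length Z (regular_module Z) I"
  shows "\<exists>\<mu> :: ('a, 'm) module \<Rightarrow> nat. \<exists>B. \<forall>E. right_module Z E \<and> simple_socles Z E \<longrightarrow>
     \<mu> E \<le> B \<and> (\<forall>E' j. right_module Z E' \<and> simple_socles Z E' \<and> j \<in> right_hom Z E E' \<and> inj_on j (carrier E) \<longrightarrow>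
       \<mu> E \<le> \<mu> E' \<and> (\<mu> E = \<mu> E' \<longrightarrow> (\<forall>e'\<in>carrier E'. \<exists>e\<in>carrier E. e' \<ominus>\<^bsub>E'\<^esub> j e \<in> killed E' I)))"
  using assms(2)
proof (induction rule: finite_length.induct)
  case zero
  have *: "\<exists>e\<in>carrier E. e' \<ominus>\<^bsub>E'\<^esub> j e \<in> killed E' {\<zero>\<^bsub>regular_module Z\<^esub>}"
    if "right_module Z E" "right_module Z E'" "j \<in> right_hom Z E E'" "e' \<in> carrier E'"
    for E E' :: "('a, 'm) module" and j e'
  proof -
    interpret E: right_module Z E by fact
    interpret E': right_module Z E' by fact
    have "e' \<ominus>\<^bsub>E'\<^esub> j \<zero>\<^bsub>E\<^esub> \<in> carrier E'" using that right_homD(1)[OF that(3)] by simp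
    then show ?thesis
      by (intro bexI[of _ "\<zero>\<^bsub>E\<^esub>"] killedI) (auto simp: E'.act_zero_left)
  qed
  show ?case
    by (intro exI[of _ "\<lambda>_. 0"] exI[of _ 0] allI impI conjI ballI; elim conjE; (rule *, assumption+ | simp))
next
  case (step I x m)
  interpret cring Z by (rule Z)
  interpret reg: comm_module Z "regular_module Z" by (rule comm_module_regular)
  have Ii: "submod Z (regular_module Z) I" by (rule reg.finite_length_submod[OF step(1)])
  have x: "x \<in> carrier Z" using step(2) by simp
  have mx: "x \<otimes>\<^bsub>Z\<^esub> r \<in> I" if "r \<in> m" for r using step(4)[OF that] by simp
  have mc: "r \<in> carrier Z" if "r \<in> m" for r using step(3) that by (meson ideal.Icarr maximalideal.axioms(1))
  have Ic: "y \<in> carrier Z" if "y \<in> I" for y using reg.submodD(1)[OF Ii that] by simp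
  obtain \<mu> :: "('a, 'm) module \<Rightarrow> nat" and B where
    \<mu>: "\<forall>E. right_module Z E \<and> simple_socles Z E \<longrightarrow>
     \<mu> E \<le> B \<and> (\<forall>E' j. right_module Z E' \<and> simple_socles Z E' \<and> j \<in> right_hom Z E E' \<and> inj_on j (carrier E) \<longrightarrow>
       \<mu> E \<le> \<mu> E' \<and> (\<mu> E = \<mu> E' \<longrightarrow> (\<forall>e'\<in>carrier E'. \<exists>e\<in>carrier E. e' \<ominus>\<^bsub>E'\<^esub> j e \<in> killed E' I)))"
    using step(5) by (elim exE)
  have B: "\<mu> E \<le> B" if "right_module Z E" "simple_socles Z E" for E
    using \<mu> that by simp
  have mono: "\<mu> E \<le> \<mu> E'" and
    eq: "\<lbrakk>\<mu> E = \<mu> E'; e' \<in> carrier E'\<rbrakk> \<Longrightarrow> \<exists>e\<in>carrier E. e' \<ominus>\<^bsub>E'\<^esub> j e \<in> killed E' I"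
    if "right_module Z E" "simple_socles Z E" "right_module Z E'" "simple_socles Z E'"
      "j \<in> right_hom Z E E'" "inj_on j (carrier E)" for E E' j e'
    using \<mu> that by simp_all
  \<comment> \<open>The flag tells whether the inclusion of \<open>Hom(Z/(I + Z x), E)\<close> in
    \<open>Hom(Z/I, E)\<close> is proper. Multiplication by \<open>x\<close> embeds the quotient
    into the part of \<open>E\<close> killed by \<open>m\<close>, so with simple socles one bit is
    enough.\<close>
  define flag where "flag E \<longleftrightarrow> (\<exists>e\<in>killed E I. x \<odot>\<^bsub>E\<^esub> e \<noteq> \<zero>\<^bsub>E\<^esub>)" for E :: "('a, 'm) module"
  define \<nu> where "\<nu> E = \<mu> E + (if flag E then 1 else 0)" for E
  have \<nu>: "\<nu> E \<le> \<nu> E'" "\<lbrakk>\<nu> E = \<nu> E'; e' \<in> carrier E'\<rbrakk> \<Longrightarrow> \<exists>e\<in>carrier E.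
        e' \<ominus>\<^bsub>E'\<^esub> j e \<in> killed E' (adjoin Z (regular_module Z) I x)"
    if E: "right_module Z E" "simple_socles Z E" and E': "right_module Z E'" "simple_socles Z E'"
      and j: "j \<in> right_hom Z E E'" and inj: "inj_on j (carrier E)" for E E' :: "('a, 'm) module" and j e'
  proof -
    interpret E: comm_module Z E by (intro comm_module.intro E cring_axioms)
    interpret E': comm_module Z E' by (intro comm_module.intro E' cring_axioms)
    note jD = right_homD[OF j]
    have j0: "j \<zero>\<^bsub>E\<^esub> = \<zero>\<^bsub>E'\<^esub>" by (rule right_hom_zero[OF E.M.abelian_group_axioms E'.M.abelian_group_axioms j])
    have jk: "j e \<in> killed E' I" if "e \<in> killed E I" for e
    proof (rule killedI)
      show "j e \<in> carrier E'" by (rule jD(1)[OF killedD(1)[OF that]])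
      show "r \<odot>\<^bsub>E'\<^esub> j e = \<zero>\<^bsub>E'\<^esub>" if r: "r \<in> I" for r
        using jD(4)[OF Ic[OF r] killedD(1)[OF \<open>e \<in> _\<close>]] killedD(2)[OF \<open>e \<in> _\<close> r] j0 by simp
    qed
    have jn: "x \<odot>\<^bsub>E'\<^esub> j e \<noteq> \<zero>\<^bsub>E'\<^esub>" if "e \<in> carrier E" "x \<odot>\<^bsub>E\<^esub> e \<noteq> \<zero>\<^bsub>E\<^esub>" for e
    proof
      assume "x \<odot>\<^bsub>E'\<^esub> j e = \<zero>\<^bsub>E'\<^esub>"
      then have "j (x \<odot>\<^bsub>E\<^esub> e) = j \<zero>\<^bsub>E\<^esub>" using jD(4)[OF x that(1)] j0 by simp
      then have "x \<odot>\<^bsub>E\<^esub> e = \<zero>\<^bsub>E\<^esub>"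
        by (rule inj_onD[OF inj]) (simp_all add: that x E.act_closed)
      then show False using that(2) by blast
    qed
    have fl: "flag E'" if "flag E"
    proof -
      obtain e where "e \<in> killed E I" "x \<odot>\<^bsub>E\<^esub> e \<noteq> \<zero>\<^bsub>E\<^esub>" using \<open>flag E\<close> unfolding flag_def by blast
      then show ?thesis unfolding flag_def using jk[of e] jn[of e] killedD(1)[of e E I] by auto
    qed
    have m1: "\<mu> E \<le> \<mu> E'" by (rule mono[OF E E' j inj])
    show "\<exists>e\<in>carrier E. e' \<ominus>\<^bsub>E'\<^esub> j e \<in> killed E' (adjoin Z (regular_module Z) I x)"
      if \<nu>eq: "\<nu> E = \<nu> E'" and e': "e' \<in> carrier E'"
    proof -
      \<comment> \<open>Neither summand of \<nu> can decrease along an embedding, so equal sums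
        force both summands to be equal.\<close>
      have \<mu>eq: "\<mu> E = \<mu> E'" and fe: "flag E' \<Longrightarrow> flag E"
        using \<nu>eq m1 fl unfolding \<nu>_def by (auto split: if_splits)
      obtain e where e: "e \<in> carrier E" "e' \<ominus>\<^bsub>E'\<^esub> j e \<in> killed E' I"
        using eq[OF E E' j inj \<mu>eq e'] by blast
      define d where "d = e' \<ominus>\<^bsub>E'\<^esub> j e"
      have d: "d \<in> killed E' I" "d \<in> carrier E'" using e killedD(1)[OF e(2)] by (auto simp: d_def)
      have adj: "c \<in> killed E' (adjoin Z (regular_module Z) I x)"
        if c: "c \<in> killed E' I" "x \<odot>\<^bsub>E'\<^esub> c = \<zero>\<^bsub>E'\<^esub>" for c
      proof (rule killedI)
        show cc: "c \<in> carrier E'" by (rule killedD(1)[OF c(1)])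
        fix r assume "r \<in> adjoin Z (regular_module Z) I x"
        then obtain y s where ys: "y \<in> I" "s \<in> carrier Z" "r = y \<oplus>\<^bsub>Z\<^esub> x \<otimes>\<^bsub>Z\<^esub> s" unfolding adjoin_def by auto
        show "r \<odot>\<^bsub>E'\<^esub> c = \<zero>\<^bsub>E'\<^esub>"
          unfolding ys(3) using ys(1,2) Ic x cc killedD(2)[OF c(1) ys(1)] c(2)
          by (simp add: E'.act_add_ring E'.act_mult E'.act_zero_right)
      qed
      show ?thesis
      proof (cases "x \<odot>\<^bsub>E'\<^esub> d = \<zero>\<^bsub>E'\<^esub>")
        case True
        then show ?thesis using adj[OF d(1)] e(1) by (auto simp: d_def)
      next
        case False
        then have "flag E'" unfolding flag_def using d by blast
        then obtain e1 where e1: "e1 \<in> killed E I" "x \<odot>\<^bsub>E\<^esub> e1 \<noteq> \<zero>\<^bsub>E\<^esub>" using fe unfolding flag_def by blast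
        have e1c: "e1 \<in> carrier E" by (rule killedD(1)[OF e1(1)])
        have xk: "x \<odot>\<^bsub>E'\<^esub> c \<in> killed E' m" if c: "c \<in> killed E' I" for c
        proof (rule killedI)
          have cc: "c \<in> carrier E'" by (rule killedD(1)[OF c])
          show "x \<odot>\<^bsub>E'\<^esub> c \<in> carrier E'" by (rule E'.act_closed[OF x cc])
          fix r assume r: "r \<in> m"
          show "r \<odot>\<^bsub>E'\<^esub> (x \<odot>\<^bsub>E'\<^esub> c) = \<zero>\<^bsub>E'\<^esub>"
            using killedD(2)[OF c mx[OF r]] E'.act_mult[OF x mc[OF r] cc] by simp
        qed
        \<comment> \<open>\<open>x d\<close> and \<open>x (j e1)\<close> lie in the same simple
          socle and the latter is nonzero. Hence \<open>d\<close> minus a multiple of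
          \<open>j e1\<close> is killed by \<open>x\<close> too, and the multiple still comes from
          \<open>E\<close>.\<close>
        obtain t where t: "t \<in> carrier Z" "x \<odot>\<^bsub>E'\<^esub> d = t \<odot>\<^bsub>E'\<^esub> (x \<odot>\<^bsub>E'\<^esub> j e1)"
          using E'(2)[unfolded simple_socles_def, rule_format, OF step(3) xk[OF jk[OF e1(1)]] xk[OF d(1)] jn[OF e1c e1(2)]]
          by blast
        have te: "t \<odot>\<^bsub>E\<^esub> e1 \<in> carrier E" by (rule E.act_closed[OF t(1) e1c])
        define c where "c = d \<ominus>\<^bsub>E'\<^esub> j (t \<odot>\<^bsub>E\<^esub> e1)"
        have jt: "j (t \<odot>\<^bsub>E\<^esub> e1) = t \<odot>\<^bsub>E'\<^esub> j e1" by (rule jD(4)[OF t(1) e1c])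
        have j1: "j e1 \<in> carrier E'" by (rule jD(1)[OF e1c])
        have ce: "c = e' \<ominus>\<^bsub>E'\<^esub> j (e \<oplus>\<^bsub>E\<^esub> t \<odot>\<^bsub>E\<^esub> e1)"
          unfolding c_def d_def using jD(1) e(1) te e' jD(3)[OF e(1) te]
          by (simp add: E'.M.minus_eq E'.M.minus_add E'.M.a_assoc)
        have "c \<in> killed E' I"
        proof (rule killedI)
          show "c \<in> carrier E'" unfolding c_def using d jD(1)[OF te] by simp
          fix y assume y: "y \<in> I"
          have yc: "y \<in> carrier Z" by (rule Ic[OF y])
          have "y \<odot>\<^bsub>E'\<^esub> (t \<odot>\<^bsub>E'\<^esub> j e1) = t \<odot>\<^bsub>E'\<^esub> (y \<odot>\<^bsub>E'\<^esub> j e1)"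
            by (rule E'.act_swap[OF yc t(1) j1])
          then have "y \<odot>\<^bsub>E'\<^esub> (t \<odot>\<^bsub>E'\<^esub> j e1) = \<zero>\<^bsub>E'\<^esub>"
            using killedD(2)[OF jk[OF e1(1)] y] t by (simp add: E'.act_zero_right)
          then show "y \<odot>\<^bsub>E'\<^esub> c = \<zero>\<^bsub>E'\<^esub>"
            unfolding c_def jt using yc d j1 t(1) killedD(2)[OF d(1) y]
            by (simp add: E'.act_minus E'.act_closed E'.minus_zero)
        qed
        moreover have "x \<odot>\<^bsub>E'\<^esub> c = \<zero>\<^bsub>E'\<^esub>"
        proof -
          have "x \<odot>\<^bsub>E'\<^esub> c = x \<odot>\<^bsub>E'\<^esub> d \<ominus>\<^bsub>E'\<^esub> x \<odot>\<^bsub>E'\<^esub> (t \<odot>\<^bsub>E'\<^esub> j e1)"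
            unfolding c_def jt by (intro E'.act_minus x d E'.act_closed t j1)
          also have "\<dots> = \<zero>\<^bsub>E'\<^esub>"
            unfolding t(2) E'.act_swap[OF x t(1) j1]
            using E'.act_closed[OF t(1) E'.act_closed[OF x j1]] by (simp add: E'.M.minus_eq E'.M.r_neg)
          finally show ?thesis .
        qed
        ultimately have "c \<in> killed E' (adjoin Z (regular_module Z) I x)" by (rule adj)
        then show ?thesis unfolding ce using e(1) te by blast
      qed
    qed
    show "\<nu> E \<le> \<nu> E'" using m1 fl unfolding \<nu>_def by auto
  qed
  have bound: "\<nu> E \<le> B + 1" if "right_module Z E" "simple_socles Z E" for E
    using B[OF that] unfolding \<nu>_def by simp
  show ?case
    by (intro exI[of _ \<nu>] exI[of _ "B + 1"] allI impI conjI ballI; elim conjE;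
        (rule bound, assumption+ | rule \<nu>(1), assumption+ | rule \<nu>(2), assumption+))
qed

text \<open>The pushout of \<open>E\<close> and \<open>Z\<close> along \<open>g : m \<rightarrow> E\<close> adds one composition factor \<open>Z/m\<close>. Its socles stay
  simple unless \<open>g\<close> extends to \<open>Z\<close> and \<open>E\<close> already contains \<open>Z/m\<close>.\<close>

lemma socle_extension:
  fixes E :: "('a, 'm) module"
  assumes Z: "cring Z" and inf: "infinite (UNIV :: 'm set)" and i: "inj_on (i :: 'a \<Rightarrow> 'm) (carrier Z)"
    and E: "right_module Z E" and soc: "simple_socles Z E"
    and m: "maximalideal m Z" and g: "linear_on Z (regular_module Z) m E g"
    and cond: "\<not> (\<exists>e\<in>carrier E. \<forall>r\<in>m. g r = r \<odot>\<^bsub>E\<^esub> e) \<or> killed E m \<subseteq> {\<zero>\<^bsub>E\<^esub>}"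
  obtains E' :: "('a, 'm) module" and j where "right_module Z E'" "simple_socles Z E'"
    "j \<in> right_hom Z E E'" "inj_on j (carrier E)" "j ` carrier E \<noteq> carrier E'"
proof -
  interpret cring Z by (rule Z)
  interpret E: comm_module Z E by (intro comm_module.intro E cring_axioms)
  interpret reg: comm_module Z "regular_module Z" by (rule comm_module_regular)
  interpret m: maximalideal m Z by (rule m)
  note gD = linear_onD[OF g, simplified]
  let ?P = "prod_module E (regular_module Z)"
  have P: "right_module Z ?P" by (rule right_module_prod[OF E reg.right_module_axioms])
  interpret P: right_module Z ?P by (rule P)
  have mc: "r \<in> carrier Z" if "r \<in> m" for r using that by (rule m.Icarr)
  have g0: "g \<zero>\<^bsub>Z\<^esub> = \<zero>\<^bsub>E\<^esub>"
    using gD(1)[OF m.zero_closed] gD(2)[OF m.zero_closed m.zero_closed] by simp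
  have gneg: "g (\<ominus>\<^bsub>Z\<^esub> r) = \<ominus>\<^bsub>E\<^esub> g r" if r: "r \<in> m" for r
    using gD(1,2)[OF r] gD(1)[OF m.a_inv_closed[OF r]] gD(2)[OF m.a_inv_closed[OF r] r] mc[OF r] g0
    by (intro E.M.minus_equality[symmetric]) (simp_all add: l_neg)
  \<comment> \<open>The relations of the pushout: \<open>(0, s)\<close> is to be identified with
    \<open>(g s, 0)\<close> for \<open>s\<close> in \<open>m\<close>.\<close>
  define K where "K = {(e, s) \<in> carrier ?P. s \<in> m \<and> e = \<ominus>\<^bsub>E\<^esub> g s}"
  have Kiff: "(e, s) \<in> K \<longleftrightarrow> s \<in> m \<and> e = \<ominus>\<^bsub>E\<^esub> g s" for e s
    unfolding K_def using mc gD(1) by auto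
  have K: "submod Z ?P K"
    unfolding submod_def
  proof (intro conjI ballI)
    show "K \<subseteq> carrier ?P" unfolding K_def by auto
    show "\<zero>\<^bsub>?P\<^esub> \<in> K" by (simp add: Kiff g0 E.neg_zero)
    fix x y assume "x \<in> K" "y \<in> K"
    then show "x \<oplus>\<^bsub>?P\<^esub> y \<in> K"
      by (cases x; cases y) (simp add: Kiff gD E.M.minus_add E.M.a_comm)
  next
    fix a x assume a: "a \<in> carrier Z" and x: "x \<in> K"
    obtain e s where x': "x = (e, s)" by (cases x)
    have s: "s \<in> m" "e = \<ominus>\<^bsub>E\<^esub> g s" using x by (simp_all add: x' Kiff)
    have "s \<otimes>\<^bsub>Z\<^esub> a \<in> m" by (rule m.I_r_closed[OF s(1) a])
    then show "a \<odot>\<^bsub>?P\<^esub> x \<in> K"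
      unfolding x' using s gD(3)[OF a s(1)] gD(1)[OF s(1)] a by (simp add: Kiff E.act_neg_right)
  qed
  obtain h :: "'m \<times> 'a \<Rightarrow> 'm" where "inj_on h (carrier E \<times> carrier Z)"
    by (rule infinite_prod_embedding[OF inf inj_on_id2[of "carrier E"] i])
  then have h: "inj_on h (carrier ?P)" by simp
  obtain E' :: "('a, 'm) module" and q where E': "right_module Z E'" and q: "q \<in> right_hom Z ?P E'"
    and qsurj: "q ` carrier ?P = carrier E'" and "a_kernel ?P E' q = K"
    and qeq: "\<And>x y. \<lbrakk>x \<in> carrier ?P; y \<in> carrier ?P\<rbrakk> \<Longrightarrow> q x = q y \<longleftrightarrow> x \<ominus>\<^bsub>?P\<^esub> y \<in> K"
    using quotient_module[OF P K h] by blast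
  interpret E': comm_module Z E' by (intro comm_module.intro E' cring_axioms)
  have qq: "q (e, s) = q (e', s') \<longleftrightarrow> s \<ominus>\<^bsub>Z\<^esub> s' \<in> m \<and> e \<ominus>\<^bsub>E\<^esub> e' = \<ominus>\<^bsub>E\<^esub> g (s \<ominus>\<^bsub>Z\<^esub> s')"
    if "e \<in> carrier E" "e' \<in> carrier E" "s \<in> carrier Z" "s' \<in> carrier Z" for e e' s s'
  proof -
    have "s \<ominus>\<^bsub>regular_module Z\<^esub> s' = s \<ominus>\<^bsub>Z\<^esub> s'"
      by (simp add: a_minus_def a_inv_def m_inv_def regular_module_def)
    then show ?thesis
      using that qeq[of "(e, s)" "(e', s')"] prod_module_minus[OF E reg.right_module_axioms, of "(e, s)" "(e', s')"]
      by (simp add: Kiff)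
  qed
  have q0: "q (\<zero>\<^bsub>E\<^esub>, \<zero>\<^bsub>Z\<^esub>) = \<zero>\<^bsub>E'\<^esub>"
    using right_hom_zero[OF P.M.abelian_group_axioms E'.M.abelian_group_axioms q] by simp
  have qzero: "q (e, s) = \<zero>\<^bsub>E'\<^esub> \<longleftrightarrow> s \<in> m \<and> e = \<ominus>\<^bsub>E\<^esub> g s" if "e \<in> carrier E" "s \<in> carrier Z" for e s
  proof -
    have "s \<ominus>\<^bsub>Z\<^esub> \<zero>\<^bsub>Z\<^esub> = s" using that by (simp add: minus_eq)
    then show ?thesis using qq[of e "\<zero>\<^bsub>E\<^esub>" s "\<zero>\<^bsub>Z\<^esub>"] that by (simp add: q0 E.minus_zero)
  qed
  have qc: "q (e, s) \<in> carrier E'" if "e \<in> carrier E" "s \<in> carrier Z" for e s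
    using right_homD(1)[OF q, of "(e, s)"] that by simp
  have qact: "a \<odot>\<^bsub>E'\<^esub> q (e, s) = q (a \<odot>\<^bsub>E\<^esub> e, s \<otimes>\<^bsub>Z\<^esub> a)" if "a \<in> carrier Z" "e \<in> carrier E" "s \<in> carrier Z" for a e s
    using right_homD(4)[OF q, of a "(e, s)"] that by simp
  have qE: "\<exists>e s. e \<in> carrier E \<and> s \<in> carrier Z \<and> w = q (e, s)" if "w \<in> carrier E'" for w
    using that unfolding qsurj[symmetric] by auto
  define j where "j = (\<lambda>e\<in>carrier E. q (e, \<zero>\<^bsub>Z\<^esub>))"
  have j: "j \<in> right_hom Z E E'"
  proof (rule right_homI)
    fix x y assume xy: "x \<in> carrier E" "y \<in> carrier E"
    then show "j (x \<oplus>\<^bsub>E\<^esub> y) = j x \<oplus>\<^bsub>E'\<^esub> j y"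
      using right_homD(3)[OF q, of "(x, \<zero>\<^bsub>Z\<^esub>)" "(y, \<zero>\<^bsub>Z\<^esub>)"] by (simp add: j_def)
  qed (auto simp: j_def qc qact E.act_closed)
  have inj: "inj_on j (carrier E)"
  proof (rule inj_onI)
    fix x y assume xy: "x \<in> carrier E" "y \<in> carrier E" "j x = j y"
    then have "x \<ominus>\<^bsub>E\<^esub> y = \<zero>\<^bsub>E\<^esub>"
      using qq[of x y "\<zero>\<^bsub>Z\<^esub>" "\<zero>\<^bsub>Z\<^esub>"] by (simp add: j_def minus_eq r_neg g0 E.neg_zero)
    then show "x = y" using xy by (simp add: E.M.minus_eq) (metis E.M.minus_equality E.M.minus_minus E.M.a_inv_closed)
  qed
  have onem: "\<one>\<^bsub>Z\<^esub> \<notin> m"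
    using m.I_notcarr m.one_imp_carrier by blast
  have "q (\<zero>\<^bsub>E\<^esub>, \<one>\<^bsub>Z\<^esub>) \<notin> j ` carrier E"
  proof
    assume "q (\<zero>\<^bsub>E\<^esub>, \<one>\<^bsub>Z\<^esub>) \<in> j ` carrier E"
    then obtain e where "e \<in> carrier E" "q (\<zero>\<^bsub>E\<^esub>, \<one>\<^bsub>Z\<^esub>) = q (e, \<zero>\<^bsub>Z\<^esub>)" by (auto simp: j_def)
    then show False using qq[of "\<zero>\<^bsub>E\<^esub>" e "\<one>\<^bsub>Z\<^esub>" "\<zero>\<^bsub>Z\<^esub>"] onem by (simp add: minus_eq)
  qed
  then have nsurj: "j ` carrier E \<noteq> carrier E'" using qc[OF E.M.zero_closed one_closed] by blast
  \<comment> \<open>With second component in \<open>m\<close>, the pair \<open>(e, s)\<close> has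
    the same image as \<open>(e + g s, 0)\<close>, so the element comes from \<open>E\<close>, and
    being killed is reflected by the injection \<open>j\<close>.\<close>
  have small: "\<exists>e. e \<in> killed E m' \<and> w = j e"
    if w: "w = q (e, s)" "e \<in> carrier E" "s \<in> m" and k: "w \<in> killed E' m'" and m': "m' \<subseteq> carrier Z" for w e s m'
  proof -
    have s: "s \<in> carrier Z" by (rule mc[OF w(3)])
    let ?e = "e \<oplus>\<^bsub>E\<^esub> g s"
    have ec: "?e \<in> carrier E" using w gD(1) by simp
    have "q (e, s) = q (?e, \<zero>\<^bsub>Z\<^esub>)"
    proof -
      have "s \<ominus>\<^bsub>Z\<^esub> \<zero>\<^bsub>Z\<^esub> = s" using s by (simp add: minus_eq)
      moreover have "e \<ominus>\<^bsub>E\<^esub> ?e = \<ominus>\<^bsub>E\<^esub> g s"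
        using w gD(1)[OF w(3)] by (simp add: E.M.minus_eq E.M.minus_add E.M.r_neg2)
      ultimately show ?thesis using qq[OF w(2) ec s, of "\<zero>\<^bsub>Z\<^esub>"] w(3) by simp
    qed
    then have wj: "w = j ?e" using ec w(1) by (simp add: j_def)
    have "?e \<in> killed E m'"
    proof (rule killedI[OF ec])
      fix r assume r: "r \<in> m'"
      have rc: "r \<in> carrier Z" using r m' by blast
      have "j (r \<odot>\<^bsub>E\<^esub> ?e) = j \<zero>\<^bsub>E\<^esub>"
        using right_homD(4)[OF j rc ec] killedD(2)[OF k r] wj
          right_hom_zero[OF E.M.abelian_group_axioms E'.M.abelian_group_axioms j] by simp
      then show "r \<odot>\<^bsub>E\<^esub> ?e = \<zero>\<^bsub>E\<^esub>"
        by (rule inj_onD[OF inj]) (simp_all add: E.act_closed[OF rc ec])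
    qed
    then show ?thesis using wj by blast
  qed
  \<comment> \<open>An element outside \<open>E\<close> maps to a nonzero element of the new factor
    \<open>Z/m\<close>, so only \<open>m\<close> itself can kill it; and being killed by
    \<open>m\<close> it provides an extension of \<open>g\<close> to \<open>Z\<close>.\<close>
  have big: "m' = m \<and> (\<exists>e0\<in>carrier E. \<forall>r\<in>m. g r = r \<odot>\<^bsub>E\<^esub> e0)"
    if w: "w = q (e, s)" "e \<in> carrier E" "s \<in> carrier Z" "s \<notin> m" and k: "w \<in> killed E' m'" and m': "maximalideal m' Z"
    for w e s m'
  proof -
    interpret m': maximalideal m' Z by (rule m')
    have sub: "m' \<subseteq> m"
    proof
      fix r assume r: "r \<in> m'"
      have rc: "r \<in> carrier Z" by (rule m'.Icarr[OF r])
      have "q (r \<odot>\<^bsub>E\<^esub> e, s \<otimes>\<^bsub>Z\<^esub> r) = \<zero>\<^bsub>E'\<^esub>" using killedD(2)[OF k r] qact[OF rc w(2,3)] w(1) by simp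
      then have "s \<otimes>\<^bsub>Z\<^esub> r \<in> m" using qzero[of "r \<odot>\<^bsub>E\<^esub> e" "s \<otimes>\<^bsub>Z\<^esub> r"] rc w E.act_closed by simp
      then show "r \<in> m" by (rule maximal_mult_in[OF m w(3,4) rc])
    qed
    have "m = m'"
      using m'.I_maximal[OF m.ideal_axioms sub] m.a_subset m.I_notcarr by blast
    moreover have "\<exists>e0\<in>carrier E. \<forall>r\<in>m. g r = r \<odot>\<^bsub>E\<^esub> e0"
    proof -
      obtain t u where tu: "t \<in> carrier Z" "u \<in> m" "t \<otimes>\<^bsub>Z\<^esub> s \<oplus>\<^bsub>Z\<^esub> u = \<one>\<^bsub>Z\<^esub>" using maximal_unit_mod[OF m w(3,4)] by blast
      have uc: "u \<in> carrier Z" by (rule mc[OF tu(2)])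
      have te: "t \<odot>\<^bsub>E\<^esub> e \<in> carrier E" by (rule E.act_closed[OF tu(1) w(2)])
      \<comment> \<open>Being killed means \<open>r e = - g (s r)\<close> for \<open>r\<close> in
        \<open>m\<close>. Multiply by \<open>t\<close> and use \<open>r = s r t + u r\<close>, which
        holds because \<open>t s + u = 1\<close>: \<open>g r\<close> becomes \<open>r\<close> times
        this element.\<close>
      let ?e = "\<ominus>\<^bsub>E\<^esub> (t \<odot>\<^bsub>E\<^esub> e) \<oplus>\<^bsub>E\<^esub> g u"
      have ec: "?e \<in> carrier E" using te gD(1)[OF tu(2)] by simp
      have "g r = r \<odot>\<^bsub>E\<^esub> ?e" if r: "r \<in> m" for r
      proof -
        have rc: "r \<in> carrier Z" by (rule mc[OF r])
        have "q (t \<odot>\<^bsub>E\<^esub> (r \<odot>\<^bsub>E\<^esub> e), (s \<otimes>\<^bsub>Z\<^esub> r) \<otimes>\<^bsub>Z\<^esub> t) = t \<odot>\<^bsub>E'\<^esub> (r \<odot>\<^bsub>E'\<^esub> w)"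
          using rc w tu by (simp add: qact E.act_closed)
        also have "\<dots> = \<zero>\<^bsub>E'\<^esub>"
          using killedD(2)[OF k, of r] r \<open>m = m'\<close> tu(1) by (simp add: E'.act_zero_right)
        finally have 1: "t \<odot>\<^bsub>E\<^esub> (r \<odot>\<^bsub>E\<^esub> e) = \<ominus>\<^bsub>E\<^esub> g ((s \<otimes>\<^bsub>Z\<^esub> r) \<otimes>\<^bsub>Z\<^esub> t)"
          using qzero[of "t \<odot>\<^bsub>E\<^esub> (r \<odot>\<^bsub>E\<^esub> e)" "(s \<otimes>\<^bsub>Z\<^esub> r) \<otimes>\<^bsub>Z\<^esub> t"] rc w tu by (simp add: E.act_closed)
        have srt: "(s \<otimes>\<^bsub>Z\<^esub> r) \<otimes>\<^bsub>Z\<^esub> t \<in> m" by (intro m.I_r_closed m.I_l_closed r tu w)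
        have "r = (s \<otimes>\<^bsub>Z\<^esub> r) \<otimes>\<^bsub>Z\<^esub> t \<oplus>\<^bsub>Z\<^esub> u \<otimes>\<^bsub>Z\<^esub> r"
        proof -
          have "r = (t \<otimes>\<^bsub>Z\<^esub> s \<oplus>\<^bsub>Z\<^esub> u) \<otimes>\<^bsub>Z\<^esub> r" unfolding tu(3) using rc by simp
          also have "\<dots> = (s \<otimes>\<^bsub>Z\<^esub> r) \<otimes>\<^bsub>Z\<^esub> t \<oplus>\<^bsub>Z\<^esub> u \<otimes>\<^bsub>Z\<^esub> r"
            using rc tu(1) uc w(3) by (simp add: l_distr r_distr m_ac)
          finally show ?thesis .
        qed
        then have "g r = g ((s \<otimes>\<^bsub>Z\<^esub> r) \<otimes>\<^bsub>Z\<^esub> t) \<oplus>\<^bsub>E\<^esub> g (u \<otimes>\<^bsub>Z\<^esub> r)"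
          using gD(2)[OF srt m.I_r_closed[OF tu(2) rc]] by simp
        also have "g (u \<otimes>\<^bsub>Z\<^esub> r) = r \<odot>\<^bsub>E\<^esub> g u" by (rule gD(3)[OF rc tu(2)])
        also have "g ((s \<otimes>\<^bsub>Z\<^esub> r) \<otimes>\<^bsub>Z\<^esub> t) = \<ominus>\<^bsub>E\<^esub> (t \<odot>\<^bsub>E\<^esub> (r \<odot>\<^bsub>E\<^esub> e))" unfolding 1 using gD(1)[OF srt] by simp
        also have "t \<odot>\<^bsub>E\<^esub> (r \<odot>\<^bsub>E\<^esub> e) = r \<odot>\<^bsub>E\<^esub> (t \<odot>\<^bsub>E\<^esub> e)" by (rule E.act_swap[OF tu(1) rc w(2)])
        finally show ?thesis using rc te gD(1)[OF tu(2)] by (simp add: E.act_add_mod E.act_neg_right)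
      qed
      then show ?thesis using ec by blast
    qed
    ultimately show ?thesis by blast
  qed
  have "simple_socles Z E'"
    unfolding simple_socles_def
  proof (intro allI impI ballI)
    fix m' a b assume m': "maximalideal m' Z" and a: "a \<in> killed E' m'" and b: "b \<in> killed E' m'" and a0: "a \<noteq> \<zero>\<^bsub>E'\<^esub>"
    interpret m': maximalideal m' Z by (rule m')
    obtain ea sa where ea: "ea \<in> carrier E" "sa \<in> carrier Z" "a = q (ea, sa)" using qE[OF killedD(1)[OF a]] by blast
    obtain eb sb where eb: "eb \<in> carrier E" "sb \<in> carrier Z" "b = q (eb, sb)" using qE[OF killedD(1)[OF b]] by blast
    show "\<exists>t\<in>carrier Z. b = t \<odot>\<^bsub>E'\<^esub> a"
    proof (cases "sa \<in> m \<and> sb \<in> m")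
      case True
      obtain a' where a': "a' \<in> killed E m'" "a = j a'" using small[OF ea(3,1) _ a m'.a_subset] True by blast
      obtain b' where b': "b' \<in> killed E m'" "b = j b'" using small[OF eb(3,1) _ b m'.a_subset] True by blast
      have "a' \<noteq> \<zero>\<^bsub>E\<^esub>" using a0 a'(2) right_hom_zero[OF E.M.abelian_group_axioms E'.M.abelian_group_axioms j] by auto
      then obtain t where t: "t \<in> carrier Z" "b' = t \<odot>\<^bsub>E\<^esub> a'"
        using soc[unfolded simple_socles_def, rule_format, OF m' a'(1) b'(1)] by blast
      then show ?thesis using right_homD(4)[OF j t(1) killedD(1)[OF a'(1)]] a'(2) b'(2) by auto
    next
      case False
      then have mm: "m' = m" and "\<exists>e0\<in>carrier E. \<forall>r\<in>m. g r = r \<odot>\<^bsub>E\<^esub> e0"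
        using big[OF ea(3,1,2) _ a m'] big[OF eb(3,1,2) _ b m'] by blast+
      then obtain e0 where e0: "e0 \<in> carrier E" "\<And>r. r \<in> m \<Longrightarrow> g r = r \<odot>\<^bsub>E\<^esub> e0" by blast
      have triv: "killed E m \<subseteq> {\<zero>\<^bsub>E\<^esub>}" using cond e0 by blast
      \<comment> \<open>As \<open>g\<close> is multiplication by \<open>e0\<close>, the pushout
        splits as \<open>E\<close> and a copy of \<open>Z/m\<close> spanned by \<open>?w\<close>.
        Since \<open>E\<close> has no elements killed by \<open>m\<close> besides zero, this copy is
        all of the socle at \<open>m\<close>.\<close>
      let ?w = "q (\<ominus>\<^bsub>E\<^esub> e0, \<one>\<^bsub>Z\<^esub>)"
      have wc: "?w \<in> carrier E'" using qc e0 by simp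
      have wk: "r \<odot>\<^bsub>E'\<^esub> ?w = \<zero>\<^bsub>E'\<^esub>" if r: "r \<in> m" for r
      proof -
        have rc: "r \<in> carrier Z" by (rule mc[OF r])
        have "r \<odot>\<^bsub>E'\<^esub> ?w = q (\<ominus>\<^bsub>E\<^esub> (r \<odot>\<^bsub>E\<^esub> e0), r)"
          using rc e0(1) by (simp add: qact E.act_neg_right)
        also have "\<dots> = \<zero>\<^bsub>E'\<^esub>" using qzero[of "\<ominus>\<^bsub>E\<^esub> (r \<odot>\<^bsub>E\<^esub> e0)" r] rc r e0 E.act_closed[OF rc e0(1)] by simp
        finally show ?thesis .
      qed
      have mult: "v = s \<odot>\<^bsub>E'\<^esub> ?w" if v: "v = q (e, s)" "e \<in> carrier E" "s \<in> carrier Z" "v \<in> killed E' m" for v e s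
      proof -
        have se: "s \<odot>\<^bsub>E\<^esub> e0 \<in> carrier E" by (rule E.act_closed[OF v(3) e0(1)])
        have "e \<oplus>\<^bsub>E\<^esub> s \<odot>\<^bsub>E\<^esub> e0 \<in> killed E m"
        proof (rule killedI)
          show "e \<oplus>\<^bsub>E\<^esub> s \<odot>\<^bsub>E\<^esub> e0 \<in> carrier E" using v se by simp
          fix r assume r: "r \<in> m"
          have rc: "r \<in> carrier Z" by (rule mc[OF r])
          have sr: "s \<otimes>\<^bsub>Z\<^esub> r \<in> m" by (rule m.I_l_closed[OF r v(3)])
          have "q (r \<odot>\<^bsub>E\<^esub> e, s \<otimes>\<^bsub>Z\<^esub> r) = \<zero>\<^bsub>E'\<^esub>" using killedD(2)[OF v(4) r] qact[OF rc v(2,3)] v(1) by simp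
          then have "r \<odot>\<^bsub>E\<^esub> e = \<ominus>\<^bsub>E\<^esub> g (s \<otimes>\<^bsub>Z\<^esub> r)"
            using qzero[of "r \<odot>\<^bsub>E\<^esub> e" "s \<otimes>\<^bsub>Z\<^esub> r"] rc v E.act_closed by simp
          also have "g (s \<otimes>\<^bsub>Z\<^esub> r) = r \<odot>\<^bsub>E\<^esub> (s \<odot>\<^bsub>E\<^esub> e0)"
            using e0(2)[OF sr] E.act_mult[OF v(3) rc e0(1)] by simp
          finally show "r \<odot>\<^bsub>E\<^esub> (e \<oplus>\<^bsub>E\<^esub> s \<odot>\<^bsub>E\<^esub> e0) = \<zero>\<^bsub>E\<^esub>"
            using E.act_add_mod[OF rc v(2) se] E.act_closed[OF rc se] by (simp add: E.M.l_neg)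
        qed
        then have "e \<oplus>\<^bsub>E\<^esub> s \<odot>\<^bsub>E\<^esub> e0 = \<zero>\<^bsub>E\<^esub>" using triv by blast
        then have "e = \<ominus>\<^bsub>E\<^esub> (s \<odot>\<^bsub>E\<^esub> e0)" using v(2) se by (metis E.M.minus_equality)
        then show ?thesis using qact[OF v(3), of "\<ominus>\<^bsub>E\<^esub> e0" "\<one>\<^bsub>Z\<^esub>"] v e0(1) by (simp add: E.act_neg_right)
      qed
      have aw: "a = sa \<odot>\<^bsub>E'\<^esub> ?w" and bw: "b = sb \<odot>\<^bsub>E'\<^esub> ?w"
        using mult[OF ea(3,1,2)] mult[OF eb(3,1,2)] a b mm by simp_all
      have "sa \<notin> m" using a0 aw wk by auto
      then obtain t u where tu: "t \<in> carrier Z" "u \<in> m" "t \<otimes>\<^bsub>Z\<^esub> sa \<oplus>\<^bsub>Z\<^esub> u = \<one>\<^bsub>Z\<^esub>"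
        using maximal_unit_mod[OF m ea(2)] by blast
      have uc: "u \<in> carrier Z" by (rule mc[OF tu(2)])
      have "?w = (t \<otimes>\<^bsub>Z\<^esub> sa \<oplus>\<^bsub>Z\<^esub> u) \<odot>\<^bsub>E'\<^esub> ?w" unfolding tu(3) by (simp add: E'.act_one wc)
      also have "\<dots> = t \<odot>\<^bsub>E'\<^esub> a"
        using tu(1) uc ea(2) wc wk[OF tu(2)] E'.act_swap[OF tu(1) ea(2) wc]
        by (simp add: E'.act_add_ring E'.act_mult E'.act_closed aw)
      finally have "b = (t \<otimes>\<^bsub>Z\<^esub> sb) \<odot>\<^bsub>E'\<^esub> a"
        using bw E'.act_mult[OF tu(1) eb(2) killedD(1)[OF a]] by simp
      then show ?thesis using tu(1) eb(2) by blast
    qed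
  qed
  then show thesis using that[OF E' _ j inj nsurj] by blast
qed

definition zero_module :: "('a, 'm) module" where
  "zero_module = \<lparr>carrier = {undefined}, mult = undefined, one = undefined, zero = undefined,
     add = (\<lambda>_ _. undefined), smult = (\<lambda>_ _. undefined)\<rparr>"

lemma right_module_zero: "ring \<Lambda> \<Longrightarrow> right_module \<Lambda> zero_module"
  by (intro right_module.intro right_module_axioms.intro abelian_groupI) (auto simp: zero_module_def)

text \<open>The module \<open>E\<close> is chosen with the largest value of the measure from
  \<open>socle_measure\<close> for \<open>I = Z\<close>, which exists because the measure is
  bounded. An embedding of \<open>E\<close> into a competitor preserves this value and is then onto,
  as nothing but zero is killed by \<open>1\<close>. So neither defect covered by
  \<open>socle_extension\<close> can occur.\<close>

theorem dualising_module_exists: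
  assumes art: "commutative_artinian_ring Z"
    and inf: "infinite (UNIV :: 'm set)" and i: "inj_on (i :: 'a \<Rightarrow> 'm) (carrier Z)"
  obtains E :: "('a, 'm) module" where "dualising_module Z E"
proof -
  have Z: "cring Z" using art unfolding commutative_artinian_ring_def by blast
  interpret cring Z by (rule Z)
  obtain \<mu> :: "('a, 'm) module \<Rightarrow> nat" and B where
    \<mu>: "\<forall>E. right_module Z E \<and> simple_socles Z E \<longrightarrow>
     \<mu> E \<le> B \<and> (\<forall>E' j. right_module Z E' \<and> simple_socles Z E' \<and> j \<in> right_hom Z E E' \<and> inj_on j (carrier E) \<longrightarrow>
       \<mu> E \<le> \<mu> E' \<and> (\<mu> E = \<mu> E' \<longrightarrow> (\<forall>e'\<in>carrier E'. \<exists>e\<in>carrier E. e' \<ominus>\<^bsub>E'\<^esub> j e \<in> killed E' (carrier Z))))"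
    using socle_measure[OF Z artinian_finite_length[OF art]] by (elim exE)
  define S where "S = {E :: ('a, 'm) module. right_module Z E \<and> simple_socles Z E}"
  have "zero_module \<in> S"
    using right_module_zero[OF ring_axioms] unfolding S_def simple_socles_def killed_def by (auto simp: zero_module_def)
  moreover have fin: "finite (\<mu> ` S)" by (rule finite_subset[of _ "{..B}"]) (use \<mu> in \<open>auto simp: S_def\<close>)
  ultimately have "Max (\<mu> ` S) \<in> \<mu> ` S" by (intro Max_in) auto
  then obtain E where E: "E \<in> S" "\<mu> E = Max (\<mu> ` S)" by (metis imageE)
  have max: "\<mu> E' \<le> \<mu> E" if "E' \<in> S" for E' using fin that by (simp add: E(2))
  have Er: "right_module Z E" and Es: "simple_socles Z E" using E(1) by (simp_all add: S_def)
  interpret E: right_module Z E by (rule Er)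
  have no_ext: "j ` carrier E = carrier E'"
    if E': "right_module Z E'" "simple_socles Z E'" and j: "j \<in> right_hom Z E E'" and inj: "inj_on j (carrier E)"
    for E' :: "('a, 'm) module" and j
  proof -
    interpret E': right_module Z E' by (rule E'(1))
    have 1: "\<mu> E \<le> \<mu> E' \<and> (\<mu> E = \<mu> E' \<longrightarrow> (\<forall>e'\<in>carrier E'. \<exists>e\<in>carrier E. e' \<ominus>\<^bsub>E'\<^esub> j e \<in> killed E' (carrier Z)))"
      using \<mu>[THEN spec, of E] Er Es E' j inj by simp
    then have "\<mu> E = \<mu> E'" using max[of E'] E' by (simp add: S_def)
    then have *: "\<exists>e\<in>carrier E. e' \<ominus>\<^bsub>E'\<^esub> j e \<in> killed E' (carrier Z)" if "e' \<in> carrier E'" for e' using 1 that by blast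
    have "e' \<in> j ` carrier E" if e': "e' \<in> carrier E'" for e'
    proof -
      obtain e where e: "e \<in> carrier E" "e' \<ominus>\<^bsub>E'\<^esub> j e \<in> killed E' (carrier Z)" using *[OF e'] by blast
      have jc: "j e \<in> carrier E'" by (rule right_homD(1)[OF j e(1)])
      have "e' \<ominus>\<^bsub>E'\<^esub> j e = \<zero>\<^bsub>E'\<^esub>"
        using killedD(2)[OF e(2) one_closed] e' jc by (simp add: E'.act_one)
      then have "e' = \<ominus>\<^bsub>E'\<^esub> (\<ominus>\<^bsub>E'\<^esub> j e)"
        using e' jc unfolding E'.M.minus_eq by (intro E'.M.minus_equality[symmetric]) simp_all
      then show ?thesis using jc e(1) by simp
    qed
    then show ?thesis using right_homD(1)[OF j] by blast
  qed
  have both: "(\<exists>e\<in>carrier E. \<forall>r\<in>m. g r = r \<odot>\<^bsub>E\<^esub> e) \<and> \<not> killed E m \<subseteq> {\<zero>\<^bsub>E\<^esub>}"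
    if m: "maximalideal m Z" and g: "linear_on Z (regular_module Z) m E g" for m g
  proof (rule ccontr)
    assume "\<not> ?thesis"
    then have cond: "\<not> (\<exists>e\<in>carrier E. \<forall>r\<in>m. g r = r \<odot>\<^bsub>E\<^esub> e) \<or> killed E m \<subseteq> {\<zero>\<^bsub>E\<^esub>}" by blast
    show False
      by (rule socle_extension[OF Z inf i Er Es m g cond]) (use no_ext in blast)
  qed
  have "\<exists>e\<in>killed E m. e \<noteq> \<zero>\<^bsub>E\<^esub>" if m: "maximalideal m Z" for m
  proof -
    \<comment> \<open>The zero map on \<open>m\<close> is used to enter \<open>both\<close>, whose
      second half is the nonzero socle at \<open>m\<close>.\<close>
    have "linear_on Z (regular_module Z) m E (\<lambda>_. \<zero>\<^bsub>E\<^esub>)"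
      by (simp add: linear_on_def E.act_zero_right)
    then show ?thesis using both[OF m] by blast
  qed
  then have "dualising_module Z E" unfolding dualising_module_def using Er Es both by blast
  then show thesis by (rule that)
qed

section \<open>Matlis duality\<close>

locale matlis = cring Z for Z :: "('a, 'y) ring_scheme" +
  fixes E :: "('a, 'e) module"
  assumes dualising: "dualising_module Z E"
begin

sublocale E: comm_module Z E
  using dualising unfolding dualising_module_def by (intro comm_module.intro cring_axioms) blast

section \<open>Injectivity and separation of points\<close>

lemma baer: "\<lbrakk>maximalideal m Z; linear_on Z (regular_module Z) m E g\<rbrakk>
    \<Longrightarrow> \<exists>e\<in>carrier E. \<forall>r\<in>m. g r = r \<odot>\<^bsub>E\<^esub> e"
  and socle_nonzero: "maximalideal m Z \<Longrightarrow> \<exists>e\<in>killed E m. e \<noteq> \<zero>\<^bsub>E\<^esub>"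
  and socle_simple: "\<lbrakk>maximalideal m Z; a \<in> killed E m; b \<in> killed E m; a \<noteq> \<zero>\<^bsub>E\<^esub>\<rbrakk>
    \<Longrightarrow> \<exists>t\<in>carrier Z. b = t \<odot>\<^bsub>E\<^esub> a"
  using dualising unfolding dualising_module_def simple_socles_def by blast+

text \<open>Two representations of an element of \<open>L + Z x\<close> differ by a multiple of
  \<open>x\<close> that lies in \<open>L\<close>. On such multiples \<open>F\<close> and
  \<open>e\<close> agree by assumption, so prescribing the value \<open>e\<close> at
  \<open>x\<close> is consistent.\<close>

lemma extend_linear:
  assumes M: "right_module Z M" and L: "submod Z M L" and x: "x \<in> carrier M"
    and F: "linear_on Z M L E F" and e: "e \<in> carrier E"
    and compat: "\<forall>r\<in>carrier Z. r \<odot>\<^bsub>M\<^esub> x \<in> L \<longrightarrow> F (r \<odot>\<^bsub>M\<^esub> x) = r \<odot>\<^bsub>E\<^esub> e"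
  shows "\<exists>F'. linear_on Z M (adjoin Z M L x) E F' \<and>
    (\<forall>l\<in>L. \<forall>r\<in>carrier Z. F' (l \<oplus>\<^bsub>M\<^esub> r \<odot>\<^bsub>M\<^esub> x) = F l \<oplus>\<^bsub>E\<^esub> r \<odot>\<^bsub>E\<^esub> e)"
proof -
  interpret M: comm_module Z M by (intro comm_module.intro M cring_axioms)
  note D = M.submodD[OF L] and FD = linear_onD[OF F]
  define F' where "F' y = (SOME v. \<exists>l\<in>L. \<exists>r\<in>carrier Z. y = l \<oplus>\<^bsub>M\<^esub> r \<odot>\<^bsub>M\<^esub> x \<and> v = F l \<oplus>\<^bsub>E\<^esub> r \<odot>\<^bsub>E\<^esub> e)" for y
  have wd: "F l \<oplus>\<^bsub>E\<^esub> r \<odot>\<^bsub>E\<^esub> e = F k \<oplus>\<^bsub>E\<^esub> s \<odot>\<^bsub>E\<^esub> e"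
    if lr: "l \<in> L" "r \<in> carrier Z" and ks: "k \<in> L" "s \<in> carrier Z"
      and eq: "l \<oplus>\<^bsub>M\<^esub> r \<odot>\<^bsub>M\<^esub> x = k \<oplus>\<^bsub>M\<^esub> s \<odot>\<^bsub>M\<^esub> x" for l r k s
  proof -
    have c: "l \<in> carrier M" "k \<in> carrier M" "r \<odot>\<^bsub>M\<^esub> x \<in> carrier M" "s \<odot>\<^bsub>M\<^esub> x \<in> carrier M"
      using D(1) lr ks x M.act_closed by auto
    have "(s \<ominus>\<^bsub>Z\<^esub> r) \<odot>\<^bsub>M\<^esub> x = s \<odot>\<^bsub>M\<^esub> x \<ominus>\<^bsub>M\<^esub> r \<odot>\<^bsub>M\<^esub> x"
      using lr ks x by (simp add: minus_eq M.M.minus_eq M.act_add_ring M.act_neg_left)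
    also have "\<dots> = l \<ominus>\<^bsub>M\<^esub> k"
    proof -
      have "s \<odot>\<^bsub>M\<^esub> x = \<ominus>\<^bsub>M\<^esub> k \<oplus>\<^bsub>M\<^esub> (k \<oplus>\<^bsub>M\<^esub> s \<odot>\<^bsub>M\<^esub> x)" using c by (simp add: M.M.r_neg1)
      also have "\<dots> = \<ominus>\<^bsub>M\<^esub> k \<oplus>\<^bsub>M\<^esub> (l \<oplus>\<^bsub>M\<^esub> r \<odot>\<^bsub>M\<^esub> x)" by (simp only: eq)
      finally show ?thesis
        using c by (simp only: M.M.minus_eq M.M.a_assoc M.M.r_neg M.M.a_inv_closed M.M.a_closed M.M.r_zero)
          (simp add: M.M.a_comm)
    qed
    finally have d: "(s \<ominus>\<^bsub>Z\<^esub> r) \<odot>\<^bsub>M\<^esub> x = l \<ominus>\<^bsub>M\<^esub> k" .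
    have lk: "l \<ominus>\<^bsub>M\<^esub> k \<in> L" by (rule D(6)[OF lr(1) ks(1)])
    have "F l = F (k \<oplus>\<^bsub>M\<^esub> (l \<ominus>\<^bsub>M\<^esub> k))" using c by (simp add: M.M.minus_eq M.M.a_lcomm[of k l] M.M.r_neg)
    also have "\<dots> = F k \<oplus>\<^bsub>E\<^esub> (s \<ominus>\<^bsub>Z\<^esub> r) \<odot>\<^bsub>E\<^esub> e"
      using compat[rule_format, of "s \<ominus>\<^bsub>Z\<^esub> r"] d lk lr(2) ks(2) FD(2)[OF ks(1) lk] by simp
    also have "\<dots> = F k \<oplus>\<^bsub>E\<^esub> (s \<odot>\<^bsub>E\<^esub> e \<oplus>\<^bsub>E\<^esub> \<ominus>\<^bsub>E\<^esub> (r \<odot>\<^bsub>E\<^esub> e))"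
      using lr ks e by (simp add: minus_eq E.act_add_ring E.act_neg_left)
    finally show ?thesis
      using FD(1)[OF ks(1)] E.act_closed[OF lr(2) e] E.act_closed[OF ks(2) e]
      by (simp add: E.M.a_assoc E.M.l_neg)
  qed
  have F': "F' (l \<oplus>\<^bsub>M\<^esub> r \<odot>\<^bsub>M\<^esub> x) = F l \<oplus>\<^bsub>E\<^esub> r \<odot>\<^bsub>E\<^esub> e" if lr: "l \<in> L" "r \<in> carrier Z" for l r
  proof -
    have "\<exists>k\<in>L. \<exists>s\<in>carrier Z. l \<oplus>\<^bsub>M\<^esub> r \<odot>\<^bsub>M\<^esub> x = k \<oplus>\<^bsub>M\<^esub> s \<odot>\<^bsub>M\<^esub> x \<and> F' (l \<oplus>\<^bsub>M\<^esub> r \<odot>\<^bsub>M\<^esub> x) = F k \<oplus>\<^bsub>E\<^esub> s \<odot>\<^bsub>E\<^esub> e"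
      unfolding F'_def by (rule someI[of _ "F l \<oplus>\<^bsub>E\<^esub> r \<odot>\<^bsub>E\<^esub> e"]) (intro bexI[of _ l] bexI[of _ r] conjI refl lr)
    then obtain k s where ks: "k \<in> L" "s \<in> carrier Z" "l \<oplus>\<^bsub>M\<^esub> r \<odot>\<^bsub>M\<^esub> x = k \<oplus>\<^bsub>M\<^esub> s \<odot>\<^bsub>M\<^esub> x"
      "F' (l \<oplus>\<^bsub>M\<^esub> r \<odot>\<^bsub>M\<^esub> x) = F k \<oplus>\<^bsub>E\<^esub> s \<odot>\<^bsub>E\<^esub> e" by blast
    show ?thesis unfolding ks(4) by (rule wd[OF lr ks(1,2,3), symmetric])
  qed
  have "linear_on Z M (adjoin Z M L x) E F'"
    unfolding linear_on_def
  proof (intro conjI ballI)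
    show "F' \<in> adjoin Z M L x \<rightarrow> carrier E"
      using F' FD(1) E.act_closed[OF _ e] by (auto simp: adjoin_def)
    fix a assume "a \<in> adjoin Z M L x"
    then obtain l r where a: "l \<in> L" "r \<in> carrier Z" "a = l \<oplus>\<^bsub>M\<^esub> r \<odot>\<^bsub>M\<^esub> x" unfolding adjoin_def by blast
    note ac = D(1)[OF a(1)] M.act_closed[OF a(2) x] E.act_closed[OF a(2) e] FD(1)[OF a(1)]
    {
      fix b assume "b \<in> adjoin Z M L x"
      then obtain k s where b: "k \<in> L" "s \<in> carrier Z" "b = k \<oplus>\<^bsub>M\<^esub> s \<odot>\<^bsub>M\<^esub> x" unfolding adjoin_def by blast
      note bc = D(1)[OF b(1)] M.act_closed[OF b(2) x] E.act_closed[OF b(2) e] FD(1)[OF b(1)]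
      have "a \<oplus>\<^bsub>M\<^esub> b = (l \<oplus>\<^bsub>M\<^esub> k) \<oplus>\<^bsub>M\<^esub> (r \<oplus>\<^bsub>Z\<^esub> s) \<odot>\<^bsub>M\<^esub> x"
        unfolding a(3) b(3) using ac bc a(2) b(2) x by (simp add: M.act_add_ring M.M.a_ac)
      then have "F' (a \<oplus>\<^bsub>M\<^esub> b) = (F l \<oplus>\<^bsub>E\<^esub> F k) \<oplus>\<^bsub>E\<^esub> (r \<oplus>\<^bsub>Z\<^esub> s) \<odot>\<^bsub>E\<^esub> e"
        using F'[OF D(3)[OF a(1) b(1)], of "r \<oplus>\<^bsub>Z\<^esub> s"] a(2) b(2) FD(2)[OF a(1) b(1)] by simp
      also have "\<dots> = F' a \<oplus>\<^bsub>E\<^esub> F' b"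
        unfolding a(3) b(3) F'[OF a(1,2)] F'[OF b(1,2)]
        using ac bc a(2) b(2) e by (simp add: E.act_add_ring E.M.a_ac)
      finally show "F' (a \<oplus>\<^bsub>M\<^esub> b) = F' a \<oplus>\<^bsub>E\<^esub> F' b" .
    }
    fix c assume c: "c \<in> carrier Z"
    have "c \<odot>\<^bsub>M\<^esub> a = c \<odot>\<^bsub>M\<^esub> l \<oplus>\<^bsub>M\<^esub> (r \<otimes>\<^bsub>Z\<^esub> c) \<odot>\<^bsub>M\<^esub> x"
      unfolding a(3) using ac a(2) c x by (simp add: M.act_add_mod M.act_mult)
    then show "F' (c \<odot>\<^bsub>M\<^esub> a) = c \<odot>\<^bsub>E\<^esub> F' a"
      using F'[OF D(4)[OF c a(1)], of "r \<otimes>\<^bsub>Z\<^esub> c"] F'[OF a(1,2)] a(2,3) c ac e FD(3)[OF c a(1)]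
      by (simp add: E.act_mult E.act_add_mod)
  qed
  then show ?thesis using F' by (intro exI[of _ F'] conjI ballI)
qed

lemma extend_linear_agrees:
  assumes M: "right_module Z M" and L: "submod Z M L" and x: "x \<in> carrier M" and F: "linear_on Z M L E F"
    and F': "\<forall>l\<in>L. \<forall>r\<in>carrier Z. F' (l \<oplus>\<^bsub>M\<^esub> r \<odot>\<^bsub>M\<^esub> x) = F l \<oplus>\<^bsub>E\<^esub> r \<odot>\<^bsub>E\<^esub> e"
    and e: "e \<in> carrier E" and l: "l \<in> L"
  shows "F' l = F l"
proof -
  interpret M: right_module Z M by fact
  show ?thesis
    using F'[rule_format, OF l zero_closed] M.submodD(1)[OF L l] linear_onD(1)[OF F l] x e
    by (simp add: M.act_zero_left E.act_zero_left)
qed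

text \<open>Induction along the series of \<open>K\<close>, with a growing domain \<open>L\<close>
  that contains \<open>N\<close>. When \<open>x\<close> is not yet in \<open>L\<close>, the scalars
  that move \<open>x\<close> into \<open>L\<close> are exactly those of \<open>m\<close>; a value at
  \<open>x\<close> compatible with them is what Baer's criterion for \<open>m\<close>
  provides.\<close>

lemma extend_to_finite_length:
  assumes M: "right_module Z M" and "finite_length Z M K" and N: "submod Z M N" and f: "linear_on Z M N E f"
  shows "\<exists>L F. submod Z M L \<and> N \<subseteq> L \<and> K \<subseteq> L \<and> linear_on Z M L E F \<and> (\<forall>x\<in>N. F x = f x)"
  using assms(2)
proof (induction rule: finite_length.induct)
  case zero
  interpret M: right_module Z M by (rule M)
  show ?case using M.submodD(2)[OF N] N f by blast
next
  case (step K x m)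
  interpret M: comm_module Z M by (intro comm_module.intro M cring_axioms)
  interpret m: maximalideal m Z by (rule step(3))
  obtain L F where L: "submod Z M L" "N \<subseteq> L" "K \<subseteq> L" and F: "linear_on Z M L E F" "\<forall>x\<in>N. F x = f x"
    using step(5) by blast
  note D = M.submodD[OF L(1)] and FD = linear_onD[OF F(1)]
  have mx: "r \<odot>\<^bsub>M\<^esub> x \<in> L" if "r \<in> m" for r using step(4)[OF that] L(3) by blast
  show ?case
  proof (cases "x \<in> L")
    case True
    have "adjoin Z M K x \<subseteq> L"
    proof
      fix w assume "w \<in> adjoin Z M K x"
      then obtain k r where "k \<in> K" "r \<in> carrier Z" "w = k \<oplus>\<^bsub>M\<^esub> r \<odot>\<^bsub>M\<^esub> x" unfolding adjoin_def by blast
      then show "w \<in> L" using L(3) True by (auto intro!: D(3,4))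
    qed
    then show ?thesis using L F by blast
  next
    case False
    have "linear_on Z (regular_module Z) m E (\<lambda>r. F (r \<odot>\<^bsub>M\<^esub> x))"
      unfolding linear_on_def
    proof (intro conjI ballI)
      show "(\<lambda>r. F (r \<odot>\<^bsub>M\<^esub> x)) \<in> m \<rightarrow> carrier E" using FD(1) mx by auto
      fix r assume r: "r \<in> m"
      show "F ((r \<oplus>\<^bsub>regular_module Z\<^esub> s) \<odot>\<^bsub>M\<^esub> x) = F (r \<odot>\<^bsub>M\<^esub> x) \<oplus>\<^bsub>E\<^esub> F (s \<odot>\<^bsub>M\<^esub> x)" if s: "s \<in> m" for s
        using FD(2)[OF mx[OF r] mx[OF s]] m.Icarr[OF r] m.Icarr[OF s] step(2) by (simp add: M.act_add_ring)
      show "F ((a \<odot>\<^bsub>regular_module Z\<^esub> r) \<odot>\<^bsub>M\<^esub> x) = a \<odot>\<^bsub>E\<^esub> F (r \<odot>\<^bsub>M\<^esub> x)" if a: "a \<in> carrier Z" for a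
        using FD(3)[OF a mx[OF r]] m.Icarr[OF r] a step(2) by (simp add: M.act_mult)
    qed
    then obtain e where e: "e \<in> carrier E" "\<And>r. r \<in> m \<Longrightarrow> F (r \<odot>\<^bsub>M\<^esub> x) = r \<odot>\<^bsub>E\<^esub> e"
      using baer[OF step(3)] by blast
    have inm: "r \<in> m" if r: "r \<in> carrier Z" "r \<odot>\<^bsub>M\<^esub> x \<in> L" for r
    proof (rule ccontr)
      assume "r \<notin> m"
      then obtain t u where tu: "t \<in> carrier Z" "u \<in> m" "t \<otimes>\<^bsub>Z\<^esub> r \<oplus>\<^bsub>Z\<^esub> u = \<one>\<^bsub>Z\<^esub>"
        using maximal_unit_mod[OF step(3) r(1)] by blast
      have uc: "u \<in> carrier Z" by (rule m.Icarr[OF tu(2)])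
      have "x = (t \<otimes>\<^bsub>Z\<^esub> r \<oplus>\<^bsub>Z\<^esub> u) \<odot>\<^bsub>M\<^esub> x" unfolding tu(3) using step(2) by (simp add: M.act_one)
      also have "\<dots> = t \<odot>\<^bsub>M\<^esub> (r \<odot>\<^bsub>M\<^esub> x) \<oplus>\<^bsub>M\<^esub> u \<odot>\<^bsub>M\<^esub> x"
        using tu(1) uc r(1) step(2) M.act_swap[OF tu(1) r(1) step(2)] by (simp add: M.act_add_ring M.act_mult)
      also have "\<dots> \<in> L" by (intro D(3,4) tu(1) r mx tu(2))
      finally show False using False by blast
    qed
    have compat: "\<forall>r\<in>carrier Z. r \<odot>\<^bsub>M\<^esub> x \<in> L \<longrightarrow> F (r \<odot>\<^bsub>M\<^esub> x) = r \<odot>\<^bsub>E\<^esub> e"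
      using e(2) inm by simp
    obtain F' where F': "linear_on Z M (adjoin Z M L x) E F'"
      "\<forall>l\<in>L. \<forall>r\<in>carrier Z. F' (l \<oplus>\<^bsub>M\<^esub> r \<odot>\<^bsub>M\<^esub> x) = F l \<oplus>\<^bsub>E\<^esub> r \<odot>\<^bsub>E\<^esub> e"
      using extend_linear[OF M L(1) step(2) F(1) e(1) compat] by (elim exE conjE)
    have "F' y = f y" if "y \<in> N" for y
      using extend_linear_agrees[OF M L(1) step(2) F(1) F'(2) e(1)] L(2) F(2) that by auto
    moreover have "adjoin Z M K x \<subseteq> adjoin Z M L x" using L(3) unfolding adjoin_def by blast
    moreover have "N \<subseteq> adjoin Z M L x" using M.adjoin_sub[OF L(1) step(2)] L(2) by blast
    ultimately show ?thesis using M.submod_adjoin[OF L(1) step(2)] F'(1) by blast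
  qed
qed

lemma injective:
  assumes M: "right_module Z M" and fl: "finite_length Z M (carrier M)" and N: "submod Z M N" and f: "linear_on Z M N E f"
  shows "\<exists>h\<in>right_hom Z M E. \<forall>x\<in>N. h x = f x"
proof -
  interpret M: right_module Z M by (rule M)
  obtain L F where L: "submod Z M L" "carrier M \<subseteq> L" "linear_on Z M L E F" "\<forall>x\<in>N. F x = f x"
    using extend_to_finite_length[OF M fl N f] by blast
  then have "L = carrier M" using M.submodD(1) by blast
  then have "(\<lambda>x\<in>carrier M. F x) \<in> right_hom Z M E"
    using L(3) by (intro right_homI) (auto simp: linear_on_def M.act_closed)
  then show ?thesis using L(4) M.submodD(1)[OF N] by (intro bexI[of _ "\<lambda>x\<in>carrier M. F x"]) auto
qed

text \<open>The annihilator of \<open>x\<close> lies in some maximal ideal \<open>m\<close>. Sending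
  \<open>x\<close> to a nonzero element of \<open>E\<close> killed by \<open>m\<close> is well
  defined on \<open>Z x\<close>, and the map extends to \<open>M\<close> by injectivity.\<close>

lemma separates_points:
  assumes M: "right_module Z M" and fl: "finite_length Z M (carrier M)" and x: "x \<in> carrier M" "x \<noteq> \<zero>\<^bsub>M\<^esub>"
  obtains h where "h \<in> right_hom Z M E" "h x \<noteq> \<zero>\<^bsub>E\<^esub>"
proof -
  interpret M: comm_module Z M by (intro comm_module.intro M cring_axioms)
  let ?I = "{r \<in> carrier Z. r \<odot>\<^bsub>M\<^esub> x = \<zero>\<^bsub>M\<^esub>}"
  have "submod Z (regular_module Z) ?I"
    using x(1) by (auto simp: submod_def M.act_zero_left M.act_add_ring M.act_mult M.act_zero_right)
  then have "ideal ?I Z" by (simp add: submod_regular_iff)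
  moreover have "\<one>\<^bsub>Z\<^esub> \<notin> ?I" using x by (simp add: M.act_one)
  ultimately obtain m where m: "maximalideal m Z" "?I \<subseteq> m" by (rule maximal_ideal_exists)
  obtain e where e: "e \<in> killed E m" "e \<noteq> \<zero>\<^bsub>E\<^esub>" using socle_nonzero[OF m(1)] by blast
  have ec: "e \<in> carrier E" by (rule killedD(1)[OF e(1)])
  have z: "submod Z M {\<zero>\<^bsub>M\<^esub>}" by (simp add: submod_def M.act_zero_right)
  have lz: "linear_on Z M {\<zero>\<^bsub>M\<^esub>} E (\<lambda>_. \<zero>\<^bsub>E\<^esub>)" by (simp add: linear_on_def E.act_zero_right)
  have compat: "\<forall>r\<in>carrier Z. r \<odot>\<^bsub>M\<^esub> x \<in> {\<zero>\<^bsub>M\<^esub>} \<longrightarrow> \<zero>\<^bsub>E\<^esub> = r \<odot>\<^bsub>E\<^esub> e"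
    using killedD(2)[OF e(1)] m(2) by auto
  obtain F where F: "linear_on Z M (adjoin Z M {\<zero>\<^bsub>M\<^esub>} x) E F"
    "\<forall>l\<in>{\<zero>\<^bsub>M\<^esub>}. \<forall>r\<in>carrier Z. F (l \<oplus>\<^bsub>M\<^esub> r \<odot>\<^bsub>M\<^esub> x) = \<zero>\<^bsub>E\<^esub> \<oplus>\<^bsub>E\<^esub> r \<odot>\<^bsub>E\<^esub> e"
    using extend_linear[OF M z x(1) lz ec compat] by (elim exE conjE)
  obtain h where h: "h \<in> right_hom Z M E" "\<forall>y\<in>adjoin Z M {\<zero>\<^bsub>M\<^esub>} x. h y = F y"
    using injective[OF M fl M.submod_adjoin[OF z x(1)] F(1)] by (elim bexE)
  have "h x = e"
    using h(2)[rule_format, OF M.adjoin_self[OF z x(1)]] F(2)[rule_format, of "\<zero>\<^bsub>M\<^esub>" "\<one>\<^bsub>Z\<^esub>"] x(1) ec by (simp add: M.act_one E.act_one)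
  then show thesis using that[OF h(1)] e(2) by simp
qed

text \<open>The dual of the quotient of \<open>M\<close> by \<open>K\<close>, as a part of the dual
  of \<open>M\<close>.\<close>

definition perp :: "('a, 'm) module \<Rightarrow> 'm set \<Rightarrow> ('m \<Rightarrow> 'e) set" where
  "perp M K = {f \<in> right_hom Z M E. \<forall>x\<in>K. f x = \<zero>\<^bsub>E\<^esub>}"

end

text \<open>Scalars act through the argument, because \<Lambda> acts on \<open>M\<close> and not on
  \<open>E\<close>. For scalars of \<open>Z\<close> and linear \<open>f\<close> this agrees with the
  action on values, see \<open>dual_act\<close>.\<close>

definition dual_module :: "('a, 'y) ring_scheme \<Rightarrow> ('a, 'm) module \<Rightarrow> ('a, 'e) module \<Rightarrow> ('a, 'm \<Rightarrow> 'e) module" where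
  "dual_module Z M E = \<lparr>carrier = right_hom Z M E, mult = undefined, one = undefined,
     zero = (\<lambda>x\<in>carrier M. \<zero>\<^bsub>E\<^esub>), add = (\<lambda>f g. \<lambda>x\<in>carrier M. f x \<oplus>\<^bsub>E\<^esub> g x),
     smult = (\<lambda>a f. \<lambda>x\<in>carrier M. f (a \<odot>\<^bsub>M\<^esub> x))\<rparr>"

lemma dual_module_simps [simp]:
  "carrier (dual_module Z M E) = right_hom Z M E" "\<zero>\<^bsub>dual_module Z M E\<^esub> = (\<lambda>x\<in>carrier M. \<zero>\<^bsub>E\<^esub>)"
  "f \<oplus>\<^bsub>dual_module Z M E\<^esub> g = (\<lambda>x\<in>carrier M. f x \<oplus>\<^bsub>E\<^esub> g x)"
  "a \<odot>\<^bsub>dual_module Z M E\<^esub> f = (\<lambda>x\<in>carrier M. f (a \<odot>\<^bsub>M\<^esub> x))"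
  by (simp_all add: dual_module_def)

section \<open>The dual module over the opposite ring\<close>

lemma opposite_ring_simps [simp]:
  "carrier (opposite_ring \<Lambda>) = carrier \<Lambda>" "x \<otimes>\<^bsub>opposite_ring \<Lambda>\<^esub> y = y \<otimes>\<^bsub>\<Lambda>\<^esub> x" "\<one>\<^bsub>opposite_ring \<Lambda>\<^esub> = \<one>\<^bsub>\<Lambda>\<^esub>"
  "\<zero>\<^bsub>opposite_ring \<Lambda>\<^esub> = \<zero>\<^bsub>\<Lambda>\<^esub>" "x \<oplus>\<^bsub>opposite_ring \<Lambda>\<^esub> y = x \<oplus>\<^bsub>\<Lambda>\<^esub> y"
  "opposite_ring (opposite_ring \<Lambda>) = \<Lambda>"
  by (simp_all add: opposite_ring_def)

lemma (in ring) ring_opposite: "ring (opposite_ring R)"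
proof (rule ringI)
  show "abelian_group (opposite_ring R)"
    by (rule abelian_groupI) (simp_all add: a_ac add.l_inv_ex)
  show "monoid (opposite_ring R)" by (rule monoidI) (auto simp: m_assoc)
qed (auto simp: l_distr r_distr)

context central_subring
begin

lemma central_subring_opposite: "central_subring Z (opposite_ring \<Lambda>)"
proof (intro central_subring.intro central_subring_axioms.intro Z.cring_axioms \<Lambda>.ring_opposite)
  fix a b assume "a \<in> carrier Z" "b \<in> carrier Z"
  then show "a \<otimes>\<^bsub>Z\<^esub> b = a \<otimes>\<^bsub>opposite_ring \<Lambda>\<^esub> b"
    using mult_eq[of a b] central[of a b] sub[of b] by simp
next
  fix a x assume "a \<in> carrier Z" "x \<in> carrier (opposite_ring \<Lambda>)"
  then show "a \<otimes>\<^bsub>opposite_ring \<Lambda>\<^esub> x = x \<otimes>\<^bsub>opposite_ring \<Lambda>\<^esub> a"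
    using central[of a x] by simp
qed (simp_all add: sub add_eq one_eq)

lemma right_module_dual:
  assumes M: "right_module \<Lambda> M" and E: "right_module Z E"
  shows "right_module (opposite_ring \<Lambda>) (dual_module Z M E)"
proof -
  interpret M: right_module \<Lambda> M by fact
  interpret E: right_module Z E by fact
  have MZ: "right_module Z M" by (rule right_module_restrict[OF M])
  show ?thesis
  proof (intro right_module.intro right_module_axioms.intro \<Lambda>.ring_opposite)
    show "abelian_group (dual_module Z M E)"
    proof (rule abelian_groupI)
      fix f assume "f \<in> carrier (dual_module Z M E)"
      then show "\<exists>g\<in>carrier (dual_module Z M E). g \<oplus>\<^bsub>dual_module Z M E\<^esub> f = \<zero>\<^bsub>dual_module Z M E\<^esub>"
        using right_hom_neg_closed[OF _ MZ E, of f] right_homD(1)[of f Z M E]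
        by (intro bexI[of _ "\<lambda>x\<in>carrier M. \<ominus>\<^bsub>E\<^esub> f x"]) (simp_all add: fun_eq_iff E.M.l_neg)
    next
      show "\<zero>\<^bsub>dual_module Z M E\<^esub> \<in> carrier (dual_module Z M E)"
        using right_hom_zero_closed[OF MZ E] by simp
    next
      fix f g h assume "f \<in> carrier (dual_module Z M E)" "g \<in> carrier (dual_module Z M E)" "h \<in> carrier (dual_module Z M E)"
      then have f: "f \<in> right_hom Z M E" and g: "g \<in> right_hom Z M E" and h: "h \<in> right_hom Z M E" by simp_all
      show "f \<oplus>\<^bsub>dual_module Z M E\<^esub> g \<in> carrier (dual_module Z M E)"
        using right_hom_add_closed[OF f g MZ E] by simp
      show "f \<oplus>\<^bsub>dual_module Z M E\<^esub> g \<oplus>\<^bsub>dual_module Z M E\<^esub> h = f \<oplus>\<^bsub>dual_module Z M E\<^esub> (g \<oplus>\<^bsub>dual_module Z M E\<^esub> h)"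
        by (simp add: fun_eq_iff E.M.a_assoc right_homD(1)[OF f] right_homD(1)[OF g] right_homD(1)[OF h])
      show "f \<oplus>\<^bsub>dual_module Z M E\<^esub> g = g \<oplus>\<^bsub>dual_module Z M E\<^esub> f"
        by (simp add: fun_eq_iff E.M.a_comm right_homD(1)[OF f] right_homD(1)[OF g])
      show "\<zero>\<^bsub>dual_module Z M E\<^esub> \<oplus>\<^bsub>dual_module Z M E\<^esub> f = f"
        by (rule extensionalityI[of _ "carrier M"]) (simp_all add: right_homD(1)[OF f] right_homD(2)[OF f])
    qed
  next
    fix a f assume a: "a \<in> carrier (opposite_ring \<Lambda>)" and f: "f \<in> carrier (dual_module Z M E)"
    then have a: "a \<in> carrier \<Lambda>" and f: "f \<in> right_hom Z M E" by simp_all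
    have swap: "a \<odot>\<^bsub>M\<^esub> (z \<odot>\<^bsub>M\<^esub> x) = z \<odot>\<^bsub>M\<^esub> (a \<odot>\<^bsub>M\<^esub> x)" if "z \<in> carrier Z" "x \<in> carrier M" for z x
      using M.act_mult[OF sub[OF that(1)] a that(2)] M.act_mult[OF a sub[OF that(1)] that(2)] central[OF that(1) a] by simp
    show "a \<odot>\<^bsub>dual_module Z M E\<^esub> f \<in> carrier (dual_module Z M E)"
      unfolding dual_module_simps
      by (rule right_homI) (use a sub in \<open>auto simp: M.act_closed right_homD[OF f] M.act_add_mod swap\<close>)
  next
    fix a b f assume "a \<in> carrier (opposite_ring \<Lambda>)" "b \<in> carrier (opposite_ring \<Lambda>)" "f \<in> carrier (dual_module Z M E)"
    then have ab: "a \<in> carrier \<Lambda>" "b \<in> carrier \<Lambda>" and f: "f \<in> right_hom Z M E" by simp_all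
    show "(a \<oplus>\<^bsub>opposite_ring \<Lambda>\<^esub> b) \<odot>\<^bsub>dual_module Z M E\<^esub> f =
        a \<odot>\<^bsub>dual_module Z M E\<^esub> f \<oplus>\<^bsub>dual_module Z M E\<^esub> b \<odot>\<^bsub>dual_module Z M E\<^esub> f"
      using ab right_homD(3)[OF f] by (simp add: fun_eq_iff M.act_add_ring M.act_closed)
    show "(a \<otimes>\<^bsub>opposite_ring \<Lambda>\<^esub> b) \<odot>\<^bsub>dual_module Z M E\<^esub> f = b \<odot>\<^bsub>dual_module Z M E\<^esub> (a \<odot>\<^bsub>dual_module Z M E\<^esub> f)"
      using ab by (simp add: fun_eq_iff M.act_mult M.act_closed)
  next
    fix a f g assume "a \<in> carrier (opposite_ring \<Lambda>)" "f \<in> carrier (dual_module Z M E)" "g \<in> carrier (dual_module Z M E)"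
    then show "a \<odot>\<^bsub>dual_module Z M E\<^esub> (f \<oplus>\<^bsub>dual_module Z M E\<^esub> g) =
        a \<odot>\<^bsub>dual_module Z M E\<^esub> f \<oplus>\<^bsub>dual_module Z M E\<^esub> a \<odot>\<^bsub>dual_module Z M E\<^esub> g"
      by (simp add: fun_eq_iff M.act_closed)
  next
    fix f assume "f \<in> carrier (dual_module Z M E)"
    then have f: "f \<in> right_hom Z M E" by simp
    show "\<one>\<^bsub>opposite_ring \<Lambda>\<^esub> \<odot>\<^bsub>dual_module Z M E\<^esub> f = f"
    proof (rule ext)
      fix x
      show "(\<one>\<^bsub>opposite_ring \<Lambda>\<^esub> \<odot>\<^bsub>dual_module Z M E\<^esub> f) x = f x"
        using M.act_one[of x] extensional_arb[OF right_homD(2)[OF f], of x]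
        unfolding dual_module_simps opposite_ring_simps by (cases "x \<in> carrier M") simp_all
    qed
  qed
qed

end

section \<open>Reflexivity and the length of the dual\<close>

context matlis
begin

text \<open>For \<Lambda> equal to \<open>Z\<close>, \<open>right_module_dual\<close> gives a module
  over the opposite of \<open>Z\<close>; in that ring \<open>Z\<close> is again a central subring,
  and one restricts to it.\<close>

lemma comm_module_dual: assumes "right_module Z M" shows "comm_module Z (dual_module Z M E)"
proof -
  interpret S: central_subring Z Z by (rule central_subring_self)
  interpret O: central_subring Z "opposite_ring Z" by (rule S.central_subring_opposite)
  show ?thesis
    by (rule O.comm_module_restrict[OF S.right_module_dual[OF assms E.right_module_axioms]])
qed

lemma perp_adjoin_iff:
  assumes M: "right_module Z M" and K: "submod Z M K" and x: "x \<in> carrier M"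
  shows "f \<in> perp M (adjoin Z M K x) \<longleftrightarrow> f \<in> perp M K \<and> f x = \<zero>\<^bsub>E\<^esub>"
proof -
  interpret M: comm_module Z M by (intro comm_module.intro M cring_axioms)
  show ?thesis
  proof
    assume f: "f \<in> perp M (adjoin Z M K x)"
    then show "f \<in> perp M K \<and> f x = \<zero>\<^bsub>E\<^esub>"
      using M.adjoin_sub[OF K x] M.adjoin_self[OF K x] unfolding perp_def by blast
  next
    assume f: "f \<in> perp M K \<and> f x = \<zero>\<^bsub>E\<^esub>"
    then have fh: "f \<in> right_hom Z M E" and fK: "f k = \<zero>\<^bsub>E\<^esub>" if "k \<in> K" for k
      using that unfolding perp_def by blast+
    have fh: "f \<in> right_hom Z M E" using f unfolding perp_def by blast
    have "f (k \<oplus>\<^bsub>M\<^esub> r \<odot>\<^bsub>M\<^esub> x) = \<zero>\<^bsub>E\<^esub>" if "k \<in> K" "r \<in> carrier Z" for k r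
      using right_homD(3)[OF fh M.submodD(1)[OF K that(1)] M.act_closed[OF that(2) x]]
        right_homD(4)[OF fh that(2) x] fK[OF that(1)] f that(2) by (simp add: E.act_zero_right)
    then show "f \<in> perp M (adjoin Z M K x)" using fh unfolding perp_def adjoin_def by auto
  qed
qed

lemma perp_killed:
  assumes M: "right_module Z M" and K: "submod Z M K" and x: "x \<in> carrier M" and m: "maximalideal m Z"
    and mx: "\<forall>r\<in>m. r \<odot>\<^bsub>M\<^esub> x \<in> K" and f: "f \<in> perp M K"
  shows "f x \<in> killed E m"
proof (rule killedI)
  interpret m: maximalideal m Z by (rule m)
  have fh: "f \<in> right_hom Z M E" using f unfolding perp_def by blast
  show "f x \<in> carrier E" by (rule right_homD(1)[OF fh x])
  show "r \<odot>\<^bsub>E\<^esub> f x = \<zero>\<^bsub>E\<^esub>" if r: "r \<in> m" for r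
    using right_homD(4)[OF fh m.Icarr[OF r] x] mx[rule_format, OF r] f unfolding perp_def by auto
qed

lemma dual_act: "\<lbrakk>f \<in> right_hom Z M E; a \<in> carrier Z; x \<in> carrier M\<rbrakk>
    \<Longrightarrow> (a \<odot>\<^bsub>dual_module Z M E\<^esub> f) x = a \<odot>\<^bsub>E\<^esub> f x"
  by (simp add: right_homD(4))

lemma dual_minus:
  assumes M: "right_module Z M" and f: "f \<in> right_hom Z M E" and g: "g \<in> right_hom Z M E" and x: "x \<in> carrier M"
  shows "(f \<ominus>\<^bsub>dual_module Z M E\<^esub> g) x = f x \<ominus>\<^bsub>E\<^esub> g x"
proof -
  interpret H: comm_module Z "dual_module Z M E" by (rule comm_module_dual[OF M])
  have gc: "g x \<in> carrier E" by (rule right_homD(1)[OF g x])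
  have "\<ominus>\<^bsub>dual_module Z M E\<^esub> g = (\<lambda>x\<in>carrier M. \<ominus>\<^bsub>E\<^esub> g x)"
    by (rule H.M.minus_equality)
      (use g right_hom_neg_closed[OF g M E.right_module_axioms] in
        \<open>auto simp: fun_eq_iff E.M.l_neg right_homD(1)[OF g]\<close>)
  then show ?thesis using x by (simp add: a_minus_def)
qed

text \<open>Surjectivity of evaluation into the double dual, strengthened for induction: a
  functional that vanishes on \<open>perp M K\<close> is evaluation at an element of
  \<open>K\<close>. If the step from \<open>K\<close> to \<open>K + Z x\<close> matters, the map
  \<open>f \<mapsto> f x\<close> embeds the quotient of the two \<open>perp\<close> modules into a
  simple socle, so on \<open>perp M K\<close> the functional is evaluation at some
  \<open>t x\<close>. For \<open>K\<close> the whole of \<open>M\<close> the vanishing condition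
  concerns the zero map alone.\<close>

lemma reflexive:
  assumes M: "right_module Z M" and "finite_length Z M K"
  shows "\<forall>\<theta>\<in>right_hom Z (dual_module Z M E) E. (\<forall>f\<in>perp M K. \<theta> f = \<zero>\<^bsub>E\<^esub>) \<longrightarrow>
    (\<exists>x\<in>K. \<forall>f\<in>right_hom Z M E. \<theta> f = f x)"
  using assms(2)
proof (induction rule: finite_length.induct)
  case zero
  interpret M: comm_module Z M by (intro comm_module.intro M cring_axioms)
  have "f \<zero>\<^bsub>M\<^esub> = \<zero>\<^bsub>E\<^esub>" if "f \<in> right_hom Z M E" for f
    using right_hom_zero[OF M.M.abelian_group_axioms E.M.abelian_group_axioms that] .
  then show ?case by (simp add: perp_def)
next
  case (step K x m)
  interpret M: comm_module Z M by (intro comm_module.intro M cring_axioms)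
  interpret H: comm_module Z "dual_module Z M E" by (rule comm_module_dual[OF M])
  interpret m: maximalideal m Z by (rule step(3))
  have K: "submod Z M K" by (rule M.finite_length_submod[OF step(1)])
  have mx: "\<forall>r\<in>m. r \<odot>\<^bsub>M\<^esub> x \<in> K" using step(4) by blast
  note kill = perp_killed[OF M K step(2,3) mx] and adj = perp_adjoin_iff[OF M K step(2)]
  have ph: "f \<in> right_hom Z M E" if "f \<in> perp M K" for f using that unfolding perp_def by blast
  show ?case
  proof (intro ballI impI)
    fix \<theta> assume th: "\<theta> \<in> right_hom Z (dual_module Z M E) E" and van: "\<forall>f\<in>perp M (adjoin Z M K x). \<theta> f = \<zero>\<^bsub>E\<^esub>"
    note tD = right_homD[OF th, simplified]
    show "\<exists>y\<in>adjoin Z M K x. \<forall>f\<in>right_hom Z M E. \<theta> f = f y"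
    proof (cases "\<forall>f\<in>perp M K. f x = \<zero>\<^bsub>E\<^esub>")
      case True
      then have "\<forall>f\<in>perp M K. \<theta> f = \<zero>\<^bsub>E\<^esub>" using van adj by blast
      then obtain y where "y \<in> K" "\<forall>f\<in>right_hom Z M E. \<theta> f = f y" using step(5) th by blast
      then show ?thesis using M.adjoin_sub[OF K step(2)] by blast
    next
      case False
      then obtain f0 where f0: "f0 \<in> perp M K" "f0 x \<noteq> \<zero>\<^bsub>E\<^esub>" by blast
      have f0h: "f0 \<in> right_hom Z M E" by (rule ph[OF f0(1)])
      \<comment> \<open>\<open>f - t f0\<close> vanishes on \<open>K\<close> and at
        \<open>x\<close>, hence is annihilated by \<theta>. So on \<open>perp M K\<close> both
        \<theta> and evaluation at \<open>x\<close> are governed by their values at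
        \<open>f0\<close>, with the same coefficient.\<close>
      have gen: "\<exists>t\<in>carrier Z. f x = t \<odot>\<^bsub>E\<^esub> f0 x \<and> \<theta> f = t \<odot>\<^bsub>E\<^esub> \<theta> f0" if f: "f \<in> perp M K" for f
      proof -
        have fh: "f \<in> right_hom Z M E" by (rule ph[OF f])
        obtain t where t: "t \<in> carrier Z" "f x = t \<odot>\<^bsub>E\<^esub> f0 x"
          using socle_simple[OF step(3) kill[OF f0(1)] kill[OF f] f0(2)] by blast
        let ?g = "t \<odot>\<^bsub>dual_module Z M E\<^esub> f0"
        have g: "?g \<in> right_hom Z M E" using H.act_closed[OF t(1), of f0] f0h unfolding dual_module_simps by blast
        let ?d = "f \<ominus>\<^bsub>dual_module Z M E\<^esub> ?g"
        have d: "?d \<in> right_hom Z M E" using H.M.minus_closed[of f ?g] fh g unfolding dual_module_simps(1) by blast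
        have dv: "?d y = f y \<ominus>\<^bsub>E\<^esub> t \<odot>\<^bsub>E\<^esub> f0 y" if "y \<in> carrier M" for y
          using dual_minus[OF M fh g that] dual_act[OF f0h t(1) that] by simp
        have "?d \<in> perp M (adjoin Z M K x)"
        proof -
          have "?d x = \<zero>\<^bsub>E\<^esub>" using dv[OF step(2)] t right_homD(1)[OF fh step(2)] by (simp add: E.M.minus_eq E.M.r_neg)
          moreover have "?d \<in> perp M K"
            using d dv M.submodD(1)[OF K] f f0(1) t(1) unfolding perp_def
            by (auto simp: E.act_zero_right E.minus_zero)
          ultimately show ?thesis using adj by blast
        qed
        then have "\<theta> ?d = \<zero>\<^bsub>E\<^esub>" using van by blast
        moreover have "\<theta> ?d = \<theta> f \<ominus>\<^bsub>E\<^esub> \<theta> ?g"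
          using right_hom_minus[OF H.M.abelian_group_axioms E.M.abelian_group_axioms th, of f ?g] fh g by (simp del: dual_module_simps(4))
        moreover have "\<theta> ?g = t \<odot>\<^bsub>E\<^esub> \<theta> f0" using right_homD(4)[OF th t(1), of f0] f0h by simp
        ultimately have "\<theta> f = t \<odot>\<^bsub>E\<^esub> \<theta> f0"
          using tD(1)[OF fh] E.act_closed[OF t(1) tD(1)[OF f0h]]
          by (metis E.M.minus_eq E.M.minus_equality E.M.minus_minus E.M.a_inv_closed)
        then show ?thesis using t by blast
      qed
      have "\<theta> f0 \<in> killed E m"
      proof (rule killedI[OF tD(1)[OF f0h]])
        fix r assume r: "r \<in> m"
        have rc: "r \<in> carrier Z" by (rule m.Icarr[OF r])
        let ?g = "r \<odot>\<^bsub>dual_module Z M E\<^esub> f0"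
        have g: "?g \<in> right_hom Z M E" using H.act_closed[OF rc, of f0] f0h unfolding dual_module_simps by blast
        have gv: "?g y = r \<odot>\<^bsub>E\<^esub> f0 y" if "y \<in> carrier M" for y by (rule dual_act[OF f0h rc that])
        have "?g \<in> perp M (adjoin Z M K x)"
          unfolding adj using gv[OF step(2)] killedD(2)[OF kill[OF f0(1)] r] g gv M.submodD(1)[OF K] f0(1) rc
          unfolding perp_def by (auto simp: E.act_zero_right simp del: dual_module_simps(4))
        then have "\<theta> ?g = \<zero>\<^bsub>E\<^esub>" using van by blast
        then show "r \<odot>\<^bsub>E\<^esub> \<theta> f0 = \<zero>\<^bsub>E\<^esub>" using right_homD(4)[OF th rc, of f0] f0h by simp
      qed
      then obtain t where t: "t \<in> carrier Z" "\<theta> f0 = t \<odot>\<^bsub>E\<^esub> f0 x"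
        using socle_simple[OF step(3) kill[OF f0(1)] _ f0(2)] by blast
      let ?y = "t \<odot>\<^bsub>M\<^esub> x"
      have y: "?y \<in> carrier M" by (rule M.act_closed[OF t(1) step(2)])
      \<comment> \<open>Subtracting evaluation at \<open>t x\<close> makes the functional vanish on
        \<open>perp M K\<close>, where the induction hypothesis applies.\<close>
      define \<theta>' where "\<theta>' = (\<lambda>f\<in>right_hom Z M E. \<theta> f \<ominus>\<^bsub>E\<^esub> f ?y)"
      have "\<theta>' \<in> right_hom Z (dual_module Z M E) E"
      proof (rule right_homI)
        fix f assume f: "f \<in> carrier (dual_module Z M E)"
        then have fh: "f \<in> right_hom Z M E" by simp
        show "\<theta>' f \<in> carrier E" using fh tD(1)[OF fh] right_homD(1)[OF fh y] by (simp add: \<theta>'_def)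
        show "\<theta>' (f \<oplus>\<^bsub>dual_module Z M E\<^esub> g) = \<theta>' f \<oplus>\<^bsub>E\<^esub> \<theta>' g" if g: "g \<in> carrier (dual_module Z M E)" for g
        proof -
          have gh: "g \<in> right_hom Z M E" using g by simp
          show ?thesis
            using H.M.a_closed[OF f g] right_homD(3)[OF th f g] fh gh y tD(1)[OF fh] tD(1)[OF gh]
              right_homD(1)[OF fh y] right_homD(1)[OF gh y]
            by (simp add: \<theta>'_def E.M.minus_eq E.M.minus_add E.M.a_ac)
        qed
        show "\<theta>' (a \<odot>\<^bsub>dual_module Z M E\<^esub> f) = a \<odot>\<^bsub>E\<^esub> \<theta>' f" if a: "a \<in> carrier Z" for a
          using H.act_closed[OF a f] right_homD(4)[OF th a f] dual_act[OF fh a y] fh a tD(1)[OF fh] right_homD(1)[OF fh y]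
          by (simp add: \<theta>'_def E.act_minus del: dual_module_simps(4))
      qed (simp add: \<theta>'_def)
      moreover have "\<forall>f\<in>perp M K. \<theta>' f = \<zero>\<^bsub>E\<^esub>"
      proof
        fix f assume f: "f \<in> perp M K"
        have fh: "f \<in> right_hom Z M E" by (rule ph[OF f])
        obtain s where s: "s \<in> carrier Z" "f x = s \<odot>\<^bsub>E\<^esub> f0 x" "\<theta> f = s \<odot>\<^bsub>E\<^esub> \<theta> f0" using gen[OF f] by blast
        have "f ?y = \<theta> f"
          using right_homD(4)[OF fh t(1) step(2)] s t E.act_swap[OF t(1) s(1) right_homD(1)[OF f0h step(2)]] by simp
        then show "\<theta>' f = \<zero>\<^bsub>E\<^esub>" using fh tD(1)[OF fh] by (simp add: \<theta>'_def E.M.minus_eq E.M.r_neg)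
      qed
      ultimately obtain k where k: "k \<in> K" "\<forall>f\<in>right_hom Z M E. \<theta>' f = f k" using step(5) by blast
      have kc: "k \<in> carrier M" by (rule M.submodD(1)[OF K k(1)])
      have "\<theta> f = f (k \<oplus>\<^bsub>M\<^esub> ?y)" if fh: "f \<in> right_hom Z M E" for f
      proof -
        have "\<theta> f \<ominus>\<^bsub>E\<^esub> f ?y = f k" using k(2) fh by (auto simp: \<theta>'_def)
        then have "\<theta> f = f k \<oplus>\<^bsub>E\<^esub> f ?y"
          using tD(1)[OF fh] right_homD(1)[OF fh y] right_homD(1)[OF fh kc]
          by (metis E.M.minus_eq E.M.a_assoc E.M.l_neg E.M.r_zero E.M.a_inv_closed)
        then show ?thesis using right_homD(3)[OF fh kc y] by simp
      qed
      then show ?thesis using M.adjoinI[OF k(1) t(1), of x] by blast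
    qed
  qed
qed

text \<open>Going down the series of \<open>K\<close>, each removed factor enlarges
  \<open>perp M K\<close> by at most one factor: any \<open>f0\<close> in it with
  \<open>f0 x \<noteq> 0\<close> generates the difference, again because the socle at
  \<open>m\<close> is simple. At \<open>K = 0\<close> the whole dual is reached.\<close>

lemma dual_finite_length_step:
  assumes M: "right_module Z M" and "finite_length Z M K" and "finite_length Z (dual_module Z M E) (perp M K)"
  shows "finite_length Z (dual_module Z M E) (right_hom Z M E)"
  using assms(2,3)
proof (induction rule: finite_length.induct)
  case zero
  interpret M: comm_module Z M by (intro comm_module.intro M cring_axioms)
  have "perp M {\<zero>\<^bsub>M\<^esub>} = right_hom Z M E"
    using right_hom_zero[OF M.M.abelian_group_axioms E.M.abelian_group_axioms] unfolding perp_def by blast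
  then show ?case using zero by simp
next
  case (step K x m)
  interpret M: comm_module Z M by (intro comm_module.intro M cring_axioms)
  interpret H: comm_module Z "dual_module Z M E" by (rule comm_module_dual[OF M])
  interpret m: maximalideal m Z by (rule step(3))
  have K: "submod Z M K" by (rule M.finite_length_submod[OF step(1)])
  have mx: "\<forall>r\<in>m. r \<odot>\<^bsub>M\<^esub> x \<in> K" using step(4) by blast
  note kill = perp_killed[OF M K step(2,3) mx] and adj = perp_adjoin_iff[OF M K step(2)]
  have ph: "f \<in> right_hom Z M E" if "f \<in> perp M K" for f using that unfolding perp_def by blast
  have "finite_length Z (dual_module Z M E) (perp M K)"
  proof (cases "\<forall>f\<in>perp M K. f x = \<zero>\<^bsub>E\<^esub>")
    case True
    then have "perp M K = perp M (adjoin Z M K x)" using adj by blast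
    then show ?thesis using step(6) by simp
  next
    case False
    then obtain f0 where f0: "f0 \<in> perp M K" "f0 x \<noteq> \<zero>\<^bsub>E\<^esub>" by blast
    have f0h: "f0 \<in> right_hom Z M E" by (rule ph[OF f0(1)])
    have act: "r \<odot>\<^bsub>dual_module Z M E\<^esub> f0 \<in> right_hom Z M E" if "r \<in> carrier Z" for r
      using H.act_closed[OF that, of f0] f0h unfolding dual_module_simps by blast
    have "perp M K = adjoin Z (dual_module Z M E) (perp M (adjoin Z M K x)) f0"
    proof (intro equalityI subsetI)
      fix f assume f: "f \<in> perp M K"
      have fh: "f \<in> right_hom Z M E" by (rule ph[OF f])
      obtain t where t: "t \<in> carrier Z" "f x = t \<odot>\<^bsub>E\<^esub> f0 x"
        using socle_simple[OF step(3) kill[OF f0(1)] kill[OF f] f0(2)] by blast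
      let ?g = "t \<odot>\<^bsub>dual_module Z M E\<^esub> f0"
      let ?d = "f \<ominus>\<^bsub>dual_module Z M E\<^esub> ?g"
      have g: "?g \<in> right_hom Z M E" by (rule act[OF t(1)])
      have d: "?d \<in> right_hom Z M E" using H.M.minus_closed[of f ?g] fh g unfolding dual_module_simps(1) by blast
      have dv: "?d y = f y \<ominus>\<^bsub>E\<^esub> t \<odot>\<^bsub>E\<^esub> f0 y" if "y \<in> carrier M" for y
        using dual_minus[OF M fh g that] dual_act[OF f0h t(1) that] by simp
      have "?d x = \<zero>\<^bsub>E\<^esub>" using dv[OF step(2)] t right_homD(1)[OF fh step(2)] by (simp add: E.M.minus_eq E.M.r_neg)
      moreover have "?d \<in> perp M K"
        using d dv M.submodD(1)[OF K] f f0(1) t(1) unfolding perp_def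
        by (auto simp: E.act_zero_right E.minus_zero)
      ultimately have dp: "?d \<in> perp M (adjoin Z M K x)" using adj by blast
      have "f = ?d \<oplus>\<^bsub>dual_module Z M E\<^esub> ?g"
      proof -
        have c: "f \<in> carrier (dual_module Z M E)" "?g \<in> carrier (dual_module Z M E)"
          using fh g unfolding dual_module_simps(1) by blast+
        show ?thesis
          using c by (simp only: H.M.minus_eq H.M.a_assoc H.M.l_neg H.M.a_inv_closed H.M.r_zero)
      qed
      then show "f \<in> adjoin Z (dual_module Z M E) (perp M (adjoin Z M K x)) f0"
        using H.adjoinI[OF dp t(1), of f0] by (simp del: dual_module_simps)
    next
      fix f assume "f \<in> adjoin Z (dual_module Z M E) (perp M (adjoin Z M K x)) f0"
      then obtain g r where g: "g \<in> perp M (adjoin Z M K x)" "r \<in> carrier Z"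
        "f = g \<oplus>\<^bsub>dual_module Z M E\<^esub> r \<odot>\<^bsub>dual_module Z M E\<^esub> f0" unfolding adjoin_def by blast
      have gp: "g \<in> perp M K" using g(1) adj by blast
      have "f \<in> right_hom Z M E"
        unfolding g(3) using H.M.a_closed[of g "r \<odot>\<^bsub>dual_module Z M E\<^esub> f0"] ph[OF gp] act[OF g(2)]
        by (simp del: dual_module_simps(2-4))
      moreover have "f k = \<zero>\<^bsub>E\<^esub>" if k: "k \<in> K" for k
      proof -
        have kc: "k \<in> carrier M" by (rule M.submodD(1)[OF K k])
        have "f k = g k \<oplus>\<^bsub>E\<^esub> r \<odot>\<^bsub>E\<^esub> f0 k" unfolding g(3) using kc dual_act[OF f0h g(2) kc] by simp
        then show ?thesis using gp f0(1) k g(2) unfolding perp_def by (simp add: E.act_zero_right)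
      qed
      ultimately show "f \<in> perp M K" unfolding perp_def by blast
    qed
    moreover have "finite_length Z (dual_module Z M E) (adjoin Z (dual_module Z M E) (perp M (adjoin Z M K x)) f0)"
    proof (rule finite_length.step[OF step(6) _ step(3)])
      show "f0 \<in> carrier (dual_module Z M E)" using f0h by simp
      fix r assume r: "r \<in> m"
      have rc: "r \<in> carrier Z" by (rule m.Icarr[OF r])
      have gv: "(r \<odot>\<^bsub>dual_module Z M E\<^esub> f0) y = r \<odot>\<^bsub>E\<^esub> f0 y" if "y \<in> carrier M" for y
        by (rule dual_act[OF f0h rc that])
      show "r \<odot>\<^bsub>dual_module Z M E\<^esub> f0 \<in> perp M (adjoin Z M K x)"
        unfolding adj using gv[OF step(2)] killedD(2)[OF kill[OF f0(1)] r] act[OF rc] gv M.submodD(1)[OF K] f0(1) rc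
        unfolding perp_def by (auto simp: E.act_zero_right simp del: dual_module_simps(4))
    qed
    ultimately show ?thesis by simp
  qed
  then show ?case by (rule step(5))
qed

lemma dual_finite_length:
  assumes M: "right_module Z M" and fl: "finite_length Z M (carrier M)"
  shows "finite_length Z (dual_module Z M E) (right_hom Z M E)"
proof (rule dual_finite_length_step[OF M fl])
  have "perp M (carrier M) = {\<zero>\<^bsub>dual_module Z M E\<^esub>}"
  proof -
    have z: "(\<lambda>x\<in>carrier M. \<zero>\<^bsub>E\<^esub>) \<in> right_hom Z M E" by (rule right_hom_zero_closed[OF M E.right_module_axioms])
    show ?thesis
    proof (intro equalityI subsetI)
      fix f assume "f \<in> perp M (carrier M)"
      then have f: "f \<in> right_hom Z M E" and "\<forall>x\<in>carrier M. f x = \<zero>\<^bsub>E\<^esub>" unfolding perp_def by blast+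
      then have "f = (\<lambda>x\<in>carrier M. \<zero>\<^bsub>E\<^esub>)" by (intro right_hom_eqI[OF f z]) simp
      then show "f \<in> {\<zero>\<^bsub>dual_module Z M E\<^esub>}" by simp
    next
      fix f assume "f \<in> {\<zero>\<^bsub>dual_module Z M E\<^esub>}"
      then have "f = (\<lambda>x\<in>carrier M. \<zero>\<^bsub>E\<^esub>)" by simp
      then show "f \<in> perp M (carrier M)" unfolding perp_def using z by simp
    qed
  qed
  then show "finite_length Z (dual_module Z M E) (perp M (carrier M))"
    by (simp only: finite_length.zero)
qed

end

section \<open>Finitely presented modules over an artin algebra\<close>

lemma free_right_module_simps [simp]:
  "carrier (free_right_module \<Lambda> n) = {..<n} \<rightarrow>\<^sub>E carrier \<Lambda>"
  "\<zero>\<^bsub>free_right_module \<Lambda> n\<^esub> = (\<lambda>i\<in>{..<n}. \<zero>\<^bsub>\<Lambda>\<^esub>)"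
  "v \<oplus>\<^bsub>free_right_module \<Lambda> n\<^esub> w = (\<lambda>i\<in>{..<n}. v i \<oplus>\<^bsub>\<Lambda>\<^esub> w i)"
  "a \<odot>\<^bsub>free_right_module \<Lambda> n\<^esub> v = (\<lambda>i\<in>{..<n}. v i \<otimes>\<^bsub>\<Lambda>\<^esub> a)"
  by (simp_all add: free_right_module_def)

lemma (in ring) right_module_free: "right_module R (free_right_module R n)"
proof -
  have mem: "v i \<in> carrier R" if "v \<in> carrier (free_right_module R n)" "i < n" for v i
    using PiE_mem[of v "{..<n}" "\<lambda>_. carrier R" i] that by simp
  have eqI: "v = w" if "v \<in> carrier (free_right_module R n)" "w \<in> carrier (free_right_module R n)"
    "\<And>i. i < n \<Longrightarrow> v i = w i" for v w
    by (rule extensionalityI[of _ "{..<n}"]) (use that in \<open>simp_all add: PiE_def\<close>)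
  have add: "v \<oplus>\<^bsub>free_right_module R n\<^esub> w \<in> carrier (free_right_module R n)"
    if "v \<in> carrier (free_right_module R n)" "w \<in> carrier (free_right_module R n)" for v w
    using mem[OF that(1)] mem[OF that(2)] by simp
  have act: "a \<odot>\<^bsub>free_right_module R n\<^esub> v \<in> carrier (free_right_module R n)"
    if "a \<in> carrier R" "v \<in> carrier (free_right_module R n)" for a v
    using mem[OF that(2)] that(1) by simp
  have zero: "\<zero>\<^bsub>free_right_module R n\<^esub> \<in> carrier (free_right_module R n)" by simp
  show ?thesis
  proof (intro right_module.intro right_module_axioms.intro ring_axioms)
    show "abelian_group (free_right_module R n)"
    proof (rule abelian_groupI)
      fix u v w assume u: "u \<in> carrier (free_right_module R n)" and v: "v \<in> carrier (free_right_module R n)"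
      show "u \<oplus>\<^bsub>free_right_module R n\<^esub> v \<in> carrier (free_right_module R n)" by (rule add[OF u v])
      show "u \<oplus>\<^bsub>free_right_module R n\<^esub> v = v \<oplus>\<^bsub>free_right_module R n\<^esub> u"
        by (rule eqI[OF add[OF u v] add[OF v u]]) (simp add: mem[OF u] mem[OF v] a_comm)
      assume w: "w \<in> carrier (free_right_module R n)"
      show "u \<oplus>\<^bsub>free_right_module R n\<^esub> v \<oplus>\<^bsub>free_right_module R n\<^esub> w =
          u \<oplus>\<^bsub>free_right_module R n\<^esub> (v \<oplus>\<^bsub>free_right_module R n\<^esub> w)"
        by (rule eqI[OF add[OF add[OF u v] w] add[OF u add[OF v w]]]) (simp add: mem[OF u] mem[OF v] mem[OF w] a_assoc)
    next
      fix v assume v: "v \<in> carrier (free_right_module R n)"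
      show "\<zero>\<^bsub>free_right_module R n\<^esub> \<oplus>\<^bsub>free_right_module R n\<^esub> v = v"
        by (rule eqI[OF add[OF zero v] v]) (simp add: mem[OF v])
      have w: "(\<lambda>i\<in>{..<n}. \<ominus> v i) \<in> carrier (free_right_module R n)" using mem[OF v] by simp
      have "(\<lambda>i\<in>{..<n}. \<ominus> v i) \<oplus>\<^bsub>free_right_module R n\<^esub> v = \<zero>\<^bsub>free_right_module R n\<^esub>"
        by (rule eqI[OF add[OF w v] zero]) (simp add: mem[OF v] l_neg)
      then show "\<exists>w\<in>carrier (free_right_module R n). w \<oplus>\<^bsub>free_right_module R n\<^esub> v = \<zero>\<^bsub>free_right_module R n\<^esub>"
        using w by blast
    qed (rule zero)
  next
    fix a v assume a: "a \<in> carrier R" and v: "v \<in> carrier (free_right_module R n)"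
    show "a \<odot>\<^bsub>free_right_module R n\<^esub> v \<in> carrier (free_right_module R n)" by (rule act[OF a v])
    fix b assume b: "b \<in> carrier R"
    show "(a \<oplus> b) \<odot>\<^bsub>free_right_module R n\<^esub> v =
        a \<odot>\<^bsub>free_right_module R n\<^esub> v \<oplus>\<^bsub>free_right_module R n\<^esub> b \<odot>\<^bsub>free_right_module R n\<^esub> v"
      by (rule eqI[OF act[OF a_closed[OF a b] v] add[OF act[OF a v] act[OF b v]]]) (simp add: mem[OF v] a b r_distr)
    show "(a \<otimes> b) \<odot>\<^bsub>free_right_module R n\<^esub> v = b \<odot>\<^bsub>free_right_module R n\<^esub> (a \<odot>\<^bsub>free_right_module R n\<^esub> v)"
      by (rule eqI[OF act[OF m_closed[OF a b] v] act[OF b act[OF a v]]]) (simp add: mem[OF v] a b m_assoc)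
  next
    fix a v w assume a: "a \<in> carrier R" and v: "v \<in> carrier (free_right_module R n)"
      and w: "w \<in> carrier (free_right_module R n)"
    show "a \<odot>\<^bsub>free_right_module R n\<^esub> (v \<oplus>\<^bsub>free_right_module R n\<^esub> w) =
        a \<odot>\<^bsub>free_right_module R n\<^esub> v \<oplus>\<^bsub>free_right_module R n\<^esub> a \<odot>\<^bsub>free_right_module R n\<^esub> w"
      by (rule eqI[OF act[OF a add[OF v w]] add[OF act[OF a v] act[OF a w]]]) (simp add: mem[OF v] mem[OF w] a l_distr)
  next
    fix v assume v: "v \<in> carrier (free_right_module R n)"
    show "\<one> \<odot>\<^bsub>free_right_module R n\<^esub> v = v"
      by (rule eqI[OF act[OF one_closed v] v]) (simp add: mem[OF v])
  qed
qed

primrec lincomb :: "('a, 'm) module \<Rightarrow> (nat \<Rightarrow> 'm) \<Rightarrow> (nat \<Rightarrow> 'a) \<Rightarrow> nat \<Rightarrow> 'm" where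
  "lincomb M x v 0 = \<zero>\<^bsub>M\<^esub>"
| "lincomb M x v (Suc n) = lincomb M x v n \<oplus>\<^bsub>M\<^esub> v n \<odot>\<^bsub>M\<^esub> x n"

lemma lincomb_in_submod:
  assumes "right_module \<Lambda> M" "submod \<Lambda> M N" "\<forall>i<n. x i \<in> N" "\<forall>i<n. v i \<in> carrier \<Lambda>"
  shows "lincomb M x v n \<in> N"
proof -
  interpret M: right_module \<Lambda> M by fact
  show ?thesis
    using assms(3,4)
  proof (induction n)
    case 0
    then show ?case using M.submodD(2)[OF assms(2)] by simp
  next
    case (Suc n)
    have "lincomb M x v n \<in> N" using Suc by simp
    moreover have "v n \<odot>\<^bsub>M\<^esub> x n \<in> N" by (rule M.submodD(4)[OF assms(2)]) (use Suc.prems in auto)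
    ultimately show ?case using M.submodD(3)[OF assms(2)] by simp
  qed
qed

lemma lincomb_closed:
  assumes "right_module \<Lambda> M" "\<forall>i<n. x i \<in> carrier M" "\<forall>i<n. v i \<in> carrier \<Lambda>"
  shows "lincomb M x v n \<in> carrier M"
  by (rule lincomb_in_submod[OF assms(1) right_module.submod_carrier[OF assms(1)] assms(2,3)])

lemma lincomb_add:
  assumes "right_module \<Lambda> M" "\<forall>i<n. x i \<in> carrier M" "\<forall>i<n. v i \<in> carrier \<Lambda>"
    "\<forall>i<n. w i \<in> carrier \<Lambda>" "\<forall>i<n. u i = v i \<oplus>\<^bsub>\<Lambda>\<^esub> w i"
  shows "lincomb M x u n = lincomb M x v n \<oplus>\<^bsub>M\<^esub> lincomb M x w n"
proof -
  interpret M: right_module \<Lambda> M by fact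
  show ?thesis
    using assms(2-5)
  proof (induction n)
    case (Suc n)
    have IH: "lincomb M x u n = lincomb M x v n \<oplus>\<^bsub>M\<^esub> lincomb M x w n" using Suc by simp
    have "lincomb M x v n \<in> carrier M" "lincomb M x w n \<in> carrier M"
      using Suc.prems by (simp_all add: lincomb_closed[OF assms(1)])
    moreover have "x n \<in> carrier M" "v n \<in> carrier \<Lambda>" "w n \<in> carrier \<Lambda>" "u n = v n \<oplus>\<^bsub>\<Lambda>\<^esub> w n"
      using Suc.prems by simp_all
    ultimately show ?case
      by (simp add: IH M.act_add_ring M.act_closed M.M.a_ac)
  qed simp
qed

lemma lincomb_act:
  assumes "right_module \<Lambda> M" "\<forall>i<n. x i \<in> carrier M" "\<forall>i<n. v i \<in> carrier \<Lambda>"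
    "a \<in> carrier \<Lambda>" "\<forall>i<n. u i = v i \<otimes>\<^bsub>\<Lambda>\<^esub> a"
  shows "lincomb M x u n = a \<odot>\<^bsub>M\<^esub> lincomb M x v n"
proof -
  interpret M: right_module \<Lambda> M by fact
  show ?thesis
    using assms(2,3,5)
  proof (induction n)
    case 0
    then show ?case by (simp add: M.act_zero_right assms(4))
  next
    case (Suc n)
    have IH: "lincomb M x u n = a \<odot>\<^bsub>M\<^esub> lincomb M x v n" using Suc by simp
    have "lincomb M x v n \<in> carrier M"
      using Suc.prems by (simp add: lincomb_closed[OF assms(1)])
    moreover have "x n \<in> carrier M" "v n \<in> carrier \<Lambda>" "u n = v n \<otimes>\<^bsub>\<Lambda>\<^esub> a"
      using Suc.prems by simp_all
    ultimately show ?case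
      by (simp add: IH M.act_add_mod M.act_mult M.act_closed assms(4))
  qed
qed

lemma lincomb_cong:
  "\<lbrakk>\<forall>i<n. x i = y i; \<forall>i<n. v i = w i\<rbrakk> \<Longrightarrow> lincomb M x v n = lincomb M y w n"
  by (induction n) auto

lemma lincomb_hom:
  assumes M: "right_module \<Lambda> M" and x: "\<forall>i<n. x i \<in> carrier M"
  shows "(\<lambda>v\<in>carrier (free_right_module \<Lambda> n). lincomb M x v n) \<in> right_hom \<Lambda> (free_right_module \<Lambda> n) M"
proof -
  interpret M: right_module \<Lambda> M by fact
  interpret F: right_module \<Lambda> "free_right_module \<Lambda> n" by (rule M.R.right_module_free)
  have mem: "\<forall>i<n. v i \<in> carrier \<Lambda>" if "v \<in> carrier (free_right_module \<Lambda> n)" for v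
    using that by auto
  show ?thesis
  proof (rule right_homI)
    fix v assume v: "v \<in> carrier (free_right_module \<Lambda> n)"
    show "(\<lambda>v\<in>carrier (free_right_module \<Lambda> n). lincomb M x v n) v \<in> carrier M"
      using lincomb_closed[OF M x mem[OF v]] v by simp
    fix w assume w: "w \<in> carrier (free_right_module \<Lambda> n)"
    have "lincomb M x (v \<oplus>\<^bsub>free_right_module \<Lambda> n\<^esub> w) n = lincomb M x v n \<oplus>\<^bsub>M\<^esub> lincomb M x w n"
      by (rule lincomb_add[OF M x mem[OF v] mem[OF w]]) simp
    then show "(\<lambda>v\<in>carrier (free_right_module \<Lambda> n). lincomb M x v n) (v \<oplus>\<^bsub>free_right_module \<Lambda> n\<^esub> w) =
        (\<lambda>v\<in>carrier (free_right_module \<Lambda> n). lincomb M x v n) v \<oplus>\<^bsub>M\<^esub>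
        (\<lambda>v\<in>carrier (free_right_module \<Lambda> n). lincomb M x v n) w"
      using F.M.a_closed[OF v w] v w by (simp only: restrict_apply if_True)
  next
    fix a v assume a: "a \<in> carrier \<Lambda>" and v: "v \<in> carrier (free_right_module \<Lambda> n)"
    have "lincomb M x (a \<odot>\<^bsub>free_right_module \<Lambda> n\<^esub> v) n = a \<odot>\<^bsub>M\<^esub> lincomb M x v n"
      by (rule lincomb_act[OF M x mem[OF v] a]) simp
    then show "(\<lambda>v\<in>carrier (free_right_module \<Lambda> n). lincomb M x v n) (a \<odot>\<^bsub>free_right_module \<Lambda> n\<^esub> v) =
        a \<odot>\<^bsub>M\<^esub> (\<lambda>v\<in>carrier (free_right_module \<Lambda> n). lincomb M x v n) v"
      using F.act_closed[OF a v] v by (simp only: restrict_apply if_True)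
  qed simp
qed

text \<open>One coordinate is split off at a time, and \<open>infinite_prod_embedding\<close> puts
  the resulting pairs back into \<open>'m\<close>.\<close>

lemma free_module_embedding:
  assumes u: "module_universe \<Lambda> TYPE('m)"
  shows "\<exists>j :: (nat \<Rightarrow> 'a) \<Rightarrow> 'm. inj_on j ({..<n} \<rightarrow>\<^sub>E carrier (\<Lambda> :: ('a, 'y) ring_scheme))"
proof (induction n)
  case 0
  show ?case by simp
next
  case (Suc n)
  then obtain j :: "(nat \<Rightarrow> 'a) \<Rightarrow> 'm" where j: "inj_on j ({..<n} \<rightarrow>\<^sub>E carrier \<Lambda>)" by blast
  obtain f :: "'a \<Rightarrow> 'm" where f: "inj_on f (carrier \<Lambda>)" using u unfolding module_universe_def by blast
  have inf: "infinite (UNIV :: 'm set)" using u unfolding module_universe_def by blast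
  obtain h :: "(nat \<Rightarrow> 'a) \<times> 'a \<Rightarrow> 'm" where h: "inj_on h (({..<n} \<rightarrow>\<^sub>E carrier \<Lambda>) \<times> carrier \<Lambda>)"
    by (rule infinite_prod_embedding[OF inf j f])
  have "inj_on (\<lambda>v. h (restrict v {..<n}, v n)) ({..<Suc n} \<rightarrow>\<^sub>E carrier \<Lambda>)"
  proof (rule inj_onI)
    fix v w assume v: "v \<in> {..<Suc n} \<rightarrow>\<^sub>E carrier \<Lambda>" and w: "w \<in> {..<Suc n} \<rightarrow>\<^sub>E carrier \<Lambda>"
      and eq: "h (restrict v {..<n}, v n) = h (restrict w {..<n}, w n)"
    have m: "(restrict u {..<n}, u n) \<in> ({..<n} \<rightarrow>\<^sub>E carrier \<Lambda>) \<times> carrier \<Lambda>" if "u \<in> {..<Suc n} \<rightarrow>\<^sub>E carrier \<Lambda>" for u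
      using PiE_mem[OF that] by (auto simp: less_Suc_eq)
    have e: "restrict v {..<n} = restrict w {..<n}" "v n = w n"
      using inj_onD[OF h eq m[OF v] m[OF w]] by simp_all
    show "v = w"
    proof (rule extensionalityI[of _ "{..<Suc n}"])
      fix i assume "i \<in> {..<Suc n}"
      then show "v i = w i" using e(2) fun_cong[OF e(1), of i] by (cases "i = n") (auto simp: less_Suc_eq)
    qed (use v w in \<open>auto simp: PiE_def\<close>)
  qed
  then show ?case by blast
qed

section \<open>Modules of finite length over an algebra that has finite length over its central
  subring\<close>

locale artin_center = central_subring Z \<Lambda> for Z \<Lambda> :: "('a, 'y) ring_scheme" +
  assumes artinian: "commutative_artinian_ring Z"
    and finite: "finite_length Z (regular_module \<Lambda>) (carrier \<Lambda>)"
begin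

text \<open>As \<open>Z\<close> is central, the identity is \<open>Z\<close>-linear from one regular
  module to the other and carries finite length over.\<close>

lemma artin_center_opposite: "artin_center Z (opposite_ring \<Lambda>)"
proof -
  interpret O: central_subring Z "opposite_ring \<Lambda>" by (rule central_subring_opposite)
  have "(\<lambda>x\<in>carrier \<Lambda>. x) \<in> right_hom Z (regular_module \<Lambda>) (regular_module (opposite_ring \<Lambda>))"
  proof (rule right_homI)
    fix a x assume "a \<in> carrier Z" "x \<in> carrier (regular_module \<Lambda>)"
    then show "(\<lambda>x\<in>carrier \<Lambda>. x) (a \<odot>\<^bsub>regular_module \<Lambda>\<^esub> x) =
        a \<odot>\<^bsub>regular_module (opposite_ring \<Lambda>)\<^esub> (\<lambda>x\<in>carrier \<Lambda>. x) x"
      using central[of a x] by (simp add: sub)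
  qed simp_all
  then have "finite_length Z (regular_module (opposite_ring \<Lambda>)) ((\<lambda>x\<in>carrier \<Lambda>. x) ` carrier \<Lambda>)"
    by (rule finite_length_image[OF comm_module_restrict[OF \<Lambda>.right_module_regular]
        O.comm_module_restrict[OF O.\<Lambda>.right_module_regular] _ finite])
  then show ?thesis
    by (intro artin_center.intro central_subring_opposite artin_center_axioms.intro artinian) simp
qed

text \<open>The free module is filtered by the sets \<open>V k\<close> of vectors supported on the
  first \<open>k\<close> coordinates. In the image each step adds the multiples of one element,
  which \<open>finite_length_cyclic\<close> allows.\<close>

lemma finite_length_generated:
  assumes M: "right_module \<Lambda> M" and g: "g \<in> right_hom \<Lambda> (free_right_module \<Lambda> n) M"
    and surj: "g ` carrier (free_right_module \<Lambda> n) = carrier M"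
  shows "finite_length Z M (carrier M)"
proof -
  interpret M: right_module \<Lambda> M by fact
  interpret F: right_module \<Lambda> "free_right_module \<Lambda> n" by (rule \<Lambda>.right_module_free)
  let ?F = "{..<n} \<rightarrow>\<^sub>E carrier \<Lambda>"
  define V where "V k = {v \<in> ?F. \<forall>i. k \<le> i \<and> i < n \<longrightarrow> v i = \<zero>\<^bsub>\<Lambda>\<^esub>}" for k
  have "finite_length Z M (g ` V k)" if "k \<le> n" for k
    using that
  proof (induction k)
    case 0
    have "V 0 = {\<zero>\<^bsub>free_right_module \<Lambda> n\<^esub>}"
    proof (intro equalityI subsetI)
      fix v assume "v \<in> V 0"
      then have "v = (\<lambda>i\<in>{..<n}. \<zero>\<^bsub>\<Lambda>\<^esub>)"
        unfolding V_def by (intro extensionalityI[of _ "{..<n}"]) (auto simp: PiE_def)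
      then show "v \<in> {\<zero>\<^bsub>free_right_module \<Lambda> n\<^esub>}" by simp
    qed (auto simp: V_def)
    then have "g ` V 0 = {\<zero>\<^bsub>M\<^esub>}"
      using right_hom_zero[OF F.M.abelian_group_axioms M.M.abelian_group_axioms g] by simp
    then show ?case by (simp only: finite_length.zero)
  next
    case (Suc k)
    define e where "e = (\<lambda>i\<in>{..<n}. if i = k then \<one>\<^bsub>\<Lambda>\<^esub> else \<zero>\<^bsub>\<Lambda>\<^esub>)"
    have e: "e \<in> carrier (free_right_module \<Lambda> n)" by (auto simp: e_def)
    have ge: "g e \<in> carrier M" by (rule right_homD(1)[OF g e])
    have "g ` V (Suc k) = {y \<oplus>\<^bsub>M\<^esub> a \<odot>\<^bsub>M\<^esub> g e |y a. y \<in> g ` V k \<and> a \<in> carrier \<Lambda>}" (is "?L = ?R")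
    proof (intro equalityI subsetI)
      fix w assume "w \<in> ?L"
      then obtain v where v: "v \<in> V (Suc k)" "w = g v" by blast
      let ?v = "\<lambda>i\<in>{..<n}. if i = k then \<zero>\<^bsub>\<Lambda>\<^esub> else v i"
      have vF: "v \<in> ?F" using v(1) unfolding V_def by blast
      have vk: "v k \<in> carrier \<Lambda>" using PiE_mem[OF vF, of k] Suc.prems by simp
      have vm: "\<forall>i<n. v i \<in> carrier \<Lambda>" using vF by auto
      have vz: "\<forall>i. Suc k \<le> i \<and> i < n \<longrightarrow> v i = \<zero>\<^bsub>\<Lambda>\<^esub>" using v(1) unfolding V_def by blast
      have "?v \<in> ?F" using vm by simp
      moreover have "\<forall>i. k \<le> i \<and> i < n \<longrightarrow> ?v i = \<zero>\<^bsub>\<Lambda>\<^esub>"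
      proof (intro allI impI)
        fix i assume "k \<le> i \<and> i < n"
        then show "?v i = \<zero>\<^bsub>\<Lambda>\<^esub>" using vz[rule_format, of i] by (cases "i = k") simp_all
      qed
      ultimately have v': "?v \<in> V k" unfolding V_def by blast
      then have v'F: "?v \<in> carrier (free_right_module \<Lambda> n)" unfolding V_def by auto
      have "v = ?v \<oplus>\<^bsub>free_right_module \<Lambda> n\<^esub> v k \<odot>\<^bsub>free_right_module \<Lambda> n\<^esub> e"
      proof (rule extensionalityI[of _ "{..<n}"])
        fix i assume i: "i \<in> {..<n}"
        have "v i \<in> carrier \<Lambda>" by (rule PiE_mem[OF vF i])
        then show "v i = (?v \<oplus>\<^bsub>free_right_module \<Lambda> n\<^esub> v k \<odot>\<^bsub>free_right_module \<Lambda> n\<^esub> e) i"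
          using i vk by (simp add: e_def)
      qed (use vF in \<open>auto simp: PiE_def\<close>)
      then have "g v = g ?v \<oplus>\<^bsub>M\<^esub> v k \<odot>\<^bsub>M\<^esub> g e"
        using right_homD(3)[OF g v'F F.act_closed[OF vk e]] right_homD(4)[OF g vk e] by simp
      then show "w \<in> ?R" using v(2) v' vk by blast
    next
      fix w assume "w \<in> ?R"
      then obtain v a where v: "v \<in> V k" "a \<in> carrier \<Lambda>" "w = g v \<oplus>\<^bsub>M\<^esub> a \<odot>\<^bsub>M\<^esub> g e" by blast
      have vF: "v \<in> carrier (free_right_module \<Lambda> n)" using v(1) unfolding V_def by simp
      let ?v = "v \<oplus>\<^bsub>free_right_module \<Lambda> n\<^esub> a \<odot>\<^bsub>free_right_module \<Lambda> n\<^esub> e"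
      have "w = g ?v" using v(3) right_homD(3)[OF g vF F.act_closed[OF v(2) e]] right_homD(4)[OF g v(2) e] by simp
      moreover have "?v \<in> V (Suc k)"
        using F.M.a_closed[OF vF F.act_closed[OF v(2) e]] v(1,2) unfolding V_def by (simp add: e_def)
      ultimately show "w \<in> ?L" by blast
    qed
    moreover have "finite_length Z M ?R"
      by (rule finite_length_cyclic[OF M _ ge finite]) (rule Suc.IH[OF Suc_leD[OF Suc.prems]])
    ultimately show ?case by (simp only:)
  qed
  moreover have "V n = carrier (free_right_module \<Lambda> n)"
    unfolding V_def free_right_module_simps(1) using not_le by blast
  ultimately show ?thesis using surj by force
qed

text \<open>Every step of the series contributes one generator, with coefficients in
  \<open>Z\<close> and so in \<Lambda>.\<close>

lemma generated_finite_length: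
  assumes M: "right_module \<Lambda> M" and "finite_length Z M N"
  shows "\<exists>n x. (\<forall>i<n. x i \<in> N) \<and> (\<forall>y\<in>N. \<exists>v\<in>carrier (free_right_module \<Lambda> n). y = lincomb M x v n)"
  using assms(2)
proof (induction rule: finite_length.induct)
  case zero
  show ?case by (intro exI[of _ 0]) simp
next
  case (step N y m)
  interpret M: right_module \<Lambda> M by fact
  interpret ZM: comm_module Z M by (rule comm_module_restrict[OF M])
  have N: "submod Z M N" by (rule ZM.finite_length_submod[OF step(1)])
  obtain n x where x: "\<forall>i<n. x i \<in> N" and span: "\<forall>y\<in>N. \<exists>v\<in>carrier (free_right_module \<Lambda> n). y = lincomb M x v n"
    using step(5) by blast
  let ?x = "x(n := y)"
  show ?case
  proof (intro exI[of _ "Suc n"] exI[of _ ?x] conjI allI impI ballI)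
    fix i assume "i < Suc n"
    then show "?x i \<in> adjoin Z M N y"
      using x ZM.adjoin_sub[OF N step(2)] ZM.adjoin_self[OF N step(2)] by (auto simp: less_Suc_eq)
  next
    fix w assume "w \<in> adjoin Z M N y"
    then obtain k r where k: "k \<in> N" "r \<in> carrier Z" "w = k \<oplus>\<^bsub>M\<^esub> r \<odot>\<^bsub>M\<^esub> y" unfolding adjoin_def by blast
    obtain v where v: "v \<in> carrier (free_right_module \<Lambda> n)" "k = lincomb M x v n" using span k(1) by blast
    have vm: "v i \<in> carrier \<Lambda>" if "i < n" for i using PiE_mem[of v "{..<n}" "\<lambda>_. carrier \<Lambda>" i] v(1) that by simp
    have "v(n := r) \<in> carrier (free_right_module \<Lambda> (Suc n))"
      using vm sub[OF k(2)] v(1) by (auto simp: PiE_iff extensional_def less_Suc_eq)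
    moreover have "lincomb M ?x (v(n := r)) n = lincomb M x v n" by (rule lincomb_cong) auto
    ultimately show "\<exists>v\<in>carrier (free_right_module \<Lambda> (Suc n)). w = lincomb M ?x v (Suc n)"
      using k(3) v(2) by (intro bexI[of _ "v(n := r)"]) auto
  qed
qed

lemma cover_finite_length:
  assumes M: "right_module \<Lambda> M" and N: "submod \<Lambda> M N" and fl: "finite_length Z M N"
  shows "\<exists>n. \<exists>g\<in>right_hom \<Lambda> (free_right_module \<Lambda> n) M. g ` carrier (free_right_module \<Lambda> n) = N"
proof -
  interpret M: right_module \<Lambda> M by fact
  obtain n x where x: "\<forall>i<n. x i \<in> N" and span: "\<forall>y\<in>N. \<exists>v\<in>carrier (free_right_module \<Lambda> n). y = lincomb M x v n"
    using generated_finite_length[OF M fl] by blast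
  let ?g = "\<lambda>v\<in>carrier (free_right_module \<Lambda> n). lincomb M x v n"
  have xM: "\<forall>i<n. x i \<in> carrier M" using x M.submodD(1)[OF N] by simp
  have "?g \<in> right_hom \<Lambda> (free_right_module \<Lambda> n) M"
    by (rule lincomb_hom[OF M xM])
  moreover have "?g ` carrier (free_right_module \<Lambda> n) = N"
  proof (intro equalityI subsetI)
    fix y assume "y \<in> ?g ` carrier (free_right_module \<Lambda> n)"
    then obtain v where v: "v \<in> carrier (free_right_module \<Lambda> n)" "y = lincomb M x v n" by auto
    have "\<forall>i<n. v i \<in> carrier \<Lambda>" using v(1) by auto
    then show "y \<in> N" unfolding v(2) by (rule lincomb_in_submod[OF M N x])
  next
    fix y assume "y \<in> N"
    then obtain v where v: "v \<in> carrier (free_right_module \<Lambda> n)" "y = lincomb M x v n" using span by blast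
    then show "y \<in> ?g ` carrier (free_right_module \<Lambda> n)" by (intro image_eqI[of _ _ v]) simp_all
  qed
  ultimately show ?thesis by blast
qed

text \<open>Finite generation over \<Lambda> amounts to finite length over \<open>Z\<close>. For the
  converse direction the kernel of a free cover has finite length too, being a submodule of a module
  of finite length, and is therefore covered by a free module in turn.\<close>

lemma finitely_presented_iff:
  assumes M: "right_module \<Lambda> M"
  shows "finitely_presented \<Lambda> M \<longleftrightarrow> finite_length Z M (carrier M)"
proof
  assume "finitely_presented \<Lambda> M"
  then obtain n g where "g \<in> right_hom \<Lambda> (free_right_module \<Lambda> n) M" "g ` carrier (free_right_module \<Lambda> n) = carrier M"
    unfolding finitely_presented_def by blast
  then show "finite_length Z M (carrier M)" by (rule finite_length_generated[OF M])
next
  assume fl: "finite_length Z M (carrier M)"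
  interpret M: right_module \<Lambda> M by fact
  obtain n g where g: "g \<in> right_hom \<Lambda> (free_right_module \<Lambda> n) M" "g ` carrier (free_right_module \<Lambda> n) = carrier M"
    using cover_finite_length[OF M M.submod_carrier fl] by blast
  let ?F = "free_right_module \<Lambda> n" and ?K = "a_kernel (free_right_module \<Lambda> n) M g"
  have F: "right_module \<Lambda> ?F" by (rule \<Lambda>.right_module_free)
  interpret ZF: comm_module Z ?F by (rule comm_module_restrict[OF F])
  have K: "submod \<Lambda> ?F ?K" by (rule submod_kernel[OF F M g(1)])
  have "finite_length Z ?F (carrier ?F)"
  proof (rule finite_length_generated[OF F right_hom_id[OF F]])
    show "(\<lambda>x\<in>carrier ?F. x) ` carrier ?F = carrier ?F" by auto
  qed
  then have "finite_length Z ?F (carrier ?F \<inter> ?K)" by (rule ZF.finite_length_Int[OF _ submod_restrict[OF K]])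
  moreover have "carrier ?F \<inter> ?K = ?K" using K unfolding submod_def by blast
  ultimately have "finite_length Z ?F ?K" by simp
  then obtain k f where "f \<in> right_hom \<Lambda> (free_right_module \<Lambda> k) ?F" "f ` carrier (free_right_module \<Lambda> k) = ?K"
    using cover_finite_length[OF F K] by blast
  then show "finitely_presented \<Lambda> M" unfolding finitely_presented_def using g by blast
qed

text \<open>The element type of \<open>M\<close> is arbitrary. A free cover embeds in
  \<open>'m\<close>, a choice of preimages embeds \<open>M\<close> in the cover, and
  \<open>quotient_module\<close> by the zero submodule carries the structure over to
  \<open>'m\<close>.\<close>

lemma realise:
  fixes M :: "('a, 'b) module"
  assumes u: "module_universe \<Lambda> TYPE('m)" and M: "right_module \<Lambda> M" and fl: "finite_length Z M (carrier M)"
  shows "\<exists>N :: ('a, 'm) module. \<exists>q. N \<in> Obj (mod_cat \<Lambda>) \<and> q \<in> right_hom \<Lambda> M N \<and> bij_betw q (carrier M) (carrier N)"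
proof -
  interpret M: right_module \<Lambda> M by fact
  obtain n g where g: "g \<in> right_hom \<Lambda> (free_right_module \<Lambda> n) M" "g ` carrier (free_right_module \<Lambda> n) = carrier M"
    using cover_finite_length[OF M M.submod_carrier fl] by blast
  obtain j :: "(nat \<Rightarrow> 'a) \<Rightarrow> 'm" where j: "inj_on j (carrier (free_right_module \<Lambda> n))"
    using free_module_embedding[OF u, of n] by auto
  have "inj_on (inv_into (carrier (free_right_module \<Lambda> n)) g) (carrier M)"
    unfolding g(2)[symmetric] by (rule inj_on_inv_into) simp
  moreover have "inv_into (carrier (free_right_module \<Lambda> n)) g ` carrier M \<subseteq> carrier (free_right_module \<Lambda> n)"
    unfolding g(2)[symmetric] by (intro image_subsetI inv_into_into)
  ultimately have i: "inj_on (j \<circ> inv_into (carrier (free_right_module \<Lambda> n)) g) (carrier M)"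
    by (intro comp_inj_on inj_on_subset[OF j])
  have K: "submod \<Lambda> M {\<zero>\<^bsub>M\<^esub>}" by (simp add: submod_def M.act_zero_right)
  obtain N :: "('a, 'm) module" and q where N: "right_module \<Lambda> N" and q: "q \<in> right_hom \<Lambda> M N"
    and surj: "q ` carrier M = carrier N" and ker: "a_kernel M N q = {\<zero>\<^bsub>M\<^esub>}"
    by (rule quotient_module[OF M K i], rule that)
  interpret N: right_module \<Lambda> N by (rule N)
  have "inj_on q (carrier M)"
  proof (rule inj_onI)
    fix x y assume xy: "x \<in> carrier M" "y \<in> carrier M" "q x = q y"
    have "q (x \<ominus>\<^bsub>M\<^esub> y) = \<zero>\<^bsub>N\<^esub>"
      using right_hom_minus[OF M.M.abelian_group_axioms N.M.abelian_group_axioms q xy(1,2)] right_homD(1)[OF q xy(2)] xy(3)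
      by (simp add: N.M.minus_eq N.M.r_neg)
    then have "x \<ominus>\<^bsub>M\<^esub> y \<in> a_kernel M N q" using M.M.minus_closed[OF xy(1,2)] by (simp add: a_kernel_def')
    then have "x \<oplus>\<^bsub>M\<^esub> \<ominus>\<^bsub>M\<^esub> y = \<zero>\<^bsub>M\<^esub>" unfolding ker M.M.minus_eq by simp
    then have "\<ominus>\<^bsub>M\<^esub> (\<ominus>\<^bsub>M\<^esub> y) = x" using xy by (intro M.M.minus_equality) simp_all
    then show "x = y" using M.M.minus_minus[OF xy(2)] by (simp only:)
  qed
  then have bij: "bij_betw q (carrier M) (carrier N)" using surj by (simp add: bij_betw_def)
  have "finite_length Z N (q ` carrier M)"
    by (rule finite_length_image[OF comm_module_restrict[OF M] comm_module_restrict[OF N] right_hom_restrict[OF q] fl])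
  then have "finitely_presented \<Lambda> N" unfolding finitely_presented_iff[OF N] surj .
  then have "N \<in> Obj (mod_cat \<Lambda>)" using N by simp
  then show ?thesis using q bij by blast
qed

text \<open>A copy of the series of \<open>M\<close> is followed by that of \<open>N\<close>, run in
  the second coordinate.\<close>

lemma finite_length_prod:
  assumes M: "right_module \<Lambda> M" and N: "right_module \<Lambda> N"
    and flM: "finite_length Z M (carrier M)" and flN: "finite_length Z N K"
  shows "finite_length Z (prod_module M N) (carrier M \<times> K)"
  using flN
proof (induction rule: finite_length.induct)
  case zero
  interpret M: right_module \<Lambda> M by fact
  interpret N: right_module \<Lambda> N by fact
  have "(\<lambda>x\<in>carrier M. (x, \<zero>\<^bsub>N\<^esub>)) \<in> right_hom Z M (prod_module M N)"
    by (rule right_homI) (auto simp: sub M.act_closed N.act_zero_right)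
  then have "finite_length Z (prod_module M N) ((\<lambda>x\<in>carrier M. (x, \<zero>\<^bsub>N\<^esub>)) ` carrier M)"
    by (rule finite_length_image[OF comm_module_restrict[OF M] comm_module_restrict[OF right_module_prod[OF M N]] _ flM])
  moreover have "(\<lambda>x\<in>carrier M. (x, \<zero>\<^bsub>N\<^esub>)) ` carrier M = carrier M \<times> {\<zero>\<^bsub>N\<^esub>}" by auto
  ultimately show ?case by simp
next
  case (step K x m)
  interpret M: right_module \<Lambda> M by fact
  interpret N: right_module \<Lambda> N by fact
  interpret ZN: comm_module Z N by (rule comm_module_restrict[OF N])
  interpret m: maximalideal m Z by (rule step(3))
  have e: "(y, k) \<oplus>\<^bsub>prod_module M N\<^esub> r \<odot>\<^bsub>prod_module M N\<^esub> (\<zero>\<^bsub>M\<^esub>, x) = (y, k \<oplus>\<^bsub>N\<^esub> r \<odot>\<^bsub>N\<^esub> x)"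
    if "y \<in> carrier M" "r \<in> carrier Z" for y k r
    using that sub by (simp add: M.act_zero_right)
  have "carrier M \<times> adjoin Z N K x = adjoin Z (prod_module M N) (carrier M \<times> K) (\<zero>\<^bsub>M\<^esub>, x)"
  proof (intro equalityI subsetI)
    fix w assume "w \<in> carrier M \<times> adjoin Z N K x"
    then obtain y k r where w: "y \<in> carrier M" "k \<in> K" "r \<in> carrier Z" "w = (y, k \<oplus>\<^bsub>N\<^esub> r \<odot>\<^bsub>N\<^esub> x)"
      unfolding adjoin_def by auto
    show "w \<in> adjoin Z (prod_module M N) (carrier M \<times> K) (\<zero>\<^bsub>M\<^esub>, x)"
      unfolding w(4) e[OF w(1,3), symmetric] adjoin_def using w by blast
  next
    fix w assume "w \<in> adjoin Z (prod_module M N) (carrier M \<times> K) (\<zero>\<^bsub>M\<^esub>, x)"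
    then obtain y k r where w: "y \<in> carrier M" "k \<in> K" "r \<in> carrier Z"
      "w = (y, k) \<oplus>\<^bsub>prod_module M N\<^esub> r \<odot>\<^bsub>prod_module M N\<^esub> (\<zero>\<^bsub>M\<^esub>, x)"
      unfolding adjoin_def by blast
    show "w \<in> carrier M \<times> adjoin Z N K x"
      unfolding w(4) e[OF w(1,3)] adjoin_def using w by blast
  qed
  moreover have "finite_length Z (prod_module M N) (adjoin Z (prod_module M N) (carrier M \<times> K) (\<zero>\<^bsub>M\<^esub>, x))"
  proof (rule finite_length.step[OF step(5) _ step(3)])
    show "(\<zero>\<^bsub>M\<^esub>, x) \<in> carrier (prod_module M N)" using step(2) by simp
    fix r assume r: "r \<in> m"
    show "r \<odot>\<^bsub>prod_module M N\<^esub> (\<zero>\<^bsub>M\<^esub>, x) \<in> carrier M \<times> K"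
      using step(4)[OF r] sub[OF m.Icarr[OF r]] by (simp add: M.act_zero_right)
  qed
  ultimately show ?case by simp
qed

text \<open>The product module lives on pairs. It has finite length, so \<open>realise\<close>
  provides a copy inside \<open>'m\<close>, and the structure maps are transported along the
  bijection.\<close>

lemma has_biproducts_mod_cat:
  assumes u: "module_universe \<Lambda> TYPE('m)"
  shows "has_biproducts (mod_cat \<Lambda> :: (('a, 'm) module, 'm \<Rightarrow> 'm) precat)"
  unfolding has_biproducts_def
proof (intro ballI)
  fix X Y :: "('a, 'm) module" assume "X \<in> Obj (mod_cat \<Lambda>)" "Y \<in> Obj (mod_cat \<Lambda>)"
  then have X: "right_module \<Lambda> X" "finite_length Z X (carrier X)" and Y: "right_module \<Lambda> Y" "finite_length Z Y (carrier Y)"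
    using finitely_presented_iff by auto
  interpret X: right_module \<Lambda> X by (rule X)
  interpret Y: right_module \<Lambda> Y by (rule Y)
  let ?P = "prod_module X Y"
  have P: "right_module \<Lambda> ?P" by (rule right_module_prod[OF X(1) Y(1)])
  have fl: "finite_length Z ?P (carrier ?P)" using finite_length_prod[OF X(1) Y(1) X(2) Y(2)] by simp
  obtain W :: "('a, 'm) module" and q where W: "W \<in> Obj (mod_cat \<Lambda>)" and q: "q \<in> right_hom \<Lambda> ?P W"
    and bij: "bij_betw q (carrier ?P) (carrier W)"
    using realise[OF u P fl] by blast
  interpret W: right_module \<Lambda> W using W by simp
  define s where "s = inv_into (carrier ?P) q"
  have sq: "s (q x) = x" if "x \<in> carrier ?P" for x
    unfolding s_def using bij that by (simp add: bij_betw_def inv_into_f_f)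
  have Wx: "\<exists>x\<in>carrier ?P. w = q x" if "w \<in> carrier W" for w
    using that bij unfolding bij_betw_def by blast
  have qadd: "q x \<oplus>\<^bsub>W\<^esub> q y = q (x \<oplus>\<^bsub>?P\<^esub> y)" if "x \<in> carrier ?P" "y \<in> carrier ?P" for x y
    using right_homD(3)[OF q that] by simp
  have qact: "a \<odot>\<^bsub>W\<^esub> q x = q (a \<odot>\<^bsub>?P\<^esub> x)" if "a \<in> carrier \<Lambda>" "x \<in> carrier ?P" for a x
    using right_homD(4)[OF q that] by simp
  have qc: "q (x, y) \<in> carrier W" if "x \<in> carrier X" "y \<in> carrier Y" for x y
    using right_homD(1)[OF q, of "(x, y)"] that by simp
  have sq': "s (q (x, y)) = (x, y)" if "x \<in> carrier X" "y \<in> carrier Y" for x y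
    using sq[of "(x, y)"] that by simp
  define i where "i = (\<lambda>x\<in>carrier X. q (x, \<zero>\<^bsub>Y\<^esub>))"
  define j where "j = (\<lambda>y\<in>carrier Y. q (\<zero>\<^bsub>X\<^esub>, y))"
  define p where "p = (\<lambda>w\<in>carrier W. fst (s w))"
  define r where "r = (\<lambda>w\<in>carrier W. snd (s w))"
  have ih: "i \<in> right_hom \<Lambda> X W"
    by (rule right_homI) (auto simp: i_def qc qadd qact X.act_closed Y.act_zero_right)
  have jh: "j \<in> right_hom \<Lambda> Y W"
    by (rule right_homI) (auto simp: j_def qc qadd qact Y.act_closed X.act_zero_right)
  have ph: "p \<in> right_hom \<Lambda> W X"
  proof (rule right_homI)
    fix w w' assume w: "w \<in> carrier W" and w': "w' \<in> carrier W"
    obtain x where x: "x \<in> carrier ?P" "w = q x" using Wx[OF w] by blast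
    obtain x' where x': "x' \<in> carrier ?P" "w' = q x'" using Wx[OF w'] by blast
    show "p (w \<oplus>\<^bsub>W\<^esub> w') = p w \<oplus>\<^bsub>X\<^esub> p w'"
      using W.M.a_closed[OF w w'] w w' sq[of "x \<oplus>\<^bsub>?P\<^esub> x'"] x x' sq by (auto simp: p_def qadd)
  next
    fix w assume w: "w \<in> carrier W"
    obtain x where x: "x \<in> carrier ?P" "w = q x" using Wx[OF w] by blast
    show "p w \<in> carrier X" using w x sq[OF x(1)] by (auto simp: p_def)
    show "p (a \<odot>\<^bsub>W\<^esub> w) = a \<odot>\<^bsub>X\<^esub> p w" if a: "a \<in> carrier \<Lambda>" for a
      using W.act_closed[OF a w] w x sq[OF x(1)] sq[of "a \<odot>\<^bsub>?P\<^esub> x"] a X.act_closed Y.act_closed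
      by (auto simp: p_def qact)
  qed (simp add: p_def)
  have rh: "r \<in> right_hom \<Lambda> W Y"
  proof (rule right_homI)
    fix w w' assume w: "w \<in> carrier W" and w': "w' \<in> carrier W"
    obtain x where x: "x \<in> carrier ?P" "w = q x" using Wx[OF w] by blast
    obtain x' where x': "x' \<in> carrier ?P" "w' = q x'" using Wx[OF w'] by blast
    show "r (w \<oplus>\<^bsub>W\<^esub> w') = r w \<oplus>\<^bsub>Y\<^esub> r w'"
      using W.M.a_closed[OF w w'] w w' sq[of "x \<oplus>\<^bsub>?P\<^esub> x'"] x x' sq by (auto simp: r_def qadd)
  next
    fix w assume w: "w \<in> carrier W"
    obtain x where x: "x \<in> carrier ?P" "w = q x" using Wx[OF w] by blast
    show "r w \<in> carrier Y" using w x sq[OF x(1)] by (auto simp: r_def)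
    show "r (a \<odot>\<^bsub>W\<^esub> w) = a \<odot>\<^bsub>Y\<^esub> r w" if a: "a \<in> carrier \<Lambda>" for a
      using W.act_closed[OF a w] w x sq[OF x(1)] sq[of "a \<odot>\<^bsub>?P\<^esub> x"] a X.act_closed Y.act_closed
      by (auto simp: r_def qact)
  qed (simp add: r_def)
  have "compose (carrier W) i p \<oplus>\<^bsub>Hom (mod_cat \<Lambda>) W W\<^esub> compose (carrier W) j r = Id (mod_cat \<Lambda>) W"
  proof (rule extensionalityI[of _ "carrier W"])
    fix w assume w: "w \<in> carrier W"
    obtain x where x: "x \<in> carrier ?P" "w = q x" using Wx[OF w] by blast
    obtain x1 x2 where x12: "x = (x1, x2)" "x1 \<in> carrier X" "x2 \<in> carrier Y" using x(1) by (cases x) auto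
    have "p w = x1" "r w = x2" using w sq[OF x(1)] x(2) x12 by (simp_all add: p_def r_def)
    then show "(compose (carrier W) i p \<oplus>\<^bsub>Hom (mod_cat \<Lambda>) W W\<^esub> compose (carrier W) j r) w = Id (mod_cat \<Lambda>) W w"
      using w x(2) x12 by (simp add: compose_def i_def j_def qadd)
  qed simp_all
  moreover have "compose (carrier X) p i = (\<lambda>x\<in>carrier X. x)" "compose (carrier Y) r j = (\<lambda>x\<in>carrier Y. x)"
    "compose (carrier Y) p j = (\<lambda>x\<in>carrier Y. \<zero>\<^bsub>X\<^esub>)" "compose (carrier X) r i = (\<lambda>x\<in>carrier X. \<zero>\<^bsub>Y\<^esub>)"
    by (auto simp: compose_def i_def j_def p_def r_def qc sq' intro!: restrict_ext)
  ultimately have "is_biproduct (mod_cat \<Lambda>) X Y W i j p r"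
    unfolding is_biproduct_def using W ih jh ph rh by simp
  then show "\<exists>Z i j p q. is_biproduct (mod_cat \<Lambda> :: (('a, 'm) module, 'm \<Rightarrow> 'm) precat) X Y Z i j p q" by blast
qed

end

section \<open>Perfect pairings and Matlis duality\<close>

text \<open>The conditions say that \<open>N\<close> is the dual of \<open>M\<close> and
  \<open>M\<close> the dual of \<open>N\<close>, without naming the isomorphisms. This makes the
  notion independent of how the copy \<open>N\<close> was chosen, and symmetric up to exchanging the
  ring with its opposite, see \<open>swap\<close>.\<close>

locale perfect_pairing = central_subring Z \<Lambda> + E: right_module Z E + M: right_module \<Lambda> M +
    N: right_module "opposite_ring \<Lambda>" N
  for Z \<Lambda> :: "('a, 'y) ring_scheme" and E :: "('a, 'e) module" and M :: "('a, 'm) module"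
    and N :: "('a, 'n) module" and b :: "'m \<Rightarrow> 'n \<Rightarrow> 'e" +
  assumes left: "y \<in> carrier N \<Longrightarrow> (\<lambda>x\<in>carrier M. b x y) \<in> right_hom Z M E"
    and right: "x \<in> carrier M \<Longrightarrow> (\<lambda>y\<in>carrier N. b x y) \<in> right_hom Z N E"
    and balanced: "\<lbrakk>a \<in> carrier \<Lambda>; x \<in> carrier M; y \<in> carrier N\<rbrakk> \<Longrightarrow> b (a \<odot>\<^bsub>M\<^esub> x) y = b x (a \<odot>\<^bsub>N\<^esub> y)"
    and left_perfect: "f \<in> right_hom Z M E \<Longrightarrow> \<exists>!y. y \<in> carrier N \<and> (\<forall>x\<in>carrier M. b x y = f x)"
    and right_perfect: "g \<in> right_hom Z N E \<Longrightarrow> \<exists>!x. x \<in> carrier M \<and> (\<forall>y\<in>carrier N. b x y = g y)"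
begin

lemma closed: "\<lbrakk>x \<in> carrier M; y \<in> carrier N\<rbrakk> \<Longrightarrow> b x y \<in> carrier E"
  using right_homD(1)[OF left, of y x] by simp

lemma add_left: "\<lbrakk>x \<in> carrier M; x' \<in> carrier M; y \<in> carrier N\<rbrakk> \<Longrightarrow> b (x \<oplus>\<^bsub>M\<^esub> x') y = b x y \<oplus>\<^bsub>E\<^esub> b x' y"
  using right_homD(3)[OF left, of y x x'] by simp

lemma add_right: "\<lbrakk>x \<in> carrier M; y \<in> carrier N; y' \<in> carrier N\<rbrakk> \<Longrightarrow> b x (y \<oplus>\<^bsub>N\<^esub> y') = b x y \<oplus>\<^bsub>E\<^esub> b x y'"
  using right_homD(3)[OF right, of x y y'] by simp

lemma eqI_right:
  assumes "y \<in> carrier N" "y' \<in> carrier N" "\<forall>x\<in>carrier M. b x y = b x y'"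
  shows "y = y'"
proof -
  have "\<exists>!u. u \<in> carrier N \<and> (\<forall>x\<in>carrier M. b x u = (\<lambda>x\<in>carrier M. b x y) x)"
    by (rule left_perfect[OF left[OF assms(1)]])
  then show ?thesis using assms by auto
qed

lemma swap: "perfect_pairing Z (opposite_ring \<Lambda>) E N M (\<lambda>y x. b x y)"
proof (intro perfect_pairing.intro perfect_pairing_axioms.intro central_subring_opposite
    E.right_module_axioms N.right_module_axioms)
  show "right_module (opposite_ring (opposite_ring \<Lambda>)) M" using M.right_module_axioms by simp
  fix a x y assume "a \<in> carrier (opposite_ring \<Lambda>)" "y \<in> carrier N" "x \<in> carrier M"
  then show "b x (a \<odot>\<^bsub>N\<^esub> y) = b (a \<odot>\<^bsub>M\<^esub> x) y" by (simp add: balanced)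
qed (rule left right left_perfect right_perfect, assumption)+

end

text \<open>The transpose of \<open>f : M \<rightarrow> M'\<close>, a map from \<open>N'\<close> to
  \<open>N\<close>. Perfectness singles it out, which allows the definite description.\<close>

definition adjoint where
  "adjoint M b N M' b' N' f = (\<lambda>y\<in>carrier N'. THE n. n \<in> carrier N \<and> (\<forall>x\<in>carrier M. b x n = b' (f x) y))"

lemma adjoint:
  assumes b: "perfect_pairing Z \<Lambda> E M N b" and b': "perfect_pairing Z \<Lambda> E M' N' b'"
    and f: "f \<in> right_hom \<Lambda> M M'" and y: "y \<in> carrier N'"
  shows "adjoint M b N M' b' N' f y \<in> carrier N"
    and "x \<in> carrier M \<Longrightarrow> b x (adjoint M b N M' b' N' f y) = b' (f x) y"
proof -
  interpret b: perfect_pairing Z \<Lambda> E M N b by (rule b)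
  interpret b': perfect_pairing Z \<Lambda> E M' N' b' by (rule b')
  have "compose (carrier M) (\<lambda>x\<in>carrier M'. b' x y) f \<in> right_hom Z M E"
    by (rule right_hom_compose[OF b.right_hom_restrict[OF f] b'.left[OF y] b.right_module_restrict[OF b.M.right_module_axioms]])
  then have "\<exists>!n. n \<in> carrier N \<and> (\<forall>x\<in>carrier M. b x n = compose (carrier M) (\<lambda>x\<in>carrier M'. b' x y) f x)"
    by (rule b.left_perfect)
  moreover have "compose (carrier M) (\<lambda>x\<in>carrier M'. b' x y) f x = b' (f x) y" if "x \<in> carrier M" for x
    using that right_homD(1)[OF f that] by (simp add: compose_def)
  ultimately have "\<exists>!n. n \<in> carrier N \<and> (\<forall>x\<in>carrier M. b x n = b' (f x) y)" by (simp cong: conj_cong ball_cong)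
  from theI'[OF this] have "adjoint M b N M' b' N' f y \<in> carrier N \<and>
      (\<forall>x\<in>carrier M. b x (adjoint M b N M' b' N' f y) = b' (f x) y)"
    using y by (simp add: adjoint_def)
  then show "adjoint M b N M' b' N' f y \<in> carrier N"
    "x \<in> carrier M \<Longrightarrow> b x (adjoint M b N M' b' N' f y) = b' (f x) y" by blast+
qed

lemma adjoint_hom:
  assumes b: "perfect_pairing Z \<Lambda> E M N b" and b': "perfect_pairing Z \<Lambda> E M' N' b'"
    and f: "f \<in> right_hom \<Lambda> M M'"
  shows "adjoint M b N M' b' N' f \<in> right_hom (opposite_ring \<Lambda>) N' N"
proof -
  interpret b: perfect_pairing Z \<Lambda> E M N b by (rule b)
  interpret b': perfect_pairing Z \<Lambda> E M' N' b' by (rule b')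
  let ?g = "adjoint M b N M' b' N' f"
  note g = adjoint[OF b b' f]
  show ?thesis
  proof (rule right_homI)
    show "?g y \<in> carrier N" if "y \<in> carrier N'" for y by (rule g(1)[OF that])
    show "?g \<in> extensional (carrier N')" by (simp add: adjoint_def)
    show "?g (y \<oplus>\<^bsub>N'\<^esub> y') = ?g y \<oplus>\<^bsub>N\<^esub> ?g y'" if y: "y \<in> carrier N'" "y' \<in> carrier N'" for y y'
    proof (rule b.eqI_right[OF g(1) b.N.M.a_closed[OF g(1) g(1)]])
      show "\<forall>x\<in>carrier M. b x (?g (y \<oplus>\<^bsub>N'\<^esub> y')) = b x (?g y \<oplus>\<^bsub>N\<^esub> ?g y')"
        using y b'.N.M.a_closed[OF y] right_homD(1)[OF f]
        by (simp add: g b.add_right b'.add_right)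
    qed (use y in \<open>auto intro: b'.N.M.a_closed\<close>)
    show "?g (a \<odot>\<^bsub>N'\<^esub> y) = a \<odot>\<^bsub>N\<^esub> ?g y" if a: "a \<in> carrier (opposite_ring \<Lambda>)" and y: "y \<in> carrier N'" for a y
    proof (rule b.eqI_right)
      show "?g (a \<odot>\<^bsub>N'\<^esub> y) \<in> carrier N" by (rule g(1)[OF b'.N.act_closed[OF a y]])
      show "a \<odot>\<^bsub>N\<^esub> ?g y \<in> carrier N" by (rule b.N.act_closed[OF a g(1)[OF y]])
      show "\<forall>x\<in>carrier M. b x (?g (a \<odot>\<^bsub>N'\<^esub> y)) = b x (a \<odot>\<^bsub>N\<^esub> ?g y)"
      proof
        fix x assume x: "x \<in> carrier M"
        have a': "a \<in> carrier \<Lambda>" using a by simp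
        have "b x (?g (a \<odot>\<^bsub>N'\<^esub> y)) = b' (f x) (a \<odot>\<^bsub>N'\<^esub> y)" by (rule g(2)[OF b'.N.act_closed[OF a y] x])
        also have "\<dots> = b' (f (a \<odot>\<^bsub>M\<^esub> x)) y"
          using b'.balanced[OF a' right_homD(1)[OF f x] y] right_homD(4)[OF f a' x] by simp
        also have "\<dots> = b (a \<odot>\<^bsub>M\<^esub> x) (?g y)" by (rule g(2)[OF y b.M.act_closed[OF a' x], symmetric])
        also have "\<dots> = b x (a \<odot>\<^bsub>N\<^esub> ?g y)" by (rule b.balanced[OF a' x g(1)[OF y]])
        finally show "b x (?g (a \<odot>\<^bsub>N'\<^esub> y)) = b x (a \<odot>\<^bsub>N\<^esub> ?g y)" .
      qed
    qed
  qed
qed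

text \<open>A map with the adjunction property equals the adjoint, since elements of
  \<open>N\<close> are determined by pairing with \<open>M\<close>. Functoriality and additivity are
  read off from this.\<close>

lemma adjoint_eqI:
  assumes b: "perfect_pairing Z \<Lambda> E M N b" and b': "perfect_pairing Z \<Lambda> E M' N' b'"
    and f: "f \<in> right_hom \<Lambda> M M'" and g: "g \<in> right_hom \<Delta> N' N"
    and eq: "\<And>x y. \<lbrakk>x \<in> carrier M; y \<in> carrier N'\<rbrakk> \<Longrightarrow> b x (g y) = b' (f x) y"
  shows "adjoint M b N M' b' N' f = g"
proof (rule extensionalityI[OF right_homD(2)[OF adjoint_hom[OF b b' f]] right_homD(2)[OF g]])
  interpret b: perfect_pairing Z \<Lambda> E M N b by (rule b)
  fix y assume y: "y \<in> carrier N'"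
  show "adjoint M b N M' b' N' f y = g y"
    by (rule b.eqI_right[OF adjoint(1)[OF b b' f y] right_homD(1)[OF g y]])
      (simp add: adjoint(2)[OF b b' f y] eq y)
qed

section \<open>Existence of duals inside the universe\<close>

locale artin_duality = artin_center Z \<Lambda> + matlis Z E
  for Z \<Lambda> :: "('a, 'y) ring_scheme" and E :: "('a, 'e) module"
begin

text \<open>\<open>N\<close> is a copy of the dual module, and the pairing is evaluation at the
  function that an element of \<open>N\<close> stands for. Perfectness on the side of functionals on
  \<open>M\<close> holds by construction; for functionals on \<open>N\<close>, existence is
  reflexivity and uniqueness is separation of points.\<close>

lemma perfect_pairing_exists:
  assumes u: "module_universe \<Lambda> TYPE('m)" and M: "M \<in> Obj (mod_cat \<Lambda> :: (('a, 'm) module, 'm \<Rightarrow> 'm) precat)"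
  shows "\<exists>N b. (N :: ('a, 'm) module) \<in> Obj (mod_cat (opposite_ring \<Lambda>)) \<and> perfect_pairing Z \<Lambda> E M N b"
proof -
  interpret O: artin_center Z "opposite_ring \<Lambda>" by (rule artin_center_opposite)
  have mM: "right_module \<Lambda> M" and fl: "finite_length Z M (carrier M)"
    using M finitely_presented_iff by auto
  interpret M: right_module \<Lambda> M by (rule mM)
  have MZ: "right_module Z M" by (rule right_module_restrict[OF mM])
  interpret MZ: right_module Z M by (rule MZ)
  let ?H = "dual_module Z M E"
  have mH: "right_module (opposite_ring \<Lambda>) ?H" by (rule right_module_dual[OF mM E.right_module_axioms])
  interpret H: right_module "opposite_ring \<Lambda>" ?H by (rule mH)
  have flH: "finite_length Z ?H (carrier ?H)" using dual_finite_length[OF MZ fl] by simp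
  have u': "module_universe (opposite_ring \<Lambda>) TYPE('m)" using u by (simp add: module_universe_def)
  obtain N :: "('a, 'm) module" and q where N: "N \<in> Obj (mod_cat (opposite_ring \<Lambda>))"
    and q: "q \<in> right_hom (opposite_ring \<Lambda>) ?H N" and bij: "bij_betw q (carrier ?H) (carrier N)"
    using O.realise[OF u' mH flH] by blast
  interpret N: right_module "opposite_ring \<Lambda>" N using N by simp
  have qD: "q f \<in> carrier N" "\<lbrakk>g \<in> right_hom Z M E\<rbrakk> \<Longrightarrow> q (f \<oplus>\<^bsub>?H\<^esub> g) = q f \<oplus>\<^bsub>N\<^esub> q g"
    "a \<in> carrier \<Lambda> \<Longrightarrow> q (a \<odot>\<^bsub>?H\<^esub> f) = a \<odot>\<^bsub>N\<^esub> q f"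
    if "f \<in> right_hom Z M E" for f g a
    using right_homD(1,3,4)[OF q] that by (simp_all del: dual_module_simps(2-4))
  define s where "s = inv_into (right_hom Z M E) q"
  have sH: "s n \<in> right_hom Z M E" and qs: "q (s n) = n" if "n \<in> carrier N" for n
  proof -
    have "n \<in> q ` right_hom Z M E" using that bij by (simp add: bij_betw_def)
    then show "s n \<in> right_hom Z M E" "q (s n) = n" unfolding s_def by (rule inv_into_into, rule f_inv_into_f)
  qed
  have sq: "s (q f) = f" if "f \<in> right_hom Z M E" for f
    using bij that unfolding s_def by (simp add: bij_betw_def inv_into_f_f)
  have s_add: "s (n \<oplus>\<^bsub>N\<^esub> n') x = s n x \<oplus>\<^bsub>E\<^esub> s n' x" if n: "n \<in> carrier N" "n' \<in> carrier N" and x: "x \<in> carrier M" for n n' x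
  proof -
    have "n \<oplus>\<^bsub>N\<^esub> n' = q (s n \<oplus>\<^bsub>?H\<^esub> s n')" using qD(2)[OF sH[OF n(1)] sH[OF n(2)]] qs n by simp
    then have "s (n \<oplus>\<^bsub>N\<^esub> n') = s n \<oplus>\<^bsub>?H\<^esub> s n'"
      using sq[of "s n \<oplus>\<^bsub>?H\<^esub> s n'"] H.M.a_closed[of "s n" "s n'"] sH n by (simp del: dual_module_simps(3))
    then show ?thesis using x by simp
  qed
  have s_act: "s (a \<odot>\<^bsub>N\<^esub> n) x = s n (a \<odot>\<^bsub>M\<^esub> x)" if a: "a \<in> carrier \<Lambda>" and n: "n \<in> carrier N" and x: "x \<in> carrier M" for a n x
  proof -
    have "a \<odot>\<^bsub>N\<^esub> n = q (a \<odot>\<^bsub>?H\<^esub> s n)" using qD(3)[OF sH[OF n] a] qs[OF n] by simp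
    then have "s (a \<odot>\<^bsub>N\<^esub> n) = a \<odot>\<^bsub>?H\<^esub> s n"
      using sq[of "a \<odot>\<^bsub>?H\<^esub> s n"] H.act_closed[of a "s n"] sH[OF n] a by (simp del: dual_module_simps(4))
    then show ?thesis using x by simp
  qed
  have "perfect_pairing Z \<Lambda> E M N (\<lambda>x n. s n x)"
  proof (intro perfect_pairing.intro perfect_pairing_axioms.intro central_subring_axioms E.right_module_axioms
      M.right_module_axioms N.right_module_axioms)
    fix n assume n: "n \<in> carrier N"
    have "(\<lambda>x\<in>carrier M. s n x) = s n" using right_homD(2)[OF sH[OF n]] by (rule extensional_restrict)
    then show "(\<lambda>x\<in>carrier M. s n x) \<in> right_hom Z M E" using sH[OF n] by simp
  next
    fix x assume x: "x \<in> carrier M"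
    show "(\<lambda>n\<in>carrier N. s n x) \<in> right_hom Z N E"
    proof (rule right_homI)
      fix n assume n: "n \<in> carrier N"
      show "(\<lambda>n\<in>carrier N. s n x) n \<in> carrier E" using right_homD(1)[OF sH[OF n] x] n by simp
      show "(\<lambda>n\<in>carrier N. s n x) (n \<oplus>\<^bsub>N\<^esub> n') = (\<lambda>n\<in>carrier N. s n x) n \<oplus>\<^bsub>E\<^esub> (\<lambda>n\<in>carrier N. s n x) n'"
        if "n' \<in> carrier N" for n'
        using N.M.a_closed[OF n that] s_add[OF n that x] n that by simp
      show "(\<lambda>n\<in>carrier N. s n x) (a \<odot>\<^bsub>N\<^esub> n) = a \<odot>\<^bsub>E\<^esub> (\<lambda>n\<in>carrier N. s n x) n" if a: "a \<in> carrier Z" for a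
        using N.act_closed[of a n] s_act[OF sub[OF a] n x] right_homD(4)[OF sH[OF n] a x] sub[OF a] n by simp
    qed simp
  next
    fix a x n assume "a \<in> carrier \<Lambda>" "x \<in> carrier M" "n \<in> carrier N"
    then show "s n (a \<odot>\<^bsub>M\<^esub> x) = s (a \<odot>\<^bsub>N\<^esub> n) x" by (simp add: s_act)
  next
    fix f assume f: "f \<in> right_hom Z M E"
    show "\<exists>!n. n \<in> carrier N \<and> (\<forall>x\<in>carrier M. s n x = f x)"
    proof (rule ex1I[of _ "q f"])
      show "q f \<in> carrier N \<and> (\<forall>x\<in>carrier M. s (q f) x = f x)" using qD(1)[OF f] sq[OF f] by simp
      fix n assume n: "n \<in> carrier N \<and> (\<forall>x\<in>carrier M. s n x = f x)"
      then have n1: "n \<in> carrier N" and n2: "\<forall>x\<in>carrier M. s n x = f x" by blast+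
      have "s n = f" by (rule right_hom_eqI[OF sH[OF n1] f]) (use n2 in blast)
      then show "n = q f" using qs[OF n1] by simp
    qed
  next
    fix g assume g: "g \<in> right_hom Z N E"
    \<comment> \<open>The functional \<open>g\<close> on the copy \<open>N\<close> is pulled back to
      the genuine dual module, to which \<open>reflexive\<close> applies.\<close>
    define \<theta> where "\<theta> = compose (carrier ?H) g q"
    have t: "\<theta> \<in> right_hom Z ?H E"
      unfolding \<theta>_def by (rule right_hom_compose[OF O.right_hom_restrict[OF q] g O.right_module_restrict[OF mH]])
    have "\<theta> f = \<zero>\<^bsub>E\<^esub>" if f: "f \<in> perp M (carrier M)" for f
    proof -
      have fh: "f \<in> right_hom Z M E" and f0: "\<forall>x\<in>carrier M. f x = \<zero>\<^bsub>E\<^esub>" using f unfolding perp_def by blast+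
      have "f = \<zero>\<^bsub>?H\<^esub>" unfolding dual_module_simps(2)
        by (rule extensionalityI[OF right_homD(2)[OF fh]]) (use f0 in simp_all)
      then show ?thesis using right_hom_zero[OF H.M.abelian_group_axioms E.M.abelian_group_axioms t] by simp
    qed
    then obtain x where x: "x \<in> carrier M" "\<forall>f\<in>right_hom Z M E. \<theta> f = f x"
      using reflexive[OF MZ fl] t by blast
    show "\<exists>!x. x \<in> carrier M \<and> (\<forall>n\<in>carrier N. s n x = g n)"
    proof (rule ex1I[of _ x])
      have "s n x = g n" if n: "n \<in> carrier N" for n
        using x(2) sH[OF n] qs[OF n] by (auto simp: \<theta>_def compose_def)
      then show "x \<in> carrier M \<and> (\<forall>n\<in>carrier N. s n x = g n)" using x(1) by blast
    next
      fix x' assume x': "x' \<in> carrier M \<and> (\<forall>n\<in>carrier N. s n x' = g n)"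
      then have x'c: "x' \<in> carrier M" by blast
      have eq: "f x' = f x" if f: "f \<in> right_hom Z M E" for f
      proof -
        have "s (q f) x' = g (q f)" using x' qD(1)[OF f] by blast
        moreover have "\<theta> f = g (q f)" using f by (simp add: \<theta>_def compose_def)
        ultimately show ?thesis using x(2) f sq[OF f] by simp
      qed
      show "x' = x"
      proof (rule ccontr)
        assume ne: "x' \<noteq> x"
        have "x' \<ominus>\<^bsub>M\<^esub> x \<noteq> \<zero>\<^bsub>M\<^esub>"
        proof
          assume "x' \<ominus>\<^bsub>M\<^esub> x = \<zero>\<^bsub>M\<^esub>"
          then have "\<ominus>\<^bsub>M\<^esub> (\<ominus>\<^bsub>M\<^esub> x) = x'"
            using x'c x(1) by (intro M.M.minus_equality) (simp_all add: M.M.minus_eq)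
          then show False using ne M.M.minus_minus[OF x(1)] by simp
        qed
        then obtain h where h: "h \<in> right_hom Z M E" "h (x' \<ominus>\<^bsub>M\<^esub> x) \<noteq> \<zero>\<^bsub>E\<^esub>"
          using separates_points[OF MZ fl M.M.minus_closed[OF x'c x(1)]] by blast
        have "h (x' \<ominus>\<^bsub>M\<^esub> x) = h x' \<ominus>\<^bsub>E\<^esub> h x"
          by (rule right_hom_minus[OF M.M.abelian_group_axioms E.M.abelian_group_axioms h(1) x'c x(1)])
        then show False using eq[OF h(1)] h(2) right_homD(1)[OF h(1) x(1)] by (simp add: E.M.minus_eq E.M.r_neg)
      qed
    qed
  qed
  then show ?thesis using N by blast
qed

end

lemma adjoint_compose:
  assumes b: "perfect_pairing Z \<Lambda> E M N b" and b': "perfect_pairing Z \<Lambda> E M' N' b'"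
    and b'': "perfect_pairing Z \<Lambda> E M'' N'' b''"
    and f: "f \<in> right_hom \<Lambda> M M'" and g: "g \<in> right_hom \<Lambda> M' M''"
  shows "adjoint M b N M'' b'' N'' (compose (carrier M) g f) =
    compose (carrier N'') (adjoint M b N M' b' N' f) (adjoint M' b' N' M'' b'' N'' g)"
proof (rule adjoint_eqI[OF b b''])
  interpret b: perfect_pairing Z \<Lambda> E M N b by (rule b)
  interpret b'': perfect_pairing Z \<Lambda> E M'' N'' b'' by (rule b'')
  show "compose (carrier M) g f \<in> right_hom \<Lambda> M M''"
    by (rule right_hom_compose[OF f g b.M.right_module_axioms])
  show "compose (carrier N'') (adjoint M b N M' b' N' f) (adjoint M' b' N' M'' b'' N'' g) \<in> right_hom (opposite_ring \<Lambda>) N'' N"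
    by (rule right_hom_compose[OF adjoint_hom[OF b' b'' g] adjoint_hom[OF b b' f] b''.N.right_module_axioms])
  fix x y assume x: "x \<in> carrier M" and y: "y \<in> carrier N''"
  have "b x (adjoint M b N M' b' N' f (adjoint M' b' N' M'' b'' N'' g y)) = b'' (g (f x)) y"
    using adjoint(2)[OF b b' f adjoint(1)[OF b' b'' g y] x] adjoint(2)[OF b' b'' g y right_homD(1)[OF f x]] by simp
  then show "b x (compose (carrier N'') (adjoint M b N M' b' N' f) (adjoint M' b' N' M'' b'' N'' g) y) =
      b'' (compose (carrier M) g f x) y"
    using x y by (simp add: compose_def)
qed

lemma adjoint_id:
  assumes b: "perfect_pairing Z \<Lambda> E M N b"
  shows "adjoint M b N M b N (\<lambda>x\<in>carrier M. x) = (\<lambda>y\<in>carrier N. y)"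
proof -
  interpret b: perfect_pairing Z \<Lambda> E M N b by (rule b)
  show ?thesis
    by (rule adjoint_eqI[OF b b right_hom_id[OF b.M.right_module_axioms] right_hom_id[OF b.N.right_module_axioms]]) simp
qed

section \<open>The duality functor on finitely presented modules\<close>

definition duality_data where
  "duality_data Z \<Lambda> E D b \<longleftrightarrow> (\<forall>M\<in>Obj (mod_cat \<Lambda>). D M \<in> Obj (mod_cat (opposite_ring \<Lambda>)) \<and>
     perfect_pairing Z \<Lambda> E M (D M) (b M))"

definition dual_hom where
  "dual_hom D b M M' f = adjoint M (b M) (D M) M' (b M') (D M') f"

lemma duality_dataD:
  assumes "duality_data Z \<Lambda> E D b" "M \<in> Obj (mod_cat \<Lambda>)"
  shows "D M \<in> Obj (mod_cat (opposite_ring \<Lambda>))" "perfect_pairing Z \<Lambda> E M (D M) (b M)"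
  using assms unfolding duality_data_def by blast+

lemma contravariant_dual_hom:
  fixes \<Lambda> :: "('a, 'y) ring_scheme" and D :: "('a, 'm) module \<Rightarrow> ('a, 'm) module"
  assumes D: "duality_data Z \<Lambda> E D b"
  shows "contravariant (mod_cat \<Lambda>) (mod_cat (opposite_ring \<Lambda>)) D (dual_hom D b)"
proof (intro contravariant.intro contravariant_axioms.intro preadditive_mod_cat)
  note pair = duality_dataD(2)[OF D]
  show "additive_functor (mod_cat \<Lambda>) (op_precat (mod_cat (opposite_ring \<Lambda>))) D (dual_hom D b)"
    unfolding additive_functor_def
  proof (intro conjI ballI)
    fix X assume X: "X \<in> Obj (mod_cat \<Lambda> :: (('a, 'm) module, 'm \<Rightarrow> 'm) precat)"
    show "D X \<in> Obj (op_precat (mod_cat (opposite_ring \<Lambda>)))" using duality_dataD(1)[OF D X] by simp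
    show "dual_hom D b X X (Id (mod_cat \<Lambda>) X) = Id (op_precat (mod_cat (opposite_ring \<Lambda>))) (D X)"
      using adjoint_id[OF pair[OF X]] by (simp add: dual_hom_def)
    fix Y assume Y: "Y \<in> Obj (mod_cat \<Lambda> :: (('a, 'm) module, 'm \<Rightarrow> 'm) precat)"
    fix f assume "f \<in> Mor (mod_cat \<Lambda>) X Y"
    then have f: "f \<in> right_hom \<Lambda> X Y" by simp
    show "dual_hom D b X Y f \<in> Mor (op_precat (mod_cat (opposite_ring \<Lambda>))) (D X) (D Y)"
      using adjoint_hom[OF pair[OF X] pair[OF Y] f] by (simp add: dual_hom_def)
    { fix W g assume W: "W \<in> Obj (mod_cat \<Lambda> :: (('a, 'm) module, 'm \<Rightarrow> 'm) precat)" and "g \<in> Mor (mod_cat \<Lambda>) Y W"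
      then have g: "g \<in> right_hom \<Lambda> Y W" by simp
      show "dual_hom D b X W (Comp (mod_cat \<Lambda>) X Y W g f) =
        Comp (op_precat (mod_cat (opposite_ring \<Lambda>))) (D X) (D Y) (D W) (dual_hom D b Y W g) (dual_hom D b X Y f)"
        using adjoint_compose[OF pair[OF X] pair[OF Y] pair[OF W] f g] by (simp add: dual_hom_def) }
    fix g assume "g \<in> Mor (mod_cat \<Lambda>) X Y"
    then have g: "g \<in> right_hom \<Lambda> X Y" by simp
    interpret X: perfect_pairing Z \<Lambda> E X "D X" "b X" by (rule pair[OF X])
    interpret Y: perfect_pairing Z \<Lambda> E Y "D Y" "b Y" by (rule pair[OF Y])
    let ?f = "dual_hom D b X Y f" and ?g = "dual_hom D b X Y g"
    have f': "?f \<in> right_hom (opposite_ring \<Lambda>) (D Y) (D X)" and g': "?g \<in> right_hom (opposite_ring \<Lambda>) (D Y) (D X)"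
      unfolding dual_hom_def by (rule adjoint_hom[OF pair[OF X] pair[OF Y] f], rule adjoint_hom[OF pair[OF X] pair[OF Y] g])
    have "adjoint X (b X) (D X) Y (b Y) (D Y) (\<lambda>x\<in>carrier X. f x \<oplus>\<^bsub>Y\<^esub> g x) = (\<lambda>y\<in>carrier (D Y). ?f y \<oplus>\<^bsub>D X\<^esub> ?g y)"
    proof (rule adjoint_eqI[OF pair[OF X] pair[OF Y]])
      show "(\<lambda>x\<in>carrier X. f x \<oplus>\<^bsub>Y\<^esub> g x) \<in> right_hom \<Lambda> X Y"
        by (rule right_hom_add_closed[OF f g X.M.right_module_axioms Y.M.right_module_axioms])
      show "(\<lambda>y\<in>carrier (D Y). ?f y \<oplus>\<^bsub>D X\<^esub> ?g y) \<in> right_hom (opposite_ring \<Lambda>) (D Y) (D X)"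
        by (rule right_hom_add_closed[OF f' g' Y.N.right_module_axioms X.N.right_module_axioms])
      fix x y assume x: "x \<in> carrier X" and y: "y \<in> carrier (D Y)"
      have "b X x (?f y \<oplus>\<^bsub>D X\<^esub> ?g y) = b Y (f x \<oplus>\<^bsub>Y\<^esub> g x) y"
        unfolding X.add_right[OF x right_homD(1)[OF f' y] right_homD(1)[OF g' y]]
          Y.add_left[OF right_homD(1)[OF f x] right_homD(1)[OF g x] y]
        unfolding dual_hom_def adjoint(2)[OF pair[OF X] pair[OF Y] f y x] adjoint(2)[OF pair[OF X] pair[OF Y] g y x] ..
      then show "b X x ((\<lambda>y\<in>carrier (D Y). ?f y \<oplus>\<^bsub>D X\<^esub> ?g y) y) = b Y ((\<lambda>x\<in>carrier X. f x \<oplus>\<^bsub>Y\<^esub> g x) x) y"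
        using x y by simp
    qed
    then show "dual_hom D b X Y (f \<oplus>\<^bsub>Hom (mod_cat \<Lambda>) X Y\<^esub> g) =
      ?f \<oplus>\<^bsub>Hom (op_precat (mod_cat (opposite_ring \<Lambda>))) (D X) (D Y)\<^esub> ?g"
      by (simp add: dual_hom_def)
  qed
qed

text \<open>The unit is the adjoint of the identity of \<open>D M\<close>, taken with respect to its two pairings,
  with \<open>M\<close> and with its own dual; hence functoriality of adjoints makes it natural and invertible.\<close>

lemma dual_hom_unit:
  fixes \<Lambda> :: "('a, 'y) ring_scheme" and D G :: "('a, 'm) module \<Rightarrow> ('a, 'm) module"
  assumes D: "duality_data Z \<Lambda> E D b" and G: "duality_data Z (opposite_ring \<Lambda>) E G c"
  shows "\<exists>\<alpha>. contravariant_pair (mod_cat \<Lambda>) (mod_cat (opposite_ring \<Lambda>)) D (dual_hom D b) G (dual_hom G c) \<alpha>"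
proof -
  let ?A = "mod_cat \<Lambda> :: (('a, 'm) module, 'm \<Rightarrow> 'm) precat"
  let ?O = "opposite_ring \<Lambda>"
  define s where "s M y x = b M x y" for M y x
  define \<alpha> where "\<alpha> M = adjoint (D M) (s M) M (D M) (c (D M)) (G (D M)) (\<lambda>y\<in>carrier (D M). y)" for M
  have 1: "perfect_pairing Z ?O E (D M) M (s M)" if "M \<in> Obj ?A" for M
    unfolding s_def by (rule perfect_pairing.swap[OF duality_dataD(2)[OF D that]])
  have 2: "perfect_pairing Z ?O E (D M) (G (D M)) (c (D M))" if "M \<in> Obj ?A" for M
    by (rule duality_dataD(2)[OF G duality_dataD(1)[OF D that]])
  have i: "(\<lambda>y\<in>carrier (D M). y) \<in> right_hom ?O (D M) (D M)" if "M \<in> Obj ?A" for M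
    using duality_dataD(1)[OF D that] right_hom_id by auto
  have idid: "compose (carrier M) (\<lambda>y\<in>carrier M. y) (\<lambda>y\<in>carrier M. y) = (\<lambda>y\<in>carrier M. y)" for M :: "('a, 'm) module"
    by (auto simp: compose_def intro!: restrict_ext)
  have iso: "is_iso ?A (G (D M)) M (\<alpha> M)" if M: "M \<in> Obj ?A" for M
  proof -
    \<comment> \<open>The adjoint of the same identity with the two pairings exchanged; by
      functoriality it is inverse to \<open>\<alpha> M\<close>.\<close>
    let ?\<beta> = "adjoint (D M) (c (D M)) (G (D M)) (D M) (s M) M (\<lambda>y\<in>carrier (D M). y)"
    have "\<alpha> M \<in> right_hom \<Lambda> (G (D M)) M" "?\<beta> \<in> right_hom \<Lambda> M (G (D M))"
      using adjoint_hom[OF 1[OF M] 2[OF M] i[OF M]] adjoint_hom[OF 2[OF M] 1[OF M] i[OF M]] by (simp_all add: \<alpha>_def)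
    moreover have "compose (carrier (G (D M))) ?\<beta> (\<alpha> M) = (\<lambda>x\<in>carrier (G (D M)). x)"
      using adjoint_compose[OF 2[OF M] 1[OF M] 2[OF M] i[OF M] i[OF M]] adjoint_id[OF 2[OF M]]
      unfolding idid \<alpha>_def by simp
    moreover have "compose (carrier M) (\<alpha> M) ?\<beta> = (\<lambda>x\<in>carrier M. x)"
      using adjoint_compose[OF 1[OF M] 2[OF M] 1[OF M] i[OF M] i[OF M]] adjoint_id[OF 1[OF M]]
      unfolding idid \<alpha>_def by simp
    ultimately show ?thesis unfolding is_iso_def by auto
  qed
  have nat: "compose (carrier (G (D X))) (\<alpha> Y) (dual_hom G c (D Y) (D X) (dual_hom D b X Y f)) =
      compose (carrier (G (D X))) f (\<alpha> X)"
    if X: "X \<in> Obj ?A" and Y: "Y \<in> Obj ?A" and f: "f \<in> right_hom \<Lambda> X Y" for X Y f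
  proof -
    let ?f = "dual_hom D b X Y f"
    have fh: "?f \<in> right_hom ?O (D Y) (D X)"
      unfolding dual_hom_def by (rule adjoint_hom[OF duality_dataD(2)[OF D X] duality_dataD(2)[OF D Y] f])
    \<comment> \<open>For the swapped pairings the adjoint of the dual of \<open>f\<close> is
      \<open>f\<close> again. Both composites of the naturality square are thereby adjoints of
      \<open>?f\<close>, with respect to the original pairing of \<open>Y\<close> and the chosen one
      of \<open>D X\<close>.\<close>
    have "adjoint (D Y) (s Y) Y (D X) (s X) X ?f = f"
    proof (rule adjoint_eqI[OF 1[OF Y] 1[OF X] fh f])
      fix y x assume "y \<in> carrier (D Y)" "x \<in> carrier X"
      then show "s Y y (f x) = s X (?f y) x"
        unfolding s_def dual_hom_def
        by (simp add: adjoint(2)[OF duality_dataD(2)[OF D X] duality_dataD(2)[OF D Y] f])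
    qed
    then have "compose (carrier (G (D X))) f (\<alpha> X) =
        adjoint (D Y) (s Y) Y (D X) (c (D X)) (G (D X)) (compose (carrier (D Y)) (\<lambda>y\<in>carrier (D X). y) ?f)"
      unfolding \<alpha>_def using adjoint_compose[OF 1[OF Y] 1[OF X] 2[OF X] fh i[OF X]] by simp
    also have "compose (carrier (D Y)) (\<lambda>y\<in>carrier (D X). y) ?f = ?f"
      by (rule extensionalityI[OF compose_extensional right_homD(2)[OF fh]]) (simp add: compose_def right_homD(1)[OF fh])
    also have "?f = compose (carrier (D Y)) ?f (\<lambda>y\<in>carrier (D Y). y)"
      by (rule extensionalityI[OF right_homD(2)[OF fh] compose_extensional]) (simp add: compose_def)
    finally show ?thesis
      using adjoint_compose[OF 1[OF Y] 2[OF Y] 2[OF X] i[OF Y] fh] unfolding \<alpha>_def dual_hom_def by simp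
  qed
  have G': "contravariant (mod_cat ?O) ?A G (dual_hom G c)"
    using contravariant_dual_hom[OF G] by simp
  have "contravariant_pair ?A (mod_cat ?O) D (dual_hom D b) G (dual_hom G c) \<alpha>"
  proof (intro contravariant_pair.intro contravariant_pair_axioms.intro contravariant_dual_hom[OF D] G')
    show "natural_iso ?A ?A (\<lambda>X. G (D X)) (\<lambda>X Y f. dual_hom G c (D Y) (D X) (dual_hom D b X Y f)) (\<lambda>X. X) (\<lambda>X Y f. f) \<alpha>"
      unfolding natural_iso_def mod_cat_simps(2,5) using iso nat by blast
  qed
  then show ?thesis by blast
qed

section \<open>Exactness and acyclic complexes\<close>

context artin_duality
begin

text \<open>One inclusion is \<open>g f = 0\<close>. For the other, an element \<open>y\<close> of
  the kernel pairs to zero with the image of \<open>f\<close>, which is the kernel of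
  \<open>g\<close>. So pairing with \<open>y\<close> factors through the image of \<open>g\<close>;
  injectivity of \<open>E\<close> extends it to \<open>N\<close>, and an element of
  \<open>N'\<close> represents the extension.\<close>

lemma adjoint_exact:
  assumes L: "perfect_pairing Z \<Lambda> E L L' b" and M: "perfect_pairing Z \<Lambda> E M M' c" and N: "perfect_pairing Z \<Lambda> E N N' d"
    and f: "f \<in> right_hom \<Lambda> L M" and g: "g \<in> right_hom \<Lambda> M N" and fl: "finite_length Z N (carrier N)"
    and exact: "f ` carrier L = a_kernel M N g"
  shows "adjoint M c M' N d N' g ` carrier N' = a_kernel M' L' (adjoint L b L' M c M' f)"
proof (intro equalityI subsetI)
  interpret L: perfect_pairing Z \<Lambda> E L L' b by (rule L)
  interpret M: perfect_pairing Z \<Lambda> E M M' c by (rule M)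
  interpret N: perfect_pairing Z \<Lambda> E N N' d by (rule N)
  let ?f = "adjoint L b L' M c M' f" and ?g = "adjoint M c M' N d N' g"
  note fa = adjoint[OF L M f] and ga = adjoint[OF M N g]
  note gD = right_homD[OF g] and fD = right_homD[OF f]
  { fix y assume "y \<in> ?g ` carrier N'"
    then obtain y' where y': "y' \<in> carrier N'" "y = ?g y'" by blast
    have y: "y \<in> carrier M'" unfolding y'(2) by (rule ga(1)[OF y'(1)])
    have "?f y = \<zero>\<^bsub>L'\<^esub>"
    proof (rule L.eqI_right[OF fa(1)[OF y] L.N.M.zero_closed], rule ballI)
      fix x assume x: "x \<in> carrier L"
      have "g (f x) = \<zero>\<^bsub>N\<^esub>" using exact x by (auto simp: a_kernel_def')
      then have "b x (?f y) = d \<zero>\<^bsub>N\<^esub> y'"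
        using fa(2)[OF y x] ga(2)[OF y'(1) fD(1)[OF x]] y'(2) by simp
      also have "\<dots> = \<zero>\<^bsub>E\<^esub>"
        using right_hom_zero[OF N.M.M.abelian_group_axioms E.M.abelian_group_axioms N.left[OF y'(1)]] by simp
      also have "\<dots> = b x \<zero>\<^bsub>L'\<^esub>"
        using right_hom_zero[OF L.N.M.abelian_group_axioms E.M.abelian_group_axioms L.right[OF x]] by simp
      finally show "b x (?f y) = b x \<zero>\<^bsub>L'\<^esub>" .
    qed
    then show "y \<in> a_kernel M' L' ?f" using y by (simp add: a_kernel_def') }
  fix y assume "y \<in> a_kernel M' L' ?f"
  then have y: "y \<in> carrier M'" "?f y = \<zero>\<^bsub>L'\<^esub>" by (simp_all add: a_kernel_def')
  have van: "c x y = \<zero>\<^bsub>E\<^esub>" if "x \<in> carrier M" "g x = \<zero>\<^bsub>N\<^esub>" for x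
  proof -
    have "x \<in> f ` carrier L" unfolding exact using that by (simp add: a_kernel_def')
    then obtain w where w: "w \<in> carrier L" "x = f w" by blast
    have "c x y = b w \<zero>\<^bsub>L'\<^esub>" using fa(2)[OF y(1) w(1)] y(2) w(2) by simp
    then show ?thesis
      using right_hom_zero[OF L.N.M.abelian_group_axioms E.M.abelian_group_axioms L.right[OF w(1)]] by simp
  qed
  have cy: "(\<lambda>x\<in>carrier M. c x y) \<in> right_hom Z M E" by (rule M.left[OF y(1)])
  have well: "c x y = c x' y" if x: "x \<in> carrier M" "x' \<in> carrier M" and eq: "g x = g x'" for x x'
  proof -
    have d: "x \<ominus>\<^bsub>M\<^esub> x' \<in> carrier M" by (rule M.M.M.minus_closed[OF x])
    have "g (x \<ominus>\<^bsub>M\<^esub> x') = \<zero>\<^bsub>N\<^esub>"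
      using right_hom_minus[OF M.M.M.abelian_group_axioms N.M.M.abelian_group_axioms g x] eq gD(1)[OF x(2)]
      by (simp add: N.M.M.minus_eq N.M.M.r_neg)
    then have "c (x \<ominus>\<^bsub>M\<^esub> x') y = \<zero>\<^bsub>E\<^esub>" by (rule van[OF d])
    moreover have "x = (x \<ominus>\<^bsub>M\<^esub> x') \<oplus>\<^bsub>M\<^esub> x'"
      using x by (simp add: M.M.M.minus_eq M.M.M.a_assoc M.M.M.l_neg)
    ultimately show ?thesis using M.add_left[OF d x(2) y(1)] M.closed[OF x(2) y(1)] by simp
  qed
  \<comment> \<open>By \<open>well\<close>, pairing with \<open>y\<close> is constant on the fibres
    of \<open>g\<close>, so any preimage may be used to define the induced function on the
    image.\<close>
  define h where "h k = c (SOME x. x \<in> carrier M \<and> g x = k) y" for k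
  have h: "h (g x) = c x y" if x: "x \<in> carrier M" for x
  proof -
    have "(SOME x'. x' \<in> carrier M \<and> g x' = g x) \<in> carrier M \<and> g (SOME x'. x' \<in> carrier M \<and> g x' = g x) = g x"
      by (rule someI[of _ x]) (use x in blast)
    then show ?thesis unfolding h_def using well x by blast
  qed
  have im: "submod Z N (g ` carrier M)"
    unfolding submod_def
  proof (intro conjI ballI)
    show "g ` carrier M \<subseteq> carrier N" using gD(1) by blast
    show "\<zero>\<^bsub>N\<^esub> \<in> g ` carrier M"
      using right_hom_zero[OF M.M.M.abelian_group_axioms N.M.M.abelian_group_axioms g, symmetric] M.M.M.zero_closed
      by (rule image_eqI)
  next
    fix k k' assume "k \<in> g ` carrier M" "k' \<in> g ` carrier M"
    then obtain x x' where x: "x \<in> carrier M" "k = g x" "x' \<in> carrier M" "k' = g x'" by blast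
    show "k \<oplus>\<^bsub>N\<^esub> k' \<in> g ` carrier M"
      using gD(3)[OF x(1,3)] M.M.M.a_closed[OF x(1,3)] x(2,4) by (metis image_eqI)
  next
    fix a k assume a: "a \<in> carrier Z" and "k \<in> g ` carrier M"
    then obtain x where x: "x \<in> carrier M" "k = g x" by blast
    show "a \<odot>\<^bsub>N\<^esub> k \<in> g ` carrier M"
      using gD(4)[OF sub[OF a] x(1)] M.M.act_closed[OF sub[OF a] x(1)] x(2) by (metis image_eqI)
  qed
  have "linear_on Z N (g ` carrier M) E h"
    unfolding linear_on_def
  proof (intro conjI ballI funcsetI)
    fix k assume "k \<in> g ` carrier M"
    then obtain x where x: "x \<in> carrier M" "k = g x" by blast
    show "h k \<in> carrier E" using h[OF x(1)] M.closed[OF x(1) y(1)] x(2) by simp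
    show "h (a \<odot>\<^bsub>N\<^esub> k) = a \<odot>\<^bsub>E\<^esub> h k" if a: "a \<in> carrier Z" for a
      using gD(4)[OF sub[OF a] x(1)] h[OF x(1)] h[OF M.M.act_closed[OF sub[OF a] x(1)]]
        right_homD(4)[OF cy a x(1)] M.M.act_closed[OF sub[OF a] x(1)] x by simp
    fix k' assume "k' \<in> g ` carrier M"
    then obtain x' where x': "x' \<in> carrier M" "k' = g x'" by blast
    show "h (k \<oplus>\<^bsub>N\<^esub> k') = h k \<oplus>\<^bsub>E\<^esub> h k'"
      using gD(3)[OF x(1) x'(1)] h[OF x(1)] h[OF x'(1)] h[OF M.M.M.a_closed[OF x(1) x'(1)]]
        M.add_left[OF x(1) x'(1) y(1)] x(2) x'(2) by simp
  qed
  then obtain h' where h': "h' \<in> right_hom Z N E" "\<forall>k\<in>g ` carrier M. h' k = h k"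
    using injective[OF right_module_restrict[OF N.M.right_module_axioms] fl im] by blast
  obtain y' where y': "y' \<in> carrier N'" "\<forall>k\<in>carrier N. d k y' = h' k" using N.left_perfect[OF h'(1)] by blast
  have "?g y' = y"
  proof (rule M.eqI_right[OF ga(1)[OF y'(1)] y(1)], rule ballI)
    fix x assume x: "x \<in> carrier M"
    show "c x (?g y') = c x y"
      using ga(2)[OF y'(1) x] y'(2) gD(1)[OF x] h'(2) h[OF x] x by simp
  qed
  then show "y \<in> ?g ` carrier N'" using y'(1) by blast
qed

text \<open>Exactness of the dual in degree \<open>n\<close> comes from exactness of
  \<open>X\<close> in degree \<open>- n\<close>, applied to the terms of degrees
  \<open>- n - 1\<close>, \<open>- n\<close> and \<open>- n + 1\<close>.\<close>

lemma acyclic_dual_complex: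
  fixes D :: "('a, 'm) module \<Rightarrow> ('a, 'm) module" and X :: "(('a, 'm) module, 'm \<Rightarrow> 'm) cochain"
  assumes D: "duality_data Z \<Lambda> E D b" and X: "X \<in> bounded_complexes (mod_cat \<Lambda>)" and ac: "acyclic_complex X"
  shows "acyclic_complex (contravariant.dual_complex D (dual_hom D b) X)"
proof -
  interpret C: contravariant "mod_cat \<Lambda> :: (('a, 'm) module, 'm \<Rightarrow> 'm) precat" "mod_cat (opposite_ring \<Lambda>)" D "dual_hom D b"
    by (rule contravariant_dual_hom[OF D])
  have ob: "Ob X n \<in> Obj (mod_cat \<Lambda>)" and diff: "Diff X n \<in> right_hom \<Lambda> (Ob X n) (Ob X (n + 1))" for n
    using X unfolding bounded_complexes_def by auto
  show ?thesis
    unfolding acyclic_complex_def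
  proof
    fix n :: int
    have e: "- (n - 1) = - n + 1" "- n + 1 - 1 = - n" "- (n + 1) = - n - 1" "- n - 1 + 1 = - n" by auto
    have fl: "finite_length Z (Ob X (- n + 1)) (carrier (Ob X (- n + 1)))"
      using ob[of "- n + 1"] finitely_presented_iff by auto
    show "Diff (C.dual_complex X) (n - 1) ` carrier (Ob (C.dual_complex X) (n - 1)) =
        a_kernel (Ob (C.dual_complex X) n) (Ob (C.dual_complex X) (n + 1)) (Diff (C.dual_complex X) n)"
      unfolding C.dual_complex_simps e dual_hom_def
      by (rule adjoint_exact[OF duality_dataD(2)[OF D ob] duality_dataD(2)[OF D ob] duality_dataD(2)[OF D ob]
            diff[of "- n - 1", unfolded e] diff fl])
        (use ac in \<open>simp add: acyclic_complex_def\<close>)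
  qed
qed

lemma duality_data_exists:
  assumes u: "module_universe \<Lambda> TYPE('m)"
  shows "\<exists>(D :: ('a, 'm) module \<Rightarrow> ('a, 'm) module) b. duality_data Z \<Lambda> E D b"
proof -
  have "\<forall>M\<in>Obj (mod_cat \<Lambda> :: (('a, 'm) module, 'm \<Rightarrow> 'm) precat). \<exists>p. (fst p :: ('a, 'm) module) \<in> Obj (mod_cat (opposite_ring \<Lambda>)) \<and>
      perfect_pairing Z \<Lambda> E M (fst p) (snd p)"
    using perfect_pairing_exists[OF u] by (metis fst_conv snd_conv)
  from bchoice[OF this] obtain p where
    "\<forall>M\<in>Obj (mod_cat \<Lambda> :: (('a, 'm) module, 'm \<Rightarrow> 'm) precat). (fst (p M) :: ('a, 'm) module) \<in> Obj (mod_cat (opposite_ring \<Lambda>)) \<and>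
      perfect_pairing Z \<Lambda> E M (fst (p M)) (snd (p M))" by blast
  then have "duality_data Z \<Lambda> E (\<lambda>M. fst (p M)) (\<lambda>M. snd (p M))"
    unfolding duality_data_def by blast
  then show ?thesis by blast
qed

end

lemma right_hom_neg_image_kernel:
  assumes A: "abelian_group A" and B: "abelian_group B" and f: "f \<in> right_hom \<Lambda> A B"
  shows "(\<lambda>x\<in>carrier A. \<ominus>\<^bsub>B\<^esub> f x) ` carrier A = f ` carrier A"
    and "a_kernel A B (\<lambda>x\<in>carrier A. \<ominus>\<^bsub>B\<^esub> f x) = a_kernel A B f"
proof -
  interpret A: abelian_group A by (rule A)
  interpret B: abelian_group B by (rule B)
  show "(\<lambda>x\<in>carrier A. \<ominus>\<^bsub>B\<^esub> f x) ` carrier A = f ` carrier A"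
  proof (intro equalityI image_subsetI)
    fix x assume x: "x \<in> carrier A"
    note n = right_hom_neg[OF A B f x]
    show "(\<lambda>x\<in>carrier A. \<ominus>\<^bsub>B\<^esub> f x) x \<in> f ` carrier A"
      by (rule image_eqI[OF _ A.a_inv_closed[OF x]]) (simp add: n x)
    show "f x \<in> (\<lambda>x\<in>carrier A. \<ominus>\<^bsub>B\<^esub> f x) ` carrier A"
      by (rule image_eqI[OF _ A.a_inv_closed[OF x]]) (simp add: n x right_homD(1)[OF f x])
  qed
  have "\<ominus>\<^bsub>B\<^esub> \<zero>\<^bsub>B\<^esub> = \<zero>\<^bsub>B\<^esub>" by (rule B.minus_equality) simp_all
  then have "\<ominus>\<^bsub>B\<^esub> y = \<zero>\<^bsub>B\<^esub> \<longleftrightarrow> y = \<zero>\<^bsub>B\<^esub>" if "y \<in> carrier B" for y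
    using B.minus_minus[OF that] by metis
  then show "a_kernel A B (\<lambda>x\<in>carrier A. \<ominus>\<^bsub>B\<^esub> f x) = a_kernel A B f"
    using right_homD(1)[OF f] unfolding a_kernel_def' by auto
qed

text \<open>The sign that the unshift puts on the differentials changes neither images nor
  kernels.\<close>

lemma acyclic_unshift_complex:
  assumes X: "X \<in> bounded_complexes (mod_cat \<Lambda>)" and ac: "acyclic_complex X"
  shows "acyclic_complex (unshift_complex (mod_cat \<Lambda>) X)"
proof -
  interpret C: preadditive "mod_cat \<Lambda>" by (rule preadditive_mod_cat)
  have ob: "Ob X n \<in> Obj (mod_cat \<Lambda>)" and diff: "Diff X n \<in> right_hom \<Lambda> (Ob X n) (Ob X (n + 1))" for n
    using X unfolding bounded_complexes_def by auto
  have mod: "right_module \<Lambda> (Ob X n)" for n using ob[of n] by simp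
  have grp: "abelian_group (Ob X n)" for n by (rule right_module.axioms(2)[OF mod])
  have neg: "(\<ominus>\<^bsub>Hom (mod_cat \<Lambda>) (Ob X n) (Ob X (n + 1))\<^esub> Diff X n) = (\<lambda>x\<in>carrier (Ob X n). \<ominus>\<^bsub>Ob X (n + 1)\<^esub> Diff X n x)" for n
  proof -
    interpret H: abelian_group "Hom (mod_cat \<Lambda>) (Ob X n) (Ob X (n + 1))" by (rule C.hom_group[OF ob ob])
    interpret N: abelian_group "Ob X (n + 1)" by (rule grp)
    show ?thesis
      by (rule H.minus_equality)
        (use right_hom_neg_closed[OF diff[of n] mod mod] diff[of n] right_homD(1)[OF diff[of n]] in \<open>auto simp: N.l_neg intro!: restrict_ext\<close>)
  qed
  show ?thesis
    unfolding acyclic_complex_def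
  proof
    fix n :: int
    have e: "n - 1 - 1 + 1 = n - 1" "n - 1 + 1 = n" "n + 1 - 1 = n" by auto
    have "Diff X (n - 1 - 1) ` carrier (Ob X (n - 1 - 1)) = a_kernel (Ob X (n - 1)) (Ob X n) (Diff X (n - 1))"
      using ac[unfolded acyclic_complex_def, rule_format, of "n - 1"] unfolding e .
    then show "Diff (unshift_complex (mod_cat \<Lambda>) X) (n - 1) ` carrier (Ob (unshift_complex (mod_cat \<Lambda>) X) (n - 1)) =
        a_kernel (Ob (unshift_complex (mod_cat \<Lambda>) X) n) (Ob (unshift_complex (mod_cat \<Lambda>) X) (n + 1))
          (Diff (unshift_complex (mod_cat \<Lambda>) X) n)"
      unfolding shift_complex_simps neg[of "n - 1 - 1", unfolded e] neg[of "n - 1", unfolded e] e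
        right_hom_neg_image_kernel(1)[OF grp grp diff[of "n - 1 - 1", unfolded e]]
        right_hom_neg_image_kernel(2)[OF grp grp diff[of "n - 1", unfolded e]] .
  qed
qed

section \<open>The central image of the base ring\<close>

context
  fixes R :: "('r, 'x) ring_scheme" and \<Lambda> :: "('a, 'y) ring_scheme" and \<phi> :: "'r \<Rightarrow> 'a"
  assumes artin_algebra: "artin_algebra R \<Lambda> \<phi>"
begin

text \<open>The chain condition passes to the image: the preimages of a descending chain of ideals
  stabilise in \<open>R\<close>, and each ideal is the image of its preimage.\<close>

lemma central_image:
  defines "Z \<equiv> \<Lambda>\<lparr>carrier := \<phi> ` carrier R\<rparr>"
  shows "central_subring Z \<Lambda>" and "commutative_artinian_ring Z"
proof -
  have R: "commutative_artinian_ring R" "cring R" and \<Lambda>: "ring \<Lambda>" and \<phi>: "\<phi> \<in> ring_hom R \<Lambda>"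
    and central: "\<forall>r\<in>carrier R. \<forall>x\<in>carrier \<Lambda>. \<phi> r \<otimes>\<^bsub>\<Lambda>\<^esub> x = x \<otimes>\<^bsub>\<Lambda>\<^esub> \<phi> r"
    using artin_algebra unfolding artin_algebra_def commutative_artinian_ring_def by blast+
  interpret R: cring R by (rule R)
  interpret \<Lambda>: ring \<Lambda> by (rule \<Lambda>)
  interpret \<phi>: ring_hom_ring R \<Lambda> \<phi> by (rule ring_hom_ringI2[OF R.ring_axioms \<Lambda> \<phi>])
  have sub: "subring (\<phi> ` carrier R) \<Lambda>" by (rule \<phi>.img_is_subring[OF R.carrier_is_subring])
  have Zc: "a \<in> carrier \<Lambda>" if "a \<in> \<phi> ` carrier R" for a using that by auto
  have cen: "a \<otimes>\<^bsub>\<Lambda>\<^esub> x = x \<otimes>\<^bsub>\<Lambda>\<^esub> a" if "a \<in> \<phi> ` carrier R" "x \<in> carrier \<Lambda>" for a x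
    using central that by blast
  have "subcring (\<phi> ` carrier R) \<Lambda>"
    by (rule \<Lambda>.subcringI[OF sub cen[OF _ Zc]])
  then have Z: "cring Z" unfolding Z_def using \<Lambda>.subcring_iff subringE(1)[OF sub] by blast
  show "central_subring Z \<Lambda>"
    by (intro central_subring.intro central_subring_axioms.intro Z \<Lambda>) (unfold Z_def, simp_all add: Zc, rule cen)
  interpret Z: cring Z by (rule Z)
  interpret h: ring_hom_ring R Z \<phi>
    by (rule ring_hom_ringI[OF R.ring_axioms Z.ring_axioms]) (simp_all add: Z_def)
  have "\<exists>N. \<forall>n\<ge>N. I n = I N" if I: "\<forall>n. ideal (I n) Z \<and> I (Suc n) \<subseteq> I n" for I :: "nat \<Rightarrow> 'a set"
  proof -
    define J where "J n = {r \<in> carrier R. \<phi> r \<in> I n}" for n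
    have "\<forall>n. ideal (J n) R \<and> J (Suc n) \<subseteq> J n" using I h.ideal_vimage unfolding J_def by blast
    then obtain N where N: "\<forall>n\<ge>N. J n = J N" using R(1) unfolding commutative_artinian_ring_def by blast
    have im: "\<phi> ` J n = I n" for n
    proof -
      interpret ideal "I n" Z using I by blast
      have "I n \<subseteq> \<phi> ` carrier R" using a_subset by (simp add: Z_def)
      then show ?thesis unfolding J_def by blast
    qed
    have "I n = I N" if "n \<ge> N" for n
    proof -
      have "J n = J N" using N that by blast
      then show ?thesis using im[of n] im[of N] by metis
    qed
    then show ?thesis by blast
  qed
  then show "commutative_artinian_ring Z" unfolding commutative_artinian_ring_def using Z by blast
qed

text \<open>As \<open>Z\<close> has finite length over itself, \<open>finite_length_adjoin\<close>
  admits arbitrary elements, not only those that a maximal ideal annihilates. Adjoining the finitely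
  many generators gives a submodule of finite length that contains every linear combination of
  them.\<close>

lemma artin_center_image: "artin_center (\<Lambda>\<lparr>carrier := \<phi> ` carrier R\<rparr>) \<Lambda>"
proof (intro artin_center.intro artin_center_axioms.intro central_image)
  let ?Z = "\<Lambda>\<lparr>carrier := \<phi> ` carrier R\<rparr>"
  interpret Z: central_subring ?Z \<Lambda> by (rule central_image)
  interpret M: comm_module ?Z "regular_module \<Lambda>"
    by (rule Z.comm_module_restrict[OF Z.\<Lambda>.right_module_regular])
  have flZ: "finite_length ?Z (regular_module ?Z) (carrier ?Z)"
    by (rule artinian_finite_length[OF central_image(2)])
  have span: "\<exists>N. finite_length ?Z (regular_module \<Lambda>) N \<and> T \<subseteq> N" if "finite T" "T \<subseteq> carrier \<Lambda>" for T
    using that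
  proof (induction rule: finite_induct)
    case empty
    then show ?case using finite_length.zero by blast
  next
    case (insert s T)
    then obtain N where N: "finite_length ?Z (regular_module \<Lambda>) N" "T \<subseteq> N" by blast
    have s: "s \<in> carrier (regular_module \<Lambda>)" using insert.prems by simp
    have Ns: "submod ?Z (regular_module \<Lambda>) N" by (rule M.finite_length_submod[OF N(1)])
    have "insert s T \<subseteq> adjoin ?Z (regular_module \<Lambda>) N s"
      using N(2) M.adjoin_sub[OF Ns s] M.adjoin_self[OF Ns s] by blast
    then show ?case using M.finite_length_adjoin[OF flZ N(1) s] by blast
  qed
  obtain S where S: "finite S" "S \<subseteq> carrier \<Lambda>"
    and gen: "\<forall>x\<in>carrier \<Lambda>. \<exists>c. c \<in> S \<rightarrow> carrier R \<and> x = (\<Oplus>\<^bsub>\<Lambda>\<^esub>s\<in>S. \<phi> (c s) \<otimes>\<^bsub>\<Lambda>\<^esub> s)"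
    using artin_algebra unfolding artin_algebra_def by blast
  obtain N where N: "finite_length ?Z (regular_module \<Lambda>) N" "S \<subseteq> N" using span[OF S] by blast
  have Ns: "submod ?Z (regular_module \<Lambda>) N" by (rule M.finite_length_submod[OF N(1)])
  have summand: "\<phi> (c s) \<otimes>\<^bsub>\<Lambda>\<^esub> s \<in> N" if "c \<in> S \<rightarrow> carrier R" "s \<in> S" for c s
  proof -
    have c: "\<phi> (c s) \<in> carrier ?Z" using that by auto
    have "s \<otimes>\<^bsub>\<Lambda>\<^esub> \<phi> (c s) \<in> N" using M.submodD(4)[OF Ns c, of s] N(2) that(2) by auto
    then show ?thesis using Z.central[OF c, of s] S(2) that(2) by auto
  qed
  have sum: "(\<Oplus>\<^bsub>\<Lambda>\<^esub>s\<in>T. \<phi> (c s) \<otimes>\<^bsub>\<Lambda>\<^esub> s) \<in> N" if c: "c \<in> S \<rightarrow> carrier R" and T: "finite T" "T \<subseteq> S" for c T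
    using T
  proof (induction rule: finite_induct)
    case empty
    show ?case using M.submodD(2)[OF Ns] by simp
  next
    case (insert s T)
    have t: "\<phi> (c r) \<otimes>\<^bsub>\<Lambda>\<^esub> r \<in> N" if "r \<in> insert s T" for r by (rule summand[OF c]) (use insert.prems that in auto)
    have "\<phi> (c r) \<otimes>\<^bsub>\<Lambda>\<^esub> r \<in> carrier \<Lambda>" if "r \<in> insert s T" for r
      using M.submodD(1)[OF Ns t[OF that]] unfolding regular_module_simps(1) .
    then have "(\<Oplus>\<^bsub>\<Lambda>\<^esub>s\<in>insert s T. \<phi> (c s) \<otimes>\<^bsub>\<Lambda>\<^esub> s) = \<phi> (c s) \<otimes>\<^bsub>\<Lambda>\<^esub> s \<oplus>\<^bsub>\<Lambda>\<^esub> (\<Oplus>\<^bsub>\<Lambda>\<^esub>s\<in>T. \<phi> (c s) \<otimes>\<^bsub>\<Lambda>\<^esub> s)"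
      using insert.hyps by (intro Z.\<Lambda>.finsum_insert funcsetI) simp_all
    moreover have "\<phi> (c s) \<otimes>\<^bsub>\<Lambda>\<^esub> s \<oplus>\<^bsub>\<Lambda>\<^esub> (\<Oplus>\<^bsub>\<Lambda>\<^esub>s\<in>T. \<phi> (c s) \<otimes>\<^bsub>\<Lambda>\<^esub> s) \<in> N"
      using M.submodD(3)[OF Ns t[OF insertI1] insert.IH] insert.prems unfolding regular_module_simps(3) by blast
    ultimately show ?case by (simp only:)
  qed
  have "carrier \<Lambda> \<subseteq> N"
  proof
    fix x assume "x \<in> carrier \<Lambda>"
    then obtain c where c: "c \<in> S \<rightarrow> carrier R" "x = (\<Oplus>\<^bsub>\<Lambda>\<^esub>s\<in>S. \<phi> (c s) \<otimes>\<^bsub>\<Lambda>\<^esub> s)" using gen by blast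
    show "x \<in> N" unfolding c(2) by (rule sum[OF c(1) S(1) order_refl])
  qed
  moreover have "N \<subseteq> carrier \<Lambda>" using Ns by (simp add: submod_def)
  ultimately show "finite_length ?Z (regular_module \<Lambda>) (carrier \<Lambda>)" using N(1) by (simp add: subset_antisym)
qed

end

theorem proposition4p3:
  fixes R :: "('r, 'x) ring_scheme" and \<Lambda> :: "('a, 'y) ring_scheme" and \<phi> :: "'r \<Rightarrow> 'a"
  assumes "artin_algebra R \<Lambda> \<phi>"
    and "module_universe \<Lambda> TYPE('m)"
    and "finite_global_dimension \<Lambda> TYPE('m)"
  shows "\<exists>F Fm \<eta>. triangulated_duality
      (Kb_ac_mod (opposite_ring \<Lambda>)
        :: ((('a, 'm) module, 'm \<Rightarrow> 'm) cochain, (int \<Rightarrow> 'm \<Rightarrow> 'm) set) tricat)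
      (Kb_ac_mod \<Lambda>
        :: ((('a, 'm) module, 'm \<Rightarrow> 'm) cochain, (int \<Rightarrow> 'm \<Rightarrow> 'm) set) tricat)
      F Fm \<eta>"
proof -
  define Z where "Z = \<Lambda>\<lparr>carrier := \<phi> ` carrier R\<rparr>"
  interpret C: artin_center Z \<Lambda> unfolding Z_def by (rule artin_center_image[OF assms(1)])
  obtain i :: "'a \<Rightarrow> 'm" where inf: "infinite (UNIV :: 'm set)" and i: "inj_on i (carrier \<Lambda>)"
    using assms(2) unfolding module_universe_def by blast
  \<comment> \<open>The elements of \<open>Z\<close> are elements of \<Lambda>, so the embedding
    given by the universe also places the pushouts in the construction of \<open>E\<close> inside
    \<open>'m\<close>.\<close>
  have "inj_on i (carrier Z)" using C.sub by (intro inj_on_subset[OF i] subsetI)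
  then obtain E :: "('a, 'm) module" where E: "dualising_module Z E"
    by (rule dualising_module_exists[OF C.artinian inf])
  have matlis: "matlis Z E" by (intro matlis.intro matlis_axioms.intro C.Z.cring_axioms E)
  interpret L: artin_duality Z \<Lambda> E by (intro artin_duality.intro matlis C.artin_center_axioms)
  interpret O: artin_duality Z "opposite_ring \<Lambda>" E by (intro artin_duality.intro matlis C.artin_center_opposite)
  have u: "module_universe (opposite_ring \<Lambda>) TYPE('m)" using assms(2) by (simp add: module_universe_def)
  \<comment> \<open>The required functor starts at left modules, so \<open>D\<close> dualises over
    the opposite ring and \<open>G\<close> over \<Lambda>. Both use the same \<open>E\<close>, which
    lets the two families of pairings be compared in \<open>dual_hom_unit\<close>.\<close>
  obtain D :: "('a, 'm) module \<Rightarrow> ('a, 'm) module" and b where D: "duality_data Z (opposite_ring \<Lambda>) E D b"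
    using O.duality_data_exists[OF u] by blast
  obtain G :: "('a, 'm) module \<Rightarrow> ('a, 'm) module" and c where G: "duality_data Z \<Lambda> E G c"
    using L.duality_data_exists[OF assms(2)] by blast
  have G': "duality_data Z (opposite_ring (opposite_ring \<Lambda>)) E G c" using G by simp
  obtain \<alpha> where \<alpha>: "contravariant_pair (mod_cat (opposite_ring \<Lambda>)) (mod_cat \<Lambda>) D (dual_hom D b) G (dual_hom G c) \<alpha>"
    using dual_hom_unit[OF D G'] by auto
  obtain \<beta> where \<beta>: "contravariant_pair (mod_cat \<Lambda>) (mod_cat (opposite_ring \<Lambda>)) G (dual_hom G c) D (dual_hom D b) \<beta>"
    using dual_hom_unit[OF G D] by blast
  show ?thesis
    unfolding Kb_ac_mod_def
    by (rule Kb_duality[where P = acyclic_complex and Q = acyclic_complex, OF \<alpha> \<beta> C.has_biproducts_mod_cat[OF assms(2)]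
          O.acyclic_dual_complex[OF D] L.acyclic_dual_complex[OF G] acyclic_unshift_complex])
qed

end
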